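(* Let $\{\theta_i,X_i\}$ be the controlled Markov chain generated by the AM (adaptive Metropolis) algorithm described in the context, with target density $\pi$, increment density $q$ and stepsizes $\{\gamma_i\}$. Assume that either (a) $\mathsf{X}=\mathbb{R}^{n_x}$ with $n_x\ge1$, and $\pi$ and $q$ satisfy (A6) of the context; or (b) $\mathsf{X}=\mathbb{R}$ (so $n_x=1$), and $\pi$ and $q$ satisfy (A7) of the context; and that $\limsup_{i\to\infty}(\gamma_{i+1}^{-1}-\gamma_i^{-1})<1$. Then for any $\epsilon>0$ there exist $M,R>0$ such that, with $w(\theta):=1+|\mu|^{2+\epsilon}+|\Gamma|$ for $\theta=[\mu|\Gamma]$ and $\mathcal{W}_M:=\{\theta\in\Theta:w(\theta)\le M\}$, for any $(\theta,x)\in\Theta\times\mathsf{X}$, $$\mathbb{P}_{\theta,x}\left(\bigcap_{k=0}^\infty\bigcup_{i\ge k}\{(\theta_i,X_i)\in\mathcal{W}_M\times B(0,R)\}\right)=1.$$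
   Context: AM algorithm. $\mathsf{X}=\mathbb{R}^{n_x}$, $\theta=[\mu|\Gamma]\in\Theta=\mathbb{R}^{n_x}\times\mathcal{K}$ where $\mathcal{K}\subset\mathbb{R}^{n_x\times n_x}$ is the cone of symmetric positive definite matrices; $|\mu|$ is the Euclidean norm and $|\Gamma|=\sqrt{\mathrm{Tr}(\Gamma\Gamma^{\mathsf{T}})}$; $B(0,R)$ is the ball of radius $R$ centered at $0$, $B^c(0,R)$ its complement. Fix $\epsilon_{\mathrm{AM}}\in(0,1)$, let $q$ be a symmetric probability density ($q(z)=q(-z)$), and with $\Sigma_\theta:=(2.38^2/n_x)(\Gamma+\epsilon_{\mathrm{AM}}I_{n_x\times n_x})$ let $q_\theta(z):=\det(\Sigma_\theta)^{-1/2}q(\Sigma_\theta^{-1/2}z)$. Let $\alpha(x,y):=\min\{1,\pi(y)/\pi(x)\}$ and let $P_\theta$ be the symmetric random walk Metropolis transition probability $$P_\theta(x,A)=\int_{A-x}\alpha(x,x+z)q_\theta(z)\,\mathrm{d}z+\mathbb{I}\{x\in A\}\int_{\mathsf{X}-x}(1-\alpha(x,x+z))q_\theta(z)\,\mathrm{d}z.$$ Given $(\theta_0,X_0)=(\theta,x)$, for $i\ge0$: conditionally on the past, $X_{i+1}\sim P_{\theta_i}(X_i,\cdot)$, and $$\mu_{i+1}=\mu_i+\gamma_{i+1}(X_{i+1}-\mu_i),\quad\Gamma_{i+1}=\Gamma_i+\gamma_{i+1}\left((X_{i+1}-\mu_i)(X_{i+1}-\mu_i)^{\mathsf{T}}-\Gamma_i\right),\quad\theta_i=[\mu_i|\Gamma_i].$$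 The stepsizes satisfy $\gamma_i\in(0,\gamma^+]$ for some $\gamma^+\in(0,1)$. $\mathbb{P}_{\theta,x}$ is the law of this process. (A6): (1) $\pi$ is positive on every compact set and continuously differentiable; (2) there exists $\rho>1$ such that $\lim_{R\to\infty}\sup_{\{x:|x|\ge R\}}\frac{x}{|x|^\rho}\cdot\nabla\log\pi(x)=-\infty$; (3) for some $R>0$, $\sup_{\{x:|x|\ge R\}}\frac{x}{|x|}\cdot\frac{\nabla\pi(x)}{|\nabla\pi(x)|}<0$; (4) $q$ is the density of a standardized Gaussian or Student's $t$-distribution. (A7) ($\mathsf{X}=\mathbb{R}$, $\ell:=\log\pi$): (1) $\pi$ is a probability density with respect to Lebesgue measure, bounded away from $0$ on any compact set of $\mathbb{R}$, $\ell$ is twice differentiable, and for any $M>0$, with $\epsilon_x:=M/|\ell'(x)|$, $$\lim_{R\to\infty}\sup_{x\in B^c(0,R)}\sup_{|t|\le\epsilon_x}\frac{|\ell''(x+t)|}{|\ell'(x+t)|^2}=0,\quad\lim_{R\to\infty}\sup_{x\in B^c(0,R)}\sup_{|t|\le\epsilon_x}\frac{|\ell''(x+t)|}{|\ell'(x)|^2}=0,$$ $$\lim_{R\to\infty}\sup_{x\in B^c(0,R)}\sup_{0\le t\le\epsilon_x}\left|\frac{|\ell'(x-t)|}{|\ell'(x+t)|}-1\right|=0;$$ (2) there exists $p\in(0,1)$ such that, with $\mathrm{sgn}(x)=x/|x|$, $$\lim_{R\to\infty}\sup_{x\in B^c(0,R)}\frac{\mathrm{sgn}(x)\ell'(x)}{|x|^{p-1}}<0\quad\text{and}\quad\forall\gamma\in(0,1)\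 \lim_{R\to\infty}\inf_{x\in B^c(0,R)}\frac{\pi^{-\gamma}(x)}{|\ell'(x)|}>0;$$ (3) the increment density has the form $q_\sigma(z)=\frac1\sigma q(z/\sigma)$ (scale parameter $\sigma>0$; here $\sigma=\Sigma_\theta^{1/2}$) for a symmetric probability density $q$ with $\mathrm{supp}(q)=[-1,1]$ and $q:[-1,1]\to[\underline q,\bar q]$ for some $\underline q,\bar q\in(0,\infty)$. *)

theory Defs
  imports "HOL-Probability.Probability"
begin

definition prob_density :: "('a::euclidean_space \<Rightarrow> real) \<Rightarrow> bool" where
  "prob_density f \<longleftrightarrow>
     f \<in> borel_measurable borel \<and> (\<forall>x. 0 \<le> f x) \<and> (\<integral>\<^sup>+x. ennreal (f x) \<partial>lborel) = 1"

definition gradient :: "('a::euclidean_space \<Rightarrow> real) \<Rightarrow> 'a \<Rightarrow> 'a" where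
  "gradient f x = (THE D. GDERIV f x :> D)"

section \<open>Matrices and parameters\<close>

definition pos_def :: "real^'n^'n \<Rightarrow> bool" where
  "pos_def A \<longleftrightarrow> transpose A = A \<and> (\<forall>v. v \<noteq> 0 \<longrightarrow> 0 < v \<bullet> (A *v v))"

text \<open>The principal square root; it exists and is unique for a positive definite matrix.\<close>

definition matrix_sqrt :: "real^'n^'n \<Rightarrow> real^'n^'n" where
  "matrix_sqrt A = (THE S. pos_def S \<and> S ** S = A)"

definition outer :: "real^'n \<Rightarrow> real^'n \<Rightarrow> real^'n^'n" where
  "outer v w = (\<chi> i j. v $ i * w $ j)"

type_synonym 'n param = "(real^'n) \<times> (real^'n^'n)"

definition Theta :: "'n::finite param set" where
  "Theta = UNIV \<times> {\<Gamma>. pos_def \<Gamma>}"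

section \<open>Random walk Metropolis\<close>

definition accept :: "('a \<Rightarrow> real) \<Rightarrow> 'a \<Rightarrow> 'a \<Rightarrow> real" where
  "accept \<pi> x y = min 1 (\<pi> y / \<pi> x)"

definition rwm_kernel :: "('a::euclidean_space \<Rightarrow> real) \<Rightarrow> ('a \<Rightarrow> real) \<Rightarrow> 'a \<Rightarrow> 'a measure" where
  "rwm_kernel \<pi> r x = measure_of UNIV (sets borel)
     (\<lambda>A. (\<integral>\<^sup>+z\<in>{z. x + z \<in> A}. ennreal (accept \<pi> x (x + z) * r z) \<partial>lborel)
        + indicator A x * (\<integral>\<^sup>+z. ennreal ((1 - accept \<pi> x (x + z)) * r z) \<partial>lborel))"

section \<open>The adaptive Metropolis process\<close>

definition am_scale :: "real \<Rightarrow> 'n::finite param \<Rightarrow> real^'n^'n" where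
  "am_scale \<epsilon> \<theta> = (2.38\<^sup>2 / real CARD('n)) *\<^sub>R (snd \<theta> + \<epsilon> *\<^sub>R mat 1)"

definition am_density :: "(real^'n \<Rightarrow> real) \<Rightarrow> real \<Rightarrow> 'n::finite param \<Rightarrow> real^'n \<Rightarrow> real" where
  "am_density q \<epsilon> \<theta> z =
     det (am_scale \<epsilon> \<theta>) powr (-1/2) * q (matrix_inv (matrix_sqrt (am_scale \<epsilon> \<theta>)) *v z)"

definition am_update :: "real \<Rightarrow> 'n::finite param \<Rightarrow> real^'n \<Rightarrow> 'n param" where
  "am_update g \<theta> y = (case \<theta> of (\<mu>, \<Gamma>) \<Rightarrow>
     (\<mu> + g *\<^sub>R (y - \<mu>), \<Gamma> + g *\<^sub>R (outer (y - \<mu>) (y - \<mu>) - \<Gamma>)))"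

text \<open>
  A sample point \<open>\<omega>\<close> is a trajectory of the chain, with \<open>X\<^sub>i = \<omega> i\<close>. The parameters
  \<open>\<theta>\<^sub>i\<close> are the following deterministic function of \<open>\<omega> 1, \<dots>, \<omega> i\<close>.
\<close>

primrec am_param ::
  "(nat \<Rightarrow> real) \<Rightarrow> 'n::finite param \<Rightarrow> (nat \<Rightarrow> real^'n) \<Rightarrow> nat \<Rightarrow> 'n param" where
  "am_param \<gamma> \<theta> \<omega> 0 = \<theta>"
| "am_param \<gamma> \<theta> \<omega> (Suc i) = am_update (\<gamma> (Suc i)) (am_param \<gamma> \<theta> \<omega> i) (\<omega> (Suc i))"

text \<open>The conditional law of \<open>X\<^sub>i\<close> given \<open>X\<^sub>0, \<dots>, X\<^sub>i\<^sub>-\<^sub>1\<close>.\<close>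

definition am_step ::
  "(real^'n \<Rightarrow> real) \<Rightarrow> (real^'n \<Rightarrow> real) \<Rightarrow> real \<Rightarrow> (nat \<Rightarrow> real) \<Rightarrow> 'n::finite param \<Rightarrow> real^'n
    \<Rightarrow> nat \<Rightarrow> (nat \<Rightarrow> real^'n) \<Rightarrow> (real^'n) measure" where
  "am_step \<pi> q \<epsilon> \<gamma> \<theta> x i \<omega> = (case i of
      0 \<Rightarrow> return borel x
    | Suc j \<Rightarrow> rwm_kernel \<pi> (am_density q \<epsilon> (am_param \<gamma> \<theta> \<omega> j)) (\<omega> j))"

text \<open>
  The law on trajectory space obtained from the transition kernels \<open>am_step\<close> by the
  Ionescu-Tulcea theorem. The kernels are probability kernels when \<open>\<epsilon> > 0\<close>, \<open>\<theta> \<in> Theta\<close>, the stepsizes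
  lie in \<open>(0, 1)\<close>, \<open>\<pi>\<close> is positive and measurable, and \<open>q\<close> is a probability density.
\<close>

definition am_law ::
  "(real^'n \<Rightarrow> real) \<Rightarrow> (real^'n \<Rightarrow> real) \<Rightarrow> real \<Rightarrow> (nat \<Rightarrow> real) \<Rightarrow> 'n::finite param \<Rightarrow> real^'n
    \<Rightarrow> (nat \<Rightarrow> real^'n) measure" where
  "am_law \<pi> q \<epsilon> \<gamma> \<theta> x =
     projective_family.lim UNIV (Ionescu_Tulcea.CI (am_step \<pi> q \<epsilon> \<gamma> \<theta> x) (\<lambda>_. borel)) (\<lambda>_. borel)"

section \<open>Assumptions on the target and increment densities\<close>

definition std_gaussian_density :: "'a::euclidean_space \<Rightarrow> real" where
  "std_gaussian_density z = (2 * pi) powr (- real DIM('a) / 2) * exp (- (norm z)\<^sup>2 / 2)"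

text \<open>Location \<open>0\<close>, identity scale matrix, \<open>\<nu>\<close> degrees of freedom.\<close>

definition std_student_density :: "real \<Rightarrow> 'a::euclidean_space \<Rightarrow> real" where
  "std_student_density \<nu> z =
     Gamma ((\<nu> + real DIM('a)) / 2) / (Gamma (\<nu> / 2) * (\<nu> * pi) powr (real DIM('a) / 2))
       * (1 + (norm z)\<^sup>2 / \<nu>) powr (- (\<nu> + real DIM('a)) / 2)"

text \<open>
  Suprema, infima and their limits are taken in the extended reals, so that they always exist
  and may be infinite. Quotients by a vanishing derivative (or gradient), which are \<open>0\<close> here, do
  not affect the conditions: a vanishing gradient makes the supremum in the third clause of
  \<open>superexponential_conditions\<close> nonnegative, and the first limit in \<open>one_dim_decay\<close> forces the
  derivative of \<open>ln \<circ> \<pi>\<close> to be nonzero at all arguments that occur for large \<open>R\<close>.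
\<close>

definition superexponential_conditions :: "('a::euclidean_space \<Rightarrow> real) \<Rightarrow> ('a \<Rightarrow> real) \<Rightarrow> bool" where
  "superexponential_conditions \<pi> q \<longleftrightarrow>
     ((\<forall>K. compact K \<longrightarrow> (\<forall>x\<in>K. 0 < \<pi> x)) \<and>
      (\<forall>x. GDERIV \<pi> x :> gradient \<pi> x) \<and> continuous_on UNIV (gradient \<pi>)) \<and>
     (\<exists>\<rho>>1. ((\<lambda>R. SUP x\<in>{x. R \<le> norm x}.
                ereal ((x /\<^sub>R (norm x powr \<rho>)) \<bullet> gradient (\<lambda>y. ln (\<pi> y)) x)) \<longlongrightarrow> -\<infinity>) at_top) \<and>
     (\<exists>R>0. (SUP x\<in>{x. R \<le> norm x}.
                ereal ((x /\<^sub>R norm x) \<bullet> (gradient \<pi> x /\<^sub>R norm (gradient \<pi> x)))) < 0) \<and>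
     (q = std_gaussian_density \<or> (\<exists>\<nu>>0. q = std_student_density \<nu>))"

definition one_dim_regularity :: "(real \<Rightarrow> real) \<Rightarrow> bool" where
  "one_dim_regularity \<pi> \<longleftrightarrow>
     prob_density \<pi> \<and>
     (\<forall>K. compact K \<longrightarrow> (\<exists>c>0. \<forall>x\<in>K. c \<le> \<pi> x)) \<and>
     (let l = (\<lambda>x. ln (\<pi> x)); l' = deriv l; l'' = deriv l' in
      (\<forall>x. l field_differentiable at x \<and> l' field_differentiable at x) \<and>
      (\<forall>M>0.
         ((\<lambda>R. SUP x\<in>- ball 0 R. SUP t\<in>{t. \<bar>t\<bar> \<le> M / \<bar>l' x\<bar>}.
             ereal (\<bar>l'' (x + t)\<bar> / \<bar>l' (x + t)\<bar>\<^sup>2)) \<longlongrightarrow> 0) at_top \<and>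
         ((\<lambda>R. SUP x\<in>- ball 0 R. SUP t\<in>{t. \<bar>t\<bar> \<le> M / \<bar>l' x\<bar>}.
             ereal (\<bar>l'' (x + t)\<bar> / \<bar>l' x\<bar>\<^sup>2)) \<longlongrightarrow> 0) at_top \<and>
         ((\<lambda>R. SUP x\<in>- ball 0 R. SUP t\<in>{0..M / \<bar>l' x\<bar>}.
             ereal \<bar>\<bar>l' (x - t)\<bar> / \<bar>l' (x + t)\<bar> - 1\<bar>) \<longlongrightarrow> 0) at_top))"

definition one_dim_decay :: "(real \<Rightarrow> real) \<Rightarrow> bool" where
  "one_dim_decay \<pi> \<longleftrightarrow>
     (let l' = deriv (\<lambda>x. ln (\<pi> x)) in
      \<exists>p\<in>{0<..<1}.
        (\<exists>L<0. ((\<lambda>R. SUP x\<in>- ball 0 R. ereal (sgn x * l' x / \<bar>x\<bar> powr (p - 1))) \<longlongrightarrow> L) at_top) \<and>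
        (\<forall>g\<in>{0<..<1}.
          \<exists>L>0. ((\<lambda>R. INF x\<in>- ball 0 R. ereal (\<pi> x powr (- g) / \<bar>l' x\<bar>)) \<longlongrightarrow> L) at_top))"

text \<open>
  The scale family \<open>q (z / \<sigma>) / \<sigma>\<close> does not appear here, since \<open>am_density\<close> has this form
  in dimension one.
\<close>

definition one_dim_increment :: "(real \<Rightarrow> real) \<Rightarrow> bool" where
  "one_dim_increment q \<longleftrightarrow>
     prob_density q \<and> (\<forall>z. q (- z) = q z) \<and>
     closure {z. q z \<noteq> 0} = {-1..1} \<and>
     (\<exists>ql>0. \<exists>qu>0. \<forall>z\<in>{-1..1}. ql \<le> q z \<and> q z \<le> qu)"

text \<open>
  Densities on \<open>real^'n\<close> with \<open>CARD('n) = 1\<close> are turned into densities on \<open>real\<close> by composition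
  with the isometry \<open>vec\<close>.
\<close>

definition one_dim_conditions :: "(real \<Rightarrow> real) \<Rightarrow> (real \<Rightarrow> real) \<Rightarrow> bool" where
  "one_dim_conditions \<pi> q \<longleftrightarrow> one_dim_regularity \<pi> \<and> one_dim_decay \<pi> \<and> one_dim_increment q"

section \<open>Weights on the parameter space\<close>

text \<open>The library norm on \<^typ>\<open>real^'n^'n\<close> is the Frobenius norm.\<close>

definition am_weight :: "real \<Rightarrow> 'n::finite param \<Rightarrow> real" where
  "am_weight e \<theta> = 1 + norm (fst \<theta>) powr (2 + e) + norm (snd \<theta>)"

definition am_sublevel :: "real \<Rightarrow> real \<Rightarrow> 'n::finite param set" where
  "am_sublevel e M = {\<theta> \<in> Theta. am_weight e \<theta> \<le> M}"

end

theory Submission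
  imports Defs
begin

text \<open>
  The Lyapunov function is \<open>V = 1 / sqrt \<circ> \<pi>\<close>. With \<open>h\<^sub>\<theta>\<close> the inverse root of the determinant of the
  proposal covariance, the Metropolis kernel satisfies \<open>P\<^sub>\<theta> V \<le> V - c h\<^sub>\<theta> sqrt V\<close> outside a ball, uniformly
  in \<open>\<theta>\<close>. In \<open>real^'n\<close> a ball of fixed size inside the cone pointing towards the origin is accepted surely
  and gains a constant factor, with probability of order \<open>h\<^sub>\<theta>\<close>; the mass proposed
  at higher levels of \<open>- ln \<circ> \<pi>\<close> is dominated by the mass below, since dilations move it to many disjoint places.
  On the line the proposals \<open>x \<plusminus> z\<close> are paired: the first-order terms cancel
  and the second-order term is a gain.

  Since \<open>h\<^sub>\<theta>\<close> is at least of order \<open>w powr (- n / 2)\<close> and \<open>V\<close> grows faster than every polynomial,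
  \<open>w (\<theta>\<^sub>i) / \<gamma>\<^sub>i\<^sub>+\<^sub>1 + V (X\<^sub>i)\<close> decreases in the mean by at least one unit
  per step while \<open>(\<theta>\<^sub>i, X\<^sub>i)\<close> avoids the target set: the assumption on the stepsizes leaves a negative drift
  proportional to \<open>w\<close>, and the growth of \<open>\<mu>\<^sub>i\<close> and \<open>\<Gamma>\<^sub>i\<close> is paid for by a small power of \<open>V\<close>.
  So the target set is visited after any time.
\<close>

section \<open>Square roots of positive definite matrices\<close>

text \<open>The covariance of the proposal is unbounded, and as \<open>h\<close> tends to 0 almost
  every proposal is rejected, so no gain of the kernel is uniform in \<theta>. The estimates
  therefore isolate the factor \<open>h\<close> and keep every other constant independent of
  \<theta>. This is possible because the multiple of the identity in the covariance bounds the
  proposal scale from below. In the superexponential case the gain is even \<open>c h V\<close>; it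
  is weakened to \<open>c h sqrt V\<close> so that both cases share one form.

  The division of \<open>w\<close> by the coming stepsize has this reason: one update contracts
  \<open>w\<close> by about \<open>1 - \<gamma>\<close>, so \<open>w / \<gamma>\<close> loses about
  \<open>w\<close> whatever the size of \<gamma>, while the change of \<open>1 / \<gamma>\<close>
  gives back a fraction of \<open>w\<close> that stays below 1.

  Matrix square roots need care for two reasons: the proposal density must integrate to 1, which
  requires a change of variables, and the kernel must be measurable in \<theta>, which is derived
  from continuity of the root.\<close>

lemma symmetric_inner:
  fixes A :: "real^'n^'n"
  assumes "transpose A = A"
  shows "v \<bullet> (A *v w) = (A *v v) \<bullet> w"
  using assms by (metis dot_lmul_matrix transpose_matrix_vector)

lemma symmetricI:
  fixes A :: "real^'n^'n"
  assumes "\<And>v w. v \<bullet> (A *v w) = (A *v v) \<bullet> w"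
  shows "transpose A = A"
proof -
  have "(transpose A *v v) \<bullet> w = (A *v v) \<bullet> w" for v w
    using assms[of v w] by (metis dot_lmul_matrix transpose_matrix_vector)
  then have "transpose A *v v = A *v v" for v
    by (metis vector_eq_ldot inner_commute)
  then show ?thesis by (simp add: matrix_eq)
qed

text \<open>The eigenvector maximises the Rayleigh quotient on \<open>W\<close>.\<close>

lemma symmetric_eigenvector_exists:
  fixes A :: "real^'n^'n"
  assumes sym: "transpose A = A" and W: "subspace W" and inv: "\<And>v. v \<in> W \<Longrightarrow> A *v v \<in> W"
    and u: "u \<in> W" "u \<noteq> 0"
  obtains v l where "v \<in> W" "norm v = 1" "A *v v = l *\<^sub>R v"
proof -
  let ?K = "W \<inter> sphere 0 1" and ?f = "\<lambda>v. v \<bullet> (A *v v)"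
  have "compact ?K"
    using closed_subspace[OF W] by (simp add: closed_Int_compact)
  moreover have "u /\<^sub>R norm u \<in> ?K"
    using u W by (auto simp: subspace_mul)
  moreover have "continuous_on ?K ?f"
    by (intro continuous_intros)
  ultimately obtain v where v: "v \<in> ?K" and max: "\<And>w. w \<in> ?K \<Longrightarrow> ?f w \<le> ?f v"
    using continuous_attains_sup[of ?K ?f] by blast
  define l where "l = ?f v"
  have nv: "v \<in> W" "norm v = 1" using v by auto
  have le: "?f w \<le> l * (norm w)\<^sup>2" if "w \<in> W" for w
  proof (cases "w = 0")
    case False
    then have "w /\<^sub>R norm w \<in> ?K" using that W by (auto simp: subspace_mul)
    from max[OF this] have "(?f w) / (norm w)\<^sup>2 \<le> l"
      by (simp add: l_def matrix_vector_mult_scaleR power2_eq_square divide_inverse mult_ac)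
    then show ?thesis using False by (simp add: pos_divide_le_eq)
  qed simp
  have orth: "w \<bullet> (l *\<^sub>R v - A *v v) = 0" if w: "w \<in> W" for w
  proof -
    define b c where "b = w \<bullet> (l *\<^sub>R v - A *v v)" and "c = l * (norm w)\<^sup>2 - ?f w"
    \<comment> \<open>The bound \<open>le\<close> at \<open>v + t w\<close> is a quadratic in t
      without constant term; it can be nonnegative for all t only if the linear coefficient b
      vanishes.\<close>
    have "0 \<le> 2 * t * b + t\<^sup>2 * c" for t
    proof -
      have "v + t *\<^sub>R w \<in> W" using nv w W by (simp add: subspace_add subspace_mul)
      from le[OF this] have "0 \<le> l * ((v + t *\<^sub>R w) \<bullet> (v + t *\<^sub>R w)) - ?f (v + t *\<^sub>R w)"
        by (simp add: power2_norm_eq_inner)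
      also have "\<dots> = 2 * t * b + t\<^sup>2 * c + (l * (v \<bullet> v) - ?f v)"
      proof -
        have "v \<bullet> (A *v w) = w \<bullet> (A *v v)"
          using symmetric_inner[OF sym, of v w] by (simp only: inner_commute)
        then show ?thesis
          unfolding b_def c_def power2_norm_eq_inner
          by (simp add: matrix_vector_right_distrib matrix_vector_mult_scaleR inner_add inner_diff
              inner_commute[of w v] algebra_simps power2_eq_square)
      qed
      finally show ?thesis using nv(2) by (simp add: l_def norm_eq_1)
    qed note q = this
    show ?thesis
    proof (rule ccontr)
      assume "w \<bullet> (l *\<^sub>R v - A *v v) \<noteq> 0"
      then have b: "b \<noteq> 0" by (simp add: b_def)
      \<comment> \<open>One more than the modulus of c, so that d is positive and bounds c even if c
        is 0; the t below minimises \<open>2 t b + t^2 d\<close>.\<close>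
      define d where "d = \<bar>c\<bar> + 1"
      have d: "d > 0" "c \<le> d" by (auto simp: d_def)
      define t where "t = - b / d"
      have "2 * t * b + t\<^sup>2 * c \<le> 2 * t * b + t\<^sup>2 * d"
        using d by (intro add_left_mono mult_left_mono) auto
      also have "\<dots> = - (b\<^sup>2 / d)"
        using d by (simp add: t_def power2_eq_square)
      also have "\<dots> < 0" using b d by simp
      finally show False using q[of t] by simp
    qed
  qed
  have "l *\<^sub>R v - A *v v \<in> W" using nv inv W by (simp add: subspace_diff subspace_mul)
  from orth[OF this] have "A *v v = l *\<^sub>R v" by simp
  with nv that show ?thesis by blast
qed

text \<open>By symmetry the orthogonal complement of the eigenvectors found so far is mapped into
  itself, so maximising the Rayleigh quotient on it yields the next one as long as the complement is
  nontrivial.\<close>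

lemma symmetric_orthonormal_eigenvectors:
  fixes A :: "real^'n^'n"
  assumes sym: "transpose A = A" and "k \<le> CARD('n)"
  shows "\<exists>B. finite B \<and> card B = k \<and> pairwise orthogonal B \<and>
    (\<forall>b\<in>B. norm b = 1 \<and> (\<exists>l. A *v b = l *\<^sub>R b))"
  using assms(2)
proof (induction k)
  case 0
  show ?case by (intro exI[of _ "{}"]) auto
next
  case (Suc k)
  then obtain B where B: "finite B" "card B = k" "pairwise orthogonal B"
    and eig: "\<And>b. b \<in> B \<Longrightarrow> norm b = 1 \<and> (\<exists>l. A *v b = l *\<^sub>R b)" by auto
  let ?W = "{v. \<forall>b\<in>B. b \<bullet> v = 0}"
  have "dim B < DIM(real^'n)"
    using dim_le_card'[OF B(1)] B(2) Suc.prems by simp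
  then obtain u where u: "u \<noteq> 0" "\<And>y. y \<in> span B \<Longrightarrow> orthogonal u y"
    using orthogonal_to_subspace_exists by blast
  have uW: "u \<in> ?W" using u(2) by (auto simp: orthogonal_def inner_commute span_base)
  have W: "subspace ?W" by (auto simp: subspace_def inner_add_right)
  have inv: "A *v v \<in> ?W" if "v \<in> ?W" for v
  proof -
    have "b \<bullet> (A *v v) = 0" if "b \<in> B" for b
      using eig[OF that] \<open>v \<in> ?W\<close> that symmetric_inner[OF sym, of b v] by auto
    then show ?thesis by auto
  qed
  obtain v l where v: "v \<in> ?W" "norm v = 1" "A *v v = l *\<^sub>R v"
    using symmetric_eigenvector_exists[OF sym W inv uW u(1)] by blast
  have nin: "v \<notin> B" using v by force
  show ?case
  proof (intro exI[of _ "insert v B"] conjI ballI)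
    show "pairwise orthogonal (insert v B)"
      using B(3) v(1) by (auto simp: pairwise_insert orthogonal_def inner_commute)
  qed (use B eig v nin in auto)
qed

text \<open>The eigenvalue of b appears as \<open>b \<bullet> (A *v b)\<close>, which spares the
  choice of an eigenvalue function.\<close>

lemma orthonormal_eigenbasis:
  fixes A :: "real^'n^'n"
  assumes sym: "transpose A = A"
  obtains B where "finite B" "card B = CARD('n)" "\<forall>b\<in>B. norm b = 1"
    "\<forall>b\<in>B. A *v b = (b \<bullet> (A *v b)) *\<^sub>R b"
    "\<forall>b\<in>B. \<forall>c\<in>B. b \<bullet> c = (if b = c then 1 else 0)"
    "\<forall>v. (\<Sum>b\<in>B. (b \<bullet> v) *\<^sub>R b) = v"
proof -
  obtain B where B: "finite B" "card B = CARD('n)" "pairwise orthogonal B"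
    and eig: "\<And>b. b \<in> B \<Longrightarrow> norm b = 1 \<and> (\<exists>l. A *v b = l *\<^sub>R b)"
    using symmetric_orthonormal_eigenvectors[OF sym le_refl] by auto
  have "0 \<notin> B" using eig by force
  then have "independent B" using B(3) pairwise_orthogonal_independent by blast
  then have "span B = UNIV"
    using B(2) card_ge_dim_independent[of B UNIV] by (auto simp: top.extremum_unique)
  then have "(\<Sum>b\<in>B. (v \<bullet> b) *\<^sub>R b) = v" for v
    using orthonormal_basis_expand[of B v] B eig by auto
  then have 1: "(\<Sum>b\<in>B. (b \<bullet> v) *\<^sub>R b) = v" for v
    by (subst inner_commute)
  have nb: "b \<bullet> b = 1" if "b \<in> B" for b
    using eig[OF that] by (simp add: norm_eq_1)
  have 2: "A *v b = (b \<bullet> (A *v b)) *\<^sub>R b" if "b \<in> B" for b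
  proof -
    obtain l where "A *v b = l *\<^sub>R b" using eig \<open>b \<in> B\<close> by blast
    then show ?thesis using nb[OF that] by (simp only: inner_scaleR_right mult_1_right)
  qed
  have 3: "b \<bullet> c = (if b = c then 1 else 0)" if "b \<in> B" "c \<in> B" for b c
    using that B(3) nb by (auto simp: pairwise_def orthogonal_def)
  show ?thesis
    by (rule that[of B]) (use B(1,2) eig 1 2 3 in \<open>blast+\<close>)
qed

text \<open>S multiplies each eigenvector of A by the root of its eigenvalue. The third fact holds
  because a lower bound \<open>s^2\<close> for the form of A bounds each eigenvalue of A, hence s
  bounds each eigenvalue of S. It later makes the root Lipschitz and its inverse bounded, uniformly
  in \<theta>.\<close>

lemma pos_def_sqrt_exists:
  fixes A :: "real^'n^'n"
  assumes "pos_def A"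
  obtains S where "pos_def S" "S ** S = A"
    "\<And>s v. 0 \<le> s \<Longrightarrow> (\<And>v. s\<^sup>2 * (norm v)\<^sup>2 \<le> v \<bullet> (A *v v)) \<Longrightarrow> s * (norm v)\<^sup>2 \<le> v \<bullet> (S *v v)"
proof -
  have sym: "transpose A = A" and pos: "\<And>v. v \<noteq> 0 \<Longrightarrow> 0 < v \<bullet> (A *v v)"
    using assms by (auto simp: pos_def_def)
  obtain B where B0: "finite B" "card B = CARD('n)" "\<forall>b\<in>B. norm b = 1"
    "\<forall>b\<in>B. A *v b = (b \<bullet> (A *v b)) *\<^sub>R b"
    "\<forall>b\<in>B. \<forall>c\<in>B. b \<bullet> c = (if b = c then 1 else 0)"
    "\<forall>v. (\<Sum>b\<in>B. (b \<bullet> v) *\<^sub>R b) = v"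
    by (rule orthonormal_eigenbasis[OF sym])
  note B = B0(1,3-)[rule_format]
  define l where "l b = b \<bullet> (A *v b)" for b
  have Ab: "A *v b = l b *\<^sub>R b" if "b \<in> B" for b
    unfolding l_def by (rule B(3)[OF that])
  have l: "l b > 0" if "b \<in> B" for b unfolding l_def using B(2)[OF that] by (intro pos) auto
  have sq: "sqrt (l b) * (sqrt (l b) * x) = x * l b" if "b \<in> B" for b x
  proof -
    have "sqrt (l b) * sqrt (l b) = l b" using l[OF that] by simp
    then show ?thesis by (simp flip: mult.assoc)
  qed
  define S where "S = matrix (\<lambda>v. \<Sum>b\<in>B. (sqrt (l b) * (b \<bullet> v)) *\<^sub>R b)"
  have lin: "linear (\<lambda>v. \<Sum>b\<in>B. (sqrt (l b) * (b \<bullet> v)) *\<^sub>R b)"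
    by (rule linearI) (simp_all add: inner_add_right algebra_simps sum.distrib scaleR_sum_right)
  have S: "S *v v = (\<Sum>b\<in>B. (sqrt (l b) * (b \<bullet> v)) *\<^sub>R b)" for v
    unfolding S_def by (rule fun_cong[OF matrix_vector_mul(2)[OF lin]])
  have Sb: "b \<bullet> (S *v v) = sqrt (l b) * (b \<bullet> v)" if "b \<in> B" for b v
    unfolding S using that B(1,4)
    by (simp add: inner_sum_right if_distrib[of "\<lambda>x. _ * x"] cong: if_cong)
  have SS: "S *v (S *v v) = A *v v" for v
  proof -
    have "S *v (S *v v) = (\<Sum>b\<in>B. (sqrt (l b) * (sqrt (l b) * (b \<bullet> v))) *\<^sub>R b)"
      unfolding S[of "S *v v"] by (intro sum.cong refl) (simp add: Sb)
    also have "\<dots> = (\<Sum>b\<in>B. (b \<bullet> v) *\<^sub>R (A *v b))"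
      using sq by (intro sum.cong refl) (simp add: Ab)
    also have "\<dots> = A *v (\<Sum>b\<in>B. (b \<bullet> v) *\<^sub>R b)"
      by (simp add: linear_sum[OF matrix_vector_mul_linear] matrix_vector_mult_scaleR)
    finally show ?thesis by (simp add: B(5))
  qed
  have vSw: "v \<bullet> (S *v w) = (\<Sum>b\<in>B. sqrt (l b) * (b \<bullet> v) * (b \<bullet> w))" for v w
    unfolding S by (simp add: inner_sum_right inner_commute mult_ac)
  have nv: "(norm v)\<^sup>2 = (\<Sum>b\<in>B. (b \<bullet> v)\<^sup>2)" for v
  proof -
    have "v \<bullet> v = v \<bullet> (\<Sum>b\<in>B. (b \<bullet> v) *\<^sub>R b)" by (simp add: B(5))
    then have "v \<bullet> v = (\<Sum>b\<in>B. (b \<bullet> v)\<^sup>2)"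
      by (simp add: inner_sum_right power2_eq_square inner_commute)
    then show ?thesis by (simp only: power2_norm_eq_inner)
  qed
  have "transpose S = S"
    by (rule symmetricI) (simp add: vSw inner_commute[of "S *v _"] mult_ac)
  moreover have "0 < v \<bullet> (S *v v)" if "v \<noteq> 0" for v
  proof -
    have "\<exists>b\<in>B. b \<bullet> v \<noteq> 0"
    proof (rule ccontr)
      assume "\<not> ?thesis"
      then have "(norm v)\<^sup>2 = 0" unfolding nv by simp
      with that show False by simp
    qed
    then obtain b where b: "b \<in> B" "b \<bullet> v \<noteq> 0" by blast
    have "0 < sqrt (l b) * (b \<bullet> v) * (b \<bullet> v)"
      using l[OF b(1)] b(2) by (simp add: mult.assoc flip: power2_eq_square)
    then show ?thesis unfolding vSw
      by (intro sum_pos2[OF B(1) b(1)])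
         (auto simp: mult.assoc less_imp_le[OF l] simp flip: power2_eq_square)
  qed
  ultimately have "pos_def S" by (simp add: pos_def_def)
  moreover have "S ** S = A"
    by (simp add: matrix_eq SS flip: matrix_vector_mul_assoc)
  moreover have "s * (norm v)\<^sup>2 \<le> v \<bullet> (S *v v)"
    if "0 \<le> s" and le: "\<And>v. s\<^sup>2 * (norm v)\<^sup>2 \<le> v \<bullet> (A *v v)" for s v
  proof -
    have "s \<le> sqrt (l b)" if "b \<in> B" for b
      using le[of b] B(2)[OF that] by (simp add: l_def real_le_rsqrt)
    then show ?thesis
      unfolding vSw nv sum_distrib_left
      by (intro sum_mono) (auto simp: mult.assoc power2_eq_square intro!: mult_right_mono)
  qed
  ultimately show ?thesis using that by blast
qed

section \<open>Frobenius inner product and uniqueness of the square root\<close>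

lemma inner_matrix_rows: "(A :: real^'n^'n) \<bullet> B = (\<Sum>i\<in>UNIV. A $ i \<bullet> B $ i)"
  by (simp add: inner_vec_def)

lemma inner_transpose: "transpose A \<bullet> transpose B = (A :: real^'n^'n) \<bullet> B"
  by (simp add: inner_vec_def transpose_def) (rule sum.swap)

lemma matrix_mult_row_symmetric:
  fixes D T :: "real^'n^'n"
  assumes "transpose T = T"
  shows "(D ** T) $ i = T *v (D $ i)"
proof -
  have "T $ k $ j = T $ j $ k" for j k using assms by (metis (no_types) transpose_def vec_lambda_beta)
  then show ?thesis
    by (simp add: vec_eq_iff matrix_matrix_mult_def matrix_vector_mult_def mult.commute)
qed

text \<open>With \<open>D = S - T\<close> one has \<open>S ** S - T ** T = S ** D + D ** T\<close>, and pairing the latter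
  with \<open>D\<close> gives two quadratic forms.\<close>

lemma inner_diff_squares:
  fixes S T :: "real^'n^'n"
  assumes S: "transpose S = S" and T: "transpose T = T"
  shows "(S - T) \<bullet> (S ** S - T ** T) =
    (\<Sum>i\<in>UNIV. (S - T) $ i \<bullet> (S *v ((S - T) $ i))) + (\<Sum>i\<in>UNIV. (S - T) $ i \<bullet> (T *v ((S - T) $ i)))"
proof -
  let ?D = "S - T"
  have D: "transpose ?D = ?D" using S T by (simp add: transpose_def vec_eq_iff)
  have "?D \<bullet> (S ** ?D) = transpose ?D \<bullet> transpose (S ** ?D)" by (simp only: inner_transpose)
  also have "\<dots> = ?D \<bullet> (?D ** S)" by (simp only: matrix_transpose_mul D S)
  finally have 1: "?D \<bullet> (S ** ?D) = ?D \<bullet> (?D ** S)" .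
  have "S ** S - T ** T = S ** ?D + ?D ** T"
    by (simp add: matrix_matrix_mult_def vec_eq_iff algebra_simps sum.distrib sum_subtractf)
  then have "?D \<bullet> (S ** S - T ** T) = ?D \<bullet> (?D ** S) + ?D \<bullet> (?D ** T)"
    by (simp add: inner_add_right 1)
  then show ?thesis
    by (simp add: inner_matrix_rows[of ?D] matrix_mult_row_symmetric[OF S] matrix_mult_row_symmetric[OF T])
qed

text \<open>When the squares agree, \<open>inner_diff_squares\<close> says that two nonnegative sums
  add up to 0. The form of S then vanishes at every row of \<open>S - T\<close>, and positive
  definiteness makes the rows 0.\<close>

lemma pos_def_sqrt_unique:
  fixes S T :: "real^'n^'n"
  assumes S: "pos_def S" and T: "pos_def T" and eq: "S ** S = T ** T"
  shows "S = T"
proof -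
  let ?D = "S - T"
  have nn: "0 \<le> v \<bullet> (M *v v)" if "pos_def M" for v and M :: "real^'n^'n"
    using that by (cases "v = 0") (auto simp: pos_def_def less_imp_le)
  have "(\<Sum>i\<in>UNIV. ?D $ i \<bullet> (S *v (?D $ i))) + (\<Sum>i\<in>UNIV. ?D $ i \<bullet> (T *v (?D $ i))) = 0"
    using inner_diff_squares[of S T] S T eq by (simp add: pos_def_def)
  moreover have "0 \<le> (\<Sum>i\<in>UNIV. ?D $ i \<bullet> (T *v (?D $ i)))"
    by (intro sum_nonneg nn T)
  moreover have "0 \<le> (\<Sum>i\<in>UNIV. ?D $ i \<bullet> (S *v (?D $ i)))"
    by (intro sum_nonneg nn S)
  ultimately have "(\<Sum>i\<in>UNIV. ?D $ i \<bullet> (S *v (?D $ i))) = 0" by linarith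
  then have "?D $ i \<bullet> (S *v (?D $ i)) = 0" for i
    using nn[OF S] by (subst (asm) sum_nonneg_eq_0_iff) auto
  then have "?D $ i = 0" for i
    using S by (metis less_irrefl pos_def_def)
  then show ?thesis by (simp add: vec_eq_iff)
qed

lemma matrix_sqrt:
  fixes A :: "real^'n^'n"
  assumes A: "pos_def A"
  shows "pos_def (matrix_sqrt A)" "matrix_sqrt A ** matrix_sqrt A = A"
    "\<And>s v. 0 \<le> s \<Longrightarrow> (\<And>v. s\<^sup>2 * (norm v)\<^sup>2 \<le> v \<bullet> (A *v v)) \<Longrightarrow>
      s * (norm v)\<^sup>2 \<le> v \<bullet> (matrix_sqrt A *v v)"
proof -
  obtain S where S: "pos_def S" "S ** S = A"
    "\<And>s v. 0 \<le> s \<Longrightarrow> (\<And>v. s\<^sup>2 * (norm v)\<^sup>2 \<le> v \<bullet> (A *v v)) \<Longrightarrow> s * (norm v)\<^sup>2 \<le> v \<bullet> (S *v v)"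
    using pos_def_sqrt_exists[OF A] by blast
  have "matrix_sqrt A = S"
    unfolding matrix_sqrt_def
    by (rule the_equality) (use S pos_def_sqrt_unique in auto)
  then show "pos_def (matrix_sqrt A)" "matrix_sqrt A ** matrix_sqrt A = A"
    "\<And>s v. 0 \<le> s \<Longrightarrow> (\<And>v. s\<^sup>2 * (norm v)\<^sup>2 \<le> v \<bullet> (A *v v)) \<Longrightarrow>
      s * (norm v)\<^sup>2 \<le> v \<bullet> (matrix_sqrt A *v v)"
    using S by auto
qed

section \<open>Linear changes of variables\<close>

lemma nn_integral_translate:
  fixes f :: "'a::euclidean_space \<Rightarrow> ennreal"
  assumes [measurable]: "f \<in> borel_measurable borel"
  shows "(\<integral>\<^sup>+x. f (a + x) \<partial>lborel) = (\<integral>\<^sup>+x. f x \<partial>lborel)"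
proof -
  have "(\<integral>\<^sup>+x. f x \<partial>distr lborel borel ((+) a)) = (\<integral>\<^sup>+x. f (a + x) \<partial>lborel)"
    by (subst nn_integral_distr) auto
  then show ?thesis by (simp add: lborel_distr_plus)
qed

lemma nn_integral_scale:
  fixes f :: "'a::euclidean_space \<Rightarrow> ennreal"
  assumes [measurable]: "f \<in> borel_measurable borel" and c: "c \<noteq> 0"
  shows "(\<integral>\<^sup>+x. f x \<partial>lborel) = ennreal (\<bar>c\<bar> ^ DIM('a)) * (\<integral>\<^sup>+x. f (t + c *\<^sub>R x) \<partial>lborel)"
proof -
  have "(\<integral>\<^sup>+x. f x \<partial>lborel) =
    (\<integral>\<^sup>+x. f x \<partial>density (distr lborel borel (\<lambda>x. t + c *\<^sub>R x)) (\<lambda>_. \<bar>c\<bar> ^ DIM('a)))"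
    using lborel_affine[OF c, of t] by simp
  then show ?thesis
    by (simp add: nn_integral_density nn_integral_distr nn_integral_cmult)
qed

lemma nn_integral_reflect:
  fixes f :: "'a::euclidean_space \<Rightarrow> ennreal"
  assumes "f \<in> borel_measurable borel"
  shows "(\<integral>\<^sup>+x. f (a - x) \<partial>lborel) = (\<integral>\<^sup>+x. f x \<partial>lborel)"
  using nn_integral_scale[OF assms, of "-1" a] by simp

text \<open>The double integral argument for the uniqueness of translation invariant measures.\<close>

lemma nn_integral_linear_cross:
  fixes T :: "'a::euclidean_space \<Rightarrow> 'a" and f g :: "'a \<Rightarrow> ennreal"
  assumes T: "linear T" "surj T"
    and [measurable]: "f \<in> borel_measurable borel" "g \<in> borel_measurable borel"
  shows "(\<integral>\<^sup>+x. f (T x) \<partial>lborel) * (\<integral>\<^sup>+x. g x \<partial>lborel) = (\<integral>\<^sup>+x. g (T x) \<partial>lborel) * (\<integral>\<^sup>+x. f x \<partial>lborel)"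
proof -
  have [measurable]: "T \<in> borel_measurable borel"
    using T(1) by (intro borel_measurable_continuous_onI linear_continuous_on linear_conv_bounded_linear[THEN iffD1])
  have "(\<integral>\<^sup>+x. f (T x) \<partial>lborel) * (\<integral>\<^sup>+x. g x \<partial>lborel) = (\<integral>\<^sup>+x. f (T x) * (\<integral>\<^sup>+y. g (T x + y) \<partial>lborel) \<partial>lborel)"
    by (simp add: nn_integral_translate[of g] nn_integral_multc)
  also have "\<dots> = (\<integral>\<^sup>+x. (\<integral>\<^sup>+y. f (T x) * g (T x + y) \<partial>lborel) \<partial>lborel)"
    by (simp add: nn_integral_cmult)
  also have "\<dots> = (\<integral>\<^sup>+y. (\<integral>\<^sup>+x. f (T x) * g (T x + y) \<partial>lborel) \<partial>lborel)"
    by (rule lborel_pair.Fubini') simp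
  also have "\<dots> = (\<integral>\<^sup>+y. (\<integral>\<^sup>+x. f (T x - y) * g (T x) \<partial>lborel) \<partial>lborel)"
  proof (rule nn_integral_cong)
    fix y :: 'a
    \<comment> \<open>Translating x by a preimage s of y turns \<open>T x\<close> into
      \<open>y + T x\<close>; this is where surjectivity enters.\<close>
    obtain s where s: "T s = y" using T(2) by (metis surjD)
    have "(\<integral>\<^sup>+x. f (T x - y) * g (T x) \<partial>lborel) = (\<integral>\<^sup>+x. f (T (s + x) - y) * g (T (s + x)) \<partial>lborel)"
      using nn_integral_translate[of "\<lambda>x. f (T x - y) * g (T x)" s] by simp
    also have "\<dots> = (\<integral>\<^sup>+x. f (T x) * g (T x + y) \<partial>lborel)"
      by (intro nn_integral_cong) (simp add: linear_add[OF T(1)] s add.commute[of y])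
    finally show "(\<integral>\<^sup>+x. f (T x) * g (T x + y) \<partial>lborel) = (\<integral>\<^sup>+x. f (T x - y) * g (T x) \<partial>lborel)"
      by (rule sym)
  qed
  also have "\<dots> = (\<integral>\<^sup>+x. (\<integral>\<^sup>+y. f (T x - y) * g (T x) \<partial>lborel) \<partial>lborel)"
    by (rule lborel_pair.Fubini') simp
  also have "\<dots> = (\<integral>\<^sup>+x. (\<integral>\<^sup>+y. f y \<partial>lborel) * g (T x) \<partial>lborel)"
    by (simp add: nn_integral_multc nn_integral_reflect[of f])
  also have "\<dots> = (\<integral>\<^sup>+y. f y \<partial>lborel) * (\<integral>\<^sup>+x. g (T x) \<partial>lborel)"
    by (rule nn_integral_cmult) simp
  also have "\<dots> = (\<integral>\<^sup>+x. g (T x) \<partial>lborel) * (\<integral>\<^sup>+x. f x \<partial>lborel)"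
    by (rule mult.commute)
  finally show ?thesis .
qed

text \<open>By \<open>nn_integral_linear_cross\<close>, T changes all integrals by a common factor.
  The unit ball, which T preserves and whose measure is positive and finite, shows that the factor
  is 1.\<close>

lemma nn_integral_orthogonal:
  fixes T :: "'a::euclidean_space \<Rightarrow> 'a" and f :: "'a \<Rightarrow> ennreal"
  assumes T: "orthogonal_transformation T" and f: "f \<in> borel_measurable borel"
  shows "(\<integral>\<^sup>+x. f (T x) \<partial>lborel) = (\<integral>\<^sup>+x. f x \<partial>lborel)"
proof -
  let ?g = "indicator (ball 0 1) :: 'a \<Rightarrow> ennreal"
  have lin: "linear T" "surj T"
    using T by (auto simp: orthogonal_transformation_def orthogonal_transformation_surj)
  have "(\<integral>\<^sup>+x. f (T x) \<partial>lborel) * (\<integral>\<^sup>+x. ?g x \<partial>lborel) = (\<integral>\<^sup>+x. ?g (T x) \<partial>lborel) * (\<integral>\<^sup>+x. f x \<partial>lborel)"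
    by (rule nn_integral_linear_cross[OF lin f borel_measurable_indicator]) simp
  also have "(\<integral>\<^sup>+x. ?g (T x) \<partial>lborel) = (\<integral>\<^sup>+x. ?g x \<partial>lborel)"
    using T by (intro nn_integral_cong) (auto simp: indicator_def orthogonal_transformation_norm)
  finally have eq: "(\<integral>\<^sup>+x. f (T x) \<partial>lborel) * emeasure lborel (ball 0 1 :: 'a set) =
      (\<integral>\<^sup>+x. f x \<partial>lborel) * emeasure lborel (ball 0 1 :: 'a set)"
    by (simp add: mult.commute)
  have "emeasure lborel (ball 0 1 :: 'a set) \<noteq> 0" "emeasure lborel (ball 0 1 :: 'a set) \<noteq> \<top>"
    using content_ball_pos[of 1 "0::'a"] emeasure_lborel_ball_finite[of "0::'a" 1]
    by (auto simp: measure_def)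
  then show ?thesis
    using eq unfolding mult.commute[of _ "emeasure lborel (ball 0 1 :: 'a set)"]
    by (simp add: ennreal_mult_cancel_left)
qed

lemma nn_integral_diagonal:
  fixes f :: "real^'n \<Rightarrow> ennreal" and l :: "'n \<Rightarrow> real"
  assumes [measurable]: "f \<in> borel_measurable borel" and l: "\<And>i. 0 < l i"
  shows "(\<integral>\<^sup>+x. f x \<partial>lborel) = ennreal (\<Prod>i\<in>UNIV. l i) * (\<integral>\<^sup>+x. f (\<chi> i. l i * x $ i) \<partial>lborel)"
proof -
  \<comment> \<open>The factors are indexed by \<open>'n\<close>, whereas
    \<open>lborel_affine_euclidean\<close> expects them indexed by basis vectors; the choice
    recovers the index of a basis vector.\<close>
  define c where "c b = l (SOME i. b = axis i 1)" for b :: "real^'n"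
  have c: "c (axis i 1) = l i" for i
    unfolding c_def by (simp add: axis_eq_axis)
  define T where "T x = 0 + (\<Sum>j\<in>Basis. (c j * (x \<bullet> j)) *\<^sub>R j)" for x :: "real^'n"
  have B: "Basis = range (\<lambda>i. axis i 1 :: real^'n)"
    by (auto simp: Basis_vec_def)
  have inj: "inj (\<lambda>i. axis i 1 :: real^'n)"
    by (auto simp: inj_on_def axis_eq_axis)
  have T: "T x = (\<chi> i. l i * x $ i)" for x
    unfolding T_def B sum.reindex[OF inj]
    by (simp add: vec_eq_iff c inner_axis) (simp add: axis_def if_distrib[of "\<lambda>y. _ * y"] cong: if_cong)
  have "lborel = density (distr lborel borel T) (\<lambda>_. (\<Prod>j\<in>Basis. \<bar>c j\<bar>))"
    unfolding T_def[abs_def]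
  proof (rule lborel_affine_euclidean)
    fix j :: "real^'n" assume "j \<in> Basis"
    then obtain i where "j = axis i 1" by (auto simp: B)
    then show "c j \<noteq> 0" using l[of i] by (simp add: c)
  qed
  also have "(\<Prod>j\<in>Basis. \<bar>c j\<bar>) = (\<Prod>i\<in>UNIV. l i)"
    unfolding B prod.reindex[OF inj] using l by (simp add: c less_imp_le)
  finally have "(\<integral>\<^sup>+x. f x \<partial>lborel) =
      (\<integral>\<^sup>+x. f x \<partial>density (distr lborel borel T) (\<lambda>_. (\<Prod>i\<in>UNIV. l i)))"
    by simp
  moreover have [measurable]: "T \<in> borel_measurable borel"
    unfolding T_def[abs_def] by measurable
  ultimately show ?thesis
    by (simp add: nn_integral_density nn_integral_distr nn_integral_cmult T)
qed

text \<open>Diagonalisation writes S as an orthogonal map, a diagonal matrix and the inverse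
  orthogonal map. The outer two preserve integrals, and the diagonal part contributes the product of
  the eigenvalues, which is \<open>det S\<close>.\<close>

lemma nn_integral_pos_def:
  fixes S :: "real^'n^'n" and f :: "real^'n \<Rightarrow> ennreal"
  assumes S: "pos_def S" and [measurable]: "f \<in> borel_measurable borel"
  shows "0 < det S" "(\<integral>\<^sup>+x. f x \<partial>lborel) = ennreal (det S) * (\<integral>\<^sup>+x. f (S *v x) \<partial>lborel)"
proof -
  have sym: "transpose S = S" and pos: "\<And>v. v \<noteq> 0 \<Longrightarrow> 0 < v \<bullet> (S *v v)"
    using S by (auto simp: pos_def_def)
  obtain B where B0: "finite B" "card B = CARD('n)" "\<forall>b\<in>B. norm b = 1"
    "\<forall>b\<in>B. S *v b = (b \<bullet> (S *v b)) *\<^sub>R b"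
    "\<forall>b\<in>B. \<forall>c\<in>B. b \<bullet> c = (if b = c then 1 else 0)"
    "\<forall>v. (\<Sum>b\<in>B. (b \<bullet> v) *\<^sub>R b) = v"
    by (rule orthonormal_eigenbasis[OF sym])
  note B = B0[rule_format]
  obtain e :: "'n \<Rightarrow> real^'n" where e: "bij_betw e UNIV B"
    using finite_same_card_bij[OF finite_class.finite_UNIV B(1)] B(2) by auto
  have eB: "e i \<in> B" for i using e by (auto simp: bij_betw_def)
  have ee: "e i \<bullet> e j = (if i = j then 1 else 0)" for i j
    using B(5)[OF eB eB, of i j] e by (auto simp: bij_betw_def inj_on_def)
  define l where "l i = e i \<bullet> (S *v e i)" for i
  have l: "0 < l i" for i
    unfolding l_def using B(3)[OF eB, of i] by (intro pos) auto
  have Se: "S *v e i = l i *\<^sub>R e i" for i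
    unfolding l_def by (rule B(4)[OF eB])
  define O' :: "real^'n^'n" where "O' = (\<chi> i. e i)"
  define D :: "real^'n^'n" where "D = (\<chi> i j. if i = j then l i else 0)"
  have "O' ** transpose O' = mat 1"
    by (simp add: O'_def matrix_matrix_mult_def transpose_def mat_def vec_eq_iff ee[unfolded inner_vec_def, simplified])
  then have orth: "orthogonal_matrix O'"
    by (metis matrix_left_right_inverse orthogonal_matrix_def)
  have O': "O' *v v = (\<chi> i. e i \<bullet> v)" for v
    by (simp add: O'_def matrix_vector_mult_def inner_vec_def)
  have OT: "transpose O' *v v = (\<Sum>i\<in>UNIV. v $ i *\<^sub>R e i)" for v
    by (simp add: O'_def matrix_vector_mult_def transpose_def vec_eq_iff mult.commute)
  have D: "D *v v = (\<chi> i. l i * v $ i)" for v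
    by (simp add: D_def matrix_vector_mult_def vec_eq_iff if_distrib[of "\<lambda>x. x * _"] cong: if_cong)
  have SODO: "S *v v = transpose O' *v (D *v (O' *v v))" for v
  proof -
    have "v = (\<Sum>i\<in>UNIV. (e i \<bullet> v) *\<^sub>R e i)"
      using sum.reindex_bij_betw[OF e, of "\<lambda>b. (b \<bullet> v) *\<^sub>R b"] B(6)[of v] by simp
    then have "S *v v = S *v (\<Sum>i\<in>UNIV. (e i \<bullet> v) *\<^sub>R e i)" by (rule arg_cong)
    also have "\<dots> = (\<Sum>i\<in>UNIV. (l i * (e i \<bullet> v)) *\<^sub>R e i)"
      by (simp add: linear_sum[OF matrix_vector_mul_linear] matrix_vector_mult_scaleR Se mult.commute)
    finally show ?thesis unfolding O' D OT by simp
  qed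
  then have "S = transpose O' ** (D ** O')"
    by (simp add: matrix_eq flip: matrix_vector_mul_assoc)
  then have "det S = det O' * det O' * (\<Prod>i\<in>UNIV. l i)"
    by (simp add: det_mul det_diagonal D_def)
  also have "det O' * det O' = 1"
    using det_orthogonal_matrix[OF orth] by auto
  finally have det: "det S = (\<Prod>i\<in>UNIV. l i)" by simp
  then show "0 < det S" by (simp add: prod_pos l)
  have ot: "orthogonal_transformation ((*v) O')" "orthogonal_transformation ((*v) (transpose O'))"
    using orth by (auto simp: orthogonal_transformation_matrix orthogonal_matrix_transpose)
  have mv[measurable]: "(\<lambda>x. M *v x) \<in> borel_measurable borel" for M :: "real^'n^'n"
    by (intro borel_measurable_continuous_onI continuous_intros)
  have "(\<integral>\<^sup>+x. f (S *v x) \<partial>lborel) = (\<integral>\<^sup>+x. f (transpose O' *v (D *v x)) \<partial>lborel)"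
    unfolding SODO
    by (rule nn_integral_orthogonal[OF ot(1)], rule measurable_compose[OF measurable_compose]) measurable
  also have "ennreal (\<Prod>i\<in>UNIV. l i) * \<dots> = (\<integral>\<^sup>+x. f (transpose O' *v x) \<partial>lborel)"
    unfolding D
    by (rule nn_integral_diagonal[OF measurable_compose[OF mv assms(2)] l, symmetric])
  also have "\<dots> = (\<integral>\<^sup>+x. f x \<partial>lborel)"
    by (rule nn_integral_orthogonal[OF ot(2) assms(2)])
  finally show "(\<integral>\<^sup>+x. f x \<partial>lborel) = ennreal (det S) * (\<integral>\<^sup>+x. f (S *v x) \<partial>lborel)"
    by (simp add: det)
qed

section \<open>Uniform control of the square root on coercive matrices\<close>

lemma norm_matrix_vector_le: "norm (M *v x) \<le> norm M * norm (x :: real^'n)" for M :: "real^'n^'m"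
proof -
  have "norm (M *v x) \<le> L2_set (\<lambda>i. norm (M $ i) * norm x) UNIV"
    unfolding norm_vec_def[of "M *v x"] matrix_vector_mul_component
    by (intro L2_set_mono) (simp_all add: Cauchy_Schwarz_ineq2)
  also have "\<dots> = norm M * norm x"
    by (simp add: norm_vec_def[of M] L2_set_left_distrib)
  finally show ?thesis .
qed

text \<open>The constant enters squared so that the square roots are bounded below by s itself. All
  proposal covariances lie in one such set; there the root is Lipschitz, which fails near singular
  matrices.\<close>

definition coercive :: "real \<Rightarrow> (real^'n^'n) set" where
  "coercive s = {A. transpose A = A \<and> (\<forall>v. s\<^sup>2 * (norm v)\<^sup>2 \<le> v \<bullet> (A *v v))}"

context
  fixes s :: real assumes s: "0 < s"
begin

lemma coercive_pos_def: "A \<in> coercive s \<Longrightarrow> pos_def A"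
proof -
  assume A: "A \<in> coercive s"
  have "0 < v \<bullet> (A *v v)" if "v \<noteq> 0" for v
  proof -
    have "0 < s\<^sup>2 * (norm v)\<^sup>2" using s that by simp
    also have "\<dots> \<le> v \<bullet> (A *v v)" using A by (simp add: coercive_def)
    finally show ?thesis .
  qed
  then show ?thesis using A by (simp add: pos_def_def coercive_def)
qed

lemma coercive_sqrt:
  assumes A: "A \<in> coercive s"
  shows "s * (norm v)\<^sup>2 \<le> v \<bullet> (matrix_sqrt A *v v)" "s * norm v \<le> norm (matrix_sqrt A *v v)"
proof -
  show 1: "s * (norm v)\<^sup>2 \<le> v \<bullet> (matrix_sqrt A *v v)"
    using A s by (intro matrix_sqrt(3) coercive_pos_def) (auto simp: coercive_def)
  show "s * norm v \<le> norm (matrix_sqrt A *v v)"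
  proof (cases "v = 0")
    case False
    have "norm v * (s * norm v) \<le> norm v * norm (matrix_sqrt A *v v)"
      using 1 Cauchy_Schwarz_ineq2[of v "matrix_sqrt A *v v"] by (simp add: power2_eq_square mult_ac)
    then show ?thesis using False by simp
  qed simp
qed

lemma coercive_sqrt_inverse:
  assumes A: "A \<in> coercive s"
  shows "matrix_sqrt A *v (matrix_inv (matrix_sqrt A) *v z) = z"
    "matrix_inv (matrix_sqrt A) *v (matrix_sqrt A *v z) = z"
    "norm (matrix_inv (matrix_sqrt A) *v z) \<le> norm z / s"
proof -
  let ?S = "matrix_sqrt A"
  have "x = 0" if "?S *v x = 0" for x
    using coercive_sqrt(2)[OF A, of x] that s by (simp add: mult_le_0_iff)
  then have inv: "invertible ?S"
    using matrix_left_invertible_ker[of ?S] invertible_left_inverse by blast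
  have inv': "?S ** matrix_inv ?S = mat 1 \<and> matrix_inv ?S ** ?S = mat 1"
    unfolding matrix_inv_def by (rule someI_ex) (use inv in \<open>simp add: invertible_def\<close>)
  show 1: "?S *v (matrix_inv ?S *v z) = z" and "matrix_inv ?S *v (?S *v z) = z"
    using inv' by (simp_all add: matrix_vector_mul_assoc)
  show "norm (matrix_inv ?S *v z) \<le> norm z / s"
    using coercive_sqrt(2)[OF A, of "matrix_inv ?S *v z"] s by (simp add: 1 pos_le_divide_eq mult.commute)
qed

text \<open>Each of the two sums in \<open>inner_diff_squares\<close> is at least
  \<open>s * (norm D)^2\<close>, with D the difference of the roots, while the pairing of D with
  \<open>A - B\<close> is at most \<open>norm D * norm (A - B)\<close>.\<close>

lemma matrix_sqrt_lipschitz: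
  assumes A: "A \<in> coercive s" and B: "B \<in> coercive s"
  shows "norm (matrix_sqrt A - matrix_sqrt B) \<le> norm (A - B) / (2 * s)"
proof -
  let ?S = "matrix_sqrt A" and ?T = "matrix_sqrt B"
  let ?D = "?S - ?T"
  have le: "s * (norm M)\<^sup>2 \<le> (\<Sum>i\<in>UNIV. M $ i \<bullet> (matrix_sqrt C *v (M $ i)))"
    if "C \<in> coercive s" for M C :: "real^'n^'n"
    unfolding power2_norm_eq_inner inner_matrix_rows sum_distrib_left
    using coercive_sqrt(1)[OF that] by (intro sum_mono) (simp add: power2_norm_eq_inner)
  have "2 * s * (norm ?D)\<^sup>2 \<le> ?D \<bullet> (?S ** ?S - ?T ** ?T)"
    using le[OF A, of ?D] le[OF B, of ?D] matrix_sqrt(1)[OF coercive_pos_def[OF A]]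
      matrix_sqrt(1)[OF coercive_pos_def[OF B]]
    by (subst inner_diff_squares) (auto simp: pos_def_def)
  also have "\<dots> = ?D \<bullet> (A - B)"
    by (simp add: matrix_sqrt(2) coercive_pos_def A B)
  also have "\<dots> \<le> norm ?D * norm (A - B)"
    by (rule norm_cauchy_schwarz)
  finally have "norm ?D * (norm ?D * (2 * s)) \<le> norm ?D * norm (A - B)"
    by (simp add: power2_eq_square mult_ac)
  then have "norm ?D * (2 * s) \<le> norm (A - B)"
    by (cases "norm ?D = 0") (simp_all add: mult_le_cancel_left)
  then show ?thesis using s by (simp add: pos_le_divide_eq)
qed

text \<open>If \<open>S x = z\<close> and \<open>S' x' = z'\<close>, then
  \<open>S' (x' - x) = (z' - z) + (S - S') x\<close>. Since S' expands by at least s and the root is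
  Lipschitz, \<open>x' - x\<close> is small. Joint continuity is what makes the proposal density
  measurable in the parameter.\<close>

lemma continuous_on_sqrt_inverse:
  "continuous_on (coercive s \<times> UNIV) (\<lambda>(A, z). matrix_inv (matrix_sqrt A) *v z)"
  unfolding continuous_on_def
proof safe
  fix A :: "real^'n^'n" and z assume A: "A \<in> coercive s"
  let ?F = "\<lambda>A z. matrix_inv (matrix_sqrt A) *v z"
  let ?b = "\<lambda>p. (norm (snd p - z) + norm (fst p - A) / (2 * s) * norm (?F A z)) / s"
  have "norm (?F (fst p) (snd p) - ?F A z) \<le> ?b p" if pc: "p \<in> coercive s \<times> UNIV" for p
  proof -
    obtain A' z' where p: "p = (A', z')" and A': "A' \<in> coercive s" using pc by auto
    let ?S = "matrix_sqrt A" and ?S' = "matrix_sqrt A'" and ?x = "?F A z" and ?x' = "?F A' z'"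
    have "s * norm (?x' - ?x) \<le> norm (?S' *v (?x' - ?x))"
      by (rule coercive_sqrt(2)[OF A'])
    also have "?S' *v (?x' - ?x) = (z' - z) + (?S - ?S') *v ?x"
      using coercive_sqrt_inverse(1)[OF A'] coercive_sqrt_inverse(1)[OF A]
      by (simp add: matrix_vector_mult_diff_distrib matrix_vector_mult_diff_rdistrib)
    also have "norm \<dots> \<le> norm (z' - z) + norm (?S - ?S') * norm ?x"
      by (intro norm_triangle_le add_mono norm_matrix_vector_le) simp
    also have "\<dots> \<le> norm (z' - z) + norm (A' - A) / (2 * s) * norm ?x"
      using matrix_sqrt_lipschitz[OF A A'] by (intro add_left_mono mult_right_mono) (auto simp: norm_minus_commute)
    finally show ?thesis using s by (simp add: p pos_le_divide_eq mult.commute)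
  qed
  then have "\<forall>\<^sub>F p in at (A, z) within coercive s \<times> UNIV. norm (?F (fst p) (snd p) - ?F A z) \<le> ?b p"
    by (simp add: eventually_at_filter)
  moreover have "(?b \<longlongrightarrow> ?b (A, z)) (at (A, z) within coercive s \<times> UNIV)"
    by (intro tendsto_intros) (use s in auto)
  then have "(?b \<longlongrightarrow> 0) (at (A, z) within coercive s \<times> UNIV)" by simp
  ultimately have "((\<lambda>p. ?F (fst p) (snd p) - ?F A z) \<longlongrightarrow> 0) (at (A, z) within coercive s \<times> UNIV)"
    by (rule Lim_null_comparison)
  then show "((\<lambda>(A, z). ?F A z) \<longlongrightarrow> ?F A z) (at (A, z) within coercive s \<times> UNIV)"
    unfolding case_prod_beta by (rule LIM_zero_cancel)
qed

lemma measurable_sqrt_inverse: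
  assumes "A \<in> borel_measurable M" "z \<in> borel_measurable M" "\<And>w. w \<in> space M \<Longrightarrow> A w \<in> coercive s"
  shows "(\<lambda>w. matrix_inv (matrix_sqrt (A w)) *v z w) \<in> borel_measurable M"
proof -
  have "(\<lambda>w. (A w, z w)) \<in> measurable M (restrict_space borel (coercive s \<times> UNIV))"
    using assms by (intro measurable_restrict_space2) (auto simp: borel_prod[symmetric])
  from measurable_compose[OF this borel_measurable_continuous_on_restrict[OF continuous_on_sqrt_inverse]]
  show ?thesis by simp
qed

end

lemma borel_measurable_det: "det \<in> borel_measurable (borel :: (real^'n^'n) measure)"
proof -
  have "continuous_on UNIV (det :: real^'n^'n \<Rightarrow> real)"
    unfolding det_def[abs_def] by (intro continuous_intros)
  then show ?thesis by (rule borel_measurable_continuous_onI)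
qed

text \<open>The Leibniz sum has n! terms, each a product of n entries. Only the power of the norm
  matters: it decides how fast \<open>am_height\<close> can decay.\<close>

lemma abs_det_le: "\<bar>det A\<bar> \<le> fact CARD('n) * norm (A :: real^'n^'n) ^ CARD('n)"
proof -
  have e: "\<bar>A $ i $ j\<bar> \<le> norm A" for i j
    by (rule order_trans[OF component_le_norm_cart Finite_Cartesian_Product.norm_nth_le])
  have "\<bar>det A\<bar> \<le> (\<Sum>p | p permutes (UNIV :: 'n set). \<bar>of_int (sign p) * (\<Prod>i\<in>UNIV. A $ i $ p i)\<bar>)"
    unfolding det_def by (rule sum_abs)
  also have "\<dots> \<le> (\<Sum>p | p permutes (UNIV :: 'n set). norm A ^ CARD('n))"
  proof (rule sum_mono)
    fix p :: "'n \<Rightarrow> 'n"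
    have "(\<Prod>i\<in>UNIV. \<bar>A $ i $ p i\<bar>) \<le> (\<Prod>i\<in>(UNIV :: 'n set). norm A)"
      by (intro prod_mono) (auto simp: e)
    then show "\<bar>of_int (sign p) * (\<Prod>i\<in>UNIV. A $ i $ p i)\<bar> \<le> norm A ^ CARD('n)"
      by (simp add: abs_mult abs_prod sign_def)
  qed
  also have "\<dots> = fact CARD('n) * norm A ^ CARD('n)"
    by (simp add: card_permutations)
  finally show ?thesis .
qed

section \<open>The increment density\<close>

text \<open>The scale contributed by the multiple of the identity alone: a lower bound for the
  spread of the proposal in every direction, whatever the parameter.\<close>

definition am_floor :: "'n::finite itself \<Rightarrow> real \<Rightarrow> real" where
  "am_floor _ \<epsilon> = sqrt (2.38\<^sup>2 / real CARD('n) * \<epsilon>)"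

definition am_whiten :: "real \<Rightarrow> 'n::finite param \<Rightarrow> real^'n \<Rightarrow> real^'n" where
  "am_whiten \<epsilon> \<theta> z = matrix_inv (matrix_sqrt (am_scale \<epsilon> \<theta>)) *v z"

definition am_height :: "real \<Rightarrow> 'n::finite param \<Rightarrow> real" where
  "am_height \<epsilon> \<theta> = det (am_scale \<epsilon> \<theta>) powr (-1/2)"

lemma am_density_eq: "am_density q \<epsilon> \<theta> z = am_height \<epsilon> \<theta> * q (am_whiten \<epsilon> \<theta> z)"
  by (simp add: am_density_def am_height_def am_whiten_def)

lemma am_floor_pos: "0 < \<epsilon> \<Longrightarrow> 0 < am_floor TYPE('n::finite) \<epsilon>"
  by (simp add: am_floor_def)

lemma am_scale_coercive:
  fixes \<theta> :: "'n::finite param"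
  assumes "0 < \<epsilon>" "\<theta> \<in> Theta"
  shows "am_scale \<epsilon> \<theta> \<in> coercive (am_floor TYPE('n) \<epsilon>)"
proof -
  define c where "c = 2.38\<^sup>2 / real CARD('n)"
  have c: "c > 0" by (simp add: c_def)
  obtain \<mu> \<Gamma> where th: "\<theta> = (\<mu>, \<Gamma>)" "pos_def \<Gamma>" using assms(2) by (auto simp: Theta_def)
  have A: "am_scale \<epsilon> \<theta> = c *\<^sub>R (\<Gamma> + \<epsilon> *\<^sub>R mat 1)" by (simp add: am_scale_def c_def th)
  have Av: "am_scale \<epsilon> \<theta> *v v = c *\<^sub>R (\<Gamma> *v v + \<epsilon> *\<^sub>R v)" for v
    unfolding A by (simp add: matrix_vector_mult_add_rdistrib flip: scaleR_matrix_vector_assoc)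
  have tr: "transpose \<Gamma> = \<Gamma>" using th by (simp add: pos_def_def)
  have "transpose (am_scale \<epsilon> \<theta>) = am_scale \<epsilon> \<theta>"
    by (intro symmetricI) (simp add: Av inner_add_right inner_add_left symmetric_inner[OF tr])
  moreover have "(am_floor TYPE('n) \<epsilon>)\<^sup>2 * (norm v)\<^sup>2 \<le> v \<bullet> (am_scale \<epsilon> \<theta> *v v)" for v
  proof -
    have "0 \<le> v \<bullet> (\<Gamma> *v v)" using th(2) by (cases "v = 0") (auto simp: pos_def_def less_imp_le)
    then have "0 \<le> c * (v \<bullet> (\<Gamma> *v v))" using c by simp
    then show ?thesis
      using assms(1) unfolding Av am_floor_def c_def[symmetric] power2_norm_eq_inner
      by (simp add: inner_add_right c less_imp_le algebra_simps)
  qed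
  ultimately show ?thesis by (simp add: coercive_def)
qed

lemma am_height_sqrt:
  fixes \<theta> :: "'n::finite param"
  assumes "0 < \<epsilon>" "\<theta> \<in> Theta"
  shows "0 < det (matrix_sqrt (am_scale \<epsilon> \<theta>))" "am_height \<epsilon> \<theta> = 1 / det (matrix_sqrt (am_scale \<epsilon> \<theta>))"
    "0 < am_height \<epsilon> \<theta>" "am_height \<epsilon> \<theta> = 1 / sqrt (det (am_scale \<epsilon> \<theta>))" "0 < det (am_scale \<epsilon> \<theta>)"
proof -
  let ?A = "am_scale \<epsilon> \<theta>"
  have pd: "pos_def ?A"
    using coercive_pos_def[OF am_floor_pos am_scale_coercive] assms by blast
  show 1: "0 < det (matrix_sqrt ?A)"
    by (rule nn_integral_pos_def(1)[OF matrix_sqrt(1)[OF pd] borel_measurable_const])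
  have d: "det ?A = (det (matrix_sqrt ?A))\<^sup>2"
    using matrix_sqrt(2)[OF pd] det_mul[of "matrix_sqrt ?A" "matrix_sqrt ?A"] by (simp add: power2_eq_square)
  show 5: "0 < det ?A" using 1 by (simp add: d)
  show 4: "am_height \<epsilon> \<theta> = 1 / sqrt (det ?A)"
    unfolding am_height_def using powr_minus_divide[of "det ?A" "1/2"] powr_half_sqrt[of "det ?A"] 5 by simp
  then show "am_height \<epsilon> \<theta> = 1 / det (matrix_sqrt ?A)" using 1 by (simp add: d)
  show "0 < am_height \<epsilon> \<theta>" using 4 5 by simp
qed

lemma am_whiten_add: "am_whiten \<epsilon> \<theta> (x + y) = am_whiten \<epsilon> \<theta> x + am_whiten \<epsilon> \<theta> y"
  by (simp add: am_whiten_def matrix_vector_right_distrib)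

lemma norm_am_whiten_le:
  fixes \<theta> :: "'n::finite param"
  assumes "0 < \<epsilon>" "\<theta> \<in> Theta"
  shows "norm (am_whiten \<epsilon> \<theta> z) \<le> norm z / am_floor TYPE('n) \<epsilon>"
  unfolding am_whiten_def
  by (rule coercive_sqrt_inverse(3)[OF am_floor_pos am_scale_coercive]) (use assms in auto)

lemma measurable_am_density:
  fixes \<theta> :: "'a \<Rightarrow> 'n::finite param"
  assumes e: "0 < \<epsilon>" and q[measurable]: "q \<in> borel_measurable borel"
    and th[measurable]: "\<theta> \<in> borel_measurable M" and z[measurable]: "z \<in> borel_measurable M"
    and Th: "\<And>w. w \<in> space M \<Longrightarrow> \<theta> w \<in> Theta"
  shows "(\<lambda>w. am_density q \<epsilon> (\<theta> w) (z w)) \<in> borel_measurable M"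
proof -
  have [measurable]: "(\<lambda>w. am_scale \<epsilon> (\<theta> w)) \<in> borel_measurable M"
    unfolding am_scale_def using measurable_compose[OF th borel_measurable_continuous_onI[OF continuous_on_snd[OF continuous_on_id]]]
    by simp
  have [measurable]: "(\<lambda>w. det (am_scale \<epsilon> (\<theta> w))) \<in> borel_measurable M"
    by (rule measurable_compose[OF _ borel_measurable_det]) simp
  have [measurable]: "(\<lambda>w. matrix_inv (matrix_sqrt (am_scale \<epsilon> (\<theta> w))) *v z w) \<in> borel_measurable M"
    by (rule measurable_sqrt_inverse[OF am_floor_pos[OF e, where 'n='n]]) (auto intro!: am_scale_coercive e Th)
  show ?thesis unfolding am_density_def by measurable
qed

lemma prob_density_am_density:
  fixes \<theta> :: "'n::finite param"
  assumes e: "0 < \<epsilon>" and th: "\<theta> \<in> Theta" and q: "prob_density q"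
  shows "prob_density (am_density q \<epsilon> \<theta>)"
proof -
  let ?S = "matrix_sqrt (am_scale \<epsilon> \<theta>)"
  have qm[measurable]: "q \<in> borel_measurable borel" and q0: "\<And>x. 0 \<le> q x"
    and q1: "(\<integral>\<^sup>+x. q x \<partial>lborel) = 1" using q by (auto simp: prob_density_def)
  have co: "am_scale \<epsilon> \<theta> \<in> coercive (am_floor TYPE('n) \<epsilon>)"
    using am_scale_coercive e th by blast
  note fl = am_floor_pos[OF e, where 'n='n]
  have m[measurable]: "am_density q \<epsilon> \<theta> \<in> borel_measurable borel"
    using measurable_am_density[OF e qm, of "\<lambda>_. \<theta>" borel "\<lambda>z. z"] th by simp
  have d: "0 < det ?S" "am_height \<epsilon> \<theta> = 1 / det ?S" using am_height_sqrt[OF e th] by auto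
  have "(\<integral>\<^sup>+z. am_density q \<epsilon> \<theta> z \<partial>lborel) = ennreal (det ?S) * (\<integral>\<^sup>+z. am_density q \<epsilon> \<theta> (?S *v z) \<partial>lborel)"
    by (rule nn_integral_pos_def(2)[OF matrix_sqrt(1)[OF coercive_pos_def[OF fl co]]]) simp
  also have "(\<integral>\<^sup>+z. am_density q \<epsilon> \<theta> (?S *v z) \<partial>lborel) = (\<integral>\<^sup>+z. ennreal (1 / det ?S) * ennreal (q z) \<partial>lborel)"
    using d(1) q0 by (intro nn_integral_cong)
      (simp add: am_density_eq d(2) am_whiten_def coercive_sqrt_inverse(2)[OF fl co] flip: ennreal_mult)
  also have "\<dots> = ennreal (1 / det ?S)"
    by (simp add: nn_integral_cmult q1)
  also have "ennreal (det ?S) * \<dots> = 1"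
    using d(1) by (simp flip: ennreal_mult)
  finally show ?thesis
    using m q0 am_height_sqrt(3)[OF e th] by (simp add: prob_density_def am_density_eq less_imp_le)
qed

text \<open>The determinant of the covariance is at most of order
  \<open>(1 + norm \<Gamma>)^n\<close>, and the height is its inverse root. This is the polynomial
  rate at which a large parameter slows the chain down.\<close>

lemma am_height_lower:
  assumes e: "0 < \<epsilon>" "\<epsilon> < 1"
  obtains c where "0 < c"
    "\<And>\<theta>. (\<theta> :: 'n::finite param) \<in> Theta \<Longrightarrow> c * (1 + norm (snd \<theta>)) powr (- real CARD('n) / 2) \<le> am_height \<epsilon> \<theta>"
proof -
  let ?n = "CARD('n)"
  define a where "a = 2.38\<^sup>2 / real ?n * (1 + norm (mat 1 :: real^'n^'n))"
  define K where "K = fact ?n * a ^ ?n"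
  have a: "0 < a" unfolding a_def by (intro mult_pos_pos add_pos_nonneg) auto
  have K: "0 < K" using a by (simp add: K_def)
  have "K powr (-1/2) * (1 + norm (snd \<theta>)) powr (- real ?n / 2) \<le> am_height \<epsilon> \<theta>"
    if th: "\<theta> \<in> Theta" for \<theta> :: "'n param"
  proof -
    let ?A = "am_scale \<epsilon> \<theta>" and ?m = "1 + norm (snd \<theta>)"
    have m: "1 \<le> ?m" "0 < ?m" by (simp_all add: add_pos_nonneg)
    have "norm ?A \<le> 2.38\<^sup>2 / real ?n * (norm (snd \<theta>) + \<epsilon> * norm (mat 1 :: real^'n^'n))"
      unfolding am_scale_def norm_scaleR using e
      by (intro mult_mono norm_triangle_le) auto
    also have "\<dots> \<le> 2.38\<^sup>2 / real ?n * ((1 + norm (mat 1 :: real^'n^'n)) * ?m)"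
    proof (intro mult_left_mono)
      have "\<epsilon> * norm (mat 1 :: real^'n^'n) \<le> 1 * norm (mat 1 :: real^'n^'n)" using e by (intro mult_right_mono) auto
      moreover have "0 \<le> norm (mat 1 :: real^'n^'n) * norm (snd \<theta>)" by simp
      ultimately show "norm (snd \<theta>) + \<epsilon> * norm (mat 1 :: real^'n^'n) \<le> (1 + norm (mat 1 :: real^'n^'n)) * ?m"
        unfolding distrib_left distrib_right by linarith
    qed simp
    finally have nA: "norm ?A \<le> a * ?m" by (simp add: a_def)
    have "det ?A \<le> fact ?n * norm ?A ^ ?n" using abs_det_le[of ?A] by linarith
    also have "\<dots> \<le> fact ?n * (a * ?m) ^ ?n" using nA by (intro mult_left_mono power_mono) auto
    also have "\<dots> = K * ?m powr real ?n" using powr_realpow[of ?m ?n] m by (simp add: K_def power_mult_distrib)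
    finally have le: "det ?A \<le> K * ?m powr real ?n" .
    have "K powr (-1/2) * ?m powr (- real ?n / 2) = (K * ?m powr real ?n) powr (-1/2)"
      using K m by (simp add: powr_mult powr_powr)
    also have "\<dots> \<le> det ?A powr (-1/2)"
      using le am_height_sqrt(5)[OF e(1) th] by (intro powr_mono2') auto
    finally show ?thesis by (simp add: am_height_def)
  qed
  moreover have "0 < K powr (-1/2)" using K by simp
  ultimately show ?thesis using that by blast
qed

text \<open>The single entry of the square root plays the role of the scale parameter \<sigma>,
  which stays above \<open>am_floor\<close>.\<close>

lemma am_density_one_dim:
  fixes \<theta> :: "'n::finite param"
  assumes one: "CARD('n) = 1" and e: "0 < \<epsilon>" and th: "\<theta> \<in> Theta"
  obtains s where "am_floor TYPE('n) \<epsilon> \<le> s" "am_height \<epsilon> \<theta> = 1 / s"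
    "\<And>q t. am_density q \<epsilon> \<theta> (vec t) = 1 / s * q (vec (t / s))"
proof -
  obtain i :: 'n where i: "UNIV = {i}" using one by (auto simp: card_1_singleton_iff)
  have all: "j = i" for j :: 'n using i by blast
  let ?S = "matrix_sqrt (am_scale \<epsilon> \<theta>)"
  have co: "am_scale \<epsilon> \<theta> \<in> coercive (am_floor TYPE('n) \<epsilon>)"
    using am_scale_coercive e th by blast
  note fl = am_floor_pos[OF e, where 'n='n]
  define s where "s = ?S $ i $ i"
  have "det ?S = (\<Prod>k\<in>UNIV. ?S $ k $ k)" by (rule det_diagonal) (metis all)
  then have det: "det ?S = s" by (simp add: i s_def)
  have s0: "0 < s" using am_height_sqrt(1)[OF e th] by (simp add: det)
  have Sv: "?S *v vec t = vec (s * t)" for t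
    by (simp add: vec_eq_iff matrix_vector_mult_def i s_def) (metis all)
  have nv: "norm (vec t :: real^'n) = \<bar>t\<bar>" for t
    by (simp add: norm_vec_def L2_set_def i)
  have 1: "am_floor TYPE('n) \<epsilon> \<le> s"
    using coercive_sqrt(2)[OF fl co, of "vec 1"] s0 unfolding Sv nv by simp
  have 2: "am_height \<epsilon> \<theta> = 1 / s" using am_height_sqrt(2)[OF e th] by (simp add: det)
  have "am_whiten \<epsilon> \<theta> (vec t) = vec (t / s)" for t
    using coercive_sqrt_inverse(2)[OF fl co, of "vec (t / s)"] s0 by (simp add: am_whiten_def Sv)
  then show ?thesis using that 1 2 by (simp add: am_density_eq)
qed

section \<open>The Metropolis kernel\<close>

lemma accept_bounds:
  assumes "\<And>x. 0 < \<pi> x"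
  shows "0 \<le> accept \<pi> x y" "accept \<pi> x y \<le> 1"
  using assms[of x] assms[of y] by (auto simp: accept_def)

lemma measurable_accept[measurable]:
  assumes [measurable]: "\<pi> \<in> borel_measurable borel" "f \<in> borel_measurable M" "g \<in> borel_measurable M"
  shows "(\<lambda>w. accept \<pi> (f w) (g w)) \<in> borel_measurable M"
  unfolding accept_def by measurable

lemma nn_integral_coin:
  fixes a :: real and c d :: ennreal
  assumes "0 \<le> a" "a \<le> 1"
  shows "(\<integral>\<^sup>+u. indicator {0..1} u * (if u \<le> a then c else d) \<partial>lborel) = c * a + d * (1 - a)"
proof -
  have "(\<integral>\<^sup>+u. indicator {0..1} u * (if u \<le> a then c else d) \<partial>lborel) =
      (\<integral>\<^sup>+u. c * indicator {0..a} u + d * indicator {a<..1} u \<partial>lborel)"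
    using assms by (intro nn_integral_cong) (auto simp: indicator_def)
  also have "\<dots> = c * a + d * (1 - a)"
    using assms by (simp add: nn_integral_add nn_integral_cmult)
  finally show ?thesis .
qed

text \<open>The Metropolis kernel is realised by a proposal \<open>z\<close> and a uniform variable \<open>u\<close> deciding
  about its acceptance.\<close>

context
  fixes \<pi> r :: "'a::euclidean_space \<Rightarrow> real" and x :: 'a
  assumes pos: "\<And>x. 0 < \<pi> x" and pim[measurable]: "\<pi> \<in> borel_measurable borel"
    and r: "prob_density r"
begin

private lemma rm: "r \<in> borel_measurable borel" and r0: "0 \<le> r z"
    and r1: "(\<integral>\<^sup>+z. r z \<partial>lborel) = 1"
  using r by (auto simp: prob_density_def)

private definition "move = (\<lambda>(z, u::real). if u \<le> accept \<pi> x (x + z) then x + z else x)"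

private definition "coin = density (lborel \<Otimes>\<^sub>M lborel) (\<lambda>(z, u::real). ennreal (r z) * indicator {0..1} u)"

private lemma measurable_move: "move \<in> borel_measurable (borel \<Otimes>\<^sub>M borel)"
  unfolding move_def case_prod_beta by measurable

private lemma nn_integral_coin_move:
  assumes [measurable]: "f \<in> borel_measurable borel"
  shows "(\<integral>\<^sup>+y. f y \<partial>distr coin borel move) =
    (\<integral>\<^sup>+z. f (x + z) * ennreal (accept \<pi> x (x + z) * r z) + f x * ennreal ((1 - accept \<pi> x (x + z)) * r z) \<partial>lborel)"
proof -
  note [measurable] = rm measurable_move
  have sc: "sets coin = sets (borel \<Otimes>\<^sub>M borel)"
    unfolding coin_def by (simp cong: sets_pair_measure_cong)
  have mv: "move \<in> measurable coin borel"
    unfolding measurable_cong_sets[OF sc refl] by measurable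
  have "(\<integral>\<^sup>+y. f y \<partial>distr coin borel move) = (\<integral>\<^sup>+p. f (move p) \<partial>coin)"
    by (rule nn_integral_distr[OF mv]) simp
  also have "\<dots> = (\<integral>\<^sup>+p. (case p of (z, u) \<Rightarrow> ennreal (r z) * indicator {0..1} u) * f (move p) \<partial>(lborel \<Otimes>\<^sub>M lborel))"
    unfolding coin_def by (rule nn_integral_density) measurable
  also have "\<dots> = (\<integral>\<^sup>+z. (\<integral>\<^sup>+u. ennreal (r z) * indicator {0..1} u * f (move (z, u)) \<partial>lborel) \<partial>lborel)"
    by (subst lborel.nn_integral_fst[symmetric]) auto
  also have "\<dots> = (\<integral>\<^sup>+z. f (x + z) * ennreal (accept \<pi> x (x + z) * r z) + f x * ennreal ((1 - accept \<pi> x (x + z)) * r z) \<partial>lborel)"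
  proof (rule nn_integral_cong)
    fix z
    let ?a = "accept \<pi> x (x + z)"
    note a = accept_bounds[of \<pi> x "x + z", OF pos]
    have "(\<integral>\<^sup>+u. ennreal (r z) * indicator {0..1} u * f (move (z, u)) \<partial>lborel) =
      (\<integral>\<^sup>+u. ennreal (r z) * (indicator {0..1} u * (if u \<le> ?a then f (x + z) else f x)) \<partial>lborel)"
      by (intro nn_integral_cong) (auto simp: move_def indicator_def)
    also have "\<dots> = ennreal (r z) * (f (x + z) * ?a + f x * (1 - ?a))"
      by (simp add: nn_integral_cmult nn_integral_coin a)
    finally show "(\<integral>\<^sup>+u. ennreal (r z) * indicator {0..1} u * f (move (z, u)) \<partial>lborel) =
      f (x + z) * ennreal (?a * r z) + f x * ennreal ((1 - ?a) * r z)"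
      using a r0[of z] by (simp add: ennreal_mult distrib_left mult_ac)
  qed
  finally show ?thesis .
qed

text \<open>A set function given to \<open>measure_of\<close> has to be countably additive before it
  can be evaluated. Recognising it as the emeasure of an image measure supplies this without a
  separate verification.\<close>

private lemma rwm_kernel_eq: "rwm_kernel \<pi> r x = distr coin borel move"
proof -
  let ?K = "distr coin borel move"
  note [measurable] = rm
  have "?K = measure_of UNIV (sets borel) (emeasure ?K)"
    using measure_of_of_measure[of ?K] by simp
  also have "\<dots> = rwm_kernel \<pi> r x"
    unfolding rwm_kernel_def
  proof (rule measure_of_eq)
    fix A :: "'a set" assume "A \<in> sigma_sets UNIV (sets borel)"
    then have A[measurable]: "A \<in> sets borel" by (metis sets.sigma_sets_eq space_borel)
    have "emeasure ?K A = (\<integral>\<^sup>+y. indicator A y \<partial>?K)" by simp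
    also have "\<dots> = (\<integral>\<^sup>+z. indicator A (x + z) * ennreal (accept \<pi> x (x + z) * r z) +
        indicator A x * ennreal ((1 - accept \<pi> x (x + z)) * r z) \<partial>lborel)"
      by (rule nn_integral_coin_move) simp
    also have "\<dots> = (\<integral>\<^sup>+z. indicator A (x + z) * ennreal (accept \<pi> x (x + z) * r z) \<partial>lborel) +
        indicator A x * (\<integral>\<^sup>+z. ennreal ((1 - accept \<pi> x (x + z)) * r z) \<partial>lborel)"
      by (simp add: nn_integral_add nn_integral_cmult)
    also have "(\<integral>\<^sup>+z. indicator A (x + z) * ennreal (accept \<pi> x (x + z) * r z) \<partial>lborel) =
        (\<integral>\<^sup>+z\<in>{z. x + z \<in> A}. ennreal (accept \<pi> x (x + z) * r z) \<partial>lborel)"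
      by (intro nn_integral_cong) (auto simp: indicator_def)
    finally show "emeasure ?K A = (\<integral>\<^sup>+z\<in>{z. x + z \<in> A}. ennreal (accept \<pi> x (x + z) * r z) \<partial>lborel)
        + indicator A x * (\<integral>\<^sup>+z. ennreal ((1 - accept \<pi> x (x + z)) * r z) \<partial>lborel)" .
  qed auto
  finally show ?thesis by simp
qed

lemma sets_rwm_kernel: "sets (rwm_kernel \<pi> r x) = sets borel"
  by (simp add: rwm_kernel_eq)

lemma nn_integral_rwm_kernel:
  assumes "f \<in> borel_measurable borel"
  shows "(\<integral>\<^sup>+y. f y \<partial>rwm_kernel \<pi> r x) =
    (\<integral>\<^sup>+z. f (x + z) * ennreal (accept \<pi> x (x + z) * r z) + f x * ennreal ((1 - accept \<pi> x (x + z)) * r z) \<partial>lborel)"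
  unfolding rwm_kernel_eq by (rule nn_integral_coin_move[OF assms])

lemma prob_space_rwm_kernel: "prob_space (rwm_kernel \<pi> r x)"
proof
  have "emeasure (rwm_kernel \<pi> r x) (space (rwm_kernel \<pi> r x)) = (\<integral>\<^sup>+y. 1 \<partial>rwm_kernel \<pi> r x)"
    by simp
  also have "\<dots> = (\<integral>\<^sup>+z. ennreal (r z) \<partial>lborel)"
  proof (subst nn_integral_rwm_kernel)
    have "ennreal (accept \<pi> x (x + z) * r z) + ennreal ((1 - accept \<pi> x (x + z)) * r z) = ennreal (r z)" for z
      using accept_bounds[of \<pi> x "x + z", OF pos] r0[of z]
      by (subst ennreal_plus[symmetric]) (auto simp: mult_nonneg_nonneg simp flip: distrib_right)
    then show "(\<integral>\<^sup>+z. 1 * ennreal (accept \<pi> x (x + z) * r z) + 1 * ennreal ((1 - accept \<pi> x (x + z)) * r z) \<partial>lborel) =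
        (\<integral>\<^sup>+z. ennreal (r z) \<partial>lborel)" by simp
  qed simp
  finally show "emeasure (rwm_kernel \<pi> r x) (space (rwm_kernel \<pi> r x)) = 1" by (simp add: r1)
qed

end

lemma measurable_rwm_kernel:
  fixes \<pi> :: "'a::euclidean_space \<Rightarrow> real" and r :: "'w \<Rightarrow> 'a \<Rightarrow> real"
  assumes pos: "\<And>x. 0 < \<pi> x" and pim[measurable]: "\<pi> \<in> borel_measurable borel"
    and r: "\<And>w. w \<in> space M \<Longrightarrow> prob_density (r w)"
    and rm[measurable]: "(\<lambda>(w, z). r w z) \<in> borel_measurable (M \<Otimes>\<^sub>M borel)"
    and X[measurable]: "X \<in> borel_measurable M"
  shows "(\<lambda>w. rwm_kernel \<pi> (r w) (X w)) \<in> measurable M (subprob_algebra borel)"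
proof (rule measurable_subprob_algebra)
  fix w assume w: "w \<in> space M"
  show "subprob_space (rwm_kernel \<pi> (r w) (X w))"
    by (intro prob_space_imp_subprob_space prob_space_rwm_kernel pos pim r w)
  show "sets (rwm_kernel \<pi> (r w) (X w)) = sets borel"
    by (intro sets_rwm_kernel pos pim r w)
next
  fix A :: "'a set" assume A[measurable]: "A \<in> sets borel"
  let ?f = "\<lambda>w z. indicator A (X w + z) * ennreal (accept \<pi> (X w) (X w + z) * r w z) +
      indicator A (X w) * ennreal ((1 - accept \<pi> (X w) (X w + z)) * r w z)"
  have eq: "emeasure (rwm_kernel \<pi> (r w) (X w)) A = (\<integral>\<^sup>+z. ?f w z \<partial>lborel)" if "w \<in> space M" for w
    using nn_integral_rwm_kernel[OF pos pim r[OF that], of "indicator A" "X w"]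
    by (simp add: sets_rwm_kernel[OF pos pim r[OF that]])
  have "(\<lambda>w. \<integral>\<^sup>+z. ?f w z \<partial>lborel) \<in> borel_measurable M"
    by (intro lborel.borel_measurable_nn_integral) (simp cong: measurable_cong_sets sets_pair_measure_cong)
  then show "(\<lambda>w. emeasure (rwm_kernel \<pi> (r w) (X w)) A) \<in> borel_measurable M"
    by (simp cong: measurable_cong add: eq)
qed

section \<open>Almost sure visits of a process whose kernels satisfy a drift condition\<close>

lemma (in Ionescu_Tulcea) prob_space_lim: "prob_space PF.lim"
proof -
  have "prob_space (CI {})" by (rule PF.prob_space_P) auto
  then have "prob_space (distr PF.lim (PiM {} M) (\<lambda>x. restrict x {}))" by (simp add: distr_lim)
  then show ?thesis
    by (rule prob_space_distrD[rotated]) (auto simp: measurable_cong_sets[OF PF.sets_lim] intro!: measurable_restrict_subset)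
qed

lemma (in Ionescu_Tulcea) nn_integral_lim:
  assumes f[measurable]: "f \<in> borel_measurable (PiM {0..<n} M)"
  shows "(\<integral>\<^sup>+x. f (restrict x {0..<n}) \<partial>PF.lim) = (\<integral>\<^sup>+x. f x \<partial>C 0 n (\<lambda>_. undefined))"
proof -
  \<comment> \<open>\<open>CI J\<close> runs the chain up to time \<open>up_to J\<close> and then
    restricts; for an initial segment nothing is cut off.\<close>
  have u: "up_to {0..<n} = n"
    by (rule antisym) (use up_to_iff_Ico[of "{0..<n}" n] up_to[of "{0..<n}"] in auto)
  have "(\<integral>\<^sup>+x. f (restrict x {0..<n}) \<partial>PF.lim) = (\<integral>\<^sup>+x. f x \<partial>distr PF.lim (PiM {0..<n} M) (\<lambda>x. restrict x {0..<n}))"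
    by (rule nn_integral_distr[symmetric])
      (simp_all only: measurable_cong_sets[OF PF.sets_lim refl] measurable_restrict_subset subset_UNIV f measurable_distr_eq1)
  also have "\<dots> = (\<integral>\<^sup>+x. f x \<partial>CI {0..<n})" by (simp add: distr_lim)
  also have "\<dots> = (\<integral>\<^sup>+x. f (restrict x {0..<n}) \<partial>C 0 n (\<lambda>_. undefined))"
    unfolding CI_def u by (rule nn_integral_distr) (auto simp: measurable_cong_sets[OF sets_C])
  also have "\<dots> = (\<integral>\<^sup>+x. f x \<partial>C 0 n (\<lambda>_. undefined))"
    by (intro nn_integral_cong) (auto simp: space_C space_PiM)
  finally show ?thesis .
qed

text \<open>The tower property. It turns a drift condition on the kernels into an inequality between
  integrals under the limit law.\<close>

lemma (in Ionescu_Tulcea) nn_integral_lim_Suc: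
  assumes f[measurable]: "f \<in> borel_measurable (PiM {0..<Suc n} M)"
  shows "(\<integral>\<^sup>+x. f (restrict x {0..<Suc n}) \<partial>PF.lim) =
    (\<integral>\<^sup>+x. (\<integral>\<^sup>+y. f ((restrict x {0..<n})(n := y)) \<partial>P n (restrict x {0..<n})) \<partial>PF.lim)"
proof -
  let ?u = "\<lambda>_. undefined"
  have m: "(\<lambda>x. \<integral>\<^sup>+y. f y \<partial>eP n x) \<in> borel_measurable (PiM {0..<n} M)"
    by measurable
  have eq: "(\<integral>\<^sup>+y. f y \<partial>eP n x) = (\<integral>\<^sup>+y. f (x(n := y)) \<partial>P n x)" if "x \<in> space (PiM {0..<n} M)" for x
    by (rule nn_integral_eP[OF that f])
  have "(\<integral>\<^sup>+x. f (restrict x {0..<Suc n}) \<partial>PF.lim) = (\<integral>\<^sup>+x. f x \<partial>(C 0 n ?u \<bind> eP n))"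
    using nn_integral_lim[OF f] by simp
  also have "\<dots> = (\<integral>\<^sup>+x. (\<integral>\<^sup>+y. f y \<partial>eP n x) \<partial>C 0 n ?u)"
    by (rule nn_integral_bind[where B="PiM {0..<Suc n} M"]) (auto simp: measurable_cong_sets[OF sets_C])
  also have "\<dots> = (\<integral>\<^sup>+x. (\<integral>\<^sup>+y. f y \<partial>eP n (restrict x {0..<n})) \<partial>PF.lim)"
    by (rule nn_integral_lim[OF m, symmetric])
  also have "\<dots> = (\<integral>\<^sup>+x. (\<integral>\<^sup>+y. f ((restrict x {0..<n})(n := y)) \<partial>P n (restrict x {0..<n})) \<partial>PF.lim)"
    by (intro nn_integral_cong eq) (auto simp: PF.space_lim space_PiM)
  finally show ?thesis .
qed

text \<open>While the process avoids the target, every step costs one unit of \<open>\<Phi>\<close>, which is finite at time \<open>k\<close>.\<close>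

lemma (in Ionescu_Tulcea) AE_visits:
  fixes \<Phi> :: "nat \<Rightarrow> (nat \<Rightarrow> 'a) \<Rightarrow> ennreal" and D :: "nat \<Rightarrow> (nat \<Rightarrow> 'a) \<Rightarrow> bool"
  assumes \<Phi>[measurable]: "\<And>i. \<Phi> i \<in> borel_measurable (PiM {0..<Suc i} M)"
    and D[measurable]: "\<And>i. Measurable.pred (PiM {0..<Suc i} M) (D i)"
    and fin: "\<And>x. \<Phi> k x < \<top>"
    and drift: "\<And>i x. k \<le> i \<Longrightarrow> x \<in> space (PiM {0..<Suc i} M) \<Longrightarrow> D i x \<Longrightarrow>
      (\<integral>\<^sup>+y. \<Phi> (Suc i) (x(Suc i := y)) \<partial>P (Suc i) x) + 1 \<le> \<Phi> i x"
  shows "AE x in PF.lim. \<exists>i\<ge>k. \<not> D i (restrict x {0..<Suc i})"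
proof -
  define \<rho> where "\<rho> i x = restrict x {0..<Suc i}" for i and x :: "nat \<Rightarrow> 'a"
  \<comment> \<open>The target is avoided from time k to m, and the potential at time k is at most
    L. The potential is only known to be finite at each point; the cap L makes its integral
    finite.\<close>
  define A where "A L m x \<longleftrightarrow> \<Phi> k (\<rho> k x) \<le> of_nat L \<and> (\<forall>i\<in>{k..m}. D i (\<rho> i x))" for L m x
  define g where "g m x = (\<integral>\<^sup>+y. \<Phi> (Suc m) y \<partial>eP (Suc m) x)" for m x
  have \<rho>_lim[measurable]: "\<rho> i \<in> measurable PF.lim (PiM {0..<Suc i} M)" for i
    unfolding \<rho>_def[abs_def] measurable_cong_sets[OF PF.sets_lim refl]
    by (rule measurable_restrict_subset) simp
  have \<rho>_C: "\<rho> i \<in> measurable (PiM {0..<Suc (Suc m)} M) (PiM {0..<Suc i} M)" if "i \<le> Suc m" for i m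
    unfolding \<rho>_def[abs_def] by (rule measurable_restrict_subset) (use that in auto)
  have \<rho>_sp: "\<rho> m x \<in> space (PiM {0..<Suc m} M)" if "x \<in> space PF.lim" for m x
    using measurable_space[OF \<rho>_lim that] .
  have A_cong: "A L m x \<longleftrightarrow> A L m x'" if "k \<le> m" "\<And>i. i \<le> m \<Longrightarrow> x i = x' i" for L m x x'
  proof -
    have "\<rho> i x = \<rho> i x'" if "i \<le> m" for i
      using \<open>\<And>i. i \<le> m \<Longrightarrow> x i = x' i\<close> that by (auto simp: \<rho>_def restrict_def fun_eq_iff)
    with \<open>k \<le> m\<close> show ?thesis by (auto simp: A_def)
  qed
  have A_lim[measurable]: "Measurable.pred PF.lim (A L m)" for L m
    unfolding A_def[abs_def] by measurable
  have g[measurable]: "g m \<in> borel_measurable (PiM {0..<Suc m} M)" for m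
    unfolding g_def[abs_def] by measurable
  \<comment> \<open>On the event that the target has been avoided up to m, the mean of the potential
    drops by the probability of that event. On the left the smaller event for \<open>Suc m\<close>
    suffices, since the potential is nonnegative.\<close>
  have step: "(\<integral>\<^sup>+x. indicator {x. A L (Suc m) x} x * \<Phi> (Suc m) (\<rho> (Suc m) x) \<partial>PF.lim) +
      (\<integral>\<^sup>+x. indicator {x. A L m x} x \<partial>PF.lim) \<le> (\<integral>\<^sup>+x. indicator {x. A L m x} x * \<Phi> m (\<rho> m x) \<partial>PF.lim)"
    if km: "k \<le> m" for L m
  proof -
    define F where "F x = indicator {x. A L m x} x * \<Phi> (Suc m) x" for x
    have [measurable]: "F \<in> borel_measurable (PiM {0..<Suc (Suc m)} M)"
    proof -
      have "Measurable.pred (PiM {0..<Suc (Suc m)} M) (\<lambda>x. D i (\<rho> i x))" if "i \<le> m" for i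
        by (rule measurable_compose[OF \<rho>_C D]) (use that in auto)
      then have "Measurable.pred (PiM {0..<Suc (Suc m)} M) (\<lambda>x. \<forall>i\<in>{k..m}. D i (\<rho> i x))"
        by (intro pred_intros_finite) auto
      moreover have [measurable]: "(\<lambda>x. \<Phi> k (\<rho> k x)) \<in> borel_measurable (PiM {0..<Suc (Suc m)} M)"
        by (rule measurable_compose[OF \<rho>_C \<Phi>]) (use km in auto)
      ultimately have "Measurable.pred (PiM {0..<Suc (Suc m)} M) (A L m)"
        unfolding A_def[abs_def] by measurable
      then show ?thesis unfolding F_def[abs_def] by measurable
    qed
    have "(\<integral>\<^sup>+x. indicator {x. A L (Suc m) x} x * \<Phi> (Suc m) (\<rho> (Suc m) x) \<partial>PF.lim) \<le>
        (\<integral>\<^sup>+x. F (restrict x {0..<Suc (Suc m)}) \<partial>PF.lim)"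
    proof (rule nn_integral_mono)
      fix x
      have "A L m (restrict x {0..<Suc (Suc m)}) \<longleftrightarrow> A L m x" by (rule A_cong[OF km]) auto
      moreover have "A L (Suc m) x \<Longrightarrow> A L m x" by (auto simp: A_def)
      ultimately show "indicator {x. A L (Suc m) x} x * \<Phi> (Suc m) (\<rho> (Suc m) x) \<le> F (restrict x {0..<Suc (Suc m)})"
        by (auto simp: F_def \<rho>_def indicator_def)
    qed
    also have "\<dots> = (\<integral>\<^sup>+x. (\<integral>\<^sup>+y. F ((\<rho> m x)(Suc m := y)) \<partial>P (Suc m) (\<rho> m x)) \<partial>PF.lim)"
      unfolding \<rho>_def by (rule nn_integral_lim_Suc) measurable
    also have "\<dots> = (\<integral>\<^sup>+x. indicator {x. A L m x} x * g m (\<rho> m x) \<partial>PF.lim)"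
    proof (rule nn_integral_cong)
      fix x assume x: "x \<in> space PF.lim"
      have Ax: "A L m ((\<rho> m x)(Suc m := y)) \<longleftrightarrow> A L m x" for y
        by (rule A_cong[OF km]) (auto simp: \<rho>_def)
      have "(\<integral>\<^sup>+y. F ((\<rho> m x)(Suc m := y)) \<partial>P (Suc m) (\<rho> m x)) =
         (\<integral>\<^sup>+y. indicator {x. A L m x} x * \<Phi> (Suc m) ((\<rho> m x)(Suc m := y)) \<partial>P (Suc m) (\<rho> m x))"
        by (intro nn_integral_cong) (simp add: F_def Ax indicator_def)
      also have "\<dots> = indicator {x. A L m x} x * (\<integral>\<^sup>+y. \<Phi> (Suc m) ((\<rho> m x)(Suc m := y)) \<partial>P (Suc m) (\<rho> m x))"
        by (cases "A L m x") auto
      also have "(\<integral>\<^sup>+y. \<Phi> (Suc m) ((\<rho> m x)(Suc m := y)) \<partial>P (Suc m) (\<rho> m x)) = g m (\<rho> m x)"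
        unfolding g_def by (rule nn_integral_eP[OF \<rho>_sp[OF x] \<Phi>, symmetric])
      finally show "(\<integral>\<^sup>+y. F ((\<rho> m x)(Suc m := y)) \<partial>P (Suc m) (\<rho> m x)) = indicator {x. A L m x} x * g m (\<rho> m x)" .
    qed
    finally have "(\<integral>\<^sup>+x. indicator {x. A L (Suc m) x} x * \<Phi> (Suc m) (\<rho> (Suc m) x) \<partial>PF.lim) +
      (\<integral>\<^sup>+x. indicator {x. A L m x} x \<partial>PF.lim) \<le>
      (\<integral>\<^sup>+x. indicator {x. A L m x} x * g m (\<rho> m x) \<partial>PF.lim) + (\<integral>\<^sup>+x. indicator {x. A L m x} x \<partial>PF.lim)"
      by (rule add_right_mono)
    also have "\<dots> = (\<integral>\<^sup>+x. indicator {x. A L m x} x * g m (\<rho> m x) + indicator {x. A L m x} x \<partial>PF.lim)"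
      by (rule nn_integral_add[symmetric]) measurable
    also have "\<dots> \<le> (\<integral>\<^sup>+x. indicator {x. A L m x} x * \<Phi> m (\<rho> m x) \<partial>PF.lim)"
    proof (rule nn_integral_mono)
      fix x assume x: "x \<in> space PF.lim"
      have "g m (\<rho> m x) + 1 \<le> \<Phi> m (\<rho> m x)" if "A L m x"
      proof -
        have "D m (\<rho> m x)" using that km by (auto simp: A_def)
        from drift[OF km \<rho>_sp[OF x] this] show ?thesis
          unfolding g_def nn_integral_eP[OF \<rho>_sp[OF x] \<Phi>] .
      qed
      then show "indicator {x. A L m x} x * g m (\<rho> m x) + indicator {x. A L m x} x \<le> indicator {x. A L m x} x * \<Phi> m (\<rho> m x)"
        by (auto simp: indicator_def)
    qed
    finally show ?thesis .
  qed
  interpret L: prob_space PF.lim by (rule prob_space_lim)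
  have null: "AE x in PF.lim. \<not> (\<forall>m\<ge>k. A L m x)" for L
  proof -
    define B where "B = {x \<in> space PF.lim. \<forall>m\<ge>k. A L m x}"
    have Bs[measurable]: "B \<in> sets PF.lim" unfolding B_def by measurable
    let ?e = "emeasure PF.lim B" and ?a = "\<lambda>m. \<integral>\<^sup>+x. indicator {x. A L m x} x * \<Phi> m (\<rho> m x) \<partial>PF.lim"
    have e_le: "?e \<le> (\<integral>\<^sup>+x. indicator {x. A L m x} x \<partial>PF.lim)" if "k \<le> m" for m
      unfolding nn_integral_indicator[OF Bs, symmetric]
      by (intro nn_integral_mono) (use that in \<open>auto simp: B_def indicator_def\<close>)
    \<comment> \<open>Telescoping of \<open>step\<close>: B lies in every event
      \<open>A L m\<close>, so each of the N steps costs at least the measure of B. Hence N times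
      that measure stays below L for all N.\<close>
    have "?a (k + N) + of_nat N * ?e \<le> ?a k" for N
    proof (induction N)
      case (Suc N)
      have "?a (k + Suc N) + of_nat (Suc N) * ?e = (?a (Suc (k + N)) + ?e) + of_nat N * ?e"
        by (simp add: algebra_simps)
      also have "\<dots> \<le> ?a (k + N) + of_nat N * ?e"
        using step[of "k + N" L] e_le[of "k + N"] by (intro add_right_mono) (auto intro: order_trans[OF add_left_mono])
      finally show ?case using Suc.IH by (rule order_trans)
    qed simp
    moreover have "?a k \<le> of_nat L"
    proof -
      have "?a k \<le> (\<integral>\<^sup>+x. of_nat L \<partial>PF.lim)"
        by (intro nn_integral_mono) (auto simp: A_def indicator_def)
      then show ?thesis using L.emeasure_space_1 by (simp add: PF.space_lim)
    qed
    ultimately have le: "of_nat N * ?e \<le> of_nat L" for N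
      by (meson order_trans add_increasing zero_le order_refl)
    have "?e = 0"
    proof (rule ccontr)
      assume "?e \<noteq> 0"
      define e where "e = measure PF.lim B"
      have ee: "?e = ennreal e" by (simp add: e_def L.emeasure_eq_measure)
      have "0 < e" using \<open>?e \<noteq> 0\<close> ee by (metis e_def ennreal_0 measure_nonneg order_le_less)
      then obtain N :: nat where "real L < real N * e" using reals_Archimedean3 by blast
      moreover have "real N * e \<le> real L"
        using le[of N] \<open>0 < e\<close> unfolding ee
        by (simp add: ennreal_of_nat_eq_real_of_nat flip: ennreal_mult)
      ultimately show False by simp
    qed
    then have "B \<in> null_sets PF.lim" using Bs by auto
    then show ?thesis by (rule AE_I') (auto simp: B_def)
  qed
  have "AE x in PF.lim. \<forall>L. \<not> (\<forall>m\<ge>k. A L m x)" using null by (simp add: AE_all_countable)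
  then show ?thesis
  proof (rule AE_mp, intro AE_I2 impI)
    fix x assume x: "\<forall>L. \<not> (\<forall>m\<ge>k. A L m x)"
    obtain L :: nat where L: "\<Phi> k (\<rho> k x) \<le> of_nat L"
      using ennreal_Ex_less_of_nat[OF fin[of "\<rho> k x"]] less_imp_le by blast
    obtain m where "k \<le> m" "\<not> A L m x" using x by blast
    with L have "\<not> (\<forall>i\<in>{k..m}. D i (\<rho> i x))" by (simp add: A_def)
    then show "\<exists>i\<ge>k. \<not> D i (restrict x {0..<Suc i})" by (auto simp: \<rho>_def)
  qed
qed

section \<open>The adaptive Metropolis process\<close>

lemma am_param_cong:
  assumes "\<And>j. 1 \<le> j \<Longrightarrow> j \<le> i \<Longrightarrow> x j = y j"
  shows "am_param \<gamma> \<theta> x i = am_param \<gamma> \<theta> y i"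
  using assms by (induction i) auto

text \<open>The update is a convex combination of a positive definite and a positive semidefinite
  matrix; \<open>g < 1\<close> keeps a share of the definite one.\<close>

lemma pos_def_outer_update:
  assumes "pos_def \<Gamma>" "0 < g" "g < 1"
  shows "pos_def (\<Gamma> + g *\<^sub>R (outer v v - \<Gamma>))"
proof -
  have eq: "\<Gamma> + g *\<^sub>R (outer v v - \<Gamma>) = (1 - g) *\<^sub>R \<Gamma> + g *\<^sub>R outer v v"
    by (simp add: algebra_simps)
  have ov: "outer v v *v w = (v \<bullet> w) *\<^sub>R v" for w
    by (simp add: vec_eq_iff outer_def matrix_vector_mult_def inner_vec_def sum_distrib_left mult_ac)
  have mv: "((1 - g) *\<^sub>R \<Gamma> + g *\<^sub>R outer v v) *v w = (1 - g) *\<^sub>R (\<Gamma> *v w) + (g * (v \<bullet> w)) *\<^sub>R v" for w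
    by (simp add: matrix_vector_mult_add_rdistrib ov flip: scaleR_matrix_vector_assoc)
  have tr: "transpose \<Gamma> = \<Gamma>" using assms by (simp add: pos_def_def)
  have "transpose ((1 - g) *\<^sub>R \<Gamma> + g *\<^sub>R outer v v) = (1 - g) *\<^sub>R \<Gamma> + g *\<^sub>R outer v v"
    using tr by (simp add: vec_eq_iff transpose_def outer_def mult.commute)
  moreover have "0 < w \<bullet> (((1 - g) *\<^sub>R \<Gamma> + g *\<^sub>R outer v v) *v w)" if "w \<noteq> 0" for w
  proof -
    have "0 < (1 - g) * (w \<bullet> (\<Gamma> *v w))" using assms that by (auto simp: pos_def_def)
    moreover have "0 \<le> g * (v \<bullet> w)\<^sup>2" using assms by simp
    ultimately show ?thesis by (simp add: mv inner_add_right power2_eq_square inner_commute mult.assoc)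
  qed
  ultimately show ?thesis by (simp add: eq pos_def_def)
qed

lemma am_update_Theta:
  "\<theta> \<in> Theta \<Longrightarrow> 0 < g \<Longrightarrow> g < 1 \<Longrightarrow> am_update g \<theta> y \<in> Theta"
  by (auto simp: Theta_def am_update_def pos_def_outer_update)

lemma measurable_am_update[measurable]:
  fixes \<theta> :: "'w \<Rightarrow> 'n::finite param"
  assumes [measurable]: "\<theta> \<in> borel_measurable M" "y \<in> borel_measurable M"
  shows "(\<lambda>w. am_update g (\<theta> w) (y w)) \<in> borel_measurable M"
proof -
  have "continuous_on UNIV (\<lambda>(\<theta> :: 'n param, y). am_update g \<theta> y)"
    unfolding am_update_def outer_def case_prod_beta by (intro continuous_intros)
  from measurable_compose[OF borel_measurable_Pair[OF assms] borel_measurable_continuous_onI[OF this]]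
  show ?thesis by simp
qed

locale am_process =
  fixes \<pi> q :: "real^'n \<Rightarrow> real" and \<epsilon> :: real and \<gamma> :: "nat \<Rightarrow> real" and \<theta> :: "'n::finite param" and x :: "real^'n"
  assumes pos: "\<And>x. 0 < \<pi> x" and pim[measurable]: "\<pi> \<in> borel_measurable borel"
    and q: "prob_density q" and e: "0 < \<epsilon>" and g: "\<And>i. 1 \<le> i \<Longrightarrow> 0 < \<gamma> i \<and> \<gamma> i < 1"
    and th: "\<theta> \<in> Theta"
begin

lemma am_param_Theta: "am_param \<gamma> \<theta> w i \<in> Theta"
  using g by (induction i) (auto simp: th intro!: am_update_Theta)

lemma measurable_am_param: "i < n \<Longrightarrow> (\<lambda>w. am_param \<gamma> \<theta> w i) \<in> borel_measurable (PiM {0..<n} (\<lambda>_. borel))"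
proof (induction i)
  case (Suc i)
  then have [measurable]: "(\<lambda>w. am_param \<gamma> \<theta> w i) \<in> borel_measurable (PiM {0..<n} (\<lambda>_. borel))" by simp
  have [measurable]: "(\<lambda>w. w (Suc i)) \<in> borel_measurable (PiM {0..<n} (\<lambda>_. borel :: (real^'n) measure))"
    by (rule measurable_component_singleton) (use Suc.prems in simp)
  show ?case by simp
qed simp

lemma am_step_measurable:
  "am_step \<pi> q \<epsilon> \<gamma> \<theta> x i \<in> measurable (PiM {0..<i} (\<lambda>_. borel)) (subprob_algebra borel)"
proof (cases i)
  case 0
  have "return borel x \<in> space (subprob_algebra borel)"
    by (simp add: space_subprob_algebra prob_space_imp_subprob_space prob_space_return)
  then show ?thesis by (simp add: 0 am_step_def[abs_def])
next
  case (Suc j)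
  let ?N = "PiM {0..<i} (\<lambda>_. borel :: (real^'n) measure)"
  have qm: "q \<in> borel_measurable borel" using q by (simp add: prob_density_def)
  have [measurable]: "(\<lambda>w. am_param \<gamma> \<theta> w j) \<in> borel_measurable ?N" using measurable_am_param[of j i] Suc by simp
  have "(\<lambda>w. rwm_kernel \<pi> (am_density q \<epsilon> (am_param \<gamma> \<theta> w j)) (w j)) \<in> measurable ?N (subprob_algebra borel)"
  proof (rule measurable_rwm_kernel[OF pos pim])
    show "prob_density (am_density q \<epsilon> (am_param \<gamma> \<theta> w j))" for w
      by (rule prob_density_am_density[OF e am_param_Theta q])
    have "(\<lambda>p. am_density q \<epsilon> (am_param \<gamma> \<theta> (fst p) j) (snd p)) \<in> borel_measurable (?N \<Otimes>\<^sub>M borel)"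
      by (rule measurable_am_density[OF e qm]) (auto simp: am_param_Theta)
    then show "(\<lambda>(w, z). am_density q \<epsilon> (am_param \<gamma> \<theta> w j) z) \<in> borel_measurable (?N \<Otimes>\<^sub>M borel)"
      by (simp add: case_prod_beta)
    show "(\<lambda>w. w j) \<in> borel_measurable ?N"
      by (rule measurable_component_singleton) (use Suc in simp)
  qed
  then show ?thesis by (simp add: Suc am_step_def[abs_def])
qed

sublocale IT: Ionescu_Tulcea "am_step \<pi> q \<epsilon> \<gamma> \<theta> x" "\<lambda>_. borel"
proof (rule Ionescu_Tulcea.intro)
  show "am_step \<pi> q \<epsilon> \<gamma> \<theta> x i \<in> measurable (PiM {0..<i} (\<lambda>_. borel)) (subprob_algebra borel)" for i
    by (rule am_step_measurable)
  show "prob_space (am_step \<pi> q \<epsilon> \<gamma> \<theta> x i w)" for i w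
    by (cases i) (auto simp: am_step_def prob_space_return
        intro!: prob_space_rwm_kernel pos pim prob_density_am_density e am_param_Theta q)
qed

lemma am_law_eq: "am_law \<pi> q \<epsilon> \<gamma> \<theta> x = IT.PF.lim"
  by (simp add: am_law_def)

lemma AE_visits_infinitely_often:
  fixes \<Phi> :: "nat \<Rightarrow> 'n param \<Rightarrow> real^'n \<Rightarrow> ennreal" and S :: "('n param \<times> (real^'n)) set"
  assumes \<Phi>: "\<And>i. (\<lambda>(t, y). \<Phi> i t y) \<in> borel_measurable borel" and fin: "\<And>i t y. \<Phi> i t y < \<top>"
    and S: "S \<in> sets borel"
    and drift: "\<And>i t y. i0 \<le> i \<Longrightarrow> t \<in> Theta \<Longrightarrow> (t, y) \<notin> S \<Longrightarrow>
      (\<integral>\<^sup>+z. \<Phi> (Suc i) (am_update (\<gamma> (Suc i)) t z) z \<partial>rwm_kernel \<pi> (am_density q \<epsilon> t) y) + 1 \<le> \<Phi> i t y"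
  shows "AE w in am_law \<pi> q \<epsilon> \<gamma> \<theta> x. \<forall>k. \<exists>i\<ge>k. (am_param \<gamma> \<theta> w i, w i) \<in> S"
proof -
  have m: "(\<lambda>w. (am_param \<gamma> \<theta> w i, w i)) \<in> borel_measurable (PiM {0..<Suc i} (\<lambda>_. borel))" for i
  proof -
    have [measurable]: "(\<lambda>w. am_param \<gamma> \<theta> w i) \<in> borel_measurable (PiM {0..<Suc i} (\<lambda>_. borel))"
      by (rule measurable_am_param) simp
    have [measurable]: "(\<lambda>w. w i) \<in> borel_measurable (PiM {0..<Suc i} (\<lambda>_. borel :: (real^'n) measure))"
      by (rule measurable_component_singleton) simp
    show ?thesis by (rule borel_measurable_Pair) simp_all
  qed
  have "AE w in IT.PF.lim. \<exists>i\<ge>k. (am_param \<gamma> \<theta> w i, w i) \<in> S" if k: "i0 \<le> k" for k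
  proof -
    have "AE w in IT.PF.lim. \<exists>i\<ge>k. \<not> (am_param \<gamma> \<theta> (restrict w {0..<Suc i}) i, restrict w {0..<Suc i} i) \<notin> S"
    proof (rule IT.AE_visits[where \<Phi> = "\<lambda>i w. \<Phi> i (am_param \<gamma> \<theta> w i) (w i)"])
      show "(\<lambda>w. \<Phi> i (am_param \<gamma> \<theta> w i) (w i)) \<in> borel_measurable (PiM {0..<Suc i} (\<lambda>_. borel))" for i
        using measurable_compose[OF m \<Phi>[of i]] by simp
      show "Measurable.pred (PiM {0..<Suc i} (\<lambda>_. borel)) (\<lambda>w. (am_param \<gamma> \<theta> w i, w i) \<notin> S)" for i
        using measurable_compose[OF m[of i], where g="\<lambda>p. p \<notin> S" and L="count_space UNIV"] S by simp
      show "\<Phi> k (am_param \<gamma> \<theta> w k) (w k) < \<top>" for w by (rule fin)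
      fix i w assume i: "k \<le> i" and nS: "(am_param \<gamma> \<theta> w i, w i) \<notin> S"
      have "am_param \<gamma> \<theta> (w(Suc i := y)) i = am_param \<gamma> \<theta> w i" for y
        by (rule am_param_cong) auto
      then show "(\<integral>\<^sup>+y. \<Phi> (Suc i) (am_param \<gamma> \<theta> (w(Suc i := y)) (Suc i)) ((w(Suc i := y)) (Suc i))
          \<partial>am_step \<pi> q \<epsilon> \<gamma> \<theta> x (Suc i) w) + 1 \<le> \<Phi> i (am_param \<gamma> \<theta> w i) (w i)"
        using drift[OF order_trans[OF k i] am_param_Theta nS] by (simp add: am_step_def)
    qed
    moreover have "am_param \<gamma> \<theta> (restrict w {0..<Suc i}) i = am_param \<gamma> \<theta> w i" for w i
      by (rule am_param_cong) auto
    ultimately show ?thesis by simp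
  qed
  then have "AE w in IT.PF.lim. \<forall>k\<ge>i0. \<exists>i\<ge>k. (am_param \<gamma> \<theta> w i, w i) \<in> S"
    by (simp add: AE_all_countable)
  then show ?thesis
    unfolding am_law_eq
  proof (rule AE_mp, intro AE_I2 impI allI)
    fix w k assume *: "\<forall>k\<ge>i0. \<exists>i\<ge>k. (am_param \<gamma> \<theta> w i, w i) \<in> S"
    show "\<exists>i\<ge>k. (am_param \<gamma> \<theta> w i, w i) \<in> S"
      using *[rule_format, of "max i0 k"] by auto
  qed
qed

end

section \<open>The Lyapunov function\<close>

text \<open>\<open>metro_fac \<rho>\<close> is the factor by which one Metropolis step with ratio \<open>\<rho>\<close> changes \<open>1 / sqrt \<circ> \<pi>\<close> in the mean.\<close>

definition metro_fac :: "real \<Rightarrow> real" where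
  "metro_fac \<rho> = 1 - min 1 \<rho> + min 1 \<rho> / sqrt \<rho>"

lemma metro_fac_ge_1: "1 \<le> \<rho> \<Longrightarrow> metro_fac \<rho> = 1 / sqrt \<rho>"
  by (simp add: metro_fac_def)

lemma metro_fac_le_1: "0 < \<rho> \<Longrightarrow> \<rho> \<le> 1 \<Longrightarrow> metro_fac \<rho> = 1 - \<rho> + sqrt \<rho>"
  by (simp add: metro_fac_def real_div_sqrt)

lemma metro_fac_bounds:
  assumes "0 < \<rho>"
  shows "0 \<le> metro_fac \<rho>" "metro_fac \<rho> \<le> 2" "metro_fac \<rho> \<le> 1 + sqrt \<rho>"
proof -
  have "0 \<le> metro_fac \<rho> \<and> metro_fac \<rho> \<le> 2 \<and> metro_fac \<rho> \<le> 1 + sqrt \<rho>"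
  proof (cases "1 \<le> \<rho>")
    case True
    then have "1 \<le> sqrt \<rho>" by simp
    then have "1 / sqrt \<rho> \<le> 1" "0 \<le> 1 / sqrt \<rho>" by (auto simp: divide_le_eq)
    then show ?thesis using \<open>1 \<le> sqrt \<rho>\<close> unfolding metro_fac_ge_1[OF True] by linarith
  next
    case False
    then have "sqrt \<rho> \<le> 1" "0 \<le> sqrt \<rho>" using assms by auto
    then show ?thesis using False assms unfolding metro_fac_le_1[OF assms less_imp_le[OF False[unfolded not_le]]] by linarith
  qed
  then show "0 \<le> metro_fac \<rho>" "metro_fac \<rho> \<le> 2" "metro_fac \<rho> \<le> 1 + sqrt \<rho>" by auto
qed

lemma measurable_metro_fac[measurable]: "metro_fac \<in> borel_measurable borel"
  unfolding metro_fac_def[abs_def] by measurable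

definition lyap :: "('a \<Rightarrow> real) \<Rightarrow> 'a \<Rightarrow> real" where
  "lyap \<pi> x = 1 / sqrt (\<pi> x)"

lemma nn_integral_lyap:
  fixes \<pi> r :: "'a::euclidean_space \<Rightarrow> real"
  assumes pos: "\<And>x. 0 < \<pi> x" and pim[measurable]: "\<pi> \<in> borel_measurable borel" and r: "prob_density r"
  shows "(\<integral>\<^sup>+y. lyap \<pi> y \<partial>rwm_kernel \<pi> r x) =
    ennreal (lyap \<pi> x) * (\<integral>\<^sup>+y. ennreal (metro_fac (\<pi> y / \<pi> x) * r (y - x)) \<partial>lborel)"
proof -
  have rm[measurable]: "r \<in> borel_measurable borel" and r0: "\<And>z. 0 \<le> r z" using r by (auto simp: prob_density_def)
  have [measurable]: "lyap \<pi> \<in> borel_measurable borel" unfolding lyap_def[abs_def] by measurable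
  have "(\<integral>\<^sup>+y. lyap \<pi> y \<partial>rwm_kernel \<pi> r x) =
    (\<integral>\<^sup>+z. ennreal (lyap \<pi> (x + z)) * ennreal (accept \<pi> x (x + z) * r z) +
      ennreal (lyap \<pi> x) * ennreal ((1 - accept \<pi> x (x + z)) * r z) \<partial>lborel)"
    by (rule nn_integral_rwm_kernel[OF pos pim r]) simp
  also have "\<dots> = (\<integral>\<^sup>+z. ennreal (lyap \<pi> x) * ennreal (metro_fac (\<pi> (x + z) / \<pi> x) * r z) \<partial>lborel)"
  proof (rule nn_integral_cong)
    fix z
    let ?\<rho> = "\<pi> (x + z) / \<pi> x"
    have p: "0 < ?\<rho>" using pos by simp
    have l: "0 \<le> lyap \<pi> y" for y using pos[of y] by (simp add: lyap_def)
    note a = accept_bounds[of \<pi> x "x + z", OF pos]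
    have "lyap \<pi> (x + z) = lyap \<pi> x / sqrt ?\<rho>"
      using pos[of x] pos[of "x + z"] by (simp add: lyap_def real_sqrt_divide)
    then have eq: "lyap \<pi> (x + z) * (accept \<pi> x (x + z) * r z) + lyap \<pi> x * ((1 - accept \<pi> x (x + z)) * r z) =
      lyap \<pi> x * (metro_fac ?\<rho> * r z)"
      by (simp add: accept_def metro_fac_def algebra_simps)
    have "ennreal (lyap \<pi> (x + z)) * ennreal (accept \<pi> x (x + z) * r z) +
      ennreal (lyap \<pi> x) * ennreal ((1 - accept \<pi> x (x + z)) * r z) =
      ennreal (lyap \<pi> (x + z) * (accept \<pi> x (x + z) * r z)) + ennreal (lyap \<pi> x * ((1 - accept \<pi> x (x + z)) * r z))"
      using a l r0[of z] by (simp add: ennreal_mult)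
    also have "\<dots> = ennreal (lyap \<pi> x * (metro_fac ?\<rho> * r z))"
      using a l r0[of z] by (subst ennreal_plus[symmetric]) (auto simp: eq)
    also have "\<dots> = ennreal (lyap \<pi> x) * ennreal (metro_fac ?\<rho> * r z)"
      using l metro_fac_bounds(1)[OF p] r0[of z] by (intro ennreal_mult) auto
    finally show "ennreal (lyap \<pi> (x + z)) * ennreal (accept \<pi> x (x + z) * r z) +
      ennreal (lyap \<pi> x) * ennreal ((1 - accept \<pi> x (x + z)) * r z) =
      ennreal (lyap \<pi> x) * ennreal (metro_fac ?\<rho> * r z)" .
  qed
  also have "\<dots> = ennreal (lyap \<pi> x) * (\<integral>\<^sup>+z. ennreal (metro_fac (\<pi> (x + z) / \<pi> x) * r (x + z - x)) \<partial>lborel)"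
    by (simp add: nn_integral_cmult)
  also have "(\<integral>\<^sup>+z. ennreal (metro_fac (\<pi> (x + z) / \<pi> x) * r (x + z - x)) \<partial>lborel) =
      (\<integral>\<^sup>+y. ennreal (metro_fac (\<pi> y / \<pi> x) * r (y - x)) \<partial>lborel)"
    by (rule nn_integral_translate) measurable
  finally show ?thesis .
qed

text \<open>The accepted and the rejected part each contribute at most \<open>f x\<close>. The bound
  holds for every proposal density and is used where no gain is available.\<close>

lemma nn_integral_rwm_kernel_le:
  fixes \<pi> r :: "'a::euclidean_space \<Rightarrow> real"
  assumes pos: "\<And>x. 0 < \<pi> x" and pim[measurable]: "\<pi> \<in> borel_measurable borel" and r: "prob_density r"
    and f[measurable]: "f \<in> borel_measurable borel"
    and le: "\<And>y. ennreal (accept \<pi> x y) * f y \<le> f x"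
  shows "(\<integral>\<^sup>+y. f y \<partial>rwm_kernel \<pi> r x) \<le> 2 * f x"
proof -
  have rm[measurable]: "r \<in> borel_measurable borel" and r0: "\<And>z. 0 \<le> r z"
    and r1: "(\<integral>\<^sup>+z. r z \<partial>lborel) = 1" using r by (auto simp: prob_density_def)
  have "(\<integral>\<^sup>+y. f y \<partial>rwm_kernel \<pi> r x) \<le> (\<integral>\<^sup>+z. 2 * f x * ennreal (r z) \<partial>lborel)"
    unfolding nn_integral_rwm_kernel[OF pos pim r f]
  proof (rule nn_integral_mono)
    fix z
    note a = accept_bounds[of \<pi> x "x + z", OF pos]
    have "f (x + z) * ennreal (accept \<pi> x (x + z) * r z) = ennreal (accept \<pi> x (x + z)) * f (x + z) * ennreal (r z)"
      using a r0[of z] by (simp add: ennreal_mult mult_ac)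
    also have "\<dots> \<le> f x * ennreal (r z)" by (intro mult_right_mono le) simp
    finally have 1: "f (x + z) * ennreal (accept \<pi> x (x + z) * r z) \<le> f x * ennreal (r z)" .
    have "f x * ennreal ((1 - accept \<pi> x (x + z)) * r z) \<le> f x * ennreal (r z)"
      using a r0[of z] by (intro mult_left_mono ennreal_leI mult_left_le_one_le) auto
    with 1 show "f (x + z) * ennreal (accept \<pi> x (x + z) * r z) + f x * ennreal ((1 - accept \<pi> x (x + z)) * r z)
        \<le> 2 * f x * ennreal (r z)"
      using add_mono by (fastforce simp: mult_2 distrib_right)
  qed
  also have "\<dots> = 2 * f x" by (simp add: nn_integral_cmult r1)
  finally show ?thesis .
qed

text \<open>Below, \<open>u\<close> stands for \<open>- ln \<circ> \<pi>\<close> and \<open>l\<close> for a level slightly below the level of the current state.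
  Points above the level contribute to the drift with weight at most \<open>overshoot\<close>.\<close>

definition overshoot :: "('a \<Rightarrow> real) \<Rightarrow> real \<Rightarrow> 'a \<Rightarrow> real" where
  "overshoot u l y = (if l < u y then exp (- (u y - l) / 2) else 0)"

lemma overshoot_bounds: "0 \<le> overshoot u l y" "overshoot u l y \<le> 1"
  by (auto simp: overshoot_def)

lemma measurable_overshoot[measurable]:
  assumes [measurable]: "u \<in> borel_measurable M"
  shows "overshoot u l \<in> borel_measurable M"
  unfolding overshoot_def[abs_def] by measurable

text \<open>Above the level the weights decay at least by the factor
  \<open>exp (- 1/2) \<le> 2/3\<close> per step, so they sum to at most 3 times the first one. If
  the sequence starts at or below the level, the first weight above it is at most 1, which the
  indicator accounts for.\<close>

lemma sum_overshoot_le: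
  fixes a :: "nat \<Rightarrow> real"
  assumes "\<And>i. i < J \<Longrightarrow> a i + 1 \<le> a (Suc i)"
  shows "(\<Sum>i\<le>J. overshoot a l i) \<le> 3 * (of_bool (a 0 \<le> l) + overshoot a l 0)"
  using assms
proof (induction J arbitrary: a)
  case 0
  then show ?case using overshoot_bounds[of a l 0] by simp
next
  case (Suc J)
  let ?b = "\<lambda>i. a (Suc i)"
  have "overshoot a l (Suc i) = overshoot ?b l i" for i by (simp add: overshoot_def)
  then have eq: "(\<Sum>i\<le>Suc J. overshoot a l i) = overshoot a l 0 + (\<Sum>i\<le>J. overshoot ?b l i)"
    by (simp add: sum.atMost_Suc_shift del: sum.atMost_Suc)
  have IH: "(\<Sum>i\<le>J. overshoot ?b l i) \<le> 3 * (of_bool (a (Suc 0) \<le> l) + overshoot ?b l 0)"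
    by (rule Suc.IH) (use Suc.prems in auto)
  show ?case
  proof (cases "a 0 \<le> l")
    case True
    have "of_bool (a (Suc 0) \<le> l) + overshoot ?b l 0 \<le> 1"
    proof (cases "a (Suc 0) \<le> l")
      case True then show ?thesis by (simp add: overshoot_def)
    next
      case False then show ?thesis using overshoot_bounds(2)[of ?b l 0] by simp
    qed
    moreover have "overshoot a l 0 = 0" using True by (simp add: overshoot_def)
    ultimately show ?thesis using IH True unfolding eq by simp
  next
    case False
    have a1: "a 0 + 1 \<le> a (Suc 0)" using Suc.prems by simp
    have "exp (- (1/2)) \<le> (2/3 :: real)"
      using exp_ge_add_one_self[of "1/2::real"] by (simp add: exp_minus inverse_eq_divide divide_le_eq)
    moreover have "overshoot ?b l 0 \<le> exp (- (1/2)) * overshoot a l 0"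
    proof -
      have "exp (- (a (Suc 0) - l) / 2) \<le> exp (- (1/2) + - (a 0 - l) / 2)"
        unfolding exp_le_cancel_iff using a1 by (simp add: field_simps)
      then show ?thesis using False a1 unfolding exp_add by (simp add: overshoot_def)
    qed
    ultimately have "overshoot ?b l 0 \<le> (2/3) * overshoot a l 0"
      using overshoot_bounds(1)[of a l 0] by (meson mult_right_mono order_trans)
    then show ?thesis using IH False a1 unfolding eq by simp
  qed
qed

text \<open>A point one unit below x gives at most \<open>exp (- 1/2)\<close>; a point between the
  two levels gives at most 1; a point above x gives at most
  \<open>1 + exp ((u x - u y) / 2)\<close>. The factor \<open>exp (1/2)\<close> appears because
  overshoot is measured from the level \<open>u x - 1\<close> instead of \<open>u x\<close>, so that
  gain and loss refer to the same level.\<close>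

lemma metro_fac_level:
  "metro_fac (exp (u x - u y)) + (1 - exp (- (1/2))) * of_bool (u y \<le> u x - 1) \<le>
    1 + exp (1/2) * overshoot u (u x - 1) y"
proof -
  let ?\<rho> = "exp (u x - u y)"
  have sq: "sqrt ?\<rho> = exp ((u x - u y) / 2)"
    by (rule real_sqrt_unique) (simp_all add: power2_eq_square flip: exp_add)
  consider "u y \<le> u x - 1" | "u x - 1 < u y" "u y \<le> u x" | "u x < u y" by linarith
  then show ?thesis
  proof cases
    case 1
    then have "metro_fac ?\<rho> = exp (- ((u x - u y) / 2))"
      by (subst metro_fac_ge_1) (simp_all add: sq exp_minus inverse_eq_divide)
    also have "\<dots> \<le> exp (- (1/2))" using 1 by simp
    finally show ?thesis using 1 by (simp add: overshoot_def)
  next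
    case 2
    then have "metro_fac ?\<rho> = 1 / sqrt ?\<rho>" by (intro metro_fac_ge_1) simp
    also have "\<dots> \<le> 1" using 2 by (simp add: divide_le_eq)
    finally have "metro_fac ?\<rho> \<le> 1" .
    moreover have "0 \<le> exp (1/2) * overshoot u (u x - 1) y"
      by (intro mult_nonneg_nonneg overshoot_bounds) simp
    ultimately show ?thesis using 2 by simp
  next
    case 3
    have "metro_fac ?\<rho> \<le> 1 + exp ((u x - u y) / 2)"
      using metro_fac_bounds(3)[of ?\<rho>] unfolding sq by simp
    also have "\<dots> = 1 + exp (1/2) * overshoot u (u x - 1) y"
      using 3 by (simp add: overshoot_def field_simps flip: exp_add)
    finally show ?thesis using 3 by simp
  qed
qed

text \<open>The dilations by \<open>1 + j * \<tau>\<close> move mass sitting above the level \<open>l\<close> to \<open>J\<close> essentially disjoint places below it.\<close>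

lemma overshoot_dilation_bound:
  fixes u Q :: "'a::euclidean_space \<Rightarrow> real"
  assumes [measurable]: "u \<in> borel_measurable borel" "Q \<in> borel_measurable borel" "A \<in> sets borel"
    and Q0: "\<And>y. 0 \<le> Q y" and \<tau>: "0 < \<tau>" "real J * \<tau> \<le> 1" and C: "0 \<le> C" and e: "0 \<le> e"
    and comp: "\<And>y j. y \<in> A \<Longrightarrow> 1 \<le> j \<Longrightarrow> j \<le> J \<Longrightarrow> Q y \<le> C * Q (y /\<^sub>R (1 + real j * \<tau>)) + e"
    and gain: "\<And>y j i p. y \<in> A \<Longrightarrow> 1 \<le> j \<Longrightarrow> j \<le> J \<Longrightarrow> i < J \<Longrightarrow> p = y /\<^sub>R (1 + real j * \<tau>) \<Longrightarrow>
      u ((1 + real i * \<tau>) *\<^sub>R p) + 1 \<le> u ((1 + real (Suc i) * \<tau>) *\<^sub>R p)"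
  shows "of_nat J * (\<integral>\<^sup>+y. indicator A y * ennreal (overshoot u l y * Q y) \<partial>lborel) \<le>
    ennreal (3 * C * 2 ^ DIM('a)) * ((\<integral>\<^sup>+y. ennreal (of_bool (u y \<le> l) * Q y) \<partial>lborel) + (\<integral>\<^sup>+y. ennreal (overshoot u l y * Q y) \<partial>lborel))
    + of_nat J * (ennreal e * emeasure lborel A)"
proof -
  let ?G = "overshoot u l" and ?n = "DIM('a)" and ?c = "\<lambda>j. 1 + real j * \<tau>"
  let ?L = "\<integral>\<^sup>+y. indicator A y * ennreal (?G y * Q y) \<partial>lborel"
  define F where "F j p = indicator A (?c j *\<^sub>R p) * ?G (?c j *\<^sub>R p) * Q p" for j p
  have F0: "0 \<le> F j p" for j p unfolding F_def
    by (intro mult_nonneg_nonneg overshoot_bounds Q0) simp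
  have [measurable]: "F j \<in> borel_measurable borel" for j unfolding F_def[abs_def] by measurable
  \<comment> \<open>For one j, \<open>comp\<close> replaces \<open>Q y\<close> by the value at the
    contracted point, and the substitution \<open>y = ?c j *\<^sub>R p\<close> has Jacobian at most
    \<open>2 ^ ?n\<close>.\<close>
  have one: "?L \<le> ennreal (C * 2 ^ ?n) * (\<integral>\<^sup>+p. F j p \<partial>lborel) + ennreal e * emeasure lborel A"
    if j: "j \<in> {1..J}" for j
  proof -
    have c1: "1 \<le> ?c j" using \<tau> by simp
    have "real j * \<tau> \<le> real J * \<tau>" using j \<tau> by (intro mult_right_mono) auto
    then have c2: "?c j \<le> 2" using \<tau> by linarith
    have "?L \<le> (\<integral>\<^sup>+y. ennreal C * ennreal (indicator A y * ?G y * Q (y /\<^sub>R ?c j)) + ennreal e * indicator A y \<partial>lborel)"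
    proof (rule nn_integral_mono)
      fix y
      show "indicator A y * ennreal (?G y * Q y) \<le> ennreal C * ennreal (indicator A y * ?G y * Q (y /\<^sub>R ?c j)) + ennreal e * indicator A y"
      proof (cases "y \<in> A")
        case True
        have "?G y * Q y \<le> ?G y * (C * Q (y /\<^sub>R ?c j) + e)"
          using comp[OF True] j overshoot_bounds(1)[of u l y] by (intro mult_left_mono) auto
        also have "\<dots> \<le> C * (?G y * Q (y /\<^sub>R ?c j)) + e"
          using overshoot_bounds(2)[of u l y] e by (simp add: distrib_left mult.left_commute mult_left_le_one_le overshoot_bounds)
        finally have "ennreal (?G y * Q y) \<le> ennreal (C * (?G y * Q (y /\<^sub>R ?c j)) + e)"
          by (rule ennreal_leI)
        also have "\<dots> = ennreal (C * (?G y * Q (y /\<^sub>R ?c j))) + ennreal e"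
          by (intro ennreal_plus mult_nonneg_nonneg C e overshoot_bounds Q0)
        also have "ennreal (C * (?G y * Q (y /\<^sub>R ?c j))) = ennreal C * ennreal (?G y * Q (y /\<^sub>R ?c j))"
          by (intro ennreal_mult mult_nonneg_nonneg C overshoot_bounds Q0)
        finally show ?thesis using True by simp
      qed simp
    qed
    also have "\<dots> = ennreal C * (\<integral>\<^sup>+y. ennreal (indicator A y * ?G y * Q (y /\<^sub>R ?c j)) \<partial>lborel) + ennreal e * emeasure lborel A"
      by (simp add: nn_integral_add nn_integral_cmult)
    also have "(\<integral>\<^sup>+y. ennreal (indicator A y * ?G y * Q (y /\<^sub>R ?c j)) \<partial>lborel) =
        ennreal (\<bar>?c j\<bar> ^ ?n) * (\<integral>\<^sup>+p. F j p \<partial>lborel)"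
      using nn_integral_scale[of "\<lambda>y. ennreal (indicator A y * ?G y * Q (y /\<^sub>R ?c j))" "?c j" 0] c1
      by (simp add: F_def)
    also have "ennreal C * (ennreal (\<bar>?c j\<bar> ^ ?n) * (\<integral>\<^sup>+p. F j p \<partial>lborel)) \<le> ennreal (C * 2 ^ ?n) * (\<integral>\<^sup>+p. F j p \<partial>lborel)"
      unfolding mult.assoc[symmetric] using C c1 c2
      by (intro mult_right_mono) (auto simp flip: ennreal_mult intro!: ennreal_leI mult_left_mono power_mono)
    finally show ?thesis by (auto intro: add_right_mono)
  qed
  \<comment> \<open>The sum over j is taken along one ray. As soon as one dilate of p lies in A,
    \<open>gain\<close> makes u climb by a unit per step along the whole ray, and
    \<open>sum_overshoot_le\<close> bounds the sum by the data at p; otherwise the sum is 0.\<close>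
  have pt: "(\<Sum>j\<in>{1..J}. F j p) \<le> 3 * (of_bool (u p \<le> l) * Q p + ?G p * Q p)" for p
  proof (cases "\<exists>j\<in>{1..J}. ?c j *\<^sub>R p \<in> A")
    case True
    then obtain j where j: "1 \<le> j" "j \<le> J" "?c j *\<^sub>R p \<in> A" by auto
    have cj: "?c j \<noteq> 0" using \<tau> by (metis add_pos_nonneg less_irrefl mult_nonneg_nonneg of_nat_0_le_iff order_less_imp_le zero_less_one)
    define a where "a i = u (?c i *\<^sub>R p)" for i
    have "a i + 1 \<le> a (Suc i)" if "i < J" for i
      unfolding a_def by (rule gain[OF j(3,1,2) that]) (use cj in simp)
    then have "(\<Sum>i\<le>J. overshoot a l i) \<le> 3 * (of_bool (a 0 \<le> l) + overshoot a l 0)"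
      by (rule sum_overshoot_le)
    also have "\<dots> = 3 * (of_bool (u p \<le> l) + ?G p)" by (simp add: a_def overshoot_def)
    finally have le: "(\<Sum>i\<le>J. overshoot a l i) \<le> 3 * (of_bool (u p \<le> l) + ?G p)" .
    have "(\<Sum>j\<in>{1..J}. F j p) \<le> (\<Sum>j\<in>{1..J}. overshoot a l j * Q p)"
      using overshoot_bounds Q0
      by (intro sum_mono) (auto simp: F_def a_def overshoot_def indicator_def intro!: mult_right_mono)
    also have "\<dots> \<le> (\<Sum>j\<le>J. overshoot a l j * Q p)"
      by (intro sum_mono2) (auto intro!: mult_nonneg_nonneg overshoot_bounds Q0)
    also have "\<dots> \<le> 3 * (of_bool (u p \<le> l) + ?G p) * Q p"
      unfolding sum_distrib_right[symmetric] by (intro mult_right_mono le Q0)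
    finally show ?thesis by (simp add: algebra_simps)
  next
    case False
    then have eq: "(\<Sum>j\<in>{1..J}. F j p) = 0" by (intro sum.neutral) (auto simp: F_def)
    show ?thesis unfolding eq
      by (intro add_nonneg_nonneg mult_nonneg_nonneg overshoot_bounds Q0) simp_all
  qed
  have "of_nat J * ?L = (\<Sum>j\<in>{1..J}. ?L)" by simp
  also have "\<dots> \<le> (\<Sum>j\<in>{1..J}. ennreal (C * 2 ^ ?n) * (\<integral>\<^sup>+p. F j p \<partial>lborel) + ennreal e * emeasure lborel A)"
    by (rule sum_mono) (rule one)
  also have "\<dots> = ennreal (C * 2 ^ ?n) * (\<integral>\<^sup>+p. (\<Sum>j\<in>{1..J}. ennreal (F j p)) \<partial>lborel) + of_nat J * (ennreal e * emeasure lborel A)"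
    by (simp add: sum.distrib sum_distrib_left nn_integral_sum)
  also have "(\<integral>\<^sup>+p. (\<Sum>j\<in>{1..J}. ennreal (F j p)) \<partial>lborel) \<le>
      (\<integral>\<^sup>+p. ennreal 3 * (ennreal (of_bool (u p \<le> l) * Q p) + ennreal (?G p * Q p)) \<partial>lborel)"
  proof (rule nn_integral_mono)
    fix p
    have "(\<Sum>j\<in>{1..J}. ennreal (F j p)) = ennreal (\<Sum>j\<in>{1..J}. F j p)"
      using F0 by (simp add: sum_ennreal)
    also have "\<dots> \<le> ennreal (3 * (of_bool (u p \<le> l) * Q p + ?G p * Q p))" by (intro ennreal_leI pt)
    also have "\<dots> = ennreal 3 * (ennreal (of_bool (u p \<le> l) * Q p) + ennreal (?G p * Q p))"
    proof -
      have nn: "0 \<le> of_bool (u p \<le> l) * Q p" "0 \<le> ?G p * Q p"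
        by (rule mult_nonneg_nonneg[OF _ Q0], simp, rule mult_nonneg_nonneg[OF overshoot_bounds(1) Q0])
      show ?thesis
        unfolding ennreal_plus[OF nn, symmetric]
        by (rule ennreal_mult) (rule zero_le_numeral, rule add_nonneg_nonneg[OF nn])
    qed
    finally show "(\<Sum>j\<in>{1..J}. ennreal (F j p)) \<le> ennreal 3 * (ennreal (of_bool (u p \<le> l) * Q p) + ennreal (?G p * Q p))" .
  qed
  also have "\<dots> = ennreal 3 * ((\<integral>\<^sup>+y. ennreal (of_bool (u y \<le> l) * Q y) \<partial>lborel) + (\<integral>\<^sup>+y. ennreal (?G y * Q y) \<partial>lborel))"
    by (subst nn_integral_cmult) (auto simp: nn_integral_add)
  finally have "of_nat J * ?L \<le> ennreal (C * 2 ^ ?n) * (ennreal 3 *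
      ((\<integral>\<^sup>+y. ennreal (of_bool (u y \<le> l) * Q y) \<partial>lborel) + (\<integral>\<^sup>+y. ennreal (?G y * Q y) \<partial>lborel)))
      + of_nat J * (ennreal e * emeasure lborel A)"
    by (simp add: mult_left_mono add_right_mono)
  moreover have k: "ennreal (3 * C * 2 ^ ?n) = ennreal (C * 2 ^ ?n) * 3"
    using C by (subst ennreal_numeral[symmetric], subst ennreal_mult[symmetric]) (auto simp: mult_ac)
  ultimately show ?thesis
    by (simp add: k distrib_left mult.assoc)
qed

section \<open>Superexponential targets\<close>

context
  fixes U :: "'a::euclidean_space \<Rightarrow> real" and D :: "'a \<Rightarrow> 'a" and \<rho> R1 \<beta> :: real
  assumes dU: "\<And>x. GDERIV U x :> D x"
    and \<rho>: "1 < \<rho>" and R1: "1 \<le> R1" and \<beta>: "0 < \<beta>" "\<beta> \<le> 1"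
    and radial: "\<And>x. R1 \<le> norm x \<Longrightarrow> norm x powr \<rho> \<le> x \<bullet> D x"
    and cone: "\<And>x. R1 \<le> norm x \<Longrightarrow> \<beta> * norm x * norm (D x) \<le> x \<bullet> D x"
begin

private lemma deriv_line: "((\<lambda>t. U (a + t *\<^sub>R v)) has_real_derivative v \<bullet> D (a + t *\<^sub>R v)) (at t)"
proof -
  have "((\<lambda>t. U (a + t *\<^sub>R v)) has_derivative (\<lambda>h. (h *\<^sub>R v) \<bullet> D (a + t *\<^sub>R v))) (at t)"
    by (rule has_derivative_compose[OF _ dU[unfolded gderiv_def]]) (auto intro!: derivative_eq_intros)
  then show ?thesis by (simp add: has_field_derivative_def mult_commute_abs)
qed

lemma continuous_potential: "continuous_on UNIV U"
  using dU unfolding gderiv_def by (meson continuous_at_imp_continuous_on has_derivative_continuous)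

text \<open>Along the ray the derivative of \<open>U (t *\<^sub>R y)\<close> is at least
  \<open>t^(\<rho>-1) |y|^\<rho>\<close>, hence at least \<open>|y|^\<rho>\<close> for
  \<open>t \<ge> 1\<close>.\<close>

lemma radial_gain:
  assumes y: "R1 \<le> norm y" and l: "1 \<le> s"
  shows "U y + (s - 1) * norm y powr \<rho> \<le> U (s *\<^sub>R y)"
proof -
  define f where "f t = U (0 + t *\<^sub>R y) - t * norm y powr \<rho>" for t
  have "f 1 \<le> f s"
  proof (rule DERIV_nonneg_imp_nondecreasing[OF l])
    fix t assume t: "1 \<le> t" "t \<le> s"
    have ny: "0 < norm y" using y R1 by linarith
    have "R1 \<le> norm (t *\<^sub>R y)" using y t R1 mult_mono[of 1 t R1 "norm y"] by simp
    from radial[OF this] have "t powr \<rho> * norm y powr \<rho> \<le> t * (y \<bullet> D (t *\<^sub>R y))"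
      using t ny by (simp add: powr_mult)
    moreover have "t powr 1 \<le> t powr \<rho>" using t \<rho> by (intro powr_mono) auto
    then have "t * norm y powr \<rho> \<le> t powr \<rho> * norm y powr \<rho>" using t by (intro mult_right_mono) auto
    ultimately have "t * norm y powr \<rho> \<le> t * (y \<bullet> D (t *\<^sub>R y))" by linarith
    then have yD: "norm y powr \<rho> \<le> y \<bullet> D (t *\<^sub>R y)" using t by simp
    have dl: "((\<lambda>t. U (t *\<^sub>R y)) has_real_derivative y \<bullet> D (t *\<^sub>R y)) (at t)"
      using deriv_line[of 0 y t] by simp
    moreover have "(f has_real_derivative y \<bullet> D (0 + t *\<^sub>R y) - norm y powr \<rho>) (at t)"
      using dl unfolding f_def by (auto intro!: derivative_eq_intros)
    ultimately show "\<exists>d. (f has_real_derivative d) (at t) \<and> 0 \<le> d" using yD by auto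
  qed
  then show ?thesis by (simp add: f_def algebra_simps)
qed

text \<open>Inside the ball of radius \<open>R1\<close> compactness suffices; outside,
  \<open>radial_gain\<close> starts from the sphere of that radius, where
  \<open>R1 powr \<rho> \<ge> R1\<close>.\<close>

lemma potential_growth: obtains a b where "0 < a" "\<And>x. a * norm x - b \<le> U x"
proof -
  have "compact (U ` cball 0 R1)"
    by (intro compact_continuous_image continuous_on_subset[OF continuous_potential]) auto
  then have "bounded (U ` cball 0 R1)" by (rule compact_imp_bounded)
  then obtain B where "\<forall>x\<in>cball 0 R1. \<bar>U x\<bar> \<le> B"
    by (auto simp: bounded_iff)
  then have B: "\<bar>U x\<bar> \<le> B" if "norm x \<le> R1" for x using that by simp
  have "1 * norm x - (B + R1) \<le> U x" for x
  proof (cases "norm x \<le> R1")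
    case True
    then show ?thesis using B[OF True] True unfolding abs_le_iff by linarith
  next
    case False
    define y where "y = (R1 / norm x) *\<^sub>R x"
    have nx: "0 < norm x" "R1 \<le> norm x" using False R1 by auto
    have ny: "norm y = R1" using nx R1 by (simp add: y_def)
    have xy: "(norm x / R1) *\<^sub>R y = x" using nx R1 by (simp add: y_def)
    have "U y + (norm x / R1 - 1) * R1 powr \<rho> \<le> U x"
      using radial_gain[of y "norm x / R1"] ny nx R1 by (simp add: xy)
    moreover have "R1 powr 1 \<le> R1 powr \<rho>" using R1 \<rho> by (intro powr_mono) auto
    then have "(norm x / R1 - 1) * R1 \<le> (norm x / R1 - 1) * R1 powr \<rho>"
      using nx R1 by (intro mult_left_mono) auto
    moreover have "(norm x / R1 - 1) * R1 = norm x - R1" using R1 by (simp add: field_simps)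
    moreover have "- B \<le> U y" using B[of y] ny unfolding abs_le_iff by linarith
    ultimately show ?thesis by linarith
  qed
  then show ?thesis using that[of 1] by auto
qed

text \<open>The points are reached from x by a unit step towards the origin plus a deviation of size
  at most \<open>\<beta> / 4\<close>. By the cone condition this deviation costs at most a quarter
  of the radial slope, and far out the slope is at least 2. The radius of the ball is the same for
  all x, so its proposal probability is of the order of the height.\<close>

lemma inward_ball:
  obtains R where "R1 \<le> R" "\<And>x y. R \<le> norm x \<Longrightarrow> y \<in> ball (x - x /\<^sub>R norm x) (\<beta> / 4) \<Longrightarrow> U y \<le> U x - 1"
proof -
  \<comment> \<open>From \<open>|x| \<le> |p| + 2\<close>, the entry \<open>6 + 8 / \<beta>\<close>
    yields \<open>3/4 |x| \<le> |p| - 2 / \<beta>\<close>; the power of 2 makes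
    \<open>|p|^(\<rho>-1)\<close> at least 2. The final threshold is larger by 2, because the
    segment stays within distance 2 of x.\<close>
  define P0 where "P0 = max (max R1 (6 + 8 / \<beta>)) (2 powr (1 / (\<rho> - 1)))"
  have P0: "R1 \<le> P0" "6 + 8 / \<beta> \<le> P0" "2 powr (1 / (\<rho> - 1)) \<le> P0" by (auto simp: P0_def)
  have "U y \<le> U x - 1" if x: "P0 + 2 \<le> norm x" and y: "y \<in> ball (x - x /\<^sub>R norm x) (\<beta> / 4)" for x y
  proof -
    define w where "w = y - (x - x /\<^sub>R norm x)"
    define v where "v = y - x"
    have nx: "0 < norm x" using x P0 R1 by linarith
    have nw: "norm w \<le> \<beta> / 4" using y by (simp add: w_def dist_norm norm_minus_commute)
    have v: "v = w - x /\<^sub>R norm x" by (simp add: v_def w_def)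
    have nv: "norm v \<le> 2"
    proof -
      have "norm v \<le> norm w + norm (x /\<^sub>R norm x)" unfolding v by (rule norm_triangle_ineq4)
      also have "norm (x /\<^sub>R norm x) = 1" using nx by simp
      finally show ?thesis using nw \<beta> by linarith
    qed
    define f where "f t = U (x + t *\<^sub>R v) + t" for t
    have "f 1 \<le> f 0"
    proof (rule DERIV_nonpos_imp_nonincreasing[of 0 1])
      fix t :: real assume t: "0 \<le> t" "t \<le> 1"
      define p where "p = x + t *\<^sub>R v"
      have "norm (t *\<^sub>R v) \<le> 2" using t nv mult_mono[of t 1 "norm v" 2] by simp
      then have np: "P0 \<le> norm p" "norm x \<le> norm p + 2"
        using x norm_triangle_ineq4[of p "t *\<^sub>R v"] by (auto simp: p_def)
      then have p0: "0 < norm p" using P0 R1 by linarith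
      define Z where "Z = p \<bullet> D p"
      have Z: "norm p powr \<rho> \<le> Z" "\<beta> * norm p * norm (D p) \<le> Z"
        using radial[of p] cone[of p] np P0 by (auto simp: Z_def)
      have Z0: "0 \<le> Z" using Z(1) by (meson order_trans powr_ge_zero)
      have Dle: "norm (D p) \<le> Z / (\<beta> * norm p)"
        using Z(2) \<beta> p0 by (simp add: pos_le_divide_eq mult_ac)
      have xZ: "x \<bullet> D p = Z - (t *\<^sub>R v) \<bullet> D p" by (simp add: Z_def p_def inner_add_left)
      have "(t *\<^sub>R v) \<bullet> D p \<le> 2 * norm (D p)"
        using norm_cauchy_schwarz[of "t *\<^sub>R v" "D p"] \<open>norm (t *\<^sub>R v) \<le> 2\<close>
        by (meson mult_right_mono norm_ge_zero order_trans)
      then have xD: "Z - 2 * norm (D p) \<le> x \<bullet> D p" using xZ by linarith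
      have wD: "w \<bullet> D p \<le> \<beta> / 4 * norm (D p)"
        using norm_cauchy_schwarz[of w "D p"] nw by (meson mult_right_mono norm_ge_zero order_trans)
      have "v \<bullet> D p = w \<bullet> D p - (x \<bullet> D p) / norm x"
        by (simp add: v inner_diff_left divide_inverse mult.commute)
      also have "\<dots> \<le> \<beta> / 4 * norm (D p) - (Z - 2 * norm (D p)) / norm x"
        using wD xD nx by (intro diff_mono divide_right_mono) auto
      also have "\<dots> = (\<beta> / 4 + 2 / norm x) * norm (D p) - Z / norm x"
        by (simp add: algebra_simps diff_divide_distrib)
      also have "\<dots> \<le> (\<beta> / 4 + 2 / norm x) * (Z / (\<beta> * norm p)) - Z / norm x"
        using Dle \<beta> nx by (intro diff_right_mono mult_left_mono) auto
      also have "\<dots> = (Z / norm p) * (1 / 4 - (norm p - 2 / \<beta>) / norm x)"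
        using \<beta> nx p0 by (simp add: field_simps)
      also have "\<dots> \<le> (Z / norm p) * (- (1 / 2))"
      proof (rule mult_left_mono)
        have "3 / 4 * norm x \<le> norm p - 2 / \<beta>" using np P0(2) by simp
        then have "3 / 4 \<le> (norm p - 2 / \<beta>) / norm x" using nx by (simp add: pos_le_divide_eq)
        then show "1 / 4 - (norm p - 2 / \<beta>) / norm x \<le> - (1 / 2)" by linarith
        show "0 \<le> Z / norm p" using Z0 by simp
      qed
      finally have vD: "v \<bullet> D p \<le> (Z / norm p) * (- (1 / 2))" .
      have "2 \<le> Z / norm p"
      proof -
        have "2 = (2 powr (1 / (\<rho> - 1))) powr (\<rho> - 1)" using \<rho> by (simp add: powr_powr)
        also have "\<dots> \<le> norm p powr (\<rho> - 1)" using np P0 \<rho> by (intro powr_mono2) auto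
        also have "\<dots> = norm p powr \<rho> / norm p" using p0 by (simp add: powr_diff)
        also have "\<dots> \<le> Z / norm p" using Z(1) p0 by (intro divide_right_mono) auto
        finally show ?thesis .
      qed
      then have "(Z / norm p) * (- (1 / 2)) \<le> 2 * (- (1 / 2))" by (rule mult_right_mono_neg) simp
      with vD have "v \<bullet> D p + 1 \<le> 0" by simp
      moreover have "(f has_real_derivative v \<bullet> D (x + t *\<^sub>R v) + 1) (at t)"
        unfolding f_def by (auto intro!: derivative_eq_intros deriv_line)
      ultimately show "\<exists>d. (f has_real_derivative d) (at t) \<and> d \<le> 0" by (auto simp: p_def)
    qed simp
    then show ?thesis by (simp add: f_def v_def)
  qed
  then show ?thesis using that[of "P0 + 2"] P0 by auto
qed

end

lemma ennreal_le_1E: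
  assumes "(X :: ennreal) \<le> 1"
  obtains r where "X = ennreal r" "0 \<le> r" "r \<le> 1"
proof (cases X)
  case (real r)
  then show ?thesis using assms that[of r] by (simp flip: ennreal_1)
next
  case top
  then show ?thesis using assms by (simp add: top_unique)
qed

lemma nn_integral_bounded_density:
  fixes Q g :: "'a::euclidean_space \<Rightarrow> real"
  assumes g: "\<And>y. 0 \<le> g y" "\<And>y. g y \<le> 1" and Q: "\<And>y. 0 \<le> Q y" "(\<integral>\<^sup>+y. ennreal (Q y) \<partial>lborel) = 1"
  shows "(\<integral>\<^sup>+y. ennreal (g y * Q y) \<partial>lborel) \<le> 1"
  unfolding Q(2)[symmetric]
  by (intro nn_integral_mono ennreal_leI mult_left_le_one_le g Q)

text \<open>\<open>I\<close> and \<open>G\<close> are the masses below the level and, with weight, above it.\<close>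

lemma metro_fac_integral_le:
  fixes u Q :: "'a::euclidean_space \<Rightarrow> real"
  assumes [measurable]: "u \<in> borel_measurable borel" "Q \<in> borel_measurable borel"
    and Q0: "\<And>y. 0 \<le> Q y" and Q1: "(\<integral>\<^sup>+y. ennreal (Q y) \<partial>lborel) = ennreal mq" "0 \<le> mq"
    and I: "(\<integral>\<^sup>+y. ennreal (of_bool (u y \<le> u x - 1) * Q y) \<partial>lborel) = ennreal I" "0 \<le> I"
    and G: "(\<integral>\<^sup>+y. ennreal (overshoot u (u x - 1) y * Q y) \<partial>lborel) = ennreal G" "0 \<le> G"
  shows "(\<integral>\<^sup>+y. ennreal (metro_fac (exp (u x - u y)) * Q y) \<partial>lborel) \<le>
    ennreal (mq + exp (1/2) * G - (1 - exp (- (1/2))) * I)"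
proof -
  let ?a = "1 - exp (- (1/2)) :: real" and ?F = "\<lambda>y. metro_fac (exp (u x - u y)) * Q y"
  let ?i = "\<lambda>y. of_bool (u y \<le> u x - 1) * Q y" and ?g = "\<lambda>y. overshoot u (u x - 1) y * Q y"
  have a: "0 \<le> ?a" by simp
  have i0: "0 \<le> ?i y" for y by (intro mult_nonneg_nonneg Q0) simp
  have g0: "0 \<le> ?g y" for y by (intro mult_nonneg_nonneg overshoot_bounds Q0)
  have F0: "0 \<le> ?F y" for y by (intro mult_nonneg_nonneg metro_fac_bounds Q0) simp
  \<comment> \<open>The gain is added on the left instead of being subtracted on the right, since
    subtraction in \<open>ennreal\<close> truncates; the passage to real numbers comes after
    finiteness is known.\<close>
  have "(\<integral>\<^sup>+y. ennreal (?F y) \<partial>lborel) + ennreal (?a * I) =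
      (\<integral>\<^sup>+y. ennreal (?F y) + ennreal ?a * ennreal (?i y) \<partial>lborel)"
    using a I by (simp add: nn_integral_add nn_integral_cmult ennreal_mult)
  also have "\<dots> \<le> (\<integral>\<^sup>+y. ennreal (Q y) + ennreal (exp (1/2)) * ennreal (?g y) \<partial>lborel)"
  proof (rule nn_integral_mono)
    fix y
    have "?F y + ?a * ?i y = (metro_fac (exp (u x - u y)) + ?a * of_bool (u y \<le> u x - 1)) * Q y"
      by (simp add: algebra_simps)
    also have "\<dots> \<le> (1 + exp (1/2) * overshoot u (u x - 1) y) * Q y"
      by (intro mult_right_mono metro_fac_level Q0)
    finally have le: "?F y + ?a * ?i y \<le> Q y + exp (1/2) * ?g y" by (simp add: algebra_simps)
    have "ennreal (?F y) + ennreal ?a * ennreal (?i y) = ennreal (?F y) + ennreal (?a * ?i y)"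
      by (simp only: ennreal_mult[OF a i0])
    also have "\<dots> = ennreal (?F y + ?a * ?i y)"
      by (intro ennreal_plus[symmetric] F0 mult_nonneg_nonneg a i0)
    also have "\<dots> \<le> ennreal (Q y + exp (1/2) * ?g y)" by (rule ennreal_leI[OF le])
    also have "\<dots> = ennreal (Q y) + ennreal (exp (1/2) * ?g y)"
      by (intro ennreal_plus Q0 mult_nonneg_nonneg[OF _ g0]) simp
    also have "ennreal (exp (1/2) * ?g y) = ennreal (exp (1/2)) * ennreal (?g y)"
      by (rule ennreal_mult[OF _ g0]) simp
    finally show "ennreal (?F y) + ennreal ?a * ennreal (?i y) \<le> ennreal (Q y) + ennreal (exp (1/2)) * ennreal (?g y)" .
  qed
  also have "\<dots> = ennreal mq + ennreal (exp (1/2)) * ennreal G"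
    by (simp add: nn_integral_add nn_integral_cmult Q1 G)
  also have "\<dots> = ennreal (mq + exp (1/2) * G)"
    using G(2) Q1(2) by (simp add: ennreal_plus ennreal_mult)
  finally have le: "(\<integral>\<^sup>+y. ennreal (?F y) \<partial>lborel) + ennreal (?a * I) \<le> ennreal (mq + exp (1/2) * G)" .
  then have "(\<integral>\<^sup>+y. ennreal (?F y) \<partial>lborel) \<noteq> \<top>" by (auto simp: top_unique)
  then obtain r where r: "(\<integral>\<^sup>+y. ennreal (?F y) \<partial>lborel) = ennreal r" "0 \<le> r"
    by (cases "\<integral>\<^sup>+y. ennreal (?F y) \<partial>lborel") auto
  have "r + ?a * I \<le> mq + exp (1/2) * G"
    using le a I(2) G(2) Q1(2) r(2) unfolding r(1)
    by (simp add: ennreal_plus[symmetric] ennreal_le_iff del: ennreal_plus)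
  then show ?thesis unfolding r(1) by (intro ennreal_leI) linarith
qed

lemma shift_density:
  fixes r :: "'a::euclidean_space \<Rightarrow> real"
  assumes "prob_density r"
  shows "(\<lambda>y. r (y - x)) \<in> borel_measurable borel" "0 \<le> r (y - x)" "(\<integral>\<^sup>+y. ennreal (r (y - x)) \<partial>lborel) = 1"
proof -
  have [measurable]: "r \<in> borel_measurable borel" using assms by (simp add: prob_density_def)
  show "(\<lambda>y. r (y - x)) \<in> borel_measurable borel" by measurable
  show "0 \<le> r (y - x)" using assms by (simp add: prob_density_def)
  have "(\<integral>\<^sup>+y. ennreal (r (- x + y)) \<partial>lborel) = (\<integral>\<^sup>+y. ennreal (r y) \<partial>lborel)"
    by (rule nn_integral_translate) measurable
  then show "(\<integral>\<^sup>+y. ennreal (r (y - x)) \<partial>lborel) = 1" using assms by (simp add: prob_density_def)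
qed

section \<open>Overshoot on dyadic shells and the drift outside a ball\<close>

lemma dyadic_shell:
  fixes t :: real
  assumes "2 ^ k1 \<le> t"
  obtains k where "k1 \<le> k" "2 ^ k \<le> t" "t < 2 ^ Suc k"
proof -
  obtain n where n: "t < 2 ^ n" using real_arch_pow[of 2 t] by auto
  define m where "m = (LEAST n. t < 2 ^ n)"
  have m: "t < 2 ^ m" unfolding m_def by (rule LeastI[of "\<lambda>n. t < 2 ^ n", OF n])
  have "k1 < m"
  proof (rule ccontr)
    assume "\<not> k1 < m"
    then have "(2::real) ^ m \<le> 2 ^ k1" by (intro power_increasing) auto
    with m assms show False by linarith
  qed
  then obtain k where k: "m = Suc k" "k1 \<le> k" by (cases m) auto
  have "\<not> t < 2 ^ k" using not_less_Least[of k "\<lambda>n. t < 2 ^ n"] k(1) by (simp add: m_def[symmetric])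
  then show ?thesis using that[of k] k m by simp
qed

text \<open>With \<open>b^4 = 2^(\<rho>-1)\<close>, the radial gain at distance \<open>2^k\<close>
  exceeds linear order by the factor \<open>b^(4k)\<close>. One power \<open>b^k\<close> is spent on
  the number of dilations and one on keeping them within distance \<open>b^-k\<close>; the remaining
  two beat the constants.\<close>

definition shell_base :: "real \<Rightarrow> real" where
  "shell_base \<rho> = 2 powr ((\<rho> - 1) / 4)"

context
  fixes U :: "'a::euclidean_space \<Rightarrow> real" and D :: "'a \<Rightarrow> 'a" and \<rho> R1 \<beta> :: real
  assumes dU: "\<And>x. GDERIV U x :> D x"
    and \<rho>: "1 < \<rho>" and R1: "1 \<le> R1" and \<beta>: "0 < \<beta>" "\<beta> \<le> 1"
    and radial: "\<And>x. R1 \<le> norm x \<Longrightarrow> norm x powr \<rho> \<le> x \<bullet> D x"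
    and cone: "\<And>x. R1 \<le> norm x \<Longrightarrow> \<beta> * norm x * norm (D x) \<le> x \<bullet> D x"
begin

private lemmas gain = radial_gain[OF dU \<rho> R1 \<beta> radial cone]

private abbreviation "b \<equiv> shell_base \<rho>"

private lemma b: "1 < b" unfolding shell_base_def using \<rho> by simp

text \<open>The shell \<open>2 ^ k \<le> norm y < 2 ^ Suc k\<close> is dilated \<open>J\<close> times within a distance \<open>b ^ - k\<close>.\<close>

lemma shell_bound:
  fixes Q :: "'a \<Rightarrow> real" and m k :: nat and l h C v0 :: real
  assumes Qm: "Q \<in> borel_measurable borel" and Q0: "\<And>y. 0 \<le> Q y"
    and C: "0 \<le> C" and h: "0 \<le> h" and m: "2 ^ DIM('a) * b \<le> b ^ m"
    and comp: "\<And>y v. norm v \<le> v0 \<Longrightarrow> Q y \<le> C * Q (y + v) + h * C * norm v ^ m"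
    and k: "1 / v0 \<le> b ^ k" "0 < v0" "2 * R1 \<le> 2 ^ k" "16 * b ^ 4 \<le> b ^ k"
    and I: "(\<integral>\<^sup>+y. ennreal (of_bool (U y \<le> l) * Q y) \<partial>lborel) = ennreal I" "0 \<le> I"
    and G: "(\<integral>\<^sup>+y. ennreal (overshoot U l y * Q y) \<partial>lborel) = ennreal G" "0 \<le> G"
  shows "(\<integral>\<^sup>+y. indicator {y. 2 ^ k \<le> norm y \<and> norm y < 2 ^ Suc k} y * ennreal (overshoot U l y * Q y) \<partial>lborel)
    \<le> ennreal ((3 * C * 2 ^ DIM('a) * (I + G) + C * unit_ball_vol (real DIM('a)) * 2 ^ DIM('a) * h) * (1 / b) ^ k)"
proof -
  note [measurable] = Qm
  let ?A = "{y :: 'a. 2 ^ k \<le> norm y \<and> norm y < 2 ^ Suc k}" and ?n = "DIM('a)"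
  have [measurable]: "U \<in> borel_measurable borel"
    by (rule borel_measurable_continuous_onI[OF continuous_potential[OF dU \<rho> R1 \<beta> radial cone]])
  have Am: "?A \<in> sets borel" by measurable
  have b0: "0 < b" using b by simp
  have bk: "1 \<le> b ^ k" using b by simp
  \<comment> \<open>At least \<open>b ^ k\<close> dilations, so that dividing by J produces the
    geometric factor \<open>(1 / b) ^ k\<close>.\<close>
  define J where "J = nat \<lceil>b ^ k\<rceil>"
  have J: "b ^ k \<le> real J" "real J \<le> 2 * b ^ k" "0 < real J" using bk unfolding J_def by linarith+
  \<comment> \<open>J dilations of this size displace a point of norm below \<open>2 ^ Suc k\<close>
    by at most \<open>1 / b ^ k\<close> in total, which keeps the error in \<open>comp\<close>
    small.\<close>
  define \<tau> where "\<tau> = 1 / (b ^ k * 2 ^ Suc k * real J)"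
  have \<tau>: "0 < \<tau>" using J b0 by (simp add: \<tau>_def)
  have J\<tau>: "real J * \<tau> = 1 / (b ^ k * 2 ^ Suc k)" using J(3) by (simp add: \<tau>_def)
  have "(1::real) \<le> 2 ^ Suc k" by (rule one_le_power) simp
  then have "1 * 1 \<le> b ^ k * 2 ^ Suc k" using bk b0 by (intro mult_mono) auto
  then have J\<tau>1: "real J * \<tau> \<le> 1" unfolding J\<tau> by (simp add: divide_le_eq)
  define e where "e = h * C * (1 / b ^ k) ^ m"
  have e: "0 \<le> e" using h C b0 by (simp add: e_def)
  have "of_nat J * (\<integral>\<^sup>+y. indicator ?A y * ennreal (overshoot U l y * Q y) \<partial>lborel) \<le>
    ennreal (3 * C * 2 ^ ?n) * ((\<integral>\<^sup>+y. ennreal (of_bool (U y \<le> l) * Q y) \<partial>lborel) + (\<integral>\<^sup>+y. ennreal (overshoot U l y * Q y) \<partial>lborel))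
    + of_nat J * (ennreal e * emeasure lborel ?A)"
  proof (rule overshoot_dilation_bound[OF _ Qm Am Q0 \<tau> J\<tau>1 C e])
    fix y j assume y: "y \<in> ?A" and j: "1 \<le> j" "j \<le> J"
    define s where "s = 1 + real j * \<tau>"
    have "real j * \<tau> \<le> real J * \<tau>" using j \<tau> by (intro mult_right_mono) auto
    then have s: "1 \<le> s" "s - 1 \<le> 1 / (b ^ k * 2 ^ Suc k)" "s \<le> 2" using \<tau> J\<tau> J\<tau>1 by (auto simp: s_def)
    define v where "v = y /\<^sub>R s - y"
    have "v = - ((1 - 1 / s) *\<^sub>R y)" by (simp add: v_def scaleR_left_diff_distrib divide_inverse)
    then have "norm v = (1 - 1 / s) * norm y" using s by (simp add: divide_le_eq)
    also have "1 - 1 / s = (s - 1) / s" using s by (simp add: field_simps)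
    also have "(s - 1) / s * norm y \<le> (s - 1) / 1 * norm y"
      using s by (intro mult_right_mono divide_left_mono) auto
    also have "(s - 1) / 1 * norm y = (s - 1) * norm y" by simp
    also have "\<dots> \<le> 1 / (b ^ k * 2 ^ Suc k) * 2 ^ Suc k" using s y b0 by (intro mult_mono) auto
    also have "\<dots> = 1 / b ^ k" by simp
    finally have nv: "norm v \<le> 1 / b ^ k" .
    also have "\<dots> \<le> v0" using k(1,2) b0 by (simp add: field_simps)
    finally have "Q y \<le> C * Q (y + v) + h * C * norm v ^ m" by (rule comp)
    also have "\<dots> \<le> C * Q (y + v) + e"
      unfolding e_def using nv h C by (intro add_left_mono mult_left_mono power_mono) auto
    finally show "Q y \<le> C * Q (y /\<^sub>R (1 + real j * \<tau>)) + e" by (simp add: v_def s_def)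
    fix i p assume i: "i < J" and p: "p = y /\<^sub>R (1 + real j * \<tau>)"
    define s' where "s' = 1 + real i * \<tau>"
    have "real i * \<tau> \<le> real J * \<tau>" using i \<tau> by (intro mult_right_mono) auto
    then have "s' \<le> 2" using J\<tau>1 unfolding s'_def by linarith
    then have s': "1 \<le> s'" "s' \<le> 2" using \<tau> by (auto simp: s'_def)
    \<comment> \<open>Contraction by up to the factor 2 may leave the shell, which is why the
      requirement on k reads \<open>2 * R1 \<le> 2 ^ k\<close>.\<close>
    have np: "2 ^ k / 2 \<le> norm p"
    proof -
      have ps: "p = y /\<^sub>R s" by (simp add: p s_def)
      have "norm p = norm y / s" using s by (simp add: ps inverse_eq_divide)
      moreover have "norm y / 2 \<le> norm y / s" using s by (intro divide_left_mono) auto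
      moreover have "2 ^ k \<le> norm y" using y by simp
      ultimately show ?thesis by linarith
    qed
    have n': "2 ^ k / 2 \<le> norm (s' *\<^sub>R p)"
      using np s' mult_mono[of 1 s' "norm p" "norm p"] by simp
    have R1': "R1 \<le> norm (s' *\<^sub>R p)" using n' k(3) by linarith
    define z where "z = (1 + real (Suc i) * \<tau>) / s'"
    have "z = (s' + \<tau>) / s'" by (simp add: z_def s'_def algebra_simps)
    also have "\<dots> = 1 + \<tau> / s'" using s' by (simp add: add_divide_distrib)
    finally have z: "z - 1 = \<tau> / s'" "1 \<le> z" using s' \<tau> by auto
    have "\<tau> / 2 \<le> z - 1" unfolding z(1) using s' \<tau> by (intro divide_left_mono) auto
    moreover have "1 \<le> \<tau> / 2 * norm (s' *\<^sub>R p) powr \<rho>"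
    proof -
      \<comment> \<open>This splits \<open>2^((k-1)\<rho>)\<close> into \<open>2^(k-1)\<close> and
        \<open>b^(4(k-1))\<close>, by the choice of b.\<close>
      have ex: "(real k - 1) * \<rho> = (real k - 1) + (\<rho> - 1) / 4 * (4 * (real k - 1))"
        by (simp add: field_simps)
      have "(2 ^ k / 2) powr \<rho> = (2 powr (real k - 1)) powr \<rho>"
        by (simp add: powr_diff powr_realpow)
      also have "\<dots> = 2 powr (real k - 1) * (2 powr ((\<rho> - 1) / 4)) powr (4 * (real k - 1))"
        by (simp only: powr_powr ex powr_add)
      also have "\<dots> = 2 ^ k / 2 * (b ^ (4 * k) / b ^ 4)"
      proof -
        have "b powr (4 * (real k - 1)) = b powr (real (4 * k)) / b powr (real 4)"
          by (simp add: powr_diff[symmetric] algebra_simps)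
        then show ?thesis using b0 unfolding shell_base_def[symmetric] powr_realpow[OF b0]
          by (simp add: powr_diff powr_realpow)
      qed
      finally have eq: "(2 ^ k / 2) powr \<rho> = 2 ^ k / 2 * (b ^ (4 * k) / b ^ 4)" .
      have "16 * b ^ 4 \<le> b ^ (2 * k)"
        using k(4) bk mult_mono[of 1 "b ^ k" "b ^ k" "b ^ k"] b0
        by (simp add: power_mult power2_eq_square flip: power_mult_distrib power_add mult_2)
      then have "16 * b ^ 4 * b ^ (2 * k) \<le> b ^ (2 * k) * b ^ (2 * k)" using b0 by (intro mult_right_mono) auto
      also have "\<dots> = b ^ (4 * k)" by (simp flip: power_add)
      finally have big: "16 * b ^ (2 * k) \<le> b ^ (4 * k) / b ^ 4" using b0 by (simp add: pos_le_divide_eq mult_ac)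
      have "1 \<le> 1 / (b ^ k * 2 ^ Suc k * (2 * b ^ k)) / 2 * (2 ^ k / 2 * (16 * b ^ (2 * k)))"
      proof -
        have "b ^ (2 * k) = b ^ k * b ^ k" by (simp add: mult_2 power_add)
        then show ?thesis using b0 by (simp add: field_simps)
      qed
      also have "\<dots> \<le> \<tau> / 2 * (2 ^ k / 2 * (b ^ (4 * k) / b ^ 4))"
      proof (intro mult_mono divide_right_mono big)
        show "1 / (b ^ k * 2 ^ Suc k * (2 * b ^ k)) \<le> \<tau>"
          unfolding \<tau>_def using J b0 by (intro divide_left_mono mult_left_mono) auto
      qed (use b0 \<tau> in auto)
      also have "\<dots> = \<tau> / 2 * (2 ^ k / 2) powr \<rho>" by (simp add: eq)
      also have "\<dots> \<le> \<tau> / 2 * norm (s' *\<^sub>R p) powr \<rho>"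
        using n' \<tau> \<rho> by (intro mult_left_mono powr_mono2) auto
      finally show ?thesis .
    qed
    ultimately have "1 \<le> (z - 1) * norm (s' *\<^sub>R p) powr \<rho>"
      by (meson mult_right_mono order_trans powr_ge_zero)
    then have "U (s' *\<^sub>R p) + 1 \<le> U (z *\<^sub>R (s' *\<^sub>R p))"
      using gain[OF _ _ R1' z(2)] by linarith
    also have "z *\<^sub>R (s' *\<^sub>R p) = (1 + real (Suc i) * \<tau>) *\<^sub>R p" using s' by (simp add: z_def)
    finally show "U ((1 + real i * \<tau>) *\<^sub>R p) + 1 \<le> U ((1 + real (Suc i) * \<tau>) *\<^sub>R p)" by (simp add: s'_def)
  qed measurable
  also have "\<dots> \<le> ennreal (3 * C * 2 ^ ?n) * (ennreal I + ennreal G) + of_nat J * (ennreal e * ennreal (unit_ball_vol (real ?n) * (2 ^ Suc k) ^ ?n))"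
  proof -
    have "emeasure lborel ?A \<le> emeasure lborel (ball (0::'a) (2 ^ Suc k))"
      by (intro emeasure_mono) auto
    also have "\<dots> = ennreal (unit_ball_vol (real ?n) * (2 ^ Suc k) ^ ?n)"
      by (rule emeasure_ball) simp
    finally show ?thesis unfolding I G by (intro add_left_mono mult_left_mono) auto
  qed
  finally have le: "of_nat J * (\<integral>\<^sup>+y. indicator ?A y * ennreal (overshoot U l y * Q y) \<partial>lborel) \<le>
    ennreal (3 * C * 2 ^ ?n) * (ennreal I + ennreal G) + of_nat J * (ennreal e * ennreal (unit_ball_vol (real ?n) * (2 ^ Suc k) ^ ?n))" (is "_ * ?L \<le> _") .
  define W where "W = unit_ball_vol (real ?n) * (2 ^ Suc k) ^ ?n"
  have W: "0 \<le> W" by (simp add: W_def)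
  have "ennreal (real J) * ?L \<le> ennreal (3 * C * 2 ^ ?n * (I + G) + real J * (e * W))"
    using le C I(2) G(2) e W unfolding W_def[symmetric]
    by (simp add: ennreal_of_nat_eq_real_of_nat ennreal_mult[symmetric] ennreal_plus[symmetric] del: ennreal_plus)
  then have "ennreal (1 / real J) * (ennreal (real J) * ?L) \<le>
      ennreal (1 / real J) * ennreal (3 * C * 2 ^ ?n * (I + G) + real J * (e * W))"
    by (rule mult_left_mono) simp
  also have "ennreal (1 / real J) * (ennreal (real J) * ?L) = ?L"
    using J(3) by (simp add: mult.assoc[symmetric] ennreal_mult[symmetric])
  also have "ennreal (1 / real J) * ennreal (3 * C * 2 ^ ?n * (I + G) + real J * (e * W)) =
      ennreal (1 / real J * (3 * C * 2 ^ ?n * (I + G) + real J * (e * W)))"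
    using C I(2) G(2) e W J(3) by (intro ennreal_mult[symmetric]) auto
  also have "\<dots> \<le> ennreal ((3 * C * 2 ^ ?n * (I + G) + C * unit_ball_vol (real ?n) * 2 ^ ?n * h) * (1 / b) ^ k)"
  proof (rule ennreal_leI)
    have f1: "1 / real J * (3 * C * 2 ^ ?n * (I + G) + real J * (e * W)) = 3 * C * 2 ^ ?n * (I + G) / real J + e * W"
      using J(3) by (simp add: field_simps)
    have f2: "3 * C * 2 ^ ?n * (I + G) / real J \<le> 3 * C * 2 ^ ?n * (I + G) / b ^ k"
      using J b0 C I(2) G(2) by (intro divide_left_mono) auto
    \<comment> \<open>The shell has volume of order \<open>2^(n k)\<close> and the comparison error
      is of order \<open>b^(- m k)\<close>; the hypothesis on m leaves the product at order
      \<open>b^-k\<close>.\<close>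
    have f3: "e * W \<le> C * unit_ball_vol (real ?n) * 2 ^ ?n * h * (1 / b ^ k)"
    proof -
      have "(2 ^ ?n) ^ k * b ^ k \<le> (b ^ m) ^ k"
        using m b0 power_mono[of "2 ^ ?n * b" "b ^ m" k] by (simp add: power_mult_distrib)
      then have "(2 ^ k) ^ ?n / (b ^ k) ^ m \<le> 1 / b ^ k"
        using b0 by (simp add: field_simps flip: power_mult)
      then have "(C * unit_ball_vol (real ?n) * 2 ^ ?n * h) * ((2 ^ k) ^ ?n / (b ^ k) ^ m) \<le>
          (C * unit_ball_vol (real ?n) * 2 ^ ?n * h) * (1 / b ^ k)"
        using C h by (intro mult_left_mono) auto
      then show ?thesis by (simp add: e_def W_def power_divide power_mult_distrib mult_ac)
    qed
    show "1 / real J * (3 * C * 2 ^ ?n * (I + G) + real J * (e * W)) \<le>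
        (3 * C * 2 ^ ?n * (I + G) + C * unit_ball_vol (real ?n) * 2 ^ ?n * h) * (1 / b) ^ k"
      unfolding f1 distrib_right[of "3 * C * 2 ^ ?n * (I + G)"]
      using add_mono[OF f2 f3] by (simp only: power_one_over times_divide_eq_right mult_1_right)
  qed
  finally show ?thesis .
qed

end

text \<open>The proposal enters only through its height h, a lower bound \<open>h c0\<close> near 0
  and the shift comparison, so R and c serve all parameters. The mass I below the level is at least
  of order h because of the inward ball. Summing the shells gives
  \<open>G \<le> k0 (I + G + h)\<close> with a small k0, and since h is at most of order I, the loss
  G is a small fraction of I.\<close>

lemma superexp_drift:
  fixes U :: "'a::euclidean_space \<Rightarrow> real" and D :: "'a \<Rightarrow> 'a" and \<rho> R1 \<beta> c0 C v0 :: real and m :: nat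
  assumes dU: "\<And>x. GDERIV U x :> D x"
    and \<rho>: "1 < \<rho>" and R1: "1 \<le> R1" and \<beta>: "0 < \<beta>" "\<beta> \<le> 1"
    and radial: "\<And>x. R1 \<le> norm x \<Longrightarrow> norm x powr \<rho> \<le> x \<bullet> D x"
    and cone: "\<And>x. R1 \<le> norm x \<Longrightarrow> \<beta> * norm x * norm (D x) \<le> x \<bullet> D x"
    and c0: "0 < c0" and C: "0 \<le> C" and v0: "0 < v0"
    and m: "2 ^ DIM('a) * shell_base \<rho> \<le> shell_base \<rho> ^ m"
  obtains R c where "0 < c"
    "\<And>x h r. R \<le> norm x \<Longrightarrow> prob_density r \<Longrightarrow> 0 \<le> h \<Longrightarrow>
      (\<And>z v. norm v \<le> v0 \<Longrightarrow> r z \<le> C * r (z + v) + h * C * norm v ^ m) \<Longrightarrow>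
      (\<And>z. norm z \<le> 2 \<Longrightarrow> h * c0 \<le> r z) \<Longrightarrow>
      (\<integral>\<^sup>+y. ennreal (metro_fac (exp (U x - U y)) * r (y - x)) \<partial>lborel) \<le> ennreal (1 - c * h)"
proof -
  let ?n = "DIM('a)" and ?b = "shell_base \<rho>"
  note shell = shell_bound[OF dU \<rho> R1 \<beta> radial cone]
  have b: "1 < ?b" unfolding shell_base_def using \<rho> by simp
  have cont: "continuous_on UNIV U" by (rule continuous_potential[OF dU \<rho> R1 \<beta> radial cone])
  have Um[measurable]: "U \<in> borel_measurable borel" by (rule borel_measurable_continuous_onI[OF cont])
  define vol where "vol = unit_ball_vol (real ?n) * (\<beta> / 4) ^ ?n"
  define c1 where "c1 = c0 * vol"
  define a1 e1 :: real where "a1 = 1 - exp (- (1/2))" and "e1 = exp (1/2)"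
  define K where "K = 3 * C * 2 ^ ?n + C * unit_ball_vol (real ?n) * 2 ^ ?n"
  have c1: "0 < c1" using c0 \<beta> by (simp add: c1_def vol_def)
  have a1: "0 < a1" "0 < e1" by (simp_all add: a1_def e1_def)
  have K: "0 \<le> K" using C by (simp add: K_def)
  \<comment> \<open>Chosen so that \<open>G \<le> 2 k0 (1 + 1 / c1) I\<close> gives
    \<open>e1 G \<le> a1 I / 2\<close>, which leaves half of the gain.\<close>
  define k0 where "k0 = min (1/2) (a1 / (4 * e1 * (1 + 1 / c1)))"
  have k0: "0 < k0" "k0 \<le> 1/2" "k0 \<le> a1 / (4 * e1 * (1 + 1 / c1))"
    using a1 c1 by (auto simp: k0_def add_pos_pos)
  \<comment> \<open>The last entry makes the geometric series over the shells from k1 on contribute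
    at most the factor k0; the other two are requirements of \<open>shell_bound\<close>.\<close>
  define T where "T = max (max (1 / v0) (16 * ?b ^ 4)) (K / (k0 * (1 - 1 / ?b)))"
  obtain n1 where n1: "T < ?b ^ n1" using real_arch_pow[OF b] by blast
  obtain n2 where n2: "2 * R1 < 2 ^ n2" using real_arch_pow[of 2 "2 * R1"] by auto
  define k1 where "k1 = max n1 n2"
  have bk: "T \<le> ?b ^ k" if "k1 \<le> k" for k
  proof -
    have "?b ^ n1 \<le> ?b ^ k" using b that by (intro power_increasing) (auto simp: k1_def)
    with n1 show ?thesis by linarith
  qed
  have tk: "2 * R1 \<le> 2 ^ k" if "k1 \<le> k" for k
  proof -
    have "(2::real) ^ n2 \<le> 2 ^ k" using that by (intro power_increasing) (auto simp: k1_def)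
    with n2 show ?thesis by linarith
  qed
  obtain Rin where Rin: "R1 \<le> Rin"
    "\<And>x y. Rin \<le> norm x \<Longrightarrow> y \<in> ball (x - x /\<^sub>R norm x) (\<beta> / 4) \<Longrightarrow> U y \<le> U x - 1"
    using inward_ball[OF dU \<rho> R1 \<beta> radial cone] by blast
  obtain a b' where gr: "0 < a" "\<And>x. a * norm x - b' \<le> U x"
    using potential_growth[OF dU \<rho> R1 \<beta> radial cone] by blast
  have "bounded (U ` cball 0 (2 ^ k1))"
    by (intro compact_imp_bounded compact_continuous_image continuous_on_subset[OF cont]) auto
  then obtain B where "\<forall>y\<in>cball 0 (2 ^ k1). \<bar>U y\<bar> \<le> B" by (auto simp: bounded_iff)
  then have B: "U y \<le> B" if "norm y \<le> 2 ^ k1" for y using that by (auto simp: abs_le_iff)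
  \<comment> \<open>The last entry raises \<open>U x - 1\<close> to at least the bound B of U on the
    ball of radius \<open>2 ^ k1\<close>, so overshoot occurs only on shells of index at least
    k1.\<close>
  define R where "R = max (max Rin 1) ((B + b' + 1) / a)"
  have "(\<integral>\<^sup>+y. ennreal (metro_fac (exp (U x - U y)) * r (y - x)) \<partial>lborel) \<le> ennreal (1 - a1 / 2 * c1 * h)"
    if x: "R \<le> norm x" and r: "prob_density r" and h: "0 \<le> h"
      and comp: "\<And>z v. norm v \<le> v0 \<Longrightarrow> r z \<le> C * r (z + v) + h * C * norm v ^ m"
      and low: "\<And>z. norm z \<le> 2 \<Longrightarrow> h * c0 \<le> r z" for x h r
  proof -
    define Q where "Q y = r (y - x)" for y
    define l where "l = U x - 1"
    have Qm[measurable]: "Q \<in> borel_measurable borel" and Q0: "\<And>y. 0 \<le> Q y"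
      and Q1: "(\<integral>\<^sup>+y. ennreal (Q y) \<partial>lborel) = 1"
      using shift_density[OF r, where x = x] by (simp_all add: Q_def[abs_def])
    have xR: "Rin \<le> norm x" "1 \<le> norm x" "(B + b' + 1) / a \<le> norm x" using x by (auto simp: R_def)
    have "B + b' + 1 \<le> a * norm x" using xR(3) gr(1) by (simp add: pos_divide_le_eq mult.commute)
    then have Bl: "B \<le> l" using gr(2)[of x] by (simp add: l_def)
    obtain I where I: "(\<integral>\<^sup>+y. ennreal (of_bool (U y \<le> l) * Q y) \<partial>lborel) = ennreal I" "0 \<le> I"
      by (rule ennreal_le_1E[OF nn_integral_bounded_density[OF _ _ Q0 Q1, of "\<lambda>y. of_bool (U y \<le> l)"]]) auto
    obtain G where G: "(\<integral>\<^sup>+y. ennreal (overshoot U l y * Q y) \<partial>lborel) = ennreal G" "0 \<le> G"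
      by (rule ennreal_le_1E[OF nn_integral_bounded_density[OF _ _ Q0 Q1, of "overshoot U l"]])
        (auto simp: overshoot_bounds)
    have hI: "h * c1 \<le> I"
    proof -
      let ?B = "ball (x - x /\<^sub>R norm x) (\<beta> / 4)"
      have "ennreal (h * c1) = (\<integral>\<^sup>+y. ennreal (h * c0) * indicator ?B y \<partial>lborel)"
        using h c0 \<beta>
        by (subst nn_integral_cmult_indicator)
          (simp_all add: emeasure_ball c1_def vol_def mult.assoc ennreal_mult[symmetric])
      also have "\<dots> \<le> (\<integral>\<^sup>+y. ennreal (of_bool (U y \<le> l) * Q y) \<partial>lborel)"
      proof (rule nn_integral_mono)
        fix y
        show "ennreal (h * c0) * indicator ?B y \<le> ennreal (of_bool (U y \<le> l) * Q y)"
        proof (cases "y \<in> ?B")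
          case True
          have "norm (y - x) = norm ((y - (x - x /\<^sub>R norm x)) - x /\<^sub>R norm x)" by simp
          also have "\<dots> \<le> norm (y - (x - x /\<^sub>R norm x)) + norm (x /\<^sub>R norm x)" by (rule norm_triangle_ineq4)
          also have "norm (x /\<^sub>R norm x) \<le> 1" by (cases "x = 0") auto
          also have "norm (y - (x - x /\<^sub>R norm x)) \<le> 1"
            using True \<beta> by (simp add: dist_norm norm_minus_commute)
          finally have "norm (y - x) \<le> 2" by simp
          then have "h * c0 \<le> Q y" unfolding Q_def by (rule low)
          moreover have "U y \<le> l" unfolding l_def by (rule Rin(2)[OF xR(1) True])
          ultimately show ?thesis using True by (simp add: ennreal_leI)
        qed simp
      qed
      finally show ?thesis using I by (simp add: ennreal_le_iff)
    qed
    let ?A = "\<lambda>k. {y :: 'a. 2 ^ k \<le> norm y \<and> norm y < 2 ^ Suc k}"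
    let ?f = "\<lambda>k y. indicator (?A (k + k1)) y * ennreal (overshoot U l y * Q y)"
    define S where "S = K * (I + G + h)"
    have S: "0 \<le> S" using K I(2) G(2) h by (simp add: S_def)
    have "ennreal G \<le> (\<integral>\<^sup>+y. (\<Sum>k. ?f k y) \<partial>lborel)"
      unfolding G(1)[symmetric]
    proof (rule nn_integral_mono)
      fix y
      show "ennreal (overshoot U l y * Q y) \<le> (\<Sum>k. ?f k y)"
      proof (cases "l < U y")
        case True
        then have "2 ^ k1 \<le> norm y" using B[of y] Bl by (cases "norm y \<le> 2 ^ k1") auto
        then obtain k where k: "k1 \<le> k" "2 ^ k \<le> norm y" "norm y < 2 ^ Suc k" by (rule dyadic_shell)
        then have "ennreal (overshoot U l y * Q y) = ?f (k - k1) y" by simp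
        also have "\<dots> = (\<Sum>i\<in>{k - k1}. ?f i y)"
          by (simp only: sum.insert finite.emptyI empty_iff not_False_eq_True sum.empty add_0_right)
        also have "\<dots> \<le> (\<Sum>k. ?f k y)" by (rule sum_le_suminf[OF summableI]) auto
        finally show ?thesis .
      qed (simp add: overshoot_def)
    qed
    also have "\<dots> = (\<Sum>k. \<integral>\<^sup>+y. ?f k y \<partial>lborel)"
      by (rule nn_integral_suminf) measurable
    also have "\<dots> \<le> (\<Sum>k. ennreal (S * (1 / ?b) ^ k1 * (1 / ?b) ^ k))"
    proof (rule suminf_le[OF _ summableI summableI])
      fix k
      have kk: "k1 \<le> k + k1" by simp
      have T: "1 / v0 \<le> ?b ^ (k + k1)" "16 * ?b ^ 4 \<le> ?b ^ (k + k1)"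
        using bk[OF kk] by (auto simp: T_def)
      have Qc: "Q y \<le> C * Q (y + v) + h * C * norm v ^ m" if "norm v \<le> v0" for y v
        using comp[OF that, of "y - x"] by (simp add: Q_def algebra_simps)
      have "(\<integral>\<^sup>+y. ?f k y \<partial>lborel) \<le>
        ennreal ((3 * C * 2 ^ ?n * (I + G) + C * unit_ball_vol (real ?n) * 2 ^ ?n * h) * (1 / ?b) ^ (k + k1))"
        by (rule shell[OF _ _ Qm Q0 C h m Qc T(1) v0 tk[OF kk] T(2) I G])
      also have "\<dots> \<le> ennreal (S * (1 / ?b) ^ k1 * (1 / ?b) ^ k)"
      proof (rule ennreal_leI)
        have "3 * C * 2 ^ ?n * (I + G) + C * unit_ball_vol (real ?n) * 2 ^ ?n * h \<le> S"
        proof -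
          have "0 \<le> 3 * C * 2 ^ ?n * h" "0 \<le> C * unit_ball_vol (real ?n) * 2 ^ ?n * (I + G)"
            using C h I(2) G(2) by simp_all
          then show ?thesis by (simp add: S_def K_def algebra_simps)
        qed
        then show "(3 * C * 2 ^ ?n * (I + G) + C * unit_ball_vol (real ?n) * 2 ^ ?n * h) * (1 / ?b) ^ (k + k1)
            \<le> S * (1 / ?b) ^ k1 * (1 / ?b) ^ k"
          using b by (simp add: power_add mult.assoc mult.commute[of "(1 / ?b) ^ k1"] mult_right_mono)
      qed
      finally show "(\<integral>\<^sup>+y. ?f k y \<partial>lborel) \<le> ennreal (S * (1 / ?b) ^ k1 * (1 / ?b) ^ k)" .
    qed
    also have "\<dots> = ennreal (S * (1 / ?b) ^ k1 * (1 / (1 - 1 / ?b)))"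
      using b S by (intro suminf_ennreal_eq sums_mult geometric_sums) auto
    finally have "G \<le> S * (1 / ?b) ^ k1 * (1 / (1 - 1 / ?b))"
      using b S by (subst (asm) ennreal_le_iff) auto
    also have "\<dots> = (I + G + h) * (K / (1 - 1 / ?b) / ?b ^ k1)"
      by (simp add: S_def power_one_over field_simps)
    also have "\<dots> \<le> (I + G + h) * k0"
    proof (rule mult_left_mono)
      have "K / (k0 * (1 - 1 / ?b)) \<le> ?b ^ k1" using bk[of k1] by (simp add: T_def)
      moreover have "0 < k0 * (1 - 1 / ?b)" using k0 b by simp
      ultimately have "K \<le> ?b ^ k1 * (k0 * (1 - 1 / ?b))" by (simp add: pos_divide_le_eq)
      moreover have "0 < 1 - 1 / ?b" "0 < ?b ^ k1" using b by simp_all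
      ultimately show "K / (1 - 1 / ?b) / ?b ^ k1 \<le> k0"
        by (simp add: pos_divide_le_eq mult_ac)
    qed (use I(2) G(2) h in auto)
    finally have G1: "G \<le> (I + G + h) * k0" .
    \<comment> \<open>The term in h is absorbed into I, and the term in G into the left side, using
      \<open>k0 \<le> 1/2\<close>.\<close>
    have "h \<le> I / c1" using hI c1 by (simp add: pos_le_divide_eq)
    then have "G \<le> (I + I / c1) * k0 + G * k0"
      using G1 k0 mult_right_mono[of "I + G + h" "I + I / c1 + G" k0] by (simp add: algebra_simps)
    moreover have "G * k0 \<le> G * (1/2)" using k0 G(2) by (intro mult_left_mono) auto
    ultimately have "G \<le> 2 * ((I + I / c1) * k0)" by linarith
    also have "\<dots> = 2 * (I * (1 + 1 / c1)) * k0" by (simp add: algebra_simps)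
    also have "\<dots> \<le> 2 * (I * (1 + 1 / c1)) * (a1 / (4 * e1 * (1 + 1 / c1)))"
      using k0 I(2) c1 by (intro mult_left_mono) auto
    also have "\<dots> = I * a1 / (2 * e1)"
    proof -
      have "0 < 1 + 1 / c1" using c1 by (simp add: add_pos_pos)
      then show ?thesis using a1 by simp
    qed
    finally have "e1 * G \<le> I * a1 / 2" using a1 by (simp add: field_simps)
    moreover have "a1 / 2 * (h * c1) \<le> a1 / 2 * I" using hI a1 by (intro mult_left_mono) auto
    ultimately have "1 + e1 * G - a1 * I \<le> 1 - a1 / 2 * c1 * h" by (simp add: algebra_simps)
    moreover have "(\<integral>\<^sup>+y. ennreal (metro_fac (exp (U x - U y)) * Q y) \<partial>lborel) \<le> ennreal (1 + e1 * G - a1 * I)"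
      unfolding e1_def a1_def by (rule metro_fac_integral_le[OF Um Qm Q0 _ _ I[unfolded l_def] G[unfolded l_def]]) (simp_all add: Q1)
    ultimately show ?thesis unfolding Q_def by (meson ennreal_leI order_trans)
  qed
  then show ?thesis using that[of "a1 / 2 * c1" R] a1 c1 by simp
qed

section \<open>Gaussian and Student increments: from the assumptions to the drift\<close>

lemma gradient_eqI:
  assumes "GDERIV f x :> g"
  shows "gradient f x = g"
  unfolding gradient_def
proof (rule the_equality)
  show "GDERIV f x :> g" by (rule assms)
  fix h assume "GDERIV f x :> h"
  then have "(\<lambda>v. v \<bullet> h) = (\<lambda>v. v \<bullet> g)"
    using assms unfolding gderiv_def by (rule has_derivative_unique)
  then have "v \<bullet> h = v \<bullet> g" for v by (rule fun_cong)
  then show "h = g" by (metis vector_eq_ldot)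
qed

text \<open>The ratio of a Gaussian to its shift is unbounded, so a purely multiplicative comparison
  fails. It is bounded while \<open>|z| |v| \<le> 1\<close>; beyond that the density is at most of
  order \<open>exp (- 1 / (2 |v|^2))\<close>, which is smaller than any power of
  \<open>|v|\<close>.\<close>

lemma gaussian_shift_compare:
  assumes "0 < m"
  shows "\<exists>C\<ge>0. \<forall>z v. norm v \<le> 1 \<longrightarrow>
    std_gaussian_density z \<le> C * std_gaussian_density (z + v) + C * norm (v :: 'a::euclidean_space) ^ m"
proof -
  define K where "K = (2 * pi) powr (- real DIM('a) / 2)"
  have K: "0 \<le> K" by (simp add: K_def)
  have q: "std_gaussian_density z = K * exp (- (norm z)\<^sup>2 / 2)" for z :: 'a
    by (simp add: std_gaussian_density_def K_def)
  define A where "A = K * (2 * real m) ^ m"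
  define C where "C = exp (3/2) + A"
  have A: "0 \<le> A" using K by (simp add: A_def)
  have C: "0 \<le> C" "exp (3/2) \<le> C" "A \<le> C" using A by (auto simp: C_def)
  have "std_gaussian_density z \<le> C * std_gaussian_density (z + v) + C * norm v ^ m" if v: "norm v \<le> 1" for z v :: 'a
  proof (cases "norm z * norm v \<le> 1")
    case True
    have "(norm (z + v))\<^sup>2 \<le> (norm z + norm v)\<^sup>2" by (intro power_mono norm_triangle_ineq) auto
    also have "\<dots> = (norm z)\<^sup>2 + 2 * (norm z * norm v) + (norm v)\<^sup>2" by (simp add: power2_sum)
    also have "\<dots> \<le> (norm z)\<^sup>2 + 3" using True v power_mono[of "norm v" 1 2] by simp
    finally have "exp (- (norm z)\<^sup>2 / 2) \<le> exp (3/2 + - (norm (z + v))\<^sup>2 / 2)" by simp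
    then have "std_gaussian_density z \<le> exp (3/2) * std_gaussian_density (z + v)"
      unfolding q exp_add using K by (simp add: mult_left_mono mult.left_commute)
    also have "\<dots> \<le> C * std_gaussian_density (z + v)" using C K by (intro mult_right_mono) (auto simp: q)
    moreover have "0 \<le> C * norm v ^ m" using C by simp
    ultimately show ?thesis by linarith
  next
    case False
    define w where "w = norm v"
    have w: "0 < w" "w \<le> 1" using False v by (auto simp: w_def intro: ccontr)
    have "1 / w < norm z" using False w by (simp add: w_def pos_divide_less_eq)
    then have "(1 / w)\<^sup>2 \<le> (norm z)\<^sup>2" using w by (intro power_mono) auto
    then have "exp (- (norm z)\<^sup>2 / 2) \<le> exp (- (1 / (2 * w\<^sup>2)))" by (simp add: power_divide)
    also have "\<dots> = 1 / exp (1 / (2 * w\<^sup>2))" by (simp add: exp_minus inverse_eq_divide)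
    \<comment> \<open>The inequality \<open>(1 + s / m)^m \<le> exp s\<close> trades the exponential
      for a power, and \<open>w \<le> 1\<close> reduces \<open>1 / w^2\<close> to
      \<open>1 / w\<close>.\<close>
    also have "\<dots> \<le> 1 / (1 / (2 * real m * w)) ^ m"
    proof (rule divide_left_mono)
      have "(1 / (2 * real m * w)) ^ m \<le> (1 + 1 / (2 * w\<^sup>2) / real m) ^ m"
      proof (rule power_mono)
        have "w\<^sup>2 \<le> w" using w by (simp add: power2_eq_square mult_left_le_one_le)
        then have "1 / (2 * real m * w) \<le> 1 / (2 * real m * w\<^sup>2)"
          using w assms by (intro divide_left_mono mult_left_mono) auto
        also have "\<dots> \<le> 1 + 1 / (2 * w\<^sup>2) / real m" by (simp add: mult_ac)
        finally show "1 / (2 * real m * w) \<le> 1 + 1 / (2 * w\<^sup>2) / real m" .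
      qed (use w in simp)
      also have "\<dots> \<le> exp (1 / (2 * w\<^sup>2))"
        using assms w by (intro exp_ge_one_plus_x_over_n_power_n) (auto intro: order_trans[of _ 0])
      finally show "(1 / (2 * real m * w)) ^ m \<le> exp (1 / (2 * w\<^sup>2))" .
    qed (use w assms in auto)
    also have "\<dots> = (2 * real m) ^ m * w ^ m" by (simp add: power_divide power_mult_distrib)
    finally have "std_gaussian_density z \<le> A * w ^ m"
      unfolding q A_def using K by (simp add: mult_left_mono mult.assoc)
    also have "\<dots> \<le> C * w ^ m" using C w by (intro mult_right_mono) auto
    moreover have "0 \<le> C * std_gaussian_density (z + v)" using C K by (simp add: q)
    ultimately show ?thesis unfolding w_def by linarith
  qed
  then show ?thesis using C(1) by blast
qed

text \<open>With polynomial tails, a shift by at most 1 changes \<open>1 + |z|^2 / \<nu>\<close> by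
  at most the factor B. The form of the conclusion is the one shared with the Gaussian case.\<close>

lemma student_shift_compare:
  assumes \<nu>: "0 < \<nu>"
  shows "\<exists>C\<ge>0. \<forall>z v. norm v \<le> 1 \<longrightarrow>
    std_student_density \<nu> z \<le> C * std_student_density \<nu> (z + v) + C * norm (v :: 'a::euclidean_space) ^ m"
proof -
  define K where "K = Gamma ((\<nu> + real DIM('a)) / 2) / (Gamma (\<nu> / 2) * (\<nu> * pi) powr (real DIM('a) / 2))"
  define p where "p = (\<nu> + real DIM('a)) / 2"
  have K: "0 \<le> K" unfolding K_def using \<nu>
    by (intro divide_nonneg_nonneg mult_nonneg_nonneg less_imp_le[OF Gamma_real_pos]) (auto simp: add_pos_nonneg)
  have p: "0 < p" using \<nu> by (simp add: p_def add_pos_nonneg)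
  have q: "std_student_density \<nu> z = K * (1 + (norm z)\<^sup>2 / \<nu>) powr (- p)" for z :: 'a
    by (simp add: std_student_density_def K_def p_def minus_divide_left)
  define B where "B = 2 + 2 / \<nu>"
  define C where "C = B powr p"
  have B: "0 < B" using \<nu> by (simp add: B_def add_pos_pos)
  have "std_student_density \<nu> z \<le> C * std_student_density \<nu> (z + v) + C * norm v ^ m" if v: "norm v \<le> 1" for z v :: 'a
  proof -
    have "(norm (z + v))\<^sup>2 \<le> (norm z + norm v)\<^sup>2" by (intro power_mono norm_triangle_ineq) auto
    also have "\<dots> \<le> 2 * (norm z)\<^sup>2 + 2 * (norm v)\<^sup>2"
      using sum_squares_bound[of "norm z" "norm v"] by (simp add: power2_sum)
    also have "\<dots> \<le> 2 * (norm z)\<^sup>2 + 2" using v power_mono[of "norm v" 1 2] by simp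
    finally have "1 + (norm (z + v))\<^sup>2 / \<nu> \<le> 1 + (2 * (norm z)\<^sup>2 + 2) / \<nu>"
      using \<nu> by (intro add_left_mono divide_right_mono) auto
    also have "\<dots> \<le> B * (1 + (norm z)\<^sup>2 / \<nu>)"
    proof -
      have "0 \<le> 2 / \<nu> * ((norm z)\<^sup>2 / \<nu>)" using \<nu> by simp
      then show ?thesis unfolding B_def distrib_left distrib_right add_divide_distrib by simp
    qed
    finally have le: "1 + (norm (z + v))\<^sup>2 / \<nu> \<le> B * (1 + (norm z)\<^sup>2 / \<nu>)" .
    have pos: "0 < 1 + (norm y)\<^sup>2 / \<nu>" for y :: 'a using \<nu> by (simp add: add_pos_nonneg)
    have "(1 + (norm z)\<^sup>2 / \<nu>) powr (- p) = C * (B * (1 + (norm z)\<^sup>2 / \<nu>)) powr (- p)"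
      using B pos[of z] unfolding C_def powr_minus
      by (subst powr_mult) (auto simp: field_simps)
    also have "\<dots> \<le> C * (1 + (norm (z + v))\<^sup>2 / \<nu>) powr (- p)"
      using le pos[of "z + v"] p by (intro mult_left_mono powr_mono2') (auto simp: C_def)
    finally have "K * (1 + (norm z)\<^sup>2 / \<nu>) powr (- p) \<le> K * (C * (1 + (norm (z + v))\<^sup>2 / \<nu>) powr (- p))"
      using K by (rule mult_left_mono)
    then have "std_student_density \<nu> z \<le> C * std_student_density \<nu> (z + v)"
      unfolding q by (simp only: mult.left_commute)
    moreover have "0 \<le> C * norm v ^ m" by (simp add: C_def)
    ultimately show ?thesis by linarith
  qed
  moreover have "0 \<le> C" by (simp add: C_def)
  ultimately show ?thesis by blast
qed

lemma gaussian_lower: "\<exists>c>0. \<forall>z. norm (z :: 'a::euclidean_space) \<le> s \<longrightarrow> c \<le> std_gaussian_density z"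
proof (intro exI[of _ "(2 * pi) powr (- real DIM('a) / 2) * exp (- s\<^sup>2 / 2)"] conjI allI impI)
  fix z :: 'a assume "norm z \<le> s"
  then have "(norm z)\<^sup>2 \<le> s\<^sup>2" by (intro power_mono) auto
  then show "(2 * pi) powr (- real DIM('a) / 2) * exp (- s\<^sup>2 / 2) \<le> std_gaussian_density z"
    unfolding std_gaussian_density_def by (intro mult_left_mono) auto
qed simp

lemma student_lower:
  assumes \<nu>: "0 < \<nu>"
  shows "\<exists>c>0. \<forall>z. norm (z :: 'a::euclidean_space) \<le> s \<longrightarrow> c \<le> std_student_density \<nu> z"
proof -
  define K where "K = Gamma ((\<nu> + real DIM('a)) / 2) / (Gamma (\<nu> / 2) * (\<nu> * pi) powr (real DIM('a) / 2))"
  have K: "0 < K" unfolding K_def using \<nu>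
    by (intro divide_pos_pos mult_pos_pos Gamma_real_pos) (auto simp: add_pos_nonneg)
  have pos: "0 < 1 + t\<^sup>2 / \<nu>" for t using \<nu> by (simp add: add_pos_nonneg)
  have "K * (1 + s\<^sup>2 / \<nu>) powr (- (\<nu> + real DIM('a)) / 2) \<le> std_student_density \<nu> z" if "norm z \<le> s" for z :: 'a
  proof -
    have "(norm z)\<^sup>2 \<le> s\<^sup>2" using that by (intro power_mono) auto
    then have "1 + (norm z)\<^sup>2 / \<nu> \<le> 1 + s\<^sup>2 / \<nu>" using \<nu> by (intro add_left_mono divide_right_mono) auto
    then show ?thesis
      unfolding std_student_density_def K_def[symmetric]
      using K pos[of "norm z"] \<nu> by (intro mult_left_mono powr_mono2') auto
  qed
  moreover have "0 < K * (1 + s\<^sup>2 / \<nu>) powr (- (\<nu> + real DIM('a)) / 2)"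
    using K pos[of s] by (metis mult_pos_pos less_irrefl powr_gt_zero)
  ultimately show ?thesis by blast
qed

lemma exp_dominates_power:
  assumes "0 < (a :: real)"
  shows "\<exists>c>0. \<forall>t\<ge>0. c * (1 + t) ^ N \<le> exp (a * t)"
proof (cases "N = 0")
  case True
  then show ?thesis using assms by (intro exI[of _ 1]) auto
next
  case False
  define k where "k = min 1 (a / real N)"
  have k: "0 < k" "k \<le> 1" "k \<le> a / real N" using assms False by (auto simp: k_def)
  have "k ^ N * (1 + t) ^ N \<le> exp (a * t)" if t: "0 \<le> t" for t
  proof -
    have "k * t \<le> a / real N * t" using k t by (intro mult_right_mono) auto
    then have "k * (1 + t) \<le> 1 + a * t / real N" using k by (simp add: distrib_left)
    then have "(k * (1 + t)) ^ N \<le> (1 + a * t / real N) ^ N" using k t by (intro power_mono) auto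
    also have "\<dots> \<le> exp (a * t)"
      using assms t False by (intro exp_ge_one_plus_x_over_n_power_n) (auto intro: order_trans[of _ 0])
    finally show ?thesis by (simp add: power_mult_distrib)
  qed
  then show ?thesis using k by (intro exI[of _ "k ^ N"]) auto
qed

lemma superexponential_drift:
  fixes \<pi> q :: "real^'n \<Rightarrow> real"
  assumes e: "0 < \<epsilon>" and q: "prob_density q" and sup: "superexponential_conditions \<pi> q"
  shows "\<forall>x. 0 < \<pi> x" "continuous_on UNIV \<pi>"
    "\<exists>c>0. \<exists>R. \<forall>\<theta>\<in>Theta. \<forall>x. R \<le> norm x \<longrightarrow>
      (\<integral>\<^sup>+y. ennreal (metro_fac (\<pi> y / \<pi> x) * am_density q \<epsilon> \<theta> (y - x)) \<partial>lborel) \<le> ennreal (1 - c * am_height \<epsilon> \<theta>)"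
    "\<forall>N. \<exists>c>0. \<forall>x. c * (1 + norm x) ^ N \<le> lyap \<pi> x"
proof -
  have "\<forall>x\<in>{x}. 0 < \<pi> x" for x using sup unfolding superexponential_conditions_def by (metis compact_sing)
  then have pos: "0 < \<pi> x" for x by blast
  then show "\<forall>x. 0 < \<pi> x" by blast
  define g where "g = gradient \<pi>"
  have g: "GDERIV \<pi> x :> g x" for x using sup by (simp add: superexponential_conditions_def g_def)
  have "isCont \<pi> x" for x using g[of x] unfolding gderiv_def by (rule has_derivative_continuous)
  then show cont: "continuous_on UNIV \<pi>" by (simp add: continuous_at_imp_continuous_on)
  define U where "U x = - ln (\<pi> x)" for x
  define D where "D x = - (g x /\<^sub>R \<pi> x)" for x
  have dln: "GDERIV (\<lambda>y. ln (\<pi> y)) x :> g x /\<^sub>R \<pi> x" for x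
    using g[of x] pos[of x] unfolding gderiv_def
    by (auto intro!: derivative_eq_intros simp: divide_inverse)
  have dU: "GDERIV U x :> D x" for x
    using has_derivative_minus[OF dln[of x, unfolded gderiv_def]] by (simp add: gderiv_def U_def[abs_def] D_def)
  have gl: "gradient (\<lambda>y. ln (\<pi> y)) x = g x /\<^sub>R \<pi> x" for x by (rule gradient_eqI[OF dln])
  obtain \<rho> where \<rho>: "1 < \<rho>" and lim: "((\<lambda>R. SUP x\<in>{x. R \<le> norm x}.
      ereal ((x /\<^sub>R (norm x powr \<rho>)) \<bullet> gradient (\<lambda>y. ln (\<pi> y)) x)) \<longlongrightarrow> -\<infinity>) at_top"
    using sup unfolding superexponential_conditions_def by blast
  have "\<forall>\<^sub>F R in at_top. (SUP x\<in>{x. R \<le> norm x}.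
      ereal ((x /\<^sub>R (norm x powr \<rho>)) \<bullet> gradient (\<lambda>y. ln (\<pi> y)) x)) < ereal (- 1)"
    using lim unfolding tendsto_MInfty by blast
  then obtain Ra where Ra: "(SUP x\<in>{x. Ra \<le> norm x}.
      ereal ((x /\<^sub>R (norm x powr \<rho>)) \<bullet> gradient (\<lambda>y. ln (\<pi> y)) x)) < ereal (- 1)"
    by (auto simp: eventually_at_top_linorder)
  obtain Rb where Rb: "(SUP x\<in>{x. Rb \<le> norm x}.
      ereal ((x /\<^sub>R norm x) \<bullet> (gradient \<pi> x /\<^sub>R norm (gradient \<pi> x)))) < 0"
    using sup unfolding superexponential_conditions_def by blast
  obtain rb where rb: "(SUP x\<in>{x. Rb \<le> norm x}.
      ereal ((x /\<^sub>R norm x) \<bullet> (gradient \<pi> x /\<^sub>R norm (gradient \<pi> x)))) < ereal rb" "ereal rb < 0"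
    using ereal_dense2[OF Rb] by blast
  \<comment> \<open>\<open>rb\<close> lies strictly between the supremum and 0, so its negative is a
    quantitative cone constant; the cap at 1 meets the assumption on \<beta> in the lemmas about the
    potential.\<close>
  define R1 \<beta> where "R1 = max 1 (max Ra Rb)" and "\<beta> = min 1 (- rb)"
  have R1: "1 \<le> R1" "Ra \<le> R1" "Rb \<le> R1" by (auto simp: R1_def)
  have \<beta>: "0 < \<beta>" "\<beta> \<le> 1" "\<beta> \<le> - rb" using rb(2) by (auto simp: \<beta>_def)
  have radial: "norm x powr \<rho> \<le> x \<bullet> D x" if x: "R1 \<le> norm x" for x
  proof -
    have nx: "0 < norm x powr \<rho>" using x R1 by (metis less_le_trans norm_zero not_less powr_gt_zero zero_less_one order_less_irrefl)
    have "ereal ((x /\<^sub>R (norm x powr \<rho>)) \<bullet> gradient (\<lambda>y. ln (\<pi> y)) x) < ereal (- 1)"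
      using x R1 by (intro le_less_trans[OF SUP_upper Ra]) auto
    then have "(x /\<^sub>R (norm x powr \<rho>)) \<bullet> (g x /\<^sub>R \<pi> x) < - 1" by (simp add: gl)
    then have "(x \<bullet> (g x /\<^sub>R \<pi> x)) / (norm x powr \<rho>) < - 1" by (simp add: divide_inverse mult_ac)
    then have "x \<bullet> (g x /\<^sub>R \<pi> x) < - 1 * norm x powr \<rho>" using nx by (simp only: pos_divide_less_eq)
    then show ?thesis by (simp add: D_def)
  qed
  have cone: "\<beta> * norm x * norm (D x) \<le> x \<bullet> D x" if x: "R1 \<le> norm x" for x
  proof -
    have nx: "0 < norm x" using x R1 by linarith
    have "ereal ((x /\<^sub>R norm x) \<bullet> (gradient \<pi> x /\<^sub>R norm (gradient \<pi> x))) < ereal rb"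
      using x R1 by (intro le_less_trans[OF SUP_upper rb(1)]) auto
    then have lt: "(x /\<^sub>R norm x) \<bullet> (g x /\<^sub>R norm (g x)) < rb" by (simp add: g_def)
    \<comment> \<open>A vanishing gradient would make the left side of \<open>lt\<close> equal to 0,
      against \<open>rb < 0\<close>.\<close>
    have ng: "0 < norm (g x)" using lt rb(2) by (cases "g x = 0") auto
    have "(x \<bullet> g x) / (norm x * norm (g x)) < rb" using lt by (simp add: divide_inverse mult_ac)
    then have "x \<bullet> g x < rb * (norm x * norm (g x))" using nx ng by (simp only: pos_divide_less_eq mult_pos_pos)
    moreover have "\<beta> * (norm x * norm (g x)) \<le> - rb * (norm x * norm (g x))"
      using \<beta> by (intro mult_right_mono) auto
    ultimately have "\<beta> * (norm x * norm (g x)) \<le> - (x \<bullet> g x)" by simp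
    then have "\<beta> * (norm x * norm (g x)) / \<pi> x \<le> - (x \<bullet> g x) / \<pi> x"
      using pos[of x] by (intro divide_right_mono) auto
    then show ?thesis using pos[of x] by (simp add: D_def divide_inverse mult_ac)
  qed
  obtain a b' where gr: "0 < a" "\<And>x. a * norm x - b' \<le> U x"
    using potential_growth[OF dU \<rho> R1(1) \<beta>(1,2) radial cone] by blast
  show "\<forall>N. \<exists>c>0. \<forall>x. c * (1 + norm x) ^ N \<le> lyap \<pi> x"
  proof
    fix N
    obtain c where c: "0 < c" "\<And>t. 0 \<le> t \<Longrightarrow> c * (1 + t) ^ N \<le> exp (a / 2 * t)"
      using exp_dominates_power[of "a / 2" N] gr(1) by auto
    have "c * exp (- b' / 2) * (1 + norm x) ^ N \<le> lyap \<pi> x" for x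
    proof -
      have "c * (1 + norm x) ^ N * exp (- b' / 2) \<le> exp (a / 2 * norm x) * exp (- b' / 2)"
        using c(2)[of "norm x"] by (intro mult_right_mono) auto
      also have "\<dots> = exp ((a * norm x - b') / 2)" by (simp add: exp_add[symmetric] diff_divide_distrib)
      also have "\<dots> \<le> exp (U x / 2)" using gr(2)[of x] by simp
      also have "\<dots> = lyap \<pi> x"
      proof -
        have "sqrt (\<pi> x) = exp (- U x / 2)"
          by (rule real_sqrt_unique) (use pos[of x] in \<open>simp_all add: power2_eq_square U_def flip: exp_add\<close>)
        then show ?thesis by (simp add: lyap_def exp_minus inverse_eq_divide)
      qed
      finally show ?thesis by (simp add: mult_ac)
    qed
    then show "\<exists>c>0. \<forall>x. c * (1 + norm x) ^ N \<le> lyap \<pi> x"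
      using c(1) by (intro exI[of _ "c * exp (- b' / 2)"]) auto
  qed
  let ?n = "DIM(real^'n)" and ?s = "am_floor TYPE('n) \<epsilon>"
  have s: "0 < ?s" by (rule am_floor_pos[OF e])
  have "1 < shell_base \<rho>" unfolding shell_base_def using \<rho> by simp
  \<comment> \<open>The order of the comparison error is chosen large enough to beat the volume of
    the shells with one factor of the base to spare.\<close>
  then obtain m where m: "2 ^ ?n * shell_base \<rho> < shell_base \<rho> ^ m" using real_arch_pow by blast
  have m0: "0 < m"
  proof (rule ccontr)
    assume "\<not> 0 < m"
    moreover have "1 * 1 \<le> 2 ^ ?n * shell_base \<rho>"
      using \<open>1 < shell_base \<rho>\<close> by (intro mult_mono one_le_power) auto
    ultimately show False using m by simp
  qed
  have q0: "0 \<le> q z" for z using q by (simp add: prob_density_def)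
  have form: "q = std_gaussian_density \<or> (\<exists>\<nu>>0. q = std_student_density \<nu>)"
    using sup by (simp only: superexponential_conditions_def)
  have "\<exists>C\<ge>0. \<forall>z v. norm v \<le> 1 \<longrightarrow> q z \<le> C * q (z + v) + C * norm v ^ m"
    using form
  proof
    assume "q = std_gaussian_density"
    then show ?thesis using gaussian_shift_compare[OF m0] by simp
  next
    assume "\<exists>\<nu>>0. q = std_student_density \<nu>"
    then obtain \<nu> where "0 < \<nu>" "q = std_student_density \<nu>" by blast
    then show ?thesis using student_shift_compare by simp
  qed
  then obtain C where C: "0 \<le> C" "\<And>z v. norm v \<le> 1 \<Longrightarrow> q z \<le> C * q (z + v) + C * norm v ^ m"
    by blast
  have "\<exists>c>0. \<forall>z. norm z \<le> 2 / ?s \<longrightarrow> c \<le> q z"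
    using form
  proof
    assume "q = std_gaussian_density"
    then show ?thesis using gaussian_lower by simp
  next
    assume "\<exists>\<nu>>0. q = std_student_density \<nu>"
    then obtain \<nu> where "0 < \<nu>" "q = std_student_density \<nu>" by blast
    then show ?thesis using student_lower by simp
  qed
  then obtain c0 where c0: "0 < c0" "\<And>z. norm z \<le> 2 / ?s \<Longrightarrow> c0 \<le> q z" by blast
  \<comment> \<open>Whitening stretches a shift by at most \<open>1 / ?s\<close>, which costs the
    factor \<open>(1 / ?s) ^ m\<close> in the error term.\<close>
  define C' where "C' = C * (1 + (1 / ?s) ^ m)"
  have C': "0 \<le> C'" "C \<le> C'" "C * (1 / ?s) ^ m \<le> C'" using C(1) s by (auto simp: C'_def algebra_simps)
  show "\<exists>c>0. \<exists>R. \<forall>\<theta>\<in>Theta. \<forall>x. R \<le> norm x \<longrightarrow>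
      (\<integral>\<^sup>+y. ennreal (metro_fac (\<pi> y / \<pi> x) * am_density q \<epsilon> \<theta> (y - x)) \<partial>lborel) \<le> ennreal (1 - c * am_height \<epsilon> \<theta>)"
  proof (rule superexp_drift[OF dU \<rho> R1(1) \<beta>(1,2) radial cone c0(1) C'(1) s less_imp_le[OF m]])
  fix R c assume Rc: "0 < c"
    "\<And>x h r. R \<le> norm x \<Longrightarrow> prob_density r \<Longrightarrow> 0 \<le> h \<Longrightarrow>
      (\<And>z v. norm v \<le> ?s \<Longrightarrow> r z \<le> C' * r (z + v) + h * C' * norm v ^ m) \<Longrightarrow>
      (\<And>z. norm z \<le> 2 \<Longrightarrow> h * c0 \<le> r z) \<Longrightarrow>
      (\<integral>\<^sup>+y. ennreal (metro_fac (exp (U x - U y)) * r (y - x)) \<partial>lborel) \<le> ennreal (1 - c * h)"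
  have ratio: "exp (U x - U y) = \<pi> y / \<pi> x" for x y
    using pos[of x] pos[of y] by (simp add: U_def exp_diff exp_minus inverse_eq_divide)
  have "(\<integral>\<^sup>+y. ennreal (metro_fac (\<pi> y / \<pi> x) * am_density q \<epsilon> \<theta> (y - x)) \<partial>lborel) \<le> ennreal (1 - c * am_height \<epsilon> \<theta>)"
    if th: "\<theta> \<in> Theta" and x: "R \<le> norm x" for \<theta> x
    unfolding ratio[symmetric]
  proof (rule Rc(2)[OF x prob_density_am_density[OF e th q]])
    have h: "0 < am_height \<epsilon> \<theta>" by (rule am_height_sqrt(3)[OF e th])
    then show "0 \<le> am_height \<epsilon> \<theta>" by simp
    fix z :: "real^'n"
    have W: "norm (am_whiten \<epsilon> \<theta> z) \<le> norm z / ?s" for z by (rule norm_am_whiten_le[OF e th])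
    show "am_height \<epsilon> \<theta> * c0 \<le> am_density q \<epsilon> \<theta> z" if "norm z \<le> 2"
    proof -
      have "norm z / ?s \<le> 2 / ?s" using that s by (intro divide_right_mono) auto
      then show ?thesis unfolding am_density_eq using W[of z] h by (intro mult_left_mono c0(2)) auto
    qed
    fix v :: "real^'n" assume v: "norm v \<le> ?s"
    let ?w = "am_whiten \<epsilon> \<theta> v"
    have w: "norm ?w \<le> norm v / ?s" by (rule W)
    also have "\<dots> \<le> 1" using v s by simp
    finally have "q (am_whiten \<epsilon> \<theta> z) \<le> C * q (am_whiten \<epsilon> \<theta> z + ?w) + C * norm ?w ^ m" by (rule C(2))
    also have "\<dots> \<le> C' * q (am_whiten \<epsilon> \<theta> z + ?w) + C' * norm v ^ m"
    proof (rule add_mono)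
      show "C * q (am_whiten \<epsilon> \<theta> z + ?w) \<le> C' * q (am_whiten \<epsilon> \<theta> z + ?w)" using C' q0 by (intro mult_right_mono) auto
      have "C * norm ?w ^ m \<le> C * (norm v / ?s) ^ m" using w C(1) by (intro mult_left_mono power_mono) auto
      also have "\<dots> = C * (1 / ?s) ^ m * norm v ^ m" by (simp add: power_divide)
      also have "\<dots> \<le> C' * norm v ^ m" using C' by (intro mult_right_mono) auto
      finally show "C * norm ?w ^ m \<le> C' * norm v ^ m" .
    qed
    finally have "q (am_whiten \<epsilon> \<theta> z) \<le> C' * q (am_whiten \<epsilon> \<theta> (z + v)) + C' * norm v ^ m"
      by (simp add: am_whiten_add)
    then have "am_height \<epsilon> \<theta> * q (am_whiten \<epsilon> \<theta> z) \<le> am_height \<epsilon> \<theta> * (C' * q (am_whiten \<epsilon> \<theta> (z + v)) + C' * norm v ^ m)"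
      using h by (intro mult_left_mono) auto
    then show "am_density q \<epsilon> \<theta> z \<le> C' * am_density q \<epsilon> \<theta> (z + v) + am_height \<epsilon> \<theta> * C' * norm v ^ m"
      by (simp add: am_density_eq algebra_simps)
  qed
  then show "\<exists>c>0. \<exists>R. \<forall>\<theta>\<in>Theta. \<forall>x. R \<le> norm x \<longrightarrow>
      (\<integral>\<^sup>+y. ennreal (metro_fac (\<pi> y / \<pi> x) * am_density q \<epsilon> \<theta> (y - x)) \<partial>lborel) \<le> ennreal (1 - c * am_height \<epsilon> \<theta>)"
    using Rc(1) by blast
  qed
qed

section \<open>Targets on the real line\<close>

text \<open>Mean value theorem. Since \<open>p < 1\<close>, the lower bound for the derivative
  decreases along the half line, so its value at the right end t serves on the whole
  interval.\<close>

lemma potential_gain: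
  fixes v dv :: "real \<Rightarrow> real"
  assumes dv: "\<And>t. R0 \<le> t \<Longrightarrow> (v has_real_derivative dv t) (at t)"
    and le: "\<And>t. R0 \<le> t \<Longrightarrow> k * t powr (p - 1) \<le> dv t"
    and R0: "1 \<le> R0" and k: "0 \<le> k" and p: "p < 1" and st: "R0 \<le> s" "s \<le> t"
  shows "v s + k * (t - s) * t powr (p - 1) \<le> v t"
proof (cases "s = t")
  case False
  with st have "s < t" by simp
  from MVT2[OF this, of v dv] dv st(1) obtain z where z: "s < z" "z < t" "v t - v s = (t - s) * dv z"
    by auto
  have "t powr (p - 1) \<le> z powr (p - 1)" using z st R0 p by (intro powr_mono2') auto
  then have "k * t powr (p - 1) \<le> dv z" using le[of z] z st k by (meson less_imp_le mult_left_mono order_trans)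
  then have "(t - s) * (k * t powr (p - 1)) \<le> (t - s) * dv z" using st by (intro mult_left_mono) auto
  then show ?thesis using z(3) by (simp add: algebra_simps)
qed simp

text \<open>A dilation of a point at distance s gains an amount of order \<open>s^p\<close>. The
  factor \<open>z \<le> 2\<close> costs at most \<open>2^(1-p) \<le> 2\<close> in the slope, whence
  \<open>k / 2\<close>.\<close>

lemma potential_gain_scale:
  fixes v dv :: "real \<Rightarrow> real"
  assumes dv: "\<And>t. R0 \<le> t \<Longrightarrow> (v has_real_derivative dv t) (at t)"
    and le: "\<And>t. R0 \<le> t \<Longrightarrow> k * t powr (p - 1) \<le> dv t"
    and R0: "1 \<le> R0" and k: "0 \<le> k" and p: "0 < p" "p < 1" and s: "R0 \<le> s" and z: "1 \<le> z" "z \<le> 2"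
  shows "v s + k / 2 * (z - 1) * s powr p \<le> v (z * s)"
proof -
  have s0: "0 < s" using s R0 by linarith
  have "v s + k * (z * s - s) * (z * s) powr (p - 1) \<le> v (z * s)"
    by (rule potential_gain[OF dv le R0 k p(2) s]) (use z s0 in auto)
  moreover have "k / 2 * (z - 1) * s powr p \<le> k * (z * s - s) * (z * s) powr (p - 1)"
  proof -
    have "(2 * s) powr (p - 1) \<le> (z * s) powr (p - 1)" using z s0 p by (intro powr_mono2') auto
    moreover have "(2 :: real) powr (- 1) \<le> 2 powr (p - 1)" using p by (intro powr_mono) auto
    then have "1/2 * s powr (p - 1) \<le> (2 * s) powr (p - 1)"
      using s0 by (simp add: powr_mult powr_minus_divide mult_right_mono)
    ultimately have "1/2 * s powr (p - 1) \<le> (z * s) powr (p - 1)" by linarith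
    then have h: "k * (z * s - s) * (1/2 * s powr (p - 1)) \<le> k * (z * s - s) * (z * s) powr (p - 1)"
      using k z s0 by (intro mult_left_mono) auto
    have e1: "k * (z * s - s) * (1/2 * s powr (p - 1)) = k / 2 * (z - 1) * (s * s powr (p - 1))"
      by (simp add: algebra_simps)
    have e2: "s * s powr (p - 1) = s powr p" using s0 by (simp add: powr_mult_base)
    show ?thesis using h unfolding e1 e2 .
  qed
  ultimately show ?thesis by linarith
qed

text \<open>The part of the half line below the level outweighs the part above.\<close>

lemma half_line_drift:
  fixes u dv :: "real \<Rightarrow> real"
  assumes um: "u \<in> borel_measurable borel"
    and dv: "\<And>t. R0 \<le> t \<Longrightarrow> ((\<lambda>t. u (- t)) has_real_derivative dv t) (at t)"
    and le: "\<And>t. R0 \<le> t \<Longrightarrow> k * t powr (p - 1) \<le> dv t"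
    and R0: "1 \<le> R0" and k: "0 < k" and p: "0 < p" "p < 1" and C: "0 < C"
  shows "\<exists>R2\<ge>1. \<forall>x Q. (\<forall>y. - R2 \<le> y \<longrightarrow> y \<le> 0 \<longrightarrow> u y \<le> u x - 1) \<longrightarrow> Q \<in> borel_measurable borel \<longrightarrow>
      (\<forall>y. 0 \<le> Q y) \<longrightarrow> (\<integral>\<^sup>+y. ennreal (Q y) \<partial>lborel) = 1 \<longrightarrow> (\<forall>y y'. y \<le> y' \<longrightarrow> y' \<le> 0 \<longrightarrow> Q y \<le> C * Q y') \<longrightarrow>
      (\<integral>\<^sup>+y. ennreal (metro_fac (exp (u x - u y)) * (indicator {..0} y * Q y)) \<partial>lborel) \<le>
      (\<integral>\<^sup>+y. ennreal (indicator {..0} y * Q y) \<partial>lborel)"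
proof -
  define a1 e1 :: real where "a1 = 1 - exp (- (1/2))" and "e1 = exp (1/2)"
  have a1: "0 < a1" "0 < e1" by (simp_all add: a1_def e1_def)
  define k0 where "k0 = min (1/2) (a1 / (2 * e1))"
  have k0: "0 < k0" "k0 \<le> 1/2" "k0 \<le> a1 / (2 * e1)" using a1 by (auto simp: k0_def)
  \<comment> \<open>The dilation bound reads \<open>J G \<le> 6 C (I + G)\<close>, where 6 is 3
    times the Jacobian bound 2 on the line; this J turns it into
    \<open>G \<le> k0 (I + G)\<close>.\<close>
  obtain J :: nat where J: "6 * C / k0 < real J" using reals_Archimedean2 by blast
  have J0: "0 < real J" using J C k0 by (meson divide_pos_pos less_trans mult_pos_pos zero_less_numeral)
  \<comment> \<open>Beyond \<open>R2 / 2\<close> each dilation by \<tau> = 1 / J gains at least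
    \<open>k / 2 * (\<tau> / 2) * (8 J / k) = 2\<close> units. The leading factor 2 allows for
    points that have been contracted by up to 2.\<close>
  define R2 where "R2 = 2 * max R0 ((8 * real J / k) powr (1 / p))"
  have R2: "R0 \<le> R2 / 2" "(8 * real J / k) powr (1 / p) \<le> R2 / 2" by (auto simp: R2_def)
  have main: "(\<integral>\<^sup>+y. ennreal (metro_fac (exp (u x - u y)) * (indicator {..0} y * Q y)) \<partial>lborel) \<le>
      (\<integral>\<^sup>+y. ennreal (indicator {..0} y * Q y) \<partial>lborel)"
    if low: "\<And>y. - R2 \<le> y \<Longrightarrow> y \<le> 0 \<Longrightarrow> u y \<le> u x - 1" and Qm: "Q \<in> borel_measurable borel"
      and Q0: "\<And>y. 0 \<le> Q y" and Q1: "(\<integral>\<^sup>+y. ennreal (Q y) \<partial>lborel) = 1"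
      and mono: "\<And>y y'. y \<le> y' \<Longrightarrow> y' \<le> 0 \<Longrightarrow> Q y \<le> C * Q y'" for x and Q :: "real \<Rightarrow> real"
  proof -
    note [measurable] = um Qm
    \<comment> \<open>Contraction towards 0 does not leave the half line, so the comparison
      \<open>mono\<close> survives the restriction of Q. The restricted density has total mass
      \<open>mq\<close>, not 1.\<close>
    define P where "P y = indicator {..0} y * Q y" for y
    have Pm[measurable]: "P \<in> borel_measurable borel" unfolding P_def[abs_def] by measurable
    have P0: "0 \<le> P y" for y using Q0 by (simp add: P_def)
    have PQ: "P y \<le> Q y" for y using Q0 by (simp add: P_def indicator_def)
    have le1: "(\<integral>\<^sup>+y. ennreal (g y * P y) \<partial>lborel) \<le> 1" if "\<And>y. 0 \<le> g y" "\<And>y. g y \<le> 1" for g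
    proof -
      have "(\<integral>\<^sup>+y. ennreal (g y * P y) \<partial>lborel) \<le> (\<integral>\<^sup>+y. ennreal (g y * Q y) \<partial>lborel)"
        by (intro nn_integral_mono ennreal_leI mult_left_mono PQ that)
      also have "\<dots> \<le> 1" by (rule nn_integral_bounded_density[OF that Q0 Q1])
      finally show ?thesis .
    qed
    define l where "l = u x - 1"
    obtain mq where mq: "(\<integral>\<^sup>+y. ennreal (P y) \<partial>lborel) = ennreal mq" "0 \<le> mq"
      using le1[of "\<lambda>_. 1"] by (auto elim: ennreal_le_1E)
    obtain I where I: "(\<integral>\<^sup>+y. ennreal (of_bool (u y \<le> l) * P y) \<partial>lborel) = ennreal I" "0 \<le> I"
      by (rule ennreal_le_1E[OF le1[of "\<lambda>y. of_bool (u y \<le> l)"]]) auto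
    obtain G where G: "(\<integral>\<^sup>+y. ennreal (overshoot u l y * P y) \<partial>lborel) = ennreal G" "0 \<le> G"
      by (rule ennreal_le_1E[OF le1[of "overshoot u l"]]) (auto simp: overshoot_bounds)
    define \<tau> where "\<tau> = 1 / real J"
    have \<tau>: "0 < \<tau>" "real J * \<tau> \<le> 1" using J0 by (auto simp: \<tau>_def)
    \<comment> \<open>The additive error is 0 here, and its product with the infinite length of the
      half line is 0 in \<open>ennreal\<close>; so no decomposition into shells is required.\<close>
    have "of_nat J * (\<integral>\<^sup>+y. indicator {..< - R2} y * ennreal (overshoot u l y * P y) \<partial>lborel) \<le>
      ennreal (3 * C * 2 ^ DIM(real)) * ((\<integral>\<^sup>+y. ennreal (of_bool (u y \<le> l) * P y) \<partial>lborel) + (\<integral>\<^sup>+y. ennreal (overshoot u l y * P y) \<partial>lborel))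
      + of_nat J * (ennreal 0 * emeasure lborel {..< - R2})"
    proof (rule overshoot_dilation_bound[OF um Pm _ P0 \<tau> less_imp_le[OF C]])
      fix y j assume y: "y \<in> {..< - R2}" and j: "1 \<le> j" "j \<le> J"
      define s where "s = 1 + real j * \<tau>"
      have "real j * \<tau> \<le> real J * \<tau>" using j \<tau> by (intro mult_right_mono) auto
      then have "s \<le> 2" using \<tau> unfolding s_def by linarith
      then have s: "1 \<le> s" "s \<le> 2" using \<tau> by (auto simp: s_def)
      have y0: "y < 0" using y R2 R0 by simp
      have ys: "y /\<^sub>R s = y / s" by (simp add: divide_inverse)
      have y1: "y \<le> y / s" "y / s \<le> 0" using y0 s by (auto simp: le_divide_eq divide_le_0_iff mult_le_cancel_left1)
      show "P y \<le> C * P (y /\<^sub>R (1 + real j * \<tau>)) + 0"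
        using mono[OF y1] y1 y0 unfolding s_def[symmetric] ys by (simp add: P_def)
      fix i q assume i: "i < J" and q: "q = y /\<^sub>R (1 + real j * \<tau>)"
      define s' where "s' = 1 + real i * \<tau>"
      have "real i * \<tau> \<le> real J * \<tau>" using i \<tau> by (intro mult_right_mono) auto
      then have "s' \<le> 2" using \<tau> unfolding s'_def by linarith
      then have s': "1 \<le> s'" "s' \<le> 2" using \<tau> by (auto simp: s'_def)
      define t where "t = - q"
      have q': "q = y / s" unfolding q s_def[symmetric] ys ..
      have t: "R2 / 2 \<le> t"
      proof -
        have "- y / 2 \<le> - y / s" using s y0 by (intro divide_left_mono) auto
        then show ?thesis using y by (simp add: t_def q')
      qed
      have t0: "0 < t" using t R2 R0 by linarith
      have st: "R2 / 2 \<le> s' * t" using t mult_right_mono[OF s'(1) less_imp_le[OF t0]] by linarith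
      define z where "z = (s' + \<tau>) / s'"
      have "z = 1 + \<tau> / s'" using s' by (simp add: z_def add_divide_distrib)
      moreover have "\<tau> / 2 \<le> \<tau> / s'" using s' \<tau> by (intro divide_left_mono) auto
      moreover have "\<tau> / s' \<le> \<tau> / 1" using s' \<tau> by (intro divide_left_mono) auto
      moreover have "\<tau> \<le> 1" using J0 by (simp add: \<tau>_def)
      ultimately have z: "1 \<le> z" "z \<le> 2" "\<tau> / 2 \<le> z - 1" using \<tau> by linarith+
      have "u (- (s' * t)) + k / 2 * (z - 1) * (s' * t) powr p \<le> u (- (z * (s' * t)))"
        using potential_gain_scale[of R0 "\<lambda>t. u (- t)" dv k p "s' * t" z, OF dv le R0 less_imp_le[OF k] p _ z(1,2)]
          st R2 by linarith
      moreover have "1 \<le> k / 2 * (z - 1) * (s' * t) powr p"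
      proof -
        have "8 * real J / k = ((8 * real J / k) powr (1 / p)) powr p" using p k J0 by (simp add: powr_powr)
        also have "\<dots> \<le> (s' * t) powr p" using R2 st p by (intro powr_mono2) auto
        finally have "8 * real J / k \<le> (s' * t) powr p" .
        then have "k / 2 * (\<tau> / 2) * (8 * real J / k) \<le> k / 2 * (z - 1) * (s' * t) powr p"
          using z(3) k \<tau> J0 by (intro mult_mono) auto
        moreover have "k / 2 * (\<tau> / 2) * (8 * real J / k) = 2" using k J0 by (simp add: \<tau>_def)
        ultimately show ?thesis by linarith
      qed
      moreover have "- (z * (s' * t)) = (1 + real (Suc i) * \<tau>) * q"
      proof -
        have "z * s' = s' + \<tau>" using s' by (simp add: z_def)
        then have "z * s' = 1 + real (Suc i) * \<tau>" by (simp add: s'_def algebra_simps)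
        then have "(1 + real (Suc i) * \<tau>) * q = z * s' * q" by simp
        moreover have "- (z * (s' * t)) = z * s' * q" by (simp add: t_def)
        ultimately show ?thesis by metis
      qed
      moreover have "- (s' * t) = (1 + real i * \<tau>) * q" by (simp add: t_def s'_def)
      ultimately show "u ((1 + real i * \<tau>) *\<^sub>R q) + 1 \<le> u ((1 + real (Suc i) * \<tau>) *\<^sub>R q)" by simp
    qed auto
    also have "\<dots> = ennreal (6 * C * (I + G))"
      unfolding I G using C I(2) G(2) by (simp add: ennreal_mult[symmetric] ennreal_plus[symmetric] del: ennreal_plus)
    also have "(\<integral>\<^sup>+y. indicator {..< - R2} y * ennreal (overshoot u l y * P y) \<partial>lborel) = ennreal G"
      unfolding G(1)[symmetric]
    proof (rule nn_integral_cong)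
      fix y show "indicator {..< - R2} y * ennreal (overshoot u l y * P y) = ennreal (overshoot u l y * P y)"
        using low[of y] by (cases "y < - R2"; cases "y \<le> 0") (auto simp: overshoot_def l_def P_def)
    qed
    finally have "ennreal (real J * G) \<le> ennreal (6 * C * (I + G))"
      using G(2) by (simp add: ennreal_of_nat_eq_real_of_nat ennreal_mult)
    then have "real J * G \<le> 6 * C * (I + G)" using C I(2) G(2) by (simp add: ennreal_le_iff)
    moreover have "6 * C \<le> real J * k0" using J k0 by (simp add: pos_divide_less_eq less_imp_le)
    then have "6 * C * (I + G) \<le> real J * k0 * (I + G)" using I(2) G(2) by (intro mult_right_mono) auto
    ultimately have "real J * G \<le> real J * (k0 * (I + G))" by (simp add: mult.assoc)
    then have "G \<le> k0 * (I + G)" using J0 by (simp add: mult_le_cancel_left)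
    moreover have "k0 * G \<le> 1/2 * G" using k0 G(2) by (intro mult_right_mono) auto
    ultimately have "G \<le> 2 * (k0 * I)" by (simp add: distrib_left)
    also have "\<dots> \<le> 2 * (a1 / (2 * e1) * I)" using k0 I(2) by (intro mult_left_mono mult_right_mono) auto
    also have "\<dots> = a1 * I / e1" by simp
    finally have "e1 * G \<le> a1 * I" using a1 by (simp add: pos_le_divide_eq mult.commute)
    then have "mq + e1 * G - a1 * I \<le> mq" by simp
    moreover have "(\<integral>\<^sup>+y. ennreal (metro_fac (exp (u x - u y)) * P y) \<partial>lborel) \<le> ennreal (mq + e1 * G - a1 * I)"
      unfolding e1_def a1_def by (rule metro_fac_integral_le[OF um Pm P0 mq I[unfolded l_def] G[unfolded l_def]])
    ultimately have "(\<integral>\<^sup>+y. ennreal (metro_fac (exp (u x - u y)) * P y) \<partial>lborel) \<le> ennreal mq"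
      using order_trans ennreal_leI by blast
    then show ?thesis unfolding mq(1)[symmetric] by (simp add: P_def)
  qed
  have "1 \<le> R2" using R2 R0 by linarith
  then show ?thesis by (intro exI[of _ R2] conjI allI impI main) blast+
qed

section \<open>Reflected pairs of proposals on the line\<close>

lemma nn_integral_symmetrize:
  fixes f :: "real \<Rightarrow> ennreal"
  assumes [measurable]: "f \<in> borel_measurable borel"
  shows "(\<integral>\<^sup>+z. f z \<partial>lborel) = (\<integral>\<^sup>+z. indicator {0<..} z * (f z + f (- z)) \<partial>lborel)"
proof -
  have "(\<integral>\<^sup>+z. f z \<partial>lborel) = (\<integral>\<^sup>+z. indicator {0<..} z * f z + indicator {..<0} z * f z \<partial>lborel)"
  proof (rule nn_integral_cong_AE)
    show "AE z in lborel. f z = indicator {0<..} z * f z + indicator {..<0} z * f z"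
      using AE_lborel_singleton[of "0::real"]
    proof eventually_elim
      case (elim z)
      then show ?case by (cases "0 < z") auto
    qed
  qed
  also have "\<dots> = (\<integral>\<^sup>+z. indicator {0<..} z * f z \<partial>lborel) + (\<integral>\<^sup>+z. indicator {..<0} z * f z \<partial>lborel)"
    by (rule nn_integral_add) measurable
  also have "(\<integral>\<^sup>+z. indicator {..<0} z * f z \<partial>lborel) = (\<integral>\<^sup>+z. indicator {..<0} (0 - z) * f (0 - z) \<partial>lborel)"
    by (rule nn_integral_reflect[symmetric]) measurable
  also have "\<dots> = (\<integral>\<^sup>+z. indicator {0<..} z * f (- z) \<partial>lborel)"
    by (intro nn_integral_cong) (auto simp: indicator_def)
  also have "(\<integral>\<^sup>+z. indicator {0<..} z * f z \<partial>lborel) + \<dots> = (\<integral>\<^sup>+z. indicator {0<..} z * (f z + f (- z)) \<partial>lborel)"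
    by (subst nn_integral_add[symmetric]) (auto simp: distrib_left)
  finally show ?thesis .
qed

lemma exp_neg_lipschitz: "0 \<le> b \<Longrightarrow> exp (- b) \<le> exp (- a) + \<bar>a - b\<bar>" for a b :: real
proof (cases "b \<le> a")
  case True
  assume b: "0 \<le> b"
  have "1 - (a - b) \<le> exp (- (a - b))" using exp_ge_add_one_self[of "- (a - b)"] by linarith
  then have "exp (- b) * (1 - (a - b)) \<le> exp (- b) * exp (- (a - b))" by (intro mult_left_mono) auto
  moreover have "exp (- b) * (a - b) \<le> 1 * (a - b)" using True b by (intro mult_right_mono) auto
  ultimately show ?thesis using True by (simp add: algebra_simps flip: exp_add)
next
  case False
  then have "exp (- b) \<le> exp (- a)" by simp
  then show ?thesis by (simp add: add_increasing2)
qed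

text \<open>Reflected pairs \<open>x \<plusminus> z\<close> close to \<open>x\<close>: the first-order terms cancel.\<close>

lemma pair_drift_near:
  fixes s sp sm :: real
  assumes s: "0 \<le> s" "s \<le> 8" and sp: "\<bar>sp - s\<bar> \<le> s\<^sup>2 / 1000" and sm: "\<bar>sm - s\<bar> \<le> s\<^sup>2 / 1000"
  shows "metro_fac (exp (- sp)) + metro_fac (exp sm) + s\<^sup>2 / 200 \<le> 2"
proof -
  have "s\<^sup>2 \<le> 8 * s" using s by (simp add: power2_eq_square mult_right_mono)
  then have nn: "0 \<le> sp" "0 \<le> sm" using s sp sm by linarith+
  have sq: "sqrt (exp t) = exp (t / 2)" for t :: real
    by (rule real_sqrt_unique) (simp_all add: power2_eq_square flip: exp_add)
  have "metro_fac (exp (- sp)) = 1 - exp (- sp) + exp (- (sp / 2))"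
    using nn by (subst metro_fac_le_1) (auto simp: sq)
  moreover have "metro_fac (exp sm) = exp (- (sm / 2))"
    using nn by (subst metro_fac_ge_1) (auto simp: sq exp_minus inverse_eq_divide)
  moreover have "exp (- s) \<le> exp (- sp) + \<bar>sp - s\<bar>" by (rule exp_neg_lipschitz[OF s(1)])
  moreover have "exp (- (sp / 2)) \<le> exp (- (s / 2)) + \<bar>s / 2 - sp / 2\<bar>" using nn by (intro exp_neg_lipschitz) simp
  moreover have "exp (- (sm / 2)) \<le> exp (- (s / 2)) + \<bar>s / 2 - sm / 2\<bar>" using nn by (intro exp_neg_lipschitz) simp
  moreover have "\<bar>s / 2 - sp / 2\<bar> \<le> s\<^sup>2 / 1000" "\<bar>s / 2 - sm / 2\<bar> \<le> s\<^sup>2 / 1000"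
    using sp sm by linarith+
  \<comment> \<open>For an exactly linear potential the two factors add up to
    \<open>2 - (1 - exp (- s / 2))^2\<close>. The square is at least \<open>(s / 10)^2\<close>,
    since \<open>1 + s / 2 \<le> 5\<close>; the nonlinearity costs at most
    \<open>3 s^2 / 1000\<close>, so more than \<open>s^2 / 200\<close> remains.\<close>
  moreover have "s\<^sup>2 / 100 \<le> 1 - 2 * exp (- (s / 2)) + exp (- s)"
  proof -
    have "1 + s / 2 \<le> exp (s / 2)" by (rule exp_ge_add_one_self)
    then have "exp (- (s / 2)) \<le> 1 / (1 + s / 2)"
      using s by (simp add: exp_minus inverse_eq_divide frac_le)
    moreover have "s / 10 \<le> 1 - 1 / (1 + s / 2)"
    proof -
      have "1 - 1 / (1 + s / 2) = (s / 2) / (1 + s / 2)" using s by (simp add: field_simps)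
      moreover have "(s / 2) / 5 \<le> (s / 2) / (1 + s / 2)" using s by (intro divide_left_mono) auto
      ultimately show ?thesis by simp
    qed
    ultimately have "s / 10 \<le> 1 - exp (- (s / 2))" by linarith
    then have "(s / 10)\<^sup>2 \<le> (1 - exp (- (s / 2)))\<^sup>2" using s by (intro power_mono) auto
    also have "\<dots> = 1 - 2 * exp (- (s / 2)) + exp (- (s / 2)) * exp (- (s / 2))"
      by (simp add: power2_eq_square algebra_simps)
    also have "exp (- (s / 2)) * exp (- (s / 2)) = exp (- s)" by (simp flip: exp_add)
    finally show ?thesis by (simp add: power_divide)
  qed
  ultimately show ?thesis using sp by linarith
qed

text \<open>A change of 4 makes both terms \<open>exp (- sp / 2)\<close> and
  \<open>exp (- sm / 2)\<close> at most 1/4, and the upward proposal contributes at most 1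
  besides.\<close>

lemma pair_drift_far:
  fixes sp sm :: real
  assumes "4 \<le> sp" "4 \<le> sm"
  shows "metro_fac (exp (- sp)) + metro_fac (exp sm) + 1 / 2 \<le> 2"
proof -
  have sq: "sqrt (exp t) = exp (t / 2)" for t :: real
    by (rule real_sqrt_unique) (simp_all add: power2_eq_square flip: exp_add)
  have q: "exp (- (t / 2)) \<le> 1 / 4" if "4 \<le> t" for t :: real
  proof -
    have "(1 + 1) * (1 + 1) \<le> exp 1 * exp (1::real)"
      using exp_ge_add_one_self[of "1::real"] by (intro mult_mono) auto
    then have "4 \<le> exp (2::real)" by (simp flip: exp_add)
    also have "exp (2::real) \<le> exp (t / 2)" using that by simp
    finally show ?thesis by (simp add: exp_minus inverse_eq_divide frac_le)
  qed
  have "metro_fac (exp (- sp)) \<le> 1 + exp (- sp / 2)"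
    using metro_fac_bounds(3)[of "exp (- sp)"] unfolding sq by simp
  moreover have "metro_fac (exp sm) = exp (- (sm / 2))"
    using assms by (subst metro_fac_ge_1) (auto simp: sq exp_minus inverse_eq_divide)
  ultimately show ?thesis using q[OF assms(1)] q[OF assms(2)] by simp
qed

lemma exp_powr_dominates_power:
  fixes a p :: real
  assumes a: "0 < a" and p: "0 < p"
  shows "\<exists>c>0. \<forall>t\<ge>0. c * (1 + t) ^ N \<le> exp (a * t powr p)"
proof -
  obtain M :: nat where M: "real N / p \<le> real M" using real_arch_simple by blast
  then have M: "real N \<le> p * real M" using p by (simp add: pos_divide_le_eq mult.commute)
  obtain c where c: "0 < c" "\<And>t. 0 \<le> t \<Longrightarrow> c * (1 + t) ^ M \<le> exp (a * t)"
    using exp_dominates_power[OF a, of M] by auto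
  have "c / 2 ^ N * (1 + t) ^ N \<le> exp (a * t powr p)" if t: "0 \<le> t" for t
  proof -
    have "(1 + t) ^ N \<le> 2 ^ N * (1 + t powr p) ^ M"
    proof (cases "t \<le> 1")
      case True
      have "(1 + t) ^ N \<le> 2 ^ N * 1" using True t by (simp add: power_mono)
      also have "\<dots> \<le> 2 ^ N * (1 + t powr p) ^ M" by (intro mult_left_mono one_le_power) auto
      finally show ?thesis .
    next
      case False
      have "(1 + t) ^ N \<le> (2 * t) ^ N" using False by (intro power_mono) auto
      also have "\<dots> = 2 ^ N * t powr real N" using False by (simp add: power_mult_distrib powr_realpow)
      also have "\<dots> \<le> 2 ^ N * t powr (p * real M)" using False M by (intro mult_left_mono powr_mono) auto
      also have "t powr (p * real M) = (t powr p) ^ M" using False by (simp add: powr_powr[symmetric] powr_realpow)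
      also have "2 ^ N * (t powr p) ^ M \<le> 2 ^ N * (1 + t powr p) ^ M" by (intro mult_left_mono power_mono) auto
      finally show ?thesis by simp
    qed
    then have "c / 2 ^ N * (1 + t) ^ N \<le> c / 2 ^ N * (2 ^ N * (1 + t powr p) ^ M)"
      using c(1) by (intro mult_left_mono) auto
    also have "\<dots> = c * (1 + t powr p) ^ M" by simp
    also have "\<dots> \<le> exp (a * t powr p)" by (rule c(2)) simp
    finally show ?thesis .
  qed
  then show ?thesis using c(1) by (intro exI[of _ "c / 2 ^ N"]) auto
qed

lemma ennreal_le_diff:
  assumes "X + ennreal c \<le> 1" "0 \<le> c"
  shows "X \<le> ennreal (1 - c)"
proof -
  have "X \<le> 1" using assms(1) by (meson add_increasing2 order_trans zero_le order_refl le_add_same_cancel1)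
  then obtain r where r: "X = ennreal r" "0 \<le> r" by (rule ennreal_le_1E)
  have "ennreal (r + c) \<le> ennreal 1" using assms r by (simp add: ennreal_plus)
  then have "r + c \<le> 1" by (subst (asm) ennreal_le_iff) auto
  then show ?thesis unfolding r(1) by (intro ennreal_leI) linarith
qed

context
  fixes u d dd q :: "real \<Rightarrow> real" and R0 k p ql qu \<sigma>0 :: real
  assumes du: "\<And>x. (u has_real_derivative d x) (at x)" and ddu: "\<And>x. (d has_real_derivative dd x) (at x)"
    and R0: "1 \<le> R0" and k: "0 < k" and p: "0 < p" "p < 1"
    and right: "\<And>t. R0 \<le> t \<Longrightarrow> k * t powr (p - 1) \<le> d t"
    and left: "\<And>t. R0 \<le> t \<Longrightarrow> k * t powr (p - 1) \<le> - d (- t)"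
    and curv: "\<And>x t. R0 \<le> x \<Longrightarrow> \<bar>t\<bar> \<le> 8 / d x \<Longrightarrow> \<bar>dd (x + t)\<bar> \<le> (d x)\<^sup>2 / 1000"
    and q: "prob_density q" and qsym: "\<And>z. q (- z) = q z" and ql: "0 < ql"
    and qb: "\<And>z. \<bar>z\<bar> \<le> 1 \<Longrightarrow> ql \<le> q z \<and> q z \<le> qu" and qout: "\<And>z. 1 < \<bar>z\<bar> \<Longrightarrow> q z = 0"
    and \<sigma>0: "0 < \<sigma>0"
begin

private lemma d_pos: "R0 \<le> x \<Longrightarrow> 0 < d x"
  using right[of x] k R0 by (smt (verit) mult_pos_pos powr_gt_zero)

private lemma mono_right: "R0 \<le> s \<Longrightarrow> s \<le> t \<Longrightarrow> u s \<le> u t"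
  using potential_gain[of R0 u d k p s t, OF du right R0 less_imp_le[OF k] p(2)] k
  by (smt (verit) mult_nonneg_nonneg powr_ge_zero)

text \<open>The curvature is small compared with the squared slope, so on a window over which u
  changes by a bounded amount it is nearly linear, with an error proportional to the square of that
  change.\<close>

private lemma taylor:
  assumes x: "R0 \<le> x" and z: "\<bar>z\<bar> \<le> 8 / d x"
  shows "\<bar>u (x + z) - u x - d x * z\<bar> \<le> (d x * z)\<^sup>2 / 1000"
proof (cases "z = 0")
  case False
  have d1: "\<bar>d (x + t) - d x\<bar> \<le> \<bar>z\<bar> * ((d x)\<^sup>2 / 1000)" if t: "\<bar>t\<bar> \<le> \<bar>z\<bar>" for t
  proof -
    have "norm (d (x + t) - d x) \<le> (d x)\<^sup>2 / 1000 * norm (x + t - x)"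
    proof (rule field_differentiable_bound[where S = "cball x \<bar>z\<bar>" and f' = dd])
      fix y assume "y \<in> cball x \<bar>z\<bar>"
      then have "\<bar>y - x\<bar> \<le> 8 / d x" using z by (simp add: dist_real_def)
      from curv[OF x this] show "norm (dd y) \<le> (d x)\<^sup>2 / 1000" by simp
      show "(d has_field_derivative dd y) (at y within cball x \<bar>z\<bar>)"
        by (rule has_field_derivative_at_within[OF ddu])
    qed (use t in \<open>auto simp: dist_real_def\<close>)
    also have "\<dots> \<le> (d x)\<^sup>2 / 1000 * \<bar>z\<bar>" using t by (intro mult_left_mono) auto
    finally show ?thesis by (simp add: mult.commute)
  qed
  have "norm ((u (x + z) - d x * (x + z)) - (u x - d x * x)) \<le> \<bar>z\<bar> * ((d x)\<^sup>2 / 1000) * norm (x + z - x)"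
  proof (rule field_differentiable_bound[where S = "cball x \<bar>z\<bar>" and f' = "\<lambda>y. d y - d x" and f = "\<lambda>y. u y - d x * y"])
    fix y assume "y \<in> cball x \<bar>z\<bar>"
    then have "\<bar>y - x\<bar> \<le> \<bar>z\<bar>" by (simp add: dist_real_def)
    from d1[OF this] show "norm (d y - d x) \<le> \<bar>z\<bar> * ((d x)\<^sup>2 / 1000)" by simp
    show "((\<lambda>y. u y - d x * y) has_field_derivative d y - d x) (at y within cball x \<bar>z\<bar>)"
      by (rule has_field_derivative_at_within) (auto intro!: derivative_eq_intros du)
  qed (auto simp: dist_real_def)
  also have "\<bar>z\<bar> * ((d x)\<^sup>2 / 1000) * norm (x + z - x) = (d x * z)\<^sup>2 / 1000"
    by (simp add: power_mult_distrib power2_eq_square)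
  finally show ?thesis by (simp add: algebra_simps)
qed simp

text \<open>Proposals \<open>x \<plusminus> z\<close> with \<open>z < x\<close> are paired and yield
  a gain. Steps outward with \<open>z \<ge> x\<close> cost at most an integrable tail, and steps
  across the origin cost nothing by \<open>half_line_drift\<close>. The minimum in the bound
  reflects the width of the window on which the quadratic gain is collected: the scale bound
  \<sigma>0 or \<open>8 / d x\<close>, whichever is smaller.\<close>

lemma one_dim_side_drift:
  "\<exists>c>0. \<exists>R\<ge>R0. \<forall>x\<ge>R. \<forall>\<sigma>\<ge>\<sigma>0.
    (\<integral>\<^sup>+y. ennreal (metro_fac (exp (u x - u y)) * (1 / \<sigma> * q ((y - x) / \<sigma>))) \<partial>lborel) \<le>
    ennreal (1 - c / \<sigma> * min ((d x)\<^sup>2) (1 / d x))"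
proof -
  have uc: "continuous_on A u" for A
    by (rule continuous_at_imp_continuous_on) (use du DERIV_isCont in blast)
  have um[measurable]: "u \<in> borel_measurable borel" by (rule borel_measurable_continuous_onI[OF uc])
  have qm[measurable]: "q \<in> borel_measurable borel" and q0: "0 \<le> q z" and q1: "(\<integral>\<^sup>+z. ennreal (q z) \<partial>lborel) = 1" for z
    using q by (auto simp: prob_density_def)
  have quql: "ql \<le> qu" using qb[of 0] by simp
  have C: "0 < qu / ql" using ql quql by simp
  have dl: "((\<lambda>t. u (- t)) has_real_derivative - d (- t)) (at t)" if "R0 \<le> t" for t
    using DERIV_chain2[OF du[of "- t"] DERIV_minus[OF DERIV_ident]] by simp
  obtain R2 where R2: "1 \<le> R2" and half0: "\<forall>x Q. (\<forall>y. - R2 \<le> y \<longrightarrow> y \<le> 0 \<longrightarrow> u y \<le> u x - 1) \<longrightarrow> Q \<in> borel_measurable borel \<longrightarrow>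
      (\<forall>y. 0 \<le> Q y) \<longrightarrow> (\<integral>\<^sup>+y. ennreal (Q y) \<partial>lborel) = 1 \<longrightarrow> (\<forall>y y'. y \<le> y' \<longrightarrow> y' \<le> 0 \<longrightarrow> Q y \<le> qu / ql * Q y') \<longrightarrow>
      (\<integral>\<^sup>+y. ennreal (metro_fac (exp (u x - u y)) * (indicator {..0} y * Q y)) \<partial>lborel) \<le>
      (\<integral>\<^sup>+y. ennreal (indicator {..0} y * Q y) \<partial>lborel)"
    by (rule exE[OF half_line_drift[OF um dl left R0 k p C]])
      (assumption | (elim conjE, rule that, assumption, assumption))+
  note half = half0[rule_format]
  have "bounded (u ` {- R2..R0})" by (intro compact_imp_bounded compact_continuous_image uc) auto
  then obtain B where "\<forall>y\<in>{- R2..R0}. \<bar>u y\<bar> \<le> B" by (auto simp: bounded_iff)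
  then have B: "u y \<le> B" if "- R2 \<le> y" "y \<le> R0" for y using that by (auto simp: abs_le_iff)
  obtain c2 where c2: "0 < c2" "\<And>t. 0 \<le> t \<Longrightarrow> c2 * (1 + t) ^ 2 \<le> exp (k / 4 * t powr p)"
    using exp_powr_dominates_power[of "k / 4" p 2] k p by auto
  define K where "K = 1 / c2"
  have K: "0 < K" using c2 by (simp add: K_def)
  \<comment> \<open>The first entry places the window \<open>8 / d x\<close> within
    \<open>x / 2\<close>; the second lifts \<open>u x\<close> at least 4 above the bound B on the
    middle part.\<close>
  define T where "T = max (16 / k) (2 / k * \<bar>B + 4 - u R0\<bar>)"
  \<comment> \<open>As \<open>1 \<le> x\<close>, the last entry gives
    \<open>2 K qu \<le> ql x^2\<close>, which makes the tail beyond x cost at most what the pairs in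
    \<open>(x / 2, x)\<close> gain.\<close>
  define R where "R = max (max (2 * R0) (T powr (1 / p))) (2 * K * qu / ql)"
  \<comment> \<open>The gain \<open>(a \<mu> / 2)^2 / 200\<close> is collected on an interval of
    length \<open>\<mu> / 2\<close>, hence 1600; 512 is \<open>8^3\<close>, from the case
    \<open>\<mu> = 8 / a\<close>.\<close>
  define c where "c = ql / 1600 * min (\<sigma>0 ^ 3) 512"
  have c: "0 < c" using ql \<sigma>0 by (simp add: c_def)
  have "(\<integral>\<^sup>+y. ennreal (metro_fac (exp (u x - u y)) * (1 / \<sigma> * q ((y - x) / \<sigma>))) \<partial>lborel) \<le>
    ennreal (1 - c / \<sigma> * min ((d x)\<^sup>2) (1 / d x))" if x: "R \<le> x" and \<sigma>: "\<sigma>0 \<le> \<sigma>" for x \<sigma>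
  proof -
    have s0: "0 < \<sigma>" using \<sigma> \<sigma>0 by linarith
    have xR: "2 * R0 \<le> x" "T powr (1 / p) \<le> x" "2 * K * qu / ql \<le> x" using x by (auto simp: R_def)
    have x0: "0 < x" "R0 \<le> x" "1 \<le> x" using xR R0 by auto
    define a where "a = d x"
    have a: "0 < a" unfolding a_def by (rule d_pos[OF x0(2)])
    have T0: "0 < T" using k by (simp add: T_def less_max_iff_disj)
    have xT: "T \<le> x powr p"
    proof -
      have "T = (T powr (1 / p)) powr p" using p T0 by (simp add: powr_powr)
      also have "\<dots> \<le> x powr p" using xR p by (intro powr_mono2) auto
      finally show ?thesis .
    qed
    have gain2: "u s + k / 2 * t powr p \<le> u t" if "R0 \<le> s" "2 * s \<le> t" for s t
    proof -
      have t0: "0 < t" using that R0 by linarith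
      have "u s + k * (t - s) * t powr (p - 1) \<le> u t"
        by (rule potential_gain[OF du right R0 less_imp_le[OF k] p(2)]) (use that R0 in auto)
      moreover have "k * (t / 2) * t powr (p - 1) \<le> k * (t - s) * t powr (p - 1)"
        using k that by (intro mult_right_mono mult_left_mono) auto
      moreover have "k * (t / 2) * t powr (p - 1) = k / 2 * t powr p"
        using t0 powr_mult_base[of t "p - 1"] by (simp add: mult.assoc)
      ultimately show ?thesis by linarith
    qed
    have uB: "B + 4 \<le> u x"
    proof -
      have "2 / k * \<bar>B + 4 - u R0\<bar> \<le> x powr p" using xT by (simp add: T_def)
      then have "\<bar>B + 4 - u R0\<bar> \<le> k / 2 * x powr p" using k by (simp add: field_simps)
      then show ?thesis using gain2[of R0 x] xR(1) by linarith
    qed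
    have ax: "8 / a \<le> x / 2"
    proof -
      have "16 / k \<le> x powr p" using xT by (simp add: T_def)
      then have "16 \<le> k * x powr p" using k by (simp add: pos_divide_le_eq mult.commute)
      also have "\<dots> = k * x powr (p - 1) * x" using x0 powr_mult_base[of x "p - 1"] by (simp add: mult_ac)
      also have "\<dots> \<le> a * x" using right[OF x0(2)] x0 by (intro mult_right_mono) (auto simp: a_def)
      finally show ?thesis using a by (simp add: field_simps)
    qed
    define Q where "Q z = 1 / \<sigma> * q (z / \<sigma>)" for z
    define F where "F y = metro_fac (exp (u x - u y))" for y
    have Qm[measurable]: "Q \<in> borel_measurable borel" unfolding Q_def[abs_def] by measurable
    have Fm[measurable]: "F \<in> borel_measurable borel" unfolding F_def[abs_def] by measurable
    have Q0: "0 \<le> Q z" for z using q0[of "z / \<sigma>"] s0 by (simp add: Q_def)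
    have F0: "0 \<le> F y" for y unfolding F_def by (rule metro_fac_bounds) simp
    have Qsym: "Q (- z) = Q z" for z using qsym[of "z / \<sigma>"] by (simp add: Q_def)
    have Qlow: "ql / \<sigma> \<le> Q z" if "\<bar>z\<bar> \<le> \<sigma>" for z
      using qb[of "z / \<sigma>"] that s0 by (simp add: Q_def divide_right_mono)
    have Qout: "Q z = 0" if "\<sigma> < \<bar>z\<bar>" for z using qout[of "z / \<sigma>"] that s0 by (simp add: Q_def)
    have Qup: "Q z \<le> qu / \<sigma>" for z
    proof (cases "\<bar>z\<bar> \<le> \<sigma>")
      case True
      then show ?thesis using qb[of "z / \<sigma>"] s0 by (simp add: Q_def divide_right_mono)
    next
      case False
      then show ?thesis using Qout[of z] s0 ql quql by simp
    qed
    have Q1: "(\<integral>\<^sup>+z. ennreal (Q z) \<partial>lborel) = 1"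
    proof -
      have "(\<integral>\<^sup>+z. ennreal (Q z) \<partial>lborel) = ennreal (\<bar>\<sigma>\<bar> ^ DIM(real)) * (\<integral>\<^sup>+z. ennreal (Q (0 + \<sigma> *\<^sub>R z)) \<partial>lborel)"
        by (rule nn_integral_scale) (use s0 in auto)
      also have "(\<integral>\<^sup>+z. ennreal (Q (0 + \<sigma> *\<^sub>R z)) \<partial>lborel) = (\<integral>\<^sup>+z. ennreal (1 / \<sigma>) * ennreal (q z) \<partial>lborel)"
        using s0 q0 by (intro nn_integral_cong) (simp add: Q_def ennreal_mult[symmetric])
      also have "\<dots> = ennreal (1 / \<sigma>)" by (simp add: nn_integral_cmult q1)
      also have "ennreal (\<bar>\<sigma>\<bar> ^ DIM(real)) * ennreal (1 / \<sigma>) = 1" using s0 by (simp add: ennreal_mult[symmetric])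
      finally show ?thesis .
    qed
    \<comment> \<open>The gain of one pair: quadratic on the window, from
      \<open>pair_drift_near\<close>, and constant beyond it, from
      \<open>pair_drift_far\<close>.\<close>
    define E where "E z = (if z \<le> 8 / a then (a * z)\<^sup>2 / 200 else 1 / 2)" for z
    have Em[measurable]: "E \<in> borel_measurable borel" unfolding E_def[abs_def] by measurable
    have E0: "0 \<le> E z" for z by (simp add: E_def)
    have pair: "F (x + z) + F (x - z) + E z \<le> 2" if z: "0 < z" "z < x" for z
    proof (cases "z \<le> 8 / a")
      case True
      have sz: "0 \<le> a * z" "a * z \<le> 8" using a z True by (simp_all add: pos_le_divide_eq mult.commute)
      have 1: "\<bar>(u (x + z) - u x) - a * z\<bar> \<le> (a * z)\<^sup>2 / 1000"
        using taylor[OF x0(2), of z] True z by (simp add: a_def)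
      have "\<bar>u (x + - z) - u x - a * (- z)\<bar> \<le> (a * (- z))\<^sup>2 / 1000"
        unfolding a_def by (rule taylor[OF x0(2)]) (use True z in \<open>simp add: a_def\<close>)
      then have 2: "\<bar>(u x - u (x - z)) - a * z\<bar> \<le> (a * z)\<^sup>2 / 1000" by (simp add: abs_minus_commute algebra_simps)
      show ?thesis using pair_drift_near[OF sz 1 2] True by (simp add: F_def E_def)
    next
      case False
      \<comment> \<open>At the edge of the window u has changed by at least 7. Monotonicity carries
        this outwards, and on the inner side down to \<open>R0\<close>; below \<open>R0\<close> the
        bound B takes over.\<close>
      have t1: "\<bar>u (x + 8 / a) - u x - a * (8 / a)\<bar> \<le> (a * (8 / a))\<^sup>2 / 1000"
        unfolding a_def by (rule taylor[OF x0(2)]) (use d_pos[OF x0(2)] in simp)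
      have t2: "\<bar>u (x + - (8 / a)) - u x - a * (- (8 / a))\<bar> \<le> (a * (- (8 / a)))\<^sup>2 / 1000"
        unfolding a_def by (rule taylor[OF x0(2)]) (use d_pos[OF x0(2)] in simp)
      have v: "a * (8 / a) = 8" and v2: "a * (- (8 / a)) = - 8" using a by simp_all
      have v8: "(8::real)\<^sup>2 / 1000 \<le> 1" "(- 8::real)\<^sup>2 / 1000 \<le> 1" by simp_all
      have 1: "4 \<le> u (x + z) - u x"
      proof -
        have "u (x + 8 / a) \<le> u (x + z)" using False x0 a by (intro mono_right) (auto intro: add_increasing2)
        then show ?thesis using t1 v8 unfolding v by linarith
      qed
      have 2: "4 \<le> u x - u (x - z)"
      proof (cases "R0 \<le> x - z")
        case True
        have "u (x - z) \<le> u (x - 8 / a)" using False True by (intro mono_right) auto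
        moreover have "u (x - 8 / a) - u x - - 8 \<le> (- 8)\<^sup>2 / 1000"
          using abs_le_D1[OF t2] unfolding v2 diff_conv_add_uminus .
        ultimately show ?thesis using v8 by linarith
      next
        case nR: False
        have "u (x - z) \<le> B" by (rule B) (use nR z R2 in auto)
        then show ?thesis using uB by linarith
      qed
      show ?thesis using pair_drift_far[OF 1 2] False by (simp add: F_def E_def)
    qed
    \<comment> \<open>A majorant of \<open>exp (- (k / 4 * (x + z) powr p))\<close> that has an
      elementary primitive.\<close>
    define tl where "tl z = K / (x + z)\<^sup>2" for z
    have tail: "F (x + z) \<le> 1 + tl z" if z: "x \<le> z" for z
    proof -
      have "sqrt (exp (u x - u (x + z))) = exp ((u x - u (x + z)) / 2)"
        by (rule real_sqrt_unique) (simp_all add: power2_eq_square flip: exp_add)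
      then have "F (x + z) \<le> 1 + exp ((u x - u (x + z)) / 2)"
        using metro_fac_bounds(3)[of "exp (u x - u (x + z))"] by (simp add: F_def)
      also have "exp ((u x - u (x + z)) / 2) \<le> exp (- (k / 4 * (x + z) powr p))"
        using gain2[of x "x + z"] x0 z by simp
      also have "\<dots> = 1 / exp (k / 4 * (x + z) powr p)" by (simp add: exp_minus inverse_eq_divide)
      also have "\<dots> \<le> 1 / (c2 * (x + z)\<^sup>2)"
      proof (rule divide_left_mono)
        have "c2 * (x + z)\<^sup>2 \<le> c2 * (1 + (x + z))\<^sup>2" using c2 x0 z by (intro mult_left_mono power_mono) auto
        then show "c2 * (x + z)\<^sup>2 \<le> exp (k / 4 * (x + z) powr p)" using c2(2)[of "x + z"] x0 z by linarith
      qed (use c2 x0 z in auto)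
      finally show ?thesis by (simp add: tl_def K_def)
    qed
    have tl0: "0 \<le> tl z" for z using K by (simp add: tl_def)
    have tlm[measurable]: "tl \<in> borel_measurable borel" unfolding tl_def[abs_def] by measurable
    let ?S1 = "{0<..<x}" and ?S2 = "{x..}"
    let ?A1 = "\<integral>\<^sup>+z. ennreal (indicator ?S1 z * ((F (x + z) + F (x - z)) * Q z)) \<partial>lborel"
    let ?A2 = "\<integral>\<^sup>+z. ennreal (indicator ?S2 z * (F (x + z) * Q z)) \<partial>lborel"
    let ?A3 = "\<integral>\<^sup>+z. ennreal (indicator ?S2 z * (F (x - z) * Q z)) \<partial>lborel"
    let ?e = "\<integral>\<^sup>+z. ennreal (indicator ?S1 z * (E z * Q z)) \<partial>lborel"
    let ?t = "\<integral>\<^sup>+z. ennreal (indicator ?S2 z * (tl z * Q z)) \<partial>lborel"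
    let ?T1 = "\<integral>\<^sup>+z. ennreal (indicator ?S1 z * (2 * Q z)) \<partial>lborel"
    let ?T2 = "\<integral>\<^sup>+z. ennreal (indicator ?S2 z * Q z) \<partial>lborel"
    have split: "(\<integral>\<^sup>+z. ennreal (g z * Q z) \<partial>lborel) =
        (\<integral>\<^sup>+z. ennreal (indicator ?S1 z * ((g z + g (- z)) * Q z)) \<partial>lborel) +
        (\<integral>\<^sup>+z. ennreal (indicator ?S2 z * (g z * Q z)) \<partial>lborel) +
        (\<integral>\<^sup>+z. ennreal (indicator ?S2 z * (g (- z) * Q z)) \<partial>lborel)"
      if gm[measurable]: "g \<in> borel_measurable borel" and g0: "\<And>z. 0 \<le> g z" for g
    proof -
      have "(\<integral>\<^sup>+z. ennreal (g z * Q z) \<partial>lborel) =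
        (\<integral>\<^sup>+z. indicator {0<..} z * (ennreal (g z * Q z) + ennreal (g (- z) * Q (- z))) \<partial>lborel)"
        by (rule nn_integral_symmetrize) measurable
      also have "\<dots> = (\<integral>\<^sup>+z. ennreal (indicator ?S1 z * ((g z + g (- z)) * Q z)) +
          ennreal (indicator ?S2 z * (g z * Q z)) + ennreal (indicator ?S2 z * (g (- z) * Q z)) \<partial>lborel)"
      proof (rule nn_integral_cong)
        fix z
        have nn: "0 \<le> g z * Q z" "0 \<le> g (- z) * Q z" by (intro mult_nonneg_nonneg g0 Q0)+
        have "ennreal (g z * Q z) + ennreal (g (- z) * Q z) = ennreal ((g z + g (- z)) * Q z)"
          unfolding distrib_right by (rule ennreal_plus[OF nn, symmetric])
        then show "indicator {0<..} z * (ennreal (g z * Q z) + ennreal (g (- z) * Q (- z))) =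
          ennreal (indicator ?S1 z * ((g z + g (- z)) * Q z)) +
          ennreal (indicator ?S2 z * (g z * Q z)) + ennreal (indicator ?S2 z * (g (- z) * Q z))"
          using x0 unfolding Qsym by (cases "0 < z"; cases "z < x") auto
      qed
      also have "\<dots> = (\<integral>\<^sup>+z. ennreal (indicator ?S1 z * ((g z + g (- z)) * Q z)) \<partial>lborel) +
        (\<integral>\<^sup>+z. ennreal (indicator ?S2 z * (g z * Q z)) \<partial>lborel) +
        (\<integral>\<^sup>+z. ennreal (indicator ?S2 z * (g (- z) * Q z)) \<partial>lborel)"
        by (subst nn_integral_add; (subst nn_integral_add)?; measurable?; simp?)
      finally show ?thesis .
    qed
    have tot: "?T1 + ?T2 + ?T2 = 1"
      using split[of "\<lambda>_. 1"] Q1 by simp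
    have le1: "?A1 + ?e \<le> ?T1"
    proof -
      have "?A1 + ?e = (\<integral>\<^sup>+z. ennreal (indicator ?S1 z * ((F (x + z) + F (x - z)) * Q z)) + ennreal (indicator ?S1 z * (E z * Q z)) \<partial>lborel)"
        by (rule nn_integral_add[symmetric]) measurable
      also have "\<dots> \<le> ?T1"
      proof (rule nn_integral_mono)
        fix z
        show "ennreal (indicator ?S1 z * ((F (x + z) + F (x - z)) * Q z)) + ennreal (indicator ?S1 z * (E z * Q z)) \<le>
          ennreal (indicator ?S1 z * (2 * Q z))"
        proof (cases "z \<in> ?S1")
          case True
          have "0 \<le> (F (x + z) + F (x - z)) * Q z" "0 \<le> E z * Q z"
            by (intro mult_nonneg_nonneg add_nonneg_nonneg F0 E0 Q0)+
          from ennreal_plus[OF this] have "ennreal ((F (x + z) + F (x - z)) * Q z) + ennreal (E z * Q z) =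
            ennreal ((F (x + z) + F (x - z) + E z) * Q z)" by (simp only: distrib_right)
          also have "\<dots> \<le> ennreal (2 * Q z)"
            using pair[of z] True by (intro ennreal_leI mult_right_mono Q0) auto
          finally show ?thesis using True by simp
        qed simp
      qed
      finally show ?thesis .
    qed
    have le2: "?A2 \<le> ?T2 + ?t"
    proof -
      have "?A2 \<le> (\<integral>\<^sup>+z. ennreal (indicator ?S2 z * Q z) + ennreal (indicator ?S2 z * (tl z * Q z)) \<partial>lborel)"
      proof (rule nn_integral_mono)
        fix z
        show "ennreal (indicator ?S2 z * (F (x + z) * Q z)) \<le> ennreal (indicator ?S2 z * Q z) + ennreal (indicator ?S2 z * (tl z * Q z))"
        proof (cases "z \<in> ?S2")
          case True
          have "F (x + z) * Q z \<le> (1 + tl z) * Q z" using True by (intro mult_right_mono tail Q0) auto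
          then have "ennreal (F (x + z) * Q z) \<le> ennreal (Q z + tl z * Q z)"
            by (intro ennreal_leI) (simp add: distrib_right)
          also have "\<dots> = ennreal (Q z) + ennreal (tl z * Q z)"
            by (intro ennreal_plus mult_nonneg_nonneg tl0 Q0)
          finally show ?thesis using True by simp
        qed simp
      qed
      also have "\<dots> = ?T2 + ?t" by (rule nn_integral_add) measurable
      finally show ?thesis .
    qed
    \<comment> \<open>Proposals to the other side of the origin: among nonpositive points the loss
      is balanced by the gain, so this part stays below its proposal mass.\<close>
    have le3: "?A3 \<le> ?T2"
    proof -
      let ?P = "\<lambda>y. Q (y - x)"
      have refl: "(\<integral>\<^sup>+y. ennreal (g y * (indicator {..0} y * ?P y)) \<partial>lborel) =
          (\<integral>\<^sup>+z. ennreal (indicator ?S2 z * (g (x - z) * Q z)) \<partial>lborel)"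
        if [measurable]: "g \<in> borel_measurable borel" for g
      proof -
        have "(\<integral>\<^sup>+y. ennreal (g y * (indicator {..0} y * ?P y)) \<partial>lborel) =
          (\<integral>\<^sup>+z. ennreal (g (x - z) * (indicator {..0} (x - z) * ?P (x - z))) \<partial>lborel)"
          by (rule nn_integral_reflect[symmetric]) measurable
        also have "\<dots> = (\<integral>\<^sup>+z. ennreal (indicator ?S2 z * (g (x - z) * Q z)) \<partial>lborel)"
          by (intro nn_integral_cong) (simp add: Qsym indicator_def)
        finally show ?thesis .
      qed
      have "(\<integral>\<^sup>+y. ennreal (F y * (indicator {..0} y * ?P y)) \<partial>lborel) \<le>
        (\<integral>\<^sup>+y. ennreal (indicator {..0} y * ?P y) \<partial>lborel)"
        unfolding F_def
      proof (rule half)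
        show "u y \<le> u x - 1" if "- R2 \<le> y" "y \<le> 0" for y
          using B[of y] that uB R0 by simp
        show "(\<lambda>y. Q (y - x)) \<in> borel_measurable borel" by measurable
        show "0 \<le> Q (y - x)" for y by (rule Q0)
        show "(\<integral>\<^sup>+y. ennreal (Q (y - x)) \<partial>lborel) = 1"
          using nn_integral_translate[of "\<lambda>y. ennreal (Q y)" "- x"] Q1 by simp
        fix y y' :: real assume y: "y \<le> y'" "y' \<le> 0"
        \<comment> \<open>The point y' lies between y and x, so it is in the support of the proposal
          whenever y is, and there the density varies by at most the factor
          \<open>qu / ql\<close>.\<close>
        show "Q (y - x) \<le> qu / ql * Q (y' - x)"
        proof (cases "\<bar>y - x\<bar> \<le> \<sigma>")
          case True
          then have "ql / \<sigma> \<le> Q (y' - x)" using y x0 by (intro Qlow) auto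
          then have "qu / ql * (ql / \<sigma>) \<le> qu / ql * Q (y' - x)" using C by (intro mult_left_mono) auto
          moreover have "qu / ql * (ql / \<sigma>) = qu / \<sigma>" using ql by simp
          ultimately show ?thesis using Qup[of "y - x"] by linarith
        next
          case False
          then have "Q (y - x) = 0" using Qout[of "y - x"] by simp
          then show ?thesis using mult_nonneg_nonneg[OF less_imp_le[OF C] Q0[of "y' - x"]] by (simp only:)
        qed
      qed
      also have "(\<integral>\<^sup>+y. ennreal (indicator {..0} y * ?P y) \<partial>lborel) = ?T2"
        using refl[of "\<lambda>_. 1"] by simp
      finally show ?thesis using refl[OF Fm] by simp
    qed
    define cc where "cc = c / \<sigma> * min (a\<^sup>2) (1 / a)"
    have cc0: "0 \<le> cc" using c s0 a by (simp add: cc_def)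
    \<comment> \<open>The gain is collected on two disjoint regions:
      \<open>{\<mu> / 2..\<mu>}\<close> pays for \<open>cc\<close> and \<open>{x / 2<..<x}\<close>
      for the tail. They are disjoint because \<open>8 / a \<le> x / 2\<close>.\<close>
    have comp: "?t + ennreal cc \<le> ?e"
    proof -
      define \<mu> where "\<mu> = min \<sigma>0 (8 / a)"
      have \<mu>: "0 < \<mu>" "\<mu> \<le> 8 / a" "\<mu> \<le> \<sigma>" using \<sigma>0 a \<sigma> by (auto simp: \<mu>_def)
      define \<alpha> where "\<alpha> = (a * (\<mu> / 2))\<^sup>2 / 200 * (ql / \<sigma>)"
      \<comment> \<open>If x exceeds \<sigma>, the proposal density vanishes on the tail, so nothing
        has to be paid; its lower bound need not hold up to x in that case.\<close>
      define \<beta> where "\<beta> = (if x \<le> \<sigma> then 1 / 2 * (ql / \<sigma>) else 0)"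
      have \<alpha>0: "0 \<le> \<alpha>" and \<beta>0: "0 \<le> \<beta>" using ql s0 by (auto simp: \<alpha>_def \<beta>_def)
      have "ennreal cc \<le> ennreal \<alpha> * emeasure lborel {\<mu> / 2..\<mu>}"
      proof -
        \<comment> \<open>Two regimes: for \<open>\<mu> = \<sigma>0\<close> the gain is of order
          \<open>a^2\<close>, for \<open>\<mu> = 8 / a\<close> it is of order
          \<open>1 / a\<close>.\<close>
        have "min (\<sigma>0 ^ 3) 512 * min (a\<^sup>2) (1 / a) \<le> a\<^sup>2 * \<mu> ^ 3"
        proof (cases "\<sigma>0 \<le> 8 / a")
          case True
          have "min (\<sigma>0 ^ 3) 512 * min (a\<^sup>2) (1 / a) \<le> \<sigma>0 ^ 3 * a\<^sup>2"
            using \<sigma>0 a by (intro mult_mono) auto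
          then show ?thesis using True by (simp add: \<mu>_def min_absorb1 mult.commute)
        next
          case False
          have "min (\<sigma>0 ^ 3) 512 * min (a\<^sup>2) (1 / a) \<le> 512 * (1 / a)"
            using \<sigma>0 a by (intro mult_mono) auto
          also have "\<dots> = a\<^sup>2 * (8 / a) ^ 3" using a by (simp add: power2_eq_square power3_eq_cube field_simps)
          finally show ?thesis using False by (simp add: \<mu>_def min_absorb2)
        qed
        then have "ql / 1600 / \<sigma> * (min (\<sigma>0 ^ 3) 512 * min (a\<^sup>2) (1 / a)) \<le> ql / 1600 / \<sigma> * (a\<^sup>2 * \<mu> ^ 3)"
          using ql s0 by (intro mult_left_mono) auto
        also have "\<dots> = \<alpha> * (\<mu> / 2)" by (simp add: \<alpha>_def power2_eq_square power3_eq_cube)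
        finally have "cc \<le> \<alpha> * (\<mu> / 2)" by (simp add: cc_def c_def mult_ac)
        then have "ennreal cc \<le> ennreal (\<alpha> * (\<mu> / 2))" by (rule ennreal_leI)
        also have "\<dots> = ennreal \<alpha> * ennreal (\<mu> / 2)" using \<alpha>0 \<mu> by (intro ennreal_mult) auto
        finally show ?thesis using \<mu> by simp
      qed
      moreover have "?t \<le> ennreal \<beta> * emeasure lborel {x / 2<..<x}"
      proof (cases "x \<le> \<sigma>")
        case True
        have "?t \<le> (\<integral>\<^sup>+z. ennreal (qu / \<sigma>) * (ennreal (tl z) * indicator {x..} z) \<partial>lborel)"
        proof (rule nn_integral_mono)
          fix z
          have "tl z * Q z \<le> tl z * (qu / \<sigma>)" by (intro mult_left_mono Qup tl0)
          then have "ennreal (tl z * Q z) \<le> ennreal (qu / \<sigma> * tl z)" by (intro ennreal_leI) (simp add: mult.commute)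
          also have "\<dots> = ennreal (qu / \<sigma>) * ennreal (tl z)" using s0 quql ql tl0 by (intro ennreal_mult) auto
          finally show "ennreal (indicator ?S2 z * (tl z * Q z)) \<le> ennreal (qu / \<sigma>) * (ennreal (tl z) * indicator {x..} z)"
            by (simp add: indicator_def)
        qed
        also have "\<dots> = ennreal (qu / \<sigma>) * (\<integral>\<^sup>+z. ennreal (tl z) * indicator {x..} z \<partial>lborel)"
          by (rule nn_integral_cmult) measurable
        also have "(\<integral>\<^sup>+z. ennreal (tl z) * indicator {x..} z \<partial>lborel) = ennreal (0 - (- K / (x + x)))"
        proof (rule nn_integral_FTC_atLeast[where F = "\<lambda>z. - K / (x + z)", OF tlm])
          fix z assume "x \<le> z"
          then show "((\<lambda>z. - K / (x + z)) has_real_derivative tl z) (at z)"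
            using x0 by (auto intro!: derivative_eq_intros simp: tl_def power2_eq_square)
          show "0 \<le> tl z" by (rule tl0)
        next
          have "filterlim (\<lambda>z. x + z) at_infinity at_top"
            by (rule filterlim_at_top_imp_at_infinity[OF filterlim_tendsto_add_at_top[OF tendsto_const filterlim_ident]])
          then show "((\<lambda>z. - K / (x + z)) \<longlongrightarrow> 0) at_top" by (intro tendsto_divide_0[OF tendsto_const])
        qed
        also have "ennreal (qu / \<sigma>) * ennreal (0 - (- K / (x + x))) = ennreal (qu / \<sigma> * (K / (x + x)))"
          using s0 quql ql K x0 by (subst ennreal_mult[symmetric]) auto
        also have "\<dots> \<le> ennreal (\<beta> * (x / 2))"
        proof (rule ennreal_leI)
          have "2 * K * qu / ql * 1 \<le> x * x" using xR(3) x0 by (intro mult_mono) auto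
          then have "2 * K * qu \<le> ql * (x * x)" using ql by (simp add: pos_divide_le_eq mult.commute)
          then have "2 * K * qu / (4 * x * \<sigma>) \<le> ql * (x * x) / (4 * x * \<sigma>)" using x0 s0 by (intro divide_right_mono) auto
          then show "qu / \<sigma> * (K / (x + x)) \<le> \<beta> * (x / 2)" using True x0 s0 by (simp add: \<beta>_def field_simps)
        qed
        also have "\<dots> = ennreal \<beta> * ennreal (x / 2)" using \<beta>0 x0 by (intro ennreal_mult) auto
        finally show ?thesis using x0 by simp
      next
        case False
        have "ennreal (indicator ?S2 z * (tl z * Q z)) = 0" for z
          using False Qout[of z] by (simp add: indicator_def)
        then show ?thesis by simp
      qed
      ultimately have "?t + ennreal cc \<le> ennreal \<beta> * emeasure lborel {x / 2<..<x} + ennreal \<alpha> * emeasure lborel {\<mu> / 2..\<mu>}"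
        by (rule add_mono[rotated])
      also have "\<dots> = (\<integral>\<^sup>+z. ennreal \<beta> * indicator {x / 2<..<x} z + ennreal \<alpha> * indicator {\<mu> / 2..\<mu>} z \<partial>lborel)"
        by (subst nn_integral_add) (simp_all add: nn_integral_cmult_indicator)
      also have "\<dots> \<le> ?e"
      proof (rule nn_integral_mono)
        fix z
        show "ennreal \<beta> * indicator {x / 2<..<x} z + ennreal \<alpha> * indicator {\<mu> / 2..\<mu>} z \<le> ennreal (indicator ?S1 z * (E z * Q z))"
        proof (cases "z \<in> {\<mu> / 2..\<mu>}")
          case True
          then have z: "\<mu> / 2 \<le> z" "z \<le> \<mu>" "z \<le> x / 2" "0 < z" using \<mu> ax by auto
          have "(a * (\<mu> / 2))\<^sup>2 / 200 \<le> E z"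
            using z \<mu> a by (auto simp: E_def intro!: divide_right_mono power_mono mult_left_mono)
          then have "\<alpha> \<le> E z * Q z" unfolding \<alpha>_def
            using z \<mu> ql s0 by (intro mult_mono Qlow E0) auto
          then show ?thesis using z x0 True by (simp add: ennreal_leI)
        next
          case nz: False
          show ?thesis
          proof (cases "z \<in> {x / 2<..<x}")
            case True
            then have z: "x / 2 < z" "z < x" by auto
            have Ez: "E z = 1 / 2" using z ax by (simp add: E_def)
            have "\<beta> \<le> 1 / 2 * Q z"
            proof (cases "x \<le> \<sigma>")
              case True
              have "ql / \<sigma> \<le> Q z" by (rule Qlow) (use z x0 True in auto)
              then show ?thesis using True by (simp add: \<beta>_def)
            next
              case False then show ?thesis using Q0[of z] by (simp add: \<beta>_def)
            qed
            then have "\<beta> \<le> E z * Q z" unfolding Ez .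
            then show ?thesis using z x0 nz True by (simp add: ennreal_leI)
          qed (use nz in simp)
        qed
      qed
      finally show ?thesis .
    qed
    have "(\<integral>\<^sup>+y. ennreal (F y * Q (y - x)) \<partial>lborel) = (\<integral>\<^sup>+z. ennreal (F (x + z) * Q (x + z - x)) \<partial>lborel)"
      by (rule nn_integral_translate[symmetric]) measurable
    also have "\<dots> = (\<integral>\<^sup>+z. ennreal (F (x + z) * Q z) \<partial>lborel)" by simp
    also have "\<dots> = ?A1 + ?A2 + ?A3"
      using split[of "\<lambda>z. F (x + z)"] F0 by simp
    finally have eq: "(\<integral>\<^sup>+y. ennreal (F y * Q (y - x)) \<partial>lborel) = ?A1 + ?A2 + ?A3" .
    have "?A1 + ?A2 + ?A3 + ennreal cc \<le> ?A1 + (?T2 + ?t) + ?T2 + ennreal cc"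
      by (intro add_mono le2 le3 order_refl)
    also have "\<dots> = ?A1 + (?t + ennreal cc) + ?T2 + ?T2" by (simp add: ac_simps)
    also have "\<dots> \<le> ?A1 + ?e + ?T2 + ?T2" by (intro add_mono comp order_refl)
    also have "\<dots> \<le> ?T1 + ?T2 + ?T2" by (intro add_mono le1 order_refl)
    finally have "?A1 + ?A2 + ?A3 + ennreal cc \<le> 1" unfolding tot .
    then have "(\<integral>\<^sup>+y. ennreal (F y * Q (y - x)) \<partial>lborel) \<le> ennreal (1 - cc)"
      unfolding eq by (rule ennreal_le_diff[OF _ cc0])
    then show ?thesis by (simp add: F_def Q_def cc_def a_def)
  qed
  moreover have "R0 \<le> R" using R0 by (simp add: R_def le_max_iff_disj)
  ultimately show ?thesis using c by blast
qed

end

section \<open>Drift on the line from the one-dimensional conditions\<close>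

lemma SUP_limit_less:
  fixes f :: "real \<Rightarrow> ereal"
  assumes "((\<lambda>R. SUP x\<in>- ball 0 R. f x) \<longlongrightarrow> L) at_top" "L < c"
  shows "\<exists>R. \<forall>x. R \<le> \<bar>x\<bar> \<longrightarrow> f x < c"
proof -
  have "\<forall>\<^sub>F R in at_top. (SUP x\<in>- ball 0 R. f x) < c" by (rule order_tendstoD(2)[OF assms])
  then obtain R where R: "(SUP x\<in>- ball 0 R. f x) < c" by (auto simp: eventually_at_top_linorder)
  have "f x < c" if "R \<le> \<bar>x\<bar>" for x
    by (rule le_less_trans[OF SUP_upper R]) (use that in simp)
  then show ?thesis by blast
qed

lemma INF_limit_greater:
  fixes f :: "real \<Rightarrow> ereal"
  assumes "((\<lambda>R. INF x\<in>- ball 0 R. f x) \<longlongrightarrow> L) at_top" "c < L"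
  shows "\<exists>R. \<forall>x. R \<le> \<bar>x\<bar> \<longrightarrow> c < f x"
proof -
  have "\<forall>\<^sub>F R in at_top. c < (INF x\<in>- ball 0 R. f x)" by (rule order_tendstoD(1)[OF assms])
  then obtain R where R: "c < (INF x\<in>- ball 0 R. f x)" by (auto simp: eventually_at_top_linorder)
  have "c < f x" if "R \<le> \<bar>x\<bar>" for x
    by (rule less_le_trans[OF R INF_lower]) (use that in simp)
  then show ?thesis by blast
qed

text \<open>The limits are read off at two particular parameters: \<open>M = 8\<close> is the width
  of the window in \<open>pair_drift_near\<close>, and the exponent 1/4 is the one for which
  \<open>\<pi> powr (- (1/4))\<close> equals \<open>sqrt (lyap \<pi> x)\<close>.\<close>

lemma one_dim_bounds:
  fixes \<pi> :: "real \<Rightarrow> real"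
  assumes reg: "one_dim_regularity \<pi>" and dec: "one_dim_decay \<pi>"
  defines "l' \<equiv> deriv (\<lambda>x. ln (\<pi> x))"
  shows "\<exists>R\<ge>1. \<exists>k>0. \<exists>p\<in>{0<..<1}. \<exists>k3>0. \<forall>x. R \<le> \<bar>x\<bar> \<longrightarrow>
    k * \<bar>x\<bar> powr (p - 1) \<le> - (sgn x * l' x) \<and>
    (\<forall>t. \<bar>t\<bar> \<le> 8 / \<bar>l' x\<bar> \<longrightarrow> \<bar>deriv l' (x + t)\<bar> \<le> (l' x)\<^sup>2 / 1000) \<and>
    k3 * \<bar>l' x\<bar> \<le> \<pi> x powr (- (1/4))"
proof -
  obtain p L where p: "p \<in> {0<..<1}" and L: "L < 0"
      "((\<lambda>R. SUP x\<in>- ball 0 R. ereal (sgn x * l' x / \<bar>x\<bar> powr (p - 1))) \<longlongrightarrow> L) at_top"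
    using dec unfolding one_dim_decay_def Let_def l'_def by blast
  obtain L3 where L3: "0 < L3" "((\<lambda>R. INF x\<in>- ball 0 R. ereal (\<pi> x powr (- (1/4)) / \<bar>l' x\<bar>)) \<longlongrightarrow> L3) at_top"
  proof -
    have "(1/4 :: real) \<in> {0<..<1}" by simp
    then show ?thesis using dec that unfolding one_dim_decay_def Let_def l'_def by blast
  qed
  have L2: "((\<lambda>R. SUP x\<in>- ball 0 R. SUP t\<in>{t. \<bar>t\<bar> \<le> 8 / \<bar>l' x\<bar>}. ereal (\<bar>deriv l' (x + t)\<bar> / \<bar>l' x\<bar>\<^sup>2)) \<longlongrightarrow> 0) at_top"
  proof -
    have "(0::real) < 8" by simp
    then show ?thesis using reg unfolding one_dim_regularity_def Let_def l'_def by blast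
  qed
  obtain r where r: "L < ereal r" "r < 0" using ereal_dense2[OF L(1)] by auto
  obtain r3 where r3: "0 < r3" "ereal r3 < L3" using ereal_dense2[OF L3(1)] by auto
  obtain R1 where R1: "\<And>x. R1 \<le> \<bar>x\<bar> \<Longrightarrow> sgn x * l' x / \<bar>x\<bar> powr (p - 1) < r"
    using SUP_limit_less[OF L(2) r(1)] by auto
  obtain R2 where R2: "\<And>x. R2 \<le> \<bar>x\<bar> \<Longrightarrow>
      (SUP t\<in>{t. \<bar>t\<bar> \<le> 8 / \<bar>l' x\<bar>}. ereal (\<bar>deriv l' (x + t)\<bar> / \<bar>l' x\<bar>\<^sup>2)) < ereal (1/1000)"
    using SUP_limit_less[OF L2, of "ereal (1/1000)"] by auto
  obtain R3 where R3: "\<And>x. R3 \<le> \<bar>x\<bar> \<Longrightarrow> r3 < \<pi> x powr (- (1/4)) / \<bar>l' x\<bar>"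
    using INF_limit_greater[OF L3(2) r3(2)] by auto
  define R where "R = Max {1, R1, R2, R3}"
  have R: "1 \<le> R" "R1 \<le> R" "R2 \<le> R" "R3 \<le> R" by (auto simp: R_def)
  have "- r * \<bar>x\<bar> powr (p - 1) \<le> - (sgn x * l' x) \<and>
    (\<forall>t. \<bar>t\<bar> \<le> 8 / \<bar>l' x\<bar> \<longrightarrow> \<bar>deriv l' (x + t)\<bar> \<le> (l' x)\<^sup>2 / 1000) \<and>
    r3 * \<bar>l' x\<bar> \<le> \<pi> x powr (- (1/4))" if x: "R \<le> \<bar>x\<bar>" for x
  proof -
    have pp: "0 < \<bar>x\<bar> powr (p - 1)" using x R by simp
    have a: "sgn x * l' x < r * \<bar>x\<bar> powr (p - 1)"
      using R1[of x] x R pp by (simp add: pos_divide_less_eq)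
    moreover have "r * \<bar>x\<bar> powr (p - 1) < 0" using r pp by (simp add: mult_neg_pos)
    \<comment> \<open>The strict sign makes the derivative nonzero, so the quotients below are
      genuine and can be cleared.\<close>
    ultimately have nz: "l' x \<noteq> 0" by auto
    have "\<bar>deriv l' (x + t)\<bar> \<le> (l' x)\<^sup>2 / 1000" if t: "\<bar>t\<bar> \<le> 8 / \<bar>l' x\<bar>" for t
    proof -
      have "ereal (\<bar>deriv l' (x + t)\<bar> / \<bar>l' x\<bar>\<^sup>2) \<le> (SUP t\<in>{t. \<bar>t\<bar> \<le> 8 / \<bar>l' x\<bar>}. ereal (\<bar>deriv l' (x + t)\<bar> / \<bar>l' x\<bar>\<^sup>2))"
        by (rule SUP_upper) (use t in simp)
      also have "\<dots> < ereal (1/1000)" by (rule R2) (use x R in simp)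
      finally have "\<bar>deriv l' (x + t)\<bar> / (l' x)\<^sup>2 < 1/1000" by simp
      then show ?thesis using nz by (simp add: pos_divide_less_eq)
    qed
    moreover have "r3 * \<bar>l' x\<bar> \<le> \<pi> x powr (- (1/4))"
      using R3[of x] x R nz by (simp add: pos_less_divide_eq)
    ultimately show ?thesis using a by simp
  qed
  then show ?thesis
    using r r3 p R(1) by (intro exI[of _ R] conjI exI[of _ "- r"] bexI[of _ p] exI[of _ r3]) auto
qed

lemma sqrt_lyap: "0 < \<pi> x \<Longrightarrow> sqrt (lyap \<pi> x) = \<pi> x powr (- (1/4))"
  unfolding lyap_def powr_half_sqrt[symmetric] by (simp add: powr_half_sqrt[symmetric] powr_divide powr_powr powr_minus_divide)

lemma lyap_exp: "0 < \<pi> x \<Longrightarrow> lyap \<pi> x = exp (- ln (\<pi> x) / 2)"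
  by (simp add: lyap_def powr_half_sqrt[symmetric] powr_def exp_minus inverse_eq_divide)

text \<open>The one-sided drift is applied to the potential and to its reflection. Its gain, the
  minimum of the squared slope and the inverse slope, is at least a constant over
  \<open>sqrt V\<close>, the form required for the joint process.\<close>

lemma one_dim_real_drift:
  fixes \<pi> q :: "real \<Rightarrow> real"
  assumes reg: "one_dim_regularity \<pi>" and dec: "one_dim_decay \<pi>" and inc: "one_dim_increment q" and \<sigma>0: "0 < \<sigma>0"
  shows "\<forall>x. 0 < \<pi> x" "continuous_on UNIV \<pi>"
    "\<exists>c>0. \<exists>R. \<forall>x. R \<le> \<bar>x\<bar> \<longrightarrow> (\<forall>\<sigma>\<ge>\<sigma>0.
      (\<integral>\<^sup>+y. ennreal (metro_fac (\<pi> y / \<pi> x) * (1 / \<sigma> * q ((y - x) / \<sigma>))) \<partial>lborel) \<le>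
      ennreal (1 - c / \<sigma> / sqrt (lyap \<pi> x)))"
    "\<forall>N. \<exists>c>0. \<forall>x. c * (1 + \<bar>x\<bar>) ^ N \<le> lyap \<pi> x"
proof -
  have pos: "0 < \<pi> x" for x
  proof -
    have "compact {x}" by simp
    then have "\<exists>c>0. \<forall>y\<in>{x}. c \<le> \<pi> y" using reg unfolding one_dim_regularity_def by blast
    then show ?thesis by auto
  qed
  then show "\<forall>x. 0 < \<pi> x" by blast
  define l' where "l' = deriv (\<lambda>x. ln (\<pi> x))"
  define u where "u x = - ln (\<pi> x)" for x
  have lfd: "(\<lambda>x. ln (\<pi> x)) field_differentiable at x" "l' field_differentiable at x" for x
    using reg by (simp_all add: one_dim_regularity_def Let_def l'_def)
  have dl: "((\<lambda>x. ln (\<pi> x)) has_real_derivative l' x) (at x)" for x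
    unfolding l'_def by (rule field_differentiable_derivI[OF lfd(1)])
  have du: "(u has_real_derivative - l' x) (at x)" for x
    unfolding u_def[abs_def] by (rule DERIV_minus[OF dl])
  have ddl: "(l' has_real_derivative deriv l' x) (at x)" for x
    by (rule field_differentiable_derivI[OF lfd(2)])
  have uc: "continuous_on A u" for A
    by (rule continuous_at_imp_continuous_on) (use du DERIV_isCont in blast)
  have pu: "\<pi> = (\<lambda>x. exp (- u x))" using pos by (auto simp: u_def)
  show cont: "continuous_on UNIV \<pi>" unfolding pu by (intro continuous_intros uc)
  have pm[measurable]: "\<pi> \<in> borel_measurable borel" by (rule borel_measurable_continuous_onI[OF cont])
  have ratio: "\<pi> y / \<pi> x = exp (u x - u y)" for x y
    using pos[of x] pos[of y] by (simp add: u_def exp_diff exp_minus)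
  obtain R0 k p k3 where R0: "1 \<le> R0" and k: "0 < k" and p: "0 < p" "p < 1" and k3: "0 < k3"
    and bd: "\<And>x. R0 \<le> \<bar>x\<bar> \<Longrightarrow> k * \<bar>x\<bar> powr (p - 1) \<le> - (sgn x * l' x)"
      "\<And>x t. R0 \<le> \<bar>x\<bar> \<Longrightarrow> \<bar>t\<bar> \<le> 8 / \<bar>l' x\<bar> \<Longrightarrow> \<bar>deriv l' (x + t)\<bar> \<le> (l' x)\<^sup>2 / 1000"
      "\<And>x. R0 \<le> \<bar>x\<bar> \<Longrightarrow> k3 * \<bar>l' x\<bar> \<le> \<pi> x powr (- (1/4))"
    using one_dim_bounds[OF reg dec, folded l'_def] by (auto simp: Ball_def)
  have right: "k * t powr (p - 1) \<le> - l' t" if "R0 \<le> t" for t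
    using bd(1)[of t] that R0 by simp
  have left: "k * t powr (p - 1) \<le> l' (- t)" if "R0 \<le> t" for t
    using bd(1)[of "- t"] that R0 by (simp add: sgn_if)
  have lneg: "l' t < 0" if "R0 \<le> t" for t
  proof -
    have "0 < k * t powr (p - 1)" using k that R0 by simp
    then show ?thesis using right[OF that] by linarith
  qed
  have lpos: "0 < l' (- t)" if "R0 \<le> t" for t
  proof -
    have "0 < k * t powr (p - 1)" using k that R0 by simp
    then show ?thesis using left[OF that] by linarith
  qed
  have dul: "((\<lambda>t. u (- t)) has_real_derivative l' (- t)) (at t)" for t
    using DERIV_chain2[OF du[of "- t"] DERIV_minus[OF DERIV_ident]] by simp
  have ddul: "((\<lambda>t. l' (- t)) has_real_derivative - deriv l' (- t)) (at t)" for t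
    using DERIV_chain2[OF ddl[of "- t"] DERIV_minus[OF DERIV_ident]] by simp
  show growth: "\<forall>N. \<exists>c>0. \<forall>x. c * (1 + \<bar>x\<bar>) ^ N \<le> lyap \<pi> x"
  proof
    fix N
    have "bounded (u ` {- (2 * R0)..2 * R0})" by (intro compact_imp_bounded compact_continuous_image uc) auto
    then obtain B where Bd: "\<forall>y\<in>{- (2 * R0)..2 * R0}. \<bar>u y\<bar> \<le> B" by (auto simp: bounded_iff)
    have B: "- B \<le> u y" if "\<bar>y\<bar> \<le> 2 * R0" for y
    proof -
      have "y \<in> {- (2 * R0)..2 * R0}" using that by (auto simp: abs_le_iff)
      then have "\<bar>u y\<bar> \<le> B" using Bd by blast
      then show ?thesis by linarith
    qed
    \<comment> \<open>The added term makes the growth bound hold also on the compact middle part,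
      where only \<open>- B \<le> u\<close> is known.\<close>
    define B' where "B' = B + k / 2 * (2 * R0) powr p"
    have far: "- B + k / 2 * t powr p \<le> v t"
      if v: "\<And>t. R0 \<le> t \<Longrightarrow> (v has_real_derivative dv t) (at t)" "\<And>t. R0 \<le> t \<Longrightarrow> k * t powr (p - 1) \<le> dv t"
        and vB: "- B \<le> v R0" and t: "2 * R0 \<le> t" for v dv t
    proof -
      have t0: "0 < t" using t R0 by linarith
      have "v R0 + k * (t - R0) * t powr (p - 1) \<le> v t"
        by (rule potential_gain[OF v R0 less_imp_le[OF k] p(2)]) (use t R0 in auto)
      moreover have "k * (t / 2) * t powr (p - 1) \<le> k * (t - R0) * t powr (p - 1)"
        using k t by (intro mult_right_mono mult_left_mono) auto
      moreover have "k * (t / 2) * t powr (p - 1) = k / 2 * t powr p"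
        using t0 powr_mult_base[of t "p - 1"] by (simp add: mult.assoc)
      ultimately show ?thesis using vB by linarith
    qed
    have uB: "k / 2 * \<bar>x\<bar> powr p - B' \<le> u x" for x
    proof -
      have b0: "0 \<le> k / 2 * (2 * R0) powr p" using k by (intro mult_nonneg_nonneg) auto
      consider "2 * R0 \<le> x" | "2 * R0 \<le> - x" | "\<bar>x\<bar> \<le> 2 * R0" by linarith
      then show ?thesis
      proof cases
        case 1
        have "- B + k / 2 * x powr p \<le> u x" by (rule far[OF du right]) (use 1 R0 B[of R0] in auto)
        then show ?thesis using 1 R0 b0 by (simp add: B'_def)
      next
        case 2
        have "- B + k / 2 * (- x) powr p \<le> u (- (- x))" by (rule far[OF dul left]) (use 2 R0 B[of "- R0"] in auto)
        then show ?thesis using 2 R0 b0 by (simp add: B'_def)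
      next
        case 3
        have "k / 2 * \<bar>x\<bar> powr p \<le> k / 2 * (2 * R0) powr p" using 3 k p by (intro mult_left_mono powr_mono2) auto
        then show ?thesis using B[OF 3] by (simp add: B'_def)
      qed
    qed
    obtain c where c: "0 < c" "\<And>t. 0 \<le> t \<Longrightarrow> c * (1 + t) ^ N \<le> exp (k / 4 * t powr p)"
      using exp_powr_dominates_power[of "k / 4" p N] k p by auto
    have "c * exp (- B' / 2) * (1 + \<bar>x\<bar>) ^ N \<le> lyap \<pi> x" for x
    proof -
      have "c * (1 + \<bar>x\<bar>) ^ N * exp (- B' / 2) \<le> exp (k / 4 * \<bar>x\<bar> powr p) * exp (- B' / 2)"
        by (intro mult_right_mono c(2)) auto
      also have "\<dots> = exp ((k / 2 * \<bar>x\<bar> powr p - B') / 2)" by (simp add: diff_divide_distrib flip: exp_add)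
      also have "\<dots> \<le> exp (u x / 2)" using uB[of x] by simp
      finally show ?thesis using lyap_exp[of \<pi>, OF pos] by (simp add: u_def mult_ac)
    qed
    then show "\<exists>c>0. \<forall>x. c * (1 + \<bar>x\<bar>) ^ N \<le> lyap \<pi> x" using c(1) by (intro exI[of _ "c * exp (- B' / 2)"]) auto
  qed
  \<comment> \<open>Degree 4, because \<open>sqrt V\<close> has to dominate \<open>x^2\<close>: the
    squared slope is at least \<open>k^2 / x^2\<close>, hence at least
    \<open>k^2 sqrt c4 / sqrt V\<close>. The inverse slope is at least \<open>k3 / sqrt V\<close>
    directly.\<close>
  obtain c4 where c4: "0 < c4" "\<And>x. c4 * (1 + \<bar>x\<bar>) ^ 4 \<le> lyap \<pi> x" using growth by blast
  define c5 where "c5 = min k3 (k\<^sup>2 * sqrt c4)"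
  have c5: "0 < c5" using k3 k c4 by (simp add: c5_def)
  have minb: "c5 / sqrt (lyap \<pi> x) \<le> min (\<bar>l' x\<bar>\<^sup>2) (1 / \<bar>l' x\<bar>)" if x: "R0 \<le> \<bar>x\<bar>" and nz: "l' x \<noteq> 0" for x
  proof -
    define S a where "S = sqrt (lyap \<pi> x)" and "a = \<bar>l' x\<bar>"
    have a0: "0 < a" using nz by (simp add: a_def)
    have S0: "0 < S" using pos[of x] by (simp add: S_def lyap_def)
    have "c5 * a \<le> k3 * a" using a0 by (intro mult_right_mono) (auto simp: c5_def)
    also have "\<dots> \<le> S" using bd(3)[OF x] unfolding S_def a_def sqrt_lyap[of \<pi>, OF pos] .
    finally have 1: "c5 / S \<le> 1 / a" using a0 S0 by (simp add: field_simps)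
    have x1: "1 \<le> \<bar>x\<bar>" using x R0 by linarith
    then have "x \<noteq> 0" by auto
    have "k * (1 / \<bar>x\<bar>) \<le> k * \<bar>x\<bar> powr (p - 1)"
    proof (rule mult_left_mono)
      have "\<bar>x\<bar> powr (- 1) \<le> \<bar>x\<bar> powr (p - 1)" using x1 p by (intro powr_mono) auto
      then show "1 / \<bar>x\<bar> \<le> \<bar>x\<bar> powr (p - 1)" using x1 by (simp add: powr_minus_divide)
    qed (use k in simp)
    also have "\<dots> \<le> a" using bd(1)[OF x] by (simp add: a_def sgn_if split: if_splits)
    finally have "(k * (1 / \<bar>x\<bar>))\<^sup>2 \<le> a\<^sup>2" using k by (intro power_mono) auto
    then have ka: "k\<^sup>2 / x\<^sup>2 \<le> a\<^sup>2" by (simp add: power_mult_distrib power_divide)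
    have "sqrt c4 * x\<^sup>2 \<le> S"
    proof -
      have "c4 * \<bar>x\<bar> ^ 4 \<le> c4 * (1 + \<bar>x\<bar>) ^ 4" using c4 by (intro mult_left_mono power_mono) auto
      then have "c4 * \<bar>x\<bar> ^ 4 \<le> lyap \<pi> x" using c4(2)[of x] by linarith
      then have "sqrt (c4 * \<bar>x\<bar> ^ 4) \<le> S" unfolding S_def by (rule real_sqrt_le_mono)
      moreover have "sqrt (\<bar>x\<bar> ^ 4) = x\<^sup>2" by (rule real_sqrt_unique) (simp_all add: power_even_abs flip: power_mult)
      ultimately show ?thesis by (simp add: real_sqrt_mult)
    qed
    then have "k\<^sup>2 * (sqrt c4 * x\<^sup>2) \<le> k\<^sup>2 * S" by (intro mult_left_mono) auto
    then have "k\<^sup>2 * sqrt c4 / S \<le> k\<^sup>2 / x\<^sup>2" using S0 \<open>x \<noteq> 0\<close> by (simp add: divide_le_eq le_divide_eq mult_ac)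
    moreover have "c5 / S \<le> k\<^sup>2 * sqrt c4 / S" using S0 by (intro divide_right_mono) (auto simp: c5_def)
    ultimately have "c5 / S \<le> a\<^sup>2" using ka by linarith
    then show ?thesis using 1 by (simp add: S_def a_def)
  qed
  have q: "prob_density q" and qsym: "\<And>z. q (- z) = q z" and cl: "closure {z. q z \<noteq> 0} = {-1..1}"
    using inc by (auto simp: one_dim_increment_def)
  have qm[measurable]: "q \<in> borel_measurable borel" using q by (simp add: prob_density_def)
  obtain ql qu where ql: "0 < ql" and qb': "\<And>z. z \<in> {-1..1} \<Longrightarrow> ql \<le> q z \<and> q z \<le> qu"
    using inc unfolding one_dim_increment_def by blast
  have qb: "ql \<le> q z \<and> q z \<le> qu" if "\<bar>z\<bar> \<le> 1" for z using qb'[of z] that by (auto simp: abs_le_iff)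
  have qout: "q z = 0" if "1 < \<bar>z\<bar>" for z
  proof (rule ccontr)
    assume "q z \<noteq> 0"
    then have "z \<in> closure {z. q z \<noteq> 0}" by (intro subsetD[OF closure_subset]) simp
    then show False using that unfolding cl by auto
  qed
  have "\<exists>c>0. \<exists>R\<ge>R0. \<forall>x\<ge>R. \<forall>\<sigma>\<ge>\<sigma>0.
    (\<integral>\<^sup>+y. ennreal (metro_fac (exp (u x - u y)) * (1 / \<sigma> * q ((y - x) / \<sigma>))) \<partial>lborel) \<le>
    ennreal (1 - c / \<sigma> * min ((- l' x)\<^sup>2) (1 / (- l' x)))"
  proof (rule one_dim_side_drift[where p = p and k = k and ql = ql and qu = qu, OF du])
    show "((\<lambda>x. - l' x) has_real_derivative - deriv l' x) (at x)" for x by (rule DERIV_minus[OF ddl])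
    show "\<bar>- deriv l' (x + t)\<bar> \<le> (- l' x)\<^sup>2 / 1000" if "R0 \<le> x" "\<bar>t\<bar> \<le> 8 / - l' x" for x t
      using bd(2)[of x t] that lneg[of x] R0 by simp
    show "k * t powr (p - 1) \<le> - (- l' (- t))" if "R0 \<le> t" for t using left[OF that] by simp
  qed (fact R0 k p right q qsym ql qb qout \<sigma>0)+
  then obtain c1 R1 where c1: "0 < c1" "R0 \<le> R1" "\<And>x \<sigma>. R1 \<le> x \<Longrightarrow> \<sigma>0 \<le> \<sigma> \<Longrightarrow>
    (\<integral>\<^sup>+y. ennreal (metro_fac (exp (u x - u y)) * (1 / \<sigma> * q ((y - x) / \<sigma>))) \<partial>lborel) \<le>
    ennreal (1 - c1 / \<sigma> * min ((- l' x)\<^sup>2) (1 / (- l' x)))" by blast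
  \<comment> \<open>The same bound for the potential reflected at 0, which settles negative
    states.\<close>
  have "\<exists>c>0. \<exists>R\<ge>R0. \<forall>x\<ge>R. \<forall>\<sigma>\<ge>\<sigma>0.
    (\<integral>\<^sup>+y. ennreal (metro_fac (exp (u (- x) - u (- y))) * (1 / \<sigma> * q ((y - x) / \<sigma>))) \<partial>lborel) \<le>
    ennreal (1 - c / \<sigma> * min ((l' (- x))\<^sup>2) (1 / l' (- x)))"
  proof (rule one_dim_side_drift[where p = p and k = k and ql = ql and qu = qu, OF dul])
    show "((\<lambda>x. l' (- x)) has_real_derivative - deriv l' (- x)) (at x)" for x by (rule ddul)
    show "\<bar>- deriv l' (- (x + t))\<bar> \<le> (l' (- x))\<^sup>2 / 1000" if "R0 \<le> x" "\<bar>t\<bar> \<le> 8 / l' (- x)" for x t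
      using bd(2)[of "- x" "- t"] that lpos[of x] R0 by simp
    show "k * t powr (p - 1) \<le> - l' (- (- t))" if "R0 \<le> t" for t using right[OF that] by simp
  qed (fact R0 k p left q qsym ql qb qout \<sigma>0)+
  then obtain c2 R2 where c2: "0 < c2" "R0 \<le> R2" "\<And>x \<sigma>. R2 \<le> x \<Longrightarrow> \<sigma>0 \<le> \<sigma> \<Longrightarrow>
    (\<integral>\<^sup>+y. ennreal (metro_fac (exp (u (- x) - u (- y))) * (1 / \<sigma> * q ((y - x) / \<sigma>))) \<partial>lborel) \<le>
    ennreal (1 - c2 / \<sigma> * min ((l' (- x))\<^sup>2) (1 / l' (- x)))" by blast
  define c where "c = min c1 c2 * c5"
  have c: "0 < c" using c1 c2 c5 by (simp add: c_def)
  have "(\<integral>\<^sup>+y. ennreal (metro_fac (\<pi> y / \<pi> x) * (1 / \<sigma> * q ((y - x) / \<sigma>))) \<partial>lborel) \<le>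
      ennreal (1 - c / \<sigma> / sqrt (lyap \<pi> x))" if x: "max R1 R2 \<le> \<bar>x\<bar>" and \<sigma>: "\<sigma>0 \<le> \<sigma>" for x \<sigma>
  proof -
    have s0: "0 < \<sigma>" using \<sigma> \<sigma>0 by linarith
    have m0: "0 \<le> c5 / sqrt (lyap \<pi> x)" using c5 pos[of x] by (simp add: lyap_def)
    have conv: "ennreal (1 - c' / \<sigma> * min (\<bar>l' x\<bar>\<^sup>2) (1 / \<bar>l' x\<bar>)) \<le> ennreal (1 - c / \<sigma> / sqrt (lyap \<pi> x))"
      if "min c1 c2 \<le> c'" "l' x \<noteq> 0" for c'
    proof (rule ennreal_leI)
      have xR: "R0 \<le> \<bar>x\<bar>" using x c1(2) by simp
      have "min c1 c2 / \<sigma> * (c5 / sqrt (lyap \<pi> x)) \<le> c' / \<sigma> * min (\<bar>l' x\<bar>\<^sup>2) (1 / \<bar>l' x\<bar>)"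
        using that s0 m0 c1(1) c2(1) by (intro mult_mono minb xR divide_right_mono) auto
      then show "1 - c' / \<sigma> * min (\<bar>l' x\<bar>\<^sup>2) (1 / \<bar>l' x\<bar>) \<le> 1 - c / \<sigma> / sqrt (lyap \<pi> x)"
        by (simp add: c_def)
    qed
    consider "R1 \<le> x" "0 \<le> x" | "R2 \<le> - x" "x \<le> 0" using x by linarith
    then show ?thesis
    proof cases
      case 1
      have ng: "l' x < 0" by (rule lneg) (use 1 c1(2) in simp)
      have "(\<integral>\<^sup>+y. ennreal (metro_fac (\<pi> y / \<pi> x) * (1 / \<sigma> * q ((y - x) / \<sigma>))) \<partial>lborel) \<le>
        ennreal (1 - c1 / \<sigma> * min ((- l' x)\<^sup>2) (1 / (- l' x)))"
        unfolding ratio by (rule c1(3)[OF 1(1) \<sigma>])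
      also have "(- l' x)\<^sup>2 = \<bar>l' x\<bar>\<^sup>2" by simp
      also have "- l' x = \<bar>l' x\<bar>" using ng by simp
      also have "ennreal (1 - c1 / \<sigma> * min (\<bar>l' x\<bar>\<^sup>2) (1 / \<bar>l' x\<bar>)) \<le> ennreal (1 - c / \<sigma> / sqrt (lyap \<pi> x))"
        by (rule conv) (use ng in auto)
      finally show ?thesis .
    next
      case 2
      have ps: "0 < l' x" using lpos[of "- x"] 2 c2(2) by simp
      have "(\<integral>\<^sup>+y. ennreal (metro_fac (\<pi> y / \<pi> x) * (1 / \<sigma> * q ((y - x) / \<sigma>))) \<partial>lborel) =
        (\<integral>\<^sup>+y. ennreal (metro_fac (\<pi> (0 - y) / \<pi> x) * (1 / \<sigma> * q ((0 - y - x) / \<sigma>))) \<partial>lborel)"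
        by (rule nn_integral_reflect[symmetric]) measurable
      also have "\<dots> = (\<integral>\<^sup>+y. ennreal (metro_fac (exp (u (- (- x)) - u (- y))) * (1 / \<sigma> * q ((y - (- x)) / \<sigma>))) \<partial>lborel)"
      proof (rule nn_integral_cong)
        fix y
        have "0 - y - x = - (y - (- x))" by simp
        then have "(0 - y - x) / \<sigma> = - ((y - (- x)) / \<sigma>)" by (simp only: minus_divide_left)
        then have "q ((0 - y - x) / \<sigma>) = q ((y - (- x)) / \<sigma>)" using qsym by metis
        then show "ennreal (metro_fac (\<pi> (0 - y) / \<pi> x) * (1 / \<sigma> * q ((0 - y - x) / \<sigma>))) =
          ennreal (metro_fac (exp (u (- (- x)) - u (- y))) * (1 / \<sigma> * q ((y - (- x)) / \<sigma>)))"
          unfolding ratio by simp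
      qed
      also have "\<dots> \<le> ennreal (1 - c2 / \<sigma> * min ((l' (- (- x)))\<^sup>2) (1 / l' (- (- x))))"
        by (rule c2(3)[OF 2(1) \<sigma>])
      also have "\<dots> = ennreal (1 - c2 / \<sigma> * min (\<bar>l' x\<bar>\<^sup>2) (1 / \<bar>l' x\<bar>))" using ps by simp
      also have "\<dots> \<le> ennreal (1 - c / \<sigma> / sqrt (lyap \<pi> x))" by (rule conv) (use ps in auto)
      finally show ?thesis .
    qed
  qed
  then show "\<exists>c>0. \<exists>R. \<forall>x. R \<le> \<bar>x\<bar> \<longrightarrow> (\<forall>\<sigma>\<ge>\<sigma>0.
      (\<integral>\<^sup>+y. ennreal (metro_fac (\<pi> y / \<pi> x) * (1 / \<sigma> * q ((y - x) / \<sigma>))) \<partial>lborel) \<le>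
      ennreal (1 - c / \<sigma> / sqrt (lyap \<pi> x)))"
    using c by (intro exI[of _ c] conjI exI[of _ "max R1 R2"]) auto
qed

section \<open>Transfer from the line to vectors with one coordinate\<close>

lemma nn_integral_vec:
  fixes f :: "real^'n \<Rightarrow> ennreal"
  assumes one: "CARD('n) = 1" and [measurable]: "f \<in> borel_measurable borel"
  shows "(\<integral>\<^sup>+x. f x \<partial>lborel) = (\<integral>\<^sup>+t. f (vec t) \<partial>lborel)"
proof -
  obtain i :: 'n where i: "UNIV = {i}" using one by (auto simp: card_1_singleton_iff)
  have all: "j = i" for j :: 'n using i by blast
  have Bi: "Basis = {axis i 1 :: real^'n}" unfolding Basis_vec_def by (simp add: i)
  have "linear (vec :: real \<Rightarrow> real^'n)" by (rule linearI) (simp_all add: vec_eq_iff)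
  then have vm[measurable]: "(vec :: real \<Rightarrow> real^'n) \<in> borel_measurable borel"
    by (intro borel_measurable_continuous_onI linear_continuous_on linear_linear[THEN iffD2])
  have "lborel = distr lborel borel (vec :: real \<Rightarrow> real^'n)"
  proof (rule lborel_eqI)
    fix l u :: "real^'n"
    assume le: "\<And>b. b \<in> Basis \<Longrightarrow> l \<bullet> b \<le> u \<bullet> b"
    have "vec -` box l u = {l $ i<..<u $ i}"
      by (auto simp: mem_box Bi inner_axis)
    moreover have "l $ i \<le> u $ i" using le[of "axis i 1"] by (simp add: Bi inner_axis)
    ultimately show "emeasure (distr lborel borel (vec :: real \<Rightarrow> real^'n)) (box l u) = ennreal (\<Prod>b\<in>Basis. (u - l) \<bullet> b)"
      by (simp add: emeasure_distr Bi inner_axis)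
  qed simp
  then have "(\<integral>\<^sup>+x. f x \<partial>lborel) = (\<integral>\<^sup>+x. f x \<partial>distr lborel borel (vec :: real \<Rightarrow> real^'n))" by simp
  also have "\<dots> = (\<integral>\<^sup>+t. f (vec t) \<partial>lborel)" by (rule nn_integral_distr) simp_all
  finally show ?thesis .
qed

lemma one_dim_drift:
  fixes \<pi> q :: "real^'n \<Rightarrow> real"
  assumes one: "CARD('n) = 1" and e: "0 < \<epsilon>" and q: "prob_density q"
    and cond: "one_dim_conditions (\<lambda>t. \<pi> (vec t)) (\<lambda>t. q (vec t))"
  shows "\<forall>x. 0 < \<pi> x" "continuous_on UNIV \<pi>"
    "\<exists>c>0. \<exists>R. \<forall>\<theta>\<in>Theta. \<forall>x. R \<le> norm x \<longrightarrow>
      (\<integral>\<^sup>+y. ennreal (metro_fac (\<pi> y / \<pi> x) * am_density q \<epsilon> \<theta> (y - x)) \<partial>lborel) \<le>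
      ennreal (1 - c * am_height \<epsilon> \<theta> / sqrt (lyap \<pi> x))"
    "\<forall>N. \<exists>c>0. \<forall>x. c * (1 + norm x) ^ N \<le> lyap \<pi> x"
proof -
  let ?\<sigma> = "am_floor TYPE('n) \<epsilon>"
  have \<sigma>0: "0 < ?\<sigma>" by (rule am_floor_pos[OF e])
  note D = one_dim_real_drift[of "\<lambda>t. \<pi> (vec t)" "\<lambda>t. q (vec t)" ?\<sigma>]
  have reg: "one_dim_regularity (\<lambda>t. \<pi> (vec t))" and dec: "one_dim_decay (\<lambda>t. \<pi> (vec t))"
    and inc: "one_dim_increment (\<lambda>t. q (vec t))" using cond by (auto simp: one_dim_conditions_def)
  note D = D[OF reg dec inc \<sigma>0]
  obtain i :: 'n where i: "UNIV = {i}" using one by (auto simp: card_1_singleton_iff)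
  have all: "j = i" for j :: 'n using i by blast
  have xv: "vec (x $ i) = x" for x :: "real^'n" unfolding vec_eq_iff by (metis all vec_component)
  have nx: "norm x = \<bar>x $ i\<bar>" for x :: "real^'n" by (simp add: norm_vec_def L2_set_def i)
  have pos: "0 < \<pi> x" for x using D(1) xv[of x] by metis
  then show "\<forall>x. 0 < \<pi> x" by blast
  have "continuous_on UNIV (\<lambda>x :: real^'n. \<pi> (vec (x $ i)))"
    by (rule continuous_on_compose2[OF D(2)]) (auto intro!: continuous_intros)
  then show cont: "continuous_on UNIV \<pi>" unfolding xv .
  have pm[measurable]: "\<pi> \<in> borel_measurable borel" by (rule borel_measurable_continuous_onI[OF cont])
  have ly: "lyap (\<lambda>t. \<pi> (vec t)) (x $ i) = lyap \<pi> x" for x by (simp add: lyap_def xv)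
  show "\<forall>N. \<exists>c>0. \<forall>x. c * (1 + norm x) ^ N \<le> lyap \<pi> x"
    unfolding nx ly[symmetric] using D(4) by meson
  obtain c R where c: "0 < c" and dr: "\<And>x \<sigma>. R \<le> \<bar>x\<bar> \<Longrightarrow> ?\<sigma> \<le> \<sigma> \<Longrightarrow>
      (\<integral>\<^sup>+y. ennreal (metro_fac (\<pi> (vec y) / \<pi> (vec x)) * (1 / \<sigma> * q (vec ((y - x) / \<sigma>)))) \<partial>lborel) \<le>
      ennreal (1 - c / \<sigma> / sqrt (lyap (\<lambda>t. \<pi> (vec t)) x))" using D(3) by blast
  have "(\<integral>\<^sup>+y. ennreal (metro_fac (\<pi> y / \<pi> x) * am_density q \<epsilon> \<theta> (y - x)) \<partial>lborel) \<le>
      ennreal (1 - c * am_height \<epsilon> \<theta> / sqrt (lyap \<pi> x))" if th: "\<theta> \<in> Theta" and x: "R \<le> norm x" for \<theta> :: "'n param" and x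
  proof (rule am_density_one_dim[OF one e th])
    fix s assume s: "?\<sigma> \<le> s" "am_height \<epsilon> \<theta> = 1 / s"
      and dens: "\<And>q t. am_density q \<epsilon> \<theta> (vec t) = 1 / s * q (vec (t / s))"
    have [measurable]: "am_density q \<epsilon> \<theta> \<in> borel_measurable borel"
      using prob_density_am_density[OF e th q] by (simp add: prob_density_def)
    have "(\<integral>\<^sup>+y. ennreal (metro_fac (\<pi> y / \<pi> x) * am_density q \<epsilon> \<theta> (y - x)) \<partial>lborel) =
      (\<integral>\<^sup>+t. ennreal (metro_fac (\<pi> (vec t) / \<pi> x) * am_density q \<epsilon> \<theta> (vec t - x)) \<partial>lborel)"
      by (rule nn_integral_vec[OF one]) measurable
    also have "\<dots> = (\<integral>\<^sup>+t. ennreal (metro_fac (\<pi> (vec t) / \<pi> (vec (x $ i))) * (1 / s * q (vec ((t - x $ i) / s)))) \<partial>lborel)"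
    proof (rule nn_integral_cong)
      fix t
      have "vec t - x = vec (t - x $ i)" unfolding vec_eq_iff by (metis all vec_component vector_minus_component)
      then show "ennreal (metro_fac (\<pi> (vec t) / \<pi> x) * am_density q \<epsilon> \<theta> (vec t - x)) =
        ennreal (metro_fac (\<pi> (vec t) / \<pi> (vec (x $ i))) * (1 / s * q (vec ((t - x $ i) / s))))"
        by (simp only: dens xv)
    qed
    also have "\<dots> \<le> ennreal (1 - c / s / sqrt (lyap (\<lambda>t. \<pi> (vec t)) (x $ i)))"
      by (rule dr[OF _ s(1)]) (use x nx in simp)
    finally show ?thesis unfolding ly s(2) by simp
  qed
  then show "\<exists>c>0. \<exists>R. \<forall>\<theta>\<in>Theta. \<forall>x. R \<le> norm x \<longrightarrow>
      (\<integral>\<^sup>+y. ennreal (metro_fac (\<pi> y / \<pi> x) * am_density q \<epsilon> \<theta> (y - x)) \<partial>lborel) \<le>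
      ennreal (1 - c * am_height \<epsilon> \<theta> / sqrt (lyap \<pi> x))"
    using c by (intro exI[of _ c] conjI exI[of _ R]) auto
qed

section \<open>Drift of the joint process\<close>

lemma powr_convex_combination:
  fixes a b g p :: real
  assumes "0 \<le> a" "0 \<le> b" "0 \<le> g" "g \<le> 1" "1 \<le> p"
  shows "((1 - g) * a + g * b) powr p \<le> (1 - g) * a powr p + g * b powr p"
proof (cases "a = 0 \<or> b = 0")
  case False
  then show ?thesis
    using convex_onD[OF powr_convex[OF assms(5)], of g a b] assms by simp
next
  case True
  have le: "(s * c) powr p \<le> s * c powr p" if "0 \<le> s" "s \<le> 1" "0 \<le> c" for s c
  proof -
    have "s powr p \<le> s" using that assms(5) powr_mono'[of 1 p s] by (cases "s = 0") auto
    then show ?thesis using that by (simp add: powr_mult mult_right_mono)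
  qed
  from True show ?thesis
    using le[of "1 - g" a] le[of g b] assms by auto
qed

lemma norm_outer: "norm (outer v w :: real^'n^'n) = norm v * norm w"
proof -
  have "norm (outer v w $ i) = \<bar>v $ i\<bar> * norm w" for i
  proof -
    have "outer v w $ i = (v $ i) *\<^sub>R w" by (simp add: outer_def vec_eq_iff)
    then show ?thesis by simp
  qed
  then have "norm (outer v w) = L2_set (\<lambda>i. \<bar>v $ i\<bar> * norm w) UNIV"
    by (simp add: norm_vec_def[of "outer v w"])
  also have "\<dots> = norm v * norm w"
    by (simp add: norm_vec_def[of v] L2_set_left_distrib)
  finally show ?thesis .
qed

text \<open>An exponent above 2 absorbs the square with an arbitrarily small factor. This is why
  \<open>\<mu>\<close> enters the weight with exponent \<open>2 + e\<close>: the update of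
  \<open>\<Gamma>\<close> contains \<open>|y - \<mu>|^2\<close>.\<close>

lemma square_le_powr:
  fixes p \<kappa> :: real
  assumes p: "2 < p" and \<kappa>: "0 < \<kappa>"
  shows "\<exists>C\<ge>0. \<forall>t\<ge>0. 2 * t\<^sup>2 \<le> \<kappa> * t powr p + C"
proof -
  define T where "T = (2 / \<kappa>) powr (1 / (p - 2))"
  have "2 * t\<^sup>2 \<le> \<kappa> * t powr p + 2 * T\<^sup>2" if t: "0 \<le> t" for t
  proof (cases "t \<le> T")
    case True
    then have "t\<^sup>2 \<le> T\<^sup>2" using t by (intro power_mono) auto
    moreover have "0 \<le> \<kappa> * t powr p" using \<kappa> by simp
    ultimately show ?thesis by linarith
  next
    case False
    have T0: "0 < T" using \<kappa> by (simp add: T_def)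
    have "2 / \<kappa> = T powr (p - 2)" using p \<kappa> by (simp add: T_def powr_powr)
    also have "\<dots> \<le> t powr (p - 2)" using False T0 p by (intro powr_mono2) auto
    finally have "2 \<le> \<kappa> * t powr (p - 2)" using \<kappa> by (simp add: pos_divide_le_eq mult.commute)
    then have "2 * t\<^sup>2 \<le> \<kappa> * t powr (p - 2) * t\<^sup>2" by (intro mult_right_mono) auto
    also have "\<kappa> * t powr (p - 2) * t\<^sup>2 = \<kappa> * t powr p"
    proof -
      have "t powr (p - 2) * t powr real 2 = t powr p" by (simp flip: powr_add)
      moreover have "t powr real 2 = t\<^sup>2" using False T0 by (intro powr_realpow) linarith
      ultimately show ?thesis by simp
    qed
    finally show ?thesis by (simp add: add_increasing2)
  qed
  then show ?thesis by (intro exI[of _ "2 * T\<^sup>2"]) auto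
qed

text \<open>Both components of the parameter move by convex combination, so the weight contracts by
  \<open>1 - g\<close> up to the new contributions. The part of \<open>|y - \<mu>|^2\<close> that
  depends on \<open>\<mu>\<close> is charged to the weight with the small factor \<kappa>, the rest
  to a power of \<open>|y|\<close>.\<close>

lemma am_weight_update:
  fixes e \<kappa> :: real
  assumes e: "0 < e" and \<kappa>: "0 < \<kappa>"
  shows "\<exists>C\<ge>0. \<forall>(\<theta> :: 'n::finite param) y g. 0 < g \<longrightarrow> g < 1 \<longrightarrow>
    am_weight e (am_update g \<theta> y) \<le> (1 - g * (1 - \<kappa>)) * am_weight e \<theta> + g * (C * (1 + norm y powr (2 + e)))"
proof -
  obtain C where C: "0 \<le> C" "\<And>t. 0 \<le> t \<Longrightarrow> 2 * t\<^sup>2 \<le> \<kappa> * t powr (2 + e) + C"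
    using square_le_powr[of "2 + e" \<kappa>] e \<kappa> by auto
  have "am_weight e (am_update g \<theta> y) \<le> (1 - g * (1 - \<kappa>)) * am_weight e \<theta> + g * ((C + 3) * (1 + norm y powr (2 + e)))"
    if g: "0 < g" "g < 1" for \<theta> :: "'n param" and y g
  proof -
    obtain \<mu> \<Gamma> where th: "\<theta> = (\<mu>, \<Gamma>)" by (cases \<theta>)
    let ?p = "2 + e"
    have "norm (\<mu> + g *\<^sub>R (y - \<mu>)) = norm ((1 - g) *\<^sub>R \<mu> + g *\<^sub>R y)" by (simp add: algebra_simps)
    also have "\<dots> \<le> (1 - g) * norm \<mu> + g * norm y"
      using norm_triangle_ineq[of "(1 - g) *\<^sub>R \<mu>" "g *\<^sub>R y"] g by simp
    finally have "norm (\<mu> + g *\<^sub>R (y - \<mu>)) powr ?p \<le> ((1 - g) * norm \<mu> + g * norm y) powr ?p"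
      using e by (intro powr_mono2) auto
    also have "\<dots> \<le> (1 - g) * norm \<mu> powr ?p + g * norm y powr ?p"
      using g e by (intro powr_convex_combination) auto
    finally have 1: "norm (\<mu> + g *\<^sub>R (y - \<mu>)) powr ?p \<le> (1 - g) * norm \<mu> powr ?p + g * norm y powr ?p" .
    have "norm (\<Gamma> + g *\<^sub>R (outer (y - \<mu>) (y - \<mu>) - \<Gamma>)) = norm ((1 - g) *\<^sub>R \<Gamma> + g *\<^sub>R outer (y - \<mu>) (y - \<mu>))"
      by (simp add: algebra_simps)
    also have "\<dots> \<le> (1 - g) * norm \<Gamma> + g * (norm (y - \<mu>))\<^sup>2"
      using norm_triangle_ineq[of "(1 - g) *\<^sub>R \<Gamma>" "g *\<^sub>R outer (y - \<mu>) (y - \<mu>)"] g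
      by (simp add: norm_outer power2_eq_square)
    finally have 2: "norm (\<Gamma> + g *\<^sub>R (outer (y - \<mu>) (y - \<mu>) - \<Gamma>)) \<le> (1 - g) * norm \<Gamma> + g * (norm (y - \<mu>))\<^sup>2" .
    have "(norm (y - \<mu>))\<^sup>2 \<le> (norm y + norm \<mu>)\<^sup>2" by (intro power_mono norm_triangle_ineq4) auto
    also have "\<dots> \<le> 2 * (norm y)\<^sup>2 + 2 * (norm \<mu>)\<^sup>2"
      using sum_squares_bound[of "norm y" "norm \<mu>"] by (simp add: power2_sum)
    also have "(norm y)\<^sup>2 \<le> 1 + norm y powr ?p"
    proof (cases "norm y \<le> 1")
      case True
      then have "(norm y)\<^sup>2 \<le> 1" by (simp add: power_le_one)
      then show ?thesis by (simp add: add_increasing2)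
    next
      case False
      then have "norm y powr real 2 \<le> norm y powr ?p" using e by (intro powr_mono) auto
      moreover have "norm y powr real 2 = (norm y)\<^sup>2" using False by (intro powr_realpow) linarith
      ultimately show ?thesis by linarith
    qed
    finally have 3: "(norm (y - \<mu>))\<^sup>2 \<le> 2 * (1 + norm y powr ?p) + (\<kappa> * norm \<mu> powr ?p + C)"
      using C(2)[of "norm \<mu>"] by simp
    have nn: "0 \<le> norm y powr ?p" "0 \<le> norm \<mu> powr ?p" by simp_all
    have "am_weight e (am_update g \<theta> y) \<le> 1 + ((1 - g) * norm \<mu> powr ?p + g * norm y powr ?p) +
        ((1 - g) * norm \<Gamma> + g * (2 * (1 + norm y powr ?p) + (\<kappa> * norm \<mu> powr ?p + C)))"
      unfolding am_weight_def am_update_def th case_prod_conv fst_conv snd_conv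
      using 1 2 mult_left_mono[OF 3, of g] g by linarith
    also have "\<dots> = (1 - g) * am_weight e \<theta> + g * (\<kappa> * norm \<mu> powr ?p) + g * (3 + C + 3 * norm y powr ?p)"
      by (simp add: am_weight_def th algebra_simps)
    also have "\<dots> \<le> (1 - g) * am_weight e \<theta> + g * (\<kappa> * am_weight e \<theta>) + g * ((C + 3) * (1 + norm y powr ?p))"
    proof (intro add_mono mult_left_mono order_refl)
      show "norm \<mu> powr ?p \<le> am_weight e \<theta>" by (simp add: am_weight_def th)
      have "0 \<le> C * norm y powr ?p" using C(1) by simp
      then show "3 + C + 3 * norm y powr ?p \<le> (C + 3) * (1 + norm y powr ?p)" by (simp add: algebra_simps)
    qed (use g \<kappa> in auto)
    also have "\<dots> = (1 - g * (1 - \<kappa>)) * am_weight e \<theta> + g * ((C + 3) * (1 + norm y powr ?p))"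
      by (simp add: algebra_simps)
    finally show ?thesis .
  qed
  then show ?thesis using C(1) by (intro exI[of _ "C + 3"]) auto
qed

lemma linear_le_square:
  fixes A c X :: real
  assumes "0 < c"
  shows "A * X \<le> A\<^sup>2 / (4 * c) + c * X\<^sup>2"
proof -
  have "0 \<le> (2 * c * X - A)\<^sup>2" by simp
  then have "4 * c * (A * X) \<le> A\<^sup>2 + 4 * c * (c * X\<^sup>2)" by (simp add: power2_diff power_mult_distrib power2_eq_square algebra_simps)
  then have "A * X \<le> (A\<^sup>2 + 4 * c * (c * X\<^sup>2)) / (4 * c)" using assms by (simp add: pos_le_divide_eq mult_ac)
  then show ?thesis using assms by (simp add: add_divide_distrib)
qed

text \<open>Whichever of \<open>w\<close> and \<open>V\<close> is dominant provides enough negative drift; a large \<open>w\<close> slows the chain down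
  only by a power of \<open>w\<close>.\<close>

lemma drift_balance:
  fixes \<delta> c A :: real and n :: nat
  assumes \<delta>: "0 < \<delta>" and c: "0 < c" and A: "0 \<le> A" and n: "0 < n"
  defines "t \<equiv> 1 / (8 * real n)"
  shows "\<exists>K\<ge>0. \<forall>w\<ge>1. \<forall>V>0.
    - \<delta> * w + A * V powr t - c * w powr (- real n / 2) * sqrt V \<le> K - \<delta> / 2 * w - V powr t"
proof -
  \<comment> \<open>\<open>A + 1\<close> in place of A, because one unit of \<open>V powr t\<close>
    is to remain as negative drift. The two fractions are the errors of completing the square in the
    two nontrivial cases.\<close>
  define K where "K = (A + 1) + (A + 1)\<^sup>2 / (4 * c) + (A + 1)\<^sup>2 / (4 * (\<delta> / 2))"
  have t: "0 < t" "t \<le> 1 / 8" "t = 1 / (4 * real n) / 2" using n by (auto simp: t_def field_simps)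
  have "(A + 1) * V powr t \<le> K + \<delta> / 2 * w + c * w powr (- real n / 2) * sqrt V" if w: "1 \<le> w" and V: "0 < V" for w V
  proof -
    have K1: "A + 1 \<le> K" "(A + 1)\<^sup>2 / (4 * c) \<le> K" "(A + 1)\<^sup>2 / (4 * (\<delta> / 2)) \<le> K"
      using \<delta> c A by (auto simp: K_def add_nonneg_nonneg)
    define P Q where "P = \<delta> / 2 * w" and "Q = c * (w powr (- real n / 2) * sqrt V)"
    have n1: "0 \<le> P" "0 \<le> Q" using \<delta> c w V by (auto simp: P_def Q_def)
    have goal: "(A + 1) * V powr t \<le> K + P + Q \<Longrightarrow> ?thesis" by (simp only: P_def Q_def mult.assoc)
    \<comment> \<open>If \<open>w powr (n / 2)\<close> is at most \<open>V powr (1/4)\<close>, the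
      slowed drift is still at least \<open>c * V powr (1/4)\<close> and beats
      \<open>V powr (1/8)\<close>. Otherwise w exceeds \<open>V powr (1 / (2 n))\<close> and beats
      \<open>V powr (1 / (4 n))\<close>. Both exponents bound t from above.\<close>
    consider "V \<le> 1" | "1 < V" "w powr (real n / 2) \<le> V powr (1/4)" | "1 < V" "V powr (1/4) < w powr (real n / 2)" by linarith
    then show ?thesis
    proof cases
      case 1
      then have "V powr t \<le> 1" using V t by (simp add: powr_le1)
      then have "(A + 1) * V powr t \<le> (A + 1) * 1" using A by (intro mult_left_mono) auto
      also have "(A + 1) * 1 \<le> K" using K1 by simp
      finally show ?thesis using n1 by (intro goal) linarith
    next
      case 2
      have "V powr t \<le> V powr (1/8)" using 2 t by (intro powr_mono) auto
      then have "(A + 1) * V powr t \<le> (A + 1) * V powr (1/8)" using A by (intro mult_left_mono) auto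
      also have "\<dots> \<le> (A + 1)\<^sup>2 / (4 * c) + c * (V powr (1/8))\<^sup>2" by (rule linear_le_square[OF c])
      also have "(V powr (1/8))\<^sup>2 = V powr (1/4)" using V by (simp add: power2_eq_square flip: powr_add)
      finally have "(A + 1) * V powr t \<le> (A + 1)\<^sup>2 / (4 * c) + c * V powr (1/4)" .
      moreover have "c * V powr (1/4) \<le> Q"
        unfolding Q_def
      proof (rule mult_left_mono)
        have "V powr (1/4) * w powr (real n / 2) \<le> V powr (1/4) * V powr (1/4)"
          using 2 by (intro mult_left_mono) auto
        also have "\<dots> = sqrt V" using V by (simp add: powr_half_sqrt flip: powr_add)
        finally have "V powr (1/4) \<le> sqrt V / w powr (real n / 2)" using w by (simp add: pos_le_divide_eq)
        then show "V powr (1/4) \<le> w powr (- real n / 2) * sqrt V"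
          by (simp add: powr_minus_divide)
      qed (use c in simp)
      ultimately show ?thesis using K1 n1 by (intro goal) linarith
    next
      case 3
      have Vw: "V powr (1 / (2 * real n)) \<le> w"
      proof -
        have "V powr (1 / (2 * real n)) = (V powr (1/4)) powr (2 / real n)" using n by (simp add: powr_powr field_simps)
        also have "\<dots> \<le> (w powr (real n / 2)) powr (2 / real n)" using 3 by (intro powr_mono2) auto
        also have "\<dots> = w" using n w by (simp add: powr_powr)
        finally show ?thesis .
      qed
      have "V powr t \<le> V powr (1 / (4 * real n))" using 3 n by (intro powr_mono) (auto simp: t_def field_simps)
      then have "(A + 1) * V powr t \<le> (A + 1) * V powr (1 / (4 * real n))" using A by (intro mult_left_mono) auto
      also have "\<dots> \<le> (A + 1)\<^sup>2 / (4 * (\<delta> / 2)) + \<delta> / 2 * (V powr (1 / (4 * real n)))\<^sup>2"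
        by (rule linear_le_square) (use \<delta> in simp)
      also have "(V powr (1 / (4 * real n)))\<^sup>2 = V powr (1 / (2 * real n))"
        using V by (simp add: power2_eq_square flip: powr_add)
      finally have "(A + 1) * V powr t \<le> (A + 1)\<^sup>2 / (4 * (\<delta> / 2)) + \<delta> / 2 * V powr (1 / (2 * real n))" .
      moreover have "\<delta> / 2 * V powr (1 / (2 * real n)) \<le> P"
        unfolding P_def using Vw \<delta> by (intro mult_left_mono) auto
      ultimately show ?thesis using K1 n1 by (intro goal) linarith
    qed
  qed
  moreover have "0 \<le> K" using A c \<delta> by (simp add: K_def)
  ultimately show ?thesis
    by (intro exI[of _ K]) (fastforce simp: algebra_simps)
qed

text \<open>A move with ratio \<open>\<rho> < 1\<close> is accepted with probability \<rho> and
  multiplies \<open>V powr t\<close> by \<open>\<rho> powr (- t / 2)\<close>, a product of at most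
  1; moves with ratio at least 1 do not increase V. The bound is uniform over proposals, so this
  power of V can pay for the growth of the weight.\<close>

lemma lyap_powr_step:
  fixes \<pi> r :: "real^'n \<Rightarrow> real"
  assumes pos: "\<And>x. 0 < \<pi> x" and pim[measurable]: "\<pi> \<in> borel_measurable borel" and r: "prob_density r"
    and t: "0 \<le> t" "t \<le> 1"
  shows "(\<integral>\<^sup>+y. ennreal (lyap \<pi> y powr t) \<partial>rwm_kernel \<pi> r x) \<le> 2 * ennreal (lyap \<pi> x powr t)"
proof (rule nn_integral_rwm_kernel_le[OF pos pim r])
  have Vpos: "0 < lyap \<pi> x" for x using pos[of x] by (simp add: lyap_def)
  have [measurable]: "lyap \<pi> \<in> borel_measurable borel" unfolding lyap_def[abs_def] by measurable
  show "(\<lambda>y. ennreal (lyap \<pi> y powr t)) \<in> borel_measurable borel" by measurable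
  fix y
  note a = accept_bounds[of \<pi> x y, OF pos]
  have "accept \<pi> x y * lyap \<pi> y powr t \<le> lyap \<pi> x powr t"
  proof (cases "\<pi> x \<le> \<pi> y")
    case True
    then have "lyap \<pi> y \<le> lyap \<pi> x" using pos[of x] by (simp add: lyap_def frac_le)
    then have "lyap \<pi> y powr t \<le> lyap \<pi> x powr t" using Vpos[of y] t by (intro powr_mono2) auto
    moreover have "accept \<pi> x y * lyap \<pi> y powr t \<le> lyap \<pi> y powr t"
      using a by (simp add: mult_left_le_one_le)
    ultimately show ?thesis by linarith
  next
    case False
    define \<rho> where "\<rho> = \<pi> y / \<pi> x"
    have \<rho>: "0 < \<rho>" "\<rho> < 1" using False pos[of x] pos[of y] by (auto simp: \<rho>_def)
    have "lyap \<pi> y = lyap \<pi> x / sqrt \<rho>"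
      using pos[of x] pos[of y] by (simp add: lyap_def \<rho>_def real_sqrt_divide)
    then have "\<rho> * lyap \<pi> y powr t = \<rho> / sqrt \<rho> powr t * lyap \<pi> x powr t"
      using Vpos[of x] \<rho> by (simp add: powr_divide)
    also have "\<dots> \<le> 1 * lyap \<pi> x powr t"
    proof (rule mult_right_mono)
      have "sqrt \<rho> powr 1 \<le> sqrt \<rho> powr t" using \<rho> t by (intro powr_mono') auto
      moreover have "\<rho> \<le> sqrt \<rho>" using \<rho> by (intro real_le_rsqrt) (simp add: power2_eq_square mult_left_le_one_le)
      ultimately have "\<rho> \<le> sqrt \<rho> powr t" using \<rho> by simp
      then show "\<rho> / sqrt \<rho> powr t \<le> 1" using \<rho> by (simp add: divide_le_eq)
    qed simp
    moreover have "accept \<pi> x y = \<rho>" using \<rho> by (simp add: accept_def \<rho>_def[symmetric])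
    ultimately show ?thesis by simp
  qed
  then show "ennreal (accept \<pi> x y) * ennreal (lyap \<pi> y powr t) \<le> ennreal (lyap \<pi> x powr t)"
    using a by (simp add: ennreal_mult[symmetric] ennreal_leI)
qed

text \<open>Outside the ball \<open>V (1 - c h / sqrt V)\<close> is \<open>V - c h sqrt V\<close>.
  Inside, V is bounded and at most doubles in the mean, which the constant b covers.\<close>

lemma lyap_drift:
  fixes \<pi> q :: "real^'n \<Rightarrow> real"
  assumes e: "0 < \<epsilon>" "\<epsilon> < 1" and q: "prob_density q" and pos: "\<And>x. 0 < \<pi> x"
    and cont: "continuous_on UNIV \<pi>" and c: "0 < c"
    and drift: "\<And>\<theta> x. \<theta> \<in> Theta \<Longrightarrow> R \<le> norm x \<Longrightarrow>
      (\<integral>\<^sup>+y. ennreal (metro_fac (\<pi> y / \<pi> x) * am_density q \<epsilon> \<theta> (y - x)) \<partial>lborel) \<le>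
      ennreal (1 - c * am_height \<epsilon> \<theta> / sqrt (lyap \<pi> x))"
  shows "\<exists>c>0. \<exists>b\<ge>0. \<forall>\<theta>\<in>Theta. \<forall>x.
    (\<integral>\<^sup>+y. ennreal (lyap \<pi> y) \<partial>rwm_kernel \<pi> (am_density q \<epsilon> \<theta>) x) \<le>
    ennreal (lyap \<pi> x - c * (1 + norm (snd \<theta>)) powr (- real CARD('n) / 2) * sqrt (lyap \<pi> x) + b)"
proof -
  have pim[measurable]: "\<pi> \<in> borel_measurable borel" by (rule borel_measurable_continuous_onI[OF cont])
  have Vpos: "0 < lyap \<pi> x" for x using pos[of x] by (simp add: lyap_def)
  have Vcont: "continuous_on UNIV (lyap \<pi>)"
  proof -
    have "sqrt (\<pi> x) \<noteq> 0" for x using pos[of x] by simp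
    then show ?thesis
      unfolding lyap_def[abs_def] by (intro continuous_on_divide continuous_on_const continuous_on_real_sqrt cont) simp
  qed
  have Vm[measurable]: "lyap \<pi> \<in> borel_measurable borel" by (rule borel_measurable_continuous_onI[OF Vcont])
  obtain h where h: "0 < h" "\<And>\<theta>. (\<theta> :: 'n param) \<in> Theta \<Longrightarrow> h * (1 + norm (snd \<theta>)) powr (- real CARD('n) / 2) \<le> am_height \<epsilon> \<theta>"
    by (rule am_height_lower[OF e]) (rule that)
  have "bounded (lyap \<pi> ` cball 0 R)"
    by (intro compact_imp_bounded compact_continuous_image continuous_on_subset[OF Vcont]) auto
  then obtain B where "\<forall>x\<in>cball 0 R. \<bar>lyap \<pi> x\<bar> \<le> B" by (auto simp: bounded_iff)
  then have B: "lyap \<pi> x \<le> max B 0" if "norm x \<le> R" for x using that by (auto simp: abs_le_iff le_max_iff_disj)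
  \<comment> \<open>On the ball this covers the doubling of V as well as the negative term, whose
    coefficient is at most \<open>c h\<close> there.\<close>
  define b where "b = max B 0 + c * h * sqrt (max B 0)"
  have b: "0 \<le> b" using c h by (simp add: b_def)
  have "(\<integral>\<^sup>+y. ennreal (lyap \<pi> y) \<partial>rwm_kernel \<pi> (am_density q \<epsilon> \<theta>) x) \<le>
    ennreal (lyap \<pi> x - c * h * (1 + norm (snd \<theta>)) powr (- real CARD('n) / 2) * sqrt (lyap \<pi> x) + b)"
    if th: "\<theta> \<in> Theta" for \<theta> :: "'n param" and x
  proof -
    let ?V = "lyap \<pi> x" and ?k = "(1 + norm (snd \<theta>)) powr (- real CARD('n) / 2)"
    have r: "prob_density (am_density q \<epsilon> \<theta>)" by (rule prob_density_am_density[OF e(1) th q])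
    show ?thesis
    proof (cases "R \<le> norm x")
      case True
      have "(\<integral>\<^sup>+y. ennreal (lyap \<pi> y) \<partial>rwm_kernel \<pi> (am_density q \<epsilon> \<theta>) x) \<le>
          ennreal ?V * ennreal (1 - c * am_height \<epsilon> \<theta> / sqrt ?V)"
        unfolding nn_integral_lyap[OF pos pim r] by (intro mult_left_mono drift th True) simp
      also have "\<dots> = ennreal (?V * (1 - c * am_height \<epsilon> \<theta> / sqrt ?V))"
        using Vpos[of x] by (cases "0 \<le> 1 - c * am_height \<epsilon> \<theta> / sqrt ?V")
          (auto simp: ennreal_mult ennreal_neg mult_nonneg_nonpos)
      also have "\<dots> \<le> ennreal (?V - c * h * ?k * sqrt ?V + b)"
      proof (rule ennreal_leI)
        have "?V * (1 - c * am_height \<epsilon> \<theta> / sqrt ?V) = ?V - c * am_height \<epsilon> \<theta> * (?V / sqrt ?V)"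
          by (simp add: algebra_simps)
        also have "?V / sqrt ?V = sqrt ?V" using Vpos[of x] by (simp add: real_div_sqrt)
        also have "c * h * ?k * sqrt ?V \<le> c * am_height \<epsilon> \<theta> * sqrt ?V"
          using h(2)[OF th] c Vpos[of x] by (intro mult_right_mono) (auto simp: mult.assoc)
        then have "?V - c * am_height \<epsilon> \<theta> * sqrt ?V \<le> ?V - c * h * ?k * sqrt ?V + b" using b by linarith
        finally show "?V * (1 - c * am_height \<epsilon> \<theta> / sqrt ?V) \<le> ?V - c * h * ?k * sqrt ?V + b" .
      qed
      finally show ?thesis .
    next
      case False
      have "(\<integral>\<^sup>+y. ennreal (lyap \<pi> y) \<partial>rwm_kernel \<pi> (am_density q \<epsilon> \<theta>) x) \<le> 2 * ennreal ?V"
        using lyap_powr_step[OF pos pim r, of 1 x] Vpos by (simp add: less_imp_le)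
      also have "\<dots> = ennreal (?V + ?V)" unfolding mult_2 by (rule ennreal_plus[symmetric]) (use Vpos[of x] in simp_all)
      also have "\<dots> \<le> ennreal (?V - c * h * ?k * sqrt ?V + b)"
      proof (rule ennreal_leI)
        have VB: "?V \<le> max B 0" by (rule B) (use False in simp)
        have "?k \<le> (1 + norm (snd \<theta>)) powr 0" by (intro powr_mono) auto
        moreover have "1 + norm (snd \<theta>) \<noteq> 0" using norm_ge_zero[of "snd \<theta>"] by linarith
        ultimately have "?k \<le> 1" by simp
        then have "c * h * ?k * sqrt ?V \<le> c * h * 1 * sqrt (max B 0)"
          using VB c h Vpos[of x] by (intro mult_mono) auto
        then show "?V + ?V \<le> ?V - c * h * ?k * sqrt ?V + b" using VB by (simp add: b_def)
      qed
      finally show ?thesis .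
    qed
  qed
  then show ?thesis using c h b by (intro exI[of _ "c * h"]) auto
qed

text \<open>The drift of the joint potential holds for every parameter and state from a fixed index
  on. Its constants involve no starting point, and so M and R serve all of them.\<close>

lemma am_recurrence:
  fixes \<pi> q :: "real^'n \<Rightarrow> real" and \<gamma> :: "nat \<Rightarrow> real"
  assumes e: "0 < \<epsilon>" "\<epsilon> < 1" and q: "prob_density q" and pos: "\<And>x. 0 < \<pi> x"
    and cont: "continuous_on UNIV \<pi>" and g: "\<And>i. 1 \<le> i \<Longrightarrow> 0 < \<gamma> i \<and> \<gamma> i < 1"
    and c0: "0 < c0"
    and drift: "\<And>\<theta> x. \<theta> \<in> Theta \<Longrightarrow> R0 \<le> norm x \<Longrightarrow>
      (\<integral>\<^sup>+y. ennreal (metro_fac (\<pi> y / \<pi> x) * am_density q \<epsilon> \<theta> (y - x)) \<partial>lborel) \<le>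
      ennreal (1 - c0 * am_height \<epsilon> \<theta> / sqrt (lyap \<pi> x))"
    and growth: "\<And>N. \<exists>c>0. \<forall>x. c * (1 + norm x) ^ N \<le> lyap \<pi> x"
    and lim: "limsup (\<lambda>i. ereal (1 / \<gamma> (Suc i) - 1 / \<gamma> i)) < 1"
    and ee: "0 < ee"
  shows "\<exists>M>0. \<exists>R>0. \<forall>\<theta>\<in>Theta. \<forall>x.
    measure (am_law \<pi> q \<epsilon> \<gamma> \<theta> x)
      (\<Inter>k. \<Union>i\<in>{k..}. {\<omega> \<in> space (am_law \<pi> q \<epsilon> \<gamma> \<theta> x).
         (am_param \<gamma> \<theta> \<omega> i, \<omega> i) \<in> am_sublevel ee M \<times> ball 0 R}) = 1"
proof -
  have pim[measurable]: "\<pi> \<in> borel_measurable borel" by (rule borel_measurable_continuous_onI[OF cont])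
  have Vpos: "0 < lyap \<pi> x" for x using pos[of x] by (simp add: lyap_def)
  have Vm[measurable]: "lyap \<pi> \<in> borel_measurable borel" unfolding lyap_def[abs_def] by measurable
  let ?n = "CARD('n)" and ?w = "am_weight ee" and ?p = "2 + ee"
  obtain r where r: "limsup (\<lambda>i. ereal (1 / \<gamma> (Suc i) - 1 / \<gamma> i)) < ereal r" "ereal r < 1"
    using ereal_dense2[OF lim] by blast
  \<comment> \<open>Kept positive, since it multiplies the weight in upper bounds, and still below
    1.\<close>
  define la where "la = max r (1/2)"
  have la: "0 < la" "la < 1" "r \<le> la" using r(2) by (auto simp: la_def)
  obtain i1 where i1: "\<And>i. i1 \<le> i \<Longrightarrow> 1 / \<gamma> (Suc i) - 1 / \<gamma> i < r"
    using Limsup_lessD[OF r(1)] by (auto simp: eventually_sequentially)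
  \<comment> \<open>Half of the margin \<open>1 - la\<close>: the update contributes
    \<open>- (1 - \<delta>) w\<close>, the growth of the reciprocal stepsize at most
    \<open>la w\<close>, and \<open>- \<delta> w\<close> remains.\<close>
  define \<delta> where "\<delta> = (1 - la) / 2"
  have \<delta>: "0 < \<delta>" "\<delta> < 1" using la by (auto simp: \<delta>_def)
  obtain C1 where C1: "0 \<le> C1" "\<And>(\<theta> :: 'n param) y g. 0 < g \<Longrightarrow> g < 1 \<Longrightarrow>
    ?w (am_update g \<theta> y) \<le> (1 - g * (1 - \<delta>)) * ?w \<theta> + g * (C1 * (1 + norm y powr ?p))"
    using am_weight_update[OF ee \<delta>(1), where 'n = 'n] by blast
  obtain c b0 where c: "0 < c" and b0: "0 \<le> b0" and PV0: "\<forall>\<theta>\<in>Theta. \<forall>x.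
    (\<integral>\<^sup>+y. ennreal (lyap \<pi> y) \<partial>rwm_kernel \<pi> (am_density q \<epsilon> \<theta>) x) \<le>
    ennreal (lyap \<pi> x - c * (1 + norm (snd \<theta>)) powr (- real ?n / 2) * sqrt (lyap \<pi> x) + b0)"
    by (rule exE[OF lyap_drift[OF e q pos cont c0 drift]])
      (assumption | (elim exE conjE, rule that, assumption, assumption, assumption))+
  \<comment> \<open>Adding \<open>c^2\<close> makes the right side of the drift nonnegative as a
    real number, so that it can be added to other terms inside \<open>ennreal\<close>.\<close>
  define b where "b = b0 + c\<^sup>2"
  have b: "0 \<le> b" using b0 by (simp add: b_def)
  have PV: "(\<integral>\<^sup>+y. ennreal (lyap \<pi> y) \<partial>rwm_kernel \<pi> (am_density q \<epsilon> \<theta>) x) \<le>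
    ennreal (lyap \<pi> x - c * (1 + norm (snd \<theta>)) powr (- real ?n / 2) * sqrt (lyap \<pi> x) + b)" if "\<theta> \<in> Theta" for \<theta> x
    by (rule order_trans[OF PV0[rule_format, OF that]], rule ennreal_leI) (simp add: b_def)
  have PVnn: "0 \<le> lyap \<pi> x - c * (1 + norm (snd \<theta>)) powr (- real ?n / 2) * sqrt (lyap \<pi> x) + b" for \<theta> :: "'n param" and x
  proof -
    have "(1 + norm (snd \<theta>)) powr (- real ?n / 2) \<le> (1 + norm (snd \<theta>)) powr 0" by (intro powr_mono) auto
    moreover have "1 + norm (snd \<theta>) \<noteq> 0" using norm_ge_zero[of "snd \<theta>"] by linarith
    ultimately have "(1 + norm (snd \<theta>)) powr (- real ?n / 2) \<le> 1" by simp
    then have "c * (1 + norm (snd \<theta>)) powr (- real ?n / 2) * sqrt (lyap \<pi> x) \<le> c * 1 * sqrt (lyap \<pi> x)"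
      using c Vpos[of x] by (intro mult_right_mono mult_left_mono) auto
    moreover have "c * sqrt (lyap \<pi> x) \<le> c\<^sup>2 / (4 * 1) + 1 * (sqrt (lyap \<pi> x))\<^sup>2" by (rule linear_le_square) simp
    moreover have "(sqrt (lyap \<pi> x))\<^sup>2 = lyap \<pi> x" using Vpos[of x] by simp
    moreover have "0 \<le> c\<^sup>2" by simp
    ultimately show ?thesis using b0 unfolding b_def by linarith
  qed
  define t where "t = 1 / (8 * real ?n)"
  have "1 \<le> real ?n" by (simp add: Suc_leI)
  then have n8: "0 < 8 * real ?n" "1 \<le> 8 * real ?n" by linarith+
  have "t \<le> 1" unfolding t_def divide_le_eq_1_pos[OF n8(1)] by (rule n8(2))
  moreover have "0 < t" by (simp add: t_def)
  ultimately have t: "0 < t" "t \<le> 1" by blast+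
  \<comment> \<open>Growth of degree N with \<open>N t \<ge> 2 + ee\<close> lets
    \<open>V powr t\<close> dominate \<open>norm y powr (2 + ee)\<close>.\<close>
  obtain N :: nat where N: "?p / t \<le> real N" using real_arch_simple by blast
  obtain cg where cg: "0 < cg" "\<And>x. cg * (1 + norm x) ^ N \<le> lyap \<pi> x" using growth[of N] by blast
  define C2 where "C2 = 2 / cg powr t"
  have C2: "0 < C2" using cg by (simp add: C2_def)
  have f_le: "1 + norm y powr ?p \<le> C2 * lyap \<pi> y powr t" for y
  proof -
    have "norm y powr ?p \<le> (1 + norm y) powr ?p" using ee by (intro powr_mono2) auto
    moreover have "1 \<le> (1 + norm y) powr ?p" using ee by (intro ge_one_powr_ge_zero) auto
    ultimately have "1 + norm y powr ?p \<le> 2 * (1 + norm y) powr ?p" by linarith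
    also have "(1 + norm y) powr ?p \<le> (1 + norm y) powr (real N * t)"
      using N t by (intro powr_mono) (auto simp: pos_divide_le_eq)
    also have "\<dots> = ((1 + norm y) ^ N) powr t" by (simp add: powr_powr[symmetric] powr_realpow add_pos_nonneg)
    also have "\<dots> \<le> (lyap \<pi> y / cg) powr t"
      using cg t by (intro powr_mono2) (auto simp: pos_le_divide_eq mult.commute)
    also have "\<dots> = lyap \<pi> y powr t / cg powr t" using cg Vpos[of y] by (simp add: powr_divide)
    finally show ?thesis by (simp add: C2_def)
  qed
  \<comment> \<open>Two factors of 2: one bounds \<open>1 + la \<gamma>\<close>, the other comes
    from \<open>lyap_powr_step\<close>.\<close>
  define A where "A = 4 * C1 * C2"
  have A: "0 \<le> A" using C1 C2 by (simp add: A_def)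
  obtain K where K: "0 \<le> K" "\<And>w V. 1 \<le> w \<Longrightarrow> 0 < V \<Longrightarrow>
    - \<delta> * w + A * V powr t - c * w powr (- real ?n / 2) * sqrt V \<le> K - \<delta> / 2 * w - V powr t"
    using drift_balance[OF \<delta>(1) c A, of ?n] unfolding t_def[symmetric] by auto
  \<comment> \<open>The constants left over by \<open>drift_balance\<close> and by the drift of V,
    plus the unit that each step has to cost.\<close>
  define L where "L = K + b + 1"
  have L: "1 \<le> L" using K b by (simp add: L_def)
  \<comment> \<open>Outside \<open>S\<close> one of the two negative terms is at least L: either
    \<open>\<delta> / 2 * w\<close>, by the choice of M, or \<open>V powr t\<close>, since
    \<open>C2 L \<le> R \<le> norm y powr (2 + ee) \<le> C2 * V powr t\<close>.\<close>
  define M R where "M = 2 * L / \<delta>" and "R = max 1 (C2 * L)"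
  have M: "0 < M" and R: "1 \<le> R" "C2 * L \<le> R" using L \<delta> by (auto simp: M_def R_def)
  \<comment> \<open>Membership in \<open>Theta\<close> is left out, as it holds along every
    trajectory; this spares the measurability of the cone of positive definite matrices.\<close>
  define S :: "('n param \<times> (real^'n)) set" where "S = {p. ?w (fst p) \<le> M \<and> norm (snd p) < R}"
  have wm[measurable]: "?w \<in> borel_measurable (borel :: 'n param measure)"
    unfolding am_weight_def[abs_def] by (simp add: borel_prod[symmetric])
  have wm': "(\<lambda>p :: 'n param \<times> (real^'n). ?w (fst p)) \<in> borel_measurable borel"
    by (rule measurable_compose[OF borel_measurable_continuous_onI wm]) (intro continuous_intros)
  have Vm': "(\<lambda>p :: 'n param \<times> (real^'n). lyap \<pi> (snd p)) \<in> borel_measurable borel"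
    by (rule measurable_compose[OF borel_measurable_continuous_onI Vm]) (intro continuous_intros)
  have norm_snd_m: "(\<lambda>p :: 'n param \<times> (real^'n). norm (snd p)) \<in> borel_measurable borel"
    by (intro borel_measurable_continuous_onI continuous_intros)
  have S_sets: "S \<in> sets borel"
  proof -
    have "{p \<in> space borel. ?w (fst p) \<le> M} \<in> sets (borel :: ('n param \<times> (real^'n)) measure)"
      using wm' unfolding borel_measurable_iff_le by blast
    moreover have "{p \<in> space borel. norm (snd p) < R} \<in> sets (borel :: ('n param \<times> (real^'n)) measure)"
      using norm_snd_m unfolding borel_measurable_iff_less by blast
    ultimately have "{p \<in> space borel. ?w (fst p) \<le> M} \<inter> {p \<in> space borel. norm (snd p) < R} \<in> sets (borel :: ('n param \<times> (real^'n)) measure)"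
      by (rule sets.Int)
    then show ?thesis by (simp add: S_def Int_def)
  qed
  \<comment> \<open>The reciprocal belongs to the stepsize of the update that comes next, so its
    product with that stepsize is 1.\<close>
  define \<Phi> where "\<Phi> i \<theta> y = ennreal (1 / \<gamma> (Suc i) * ?w \<theta> + lyap \<pi> y)" for i and \<theta> :: "'n param" and y
  have w1: "1 \<le> ?w \<theta>" "1 + norm (snd \<theta>) \<le> ?w \<theta>" for \<theta> :: "'n param" by (auto simp: am_weight_def)
  have step: "(\<integral>\<^sup>+z. \<Phi> (Suc i) (am_update (\<gamma> (Suc i)) \<theta> z) z \<partial>rwm_kernel \<pi> (am_density q \<epsilon> \<theta>) y) + 1 \<le> \<Phi> i \<theta> y"
    if i: "i1 \<le> i" and th: "\<theta> \<in> Theta" and nS: "(\<theta>, y) \<notin> S" for i \<theta> y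
  proof -
    define gg a where "gg = \<gamma> (Suc i)" and "a = 1 / gg"
    have gg: "0 < gg" "gg < 1" using g[of "Suc i"] by (auto simp: gg_def)
    have a: "1 \<le> a" "a * gg = 1" "0 < a" using gg by (auto simp: a_def)
    have a2: "1 / \<gamma> (Suc (Suc i)) \<le> a + la" using i1[of "Suc i"] i la by (simp add: a_def gg_def)
    have dens: "prob_density (am_density q \<epsilon> \<theta>)" by (rule prob_density_am_density[OF e(1) th q])
    let ?k = "rwm_kernel \<pi> (am_density q \<epsilon> \<theta>) y" and ?W = "?w \<theta>" and ?V = "lyap \<pi> y"
    have ks: "sets ?k = sets borel" by (rule sets_rwm_kernel[OF pos pim dens])
    interpret k: prob_space ?k by (rule prob_space_rwm_kernel[OF pos pim dens])
    have pt: "1 / \<gamma> (Suc (Suc i)) * ?w (am_update gg \<theta> z) \<le> (a - \<delta>) * ?W + 2 * C1 * (C2 * lyap \<pi> z powr t)" for z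
    proof -
      have f0: "0 \<le> C1 * (1 + norm z powr ?p)" using C1 by simp
      have "1 / \<gamma> (Suc (Suc i)) * ?w (am_update gg \<theta> z) \<le> (a + la) * ?w (am_update gg \<theta> z)"
        using w1(1)[of "am_update gg \<theta> z"] by (intro mult_right_mono a2) auto
      also have "\<dots> \<le> (a + la) * ((1 - gg * (1 - \<delta>)) * ?W + gg * (C1 * (1 + norm z powr ?p)))"
        using a la by (intro mult_left_mono C1(2) gg) auto
      also have "\<dots> = a * ?W - a * gg * (1 - \<delta>) * ?W + la * (1 - gg * (1 - \<delta>)) * ?W +
          (a * gg + la * gg) * (C1 * (1 + norm z powr ?p))"
        by (simp add: algebra_simps)
      also have "\<dots> \<le> a * ?W - (1 - \<delta>) * ?W + la * 1 * ?W + 2 * (C1 * (1 + norm z powr ?p))"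
      proof (intro add_mono mult_right_mono mult_left_mono f0)
        show "a * ?W - a * gg * (1 - \<delta>) * ?W \<le> a * ?W - (1 - \<delta>) * ?W" by (simp add: a(2))
        show "1 - gg * (1 - \<delta>) \<le> 1" using gg \<delta> by simp
        have "la * gg \<le> 1 * 1" using la gg by (intro mult_mono) auto
        then show "a * gg + la * gg \<le> 2" by (simp add: a(2))
      qed (use la w1[of \<theta>] in auto)
      also have "\<dots> = (a - \<delta>) * ?W + 2 * C1 * (1 + norm z powr ?p)"
        by (simp add: \<delta>_def field_simps)
      also have "\<dots> \<le> (a - \<delta>) * ?W + 2 * C1 * (C2 * lyap \<pi> z powr t)"
        using C1 f_le[of z] by (intro add_left_mono mult_left_mono) auto
      finally show ?thesis .
    qed
    have aW: "0 \<le> (a - \<delta>) * ?W" using a \<delta> w1[of \<theta>] by simp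
    have "(\<integral>\<^sup>+z. \<Phi> (Suc i) (am_update gg \<theta> z) z \<partial>?k) \<le>
      (\<integral>\<^sup>+z. ennreal ((a - \<delta>) * ?W) + ennreal (2 * C1 * C2) * ennreal (lyap \<pi> z powr t) + ennreal (lyap \<pi> z) \<partial>?k)"
    proof (rule nn_integral_mono)
      fix z
      have "\<Phi> (Suc i) (am_update gg \<theta> z) z \<le> ennreal ((a - \<delta>) * ?W + 2 * C1 * (C2 * lyap \<pi> z powr t) + lyap \<pi> z)"
        unfolding \<Phi>_def by (intro ennreal_leI add_right_mono pt)
      also have "\<dots> = ennreal ((a - \<delta>) * ?W) + ennreal (2 * C1 * C2) * ennreal (lyap \<pi> z powr t) + ennreal (lyap \<pi> z)"
        using aW C1 C2 Vpos[of z] by (simp add: ennreal_plus ennreal_mult[symmetric] mult.assoc)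
      finally show "\<Phi> (Suc i) (am_update gg \<theta> z) z \<le>
        ennreal ((a - \<delta>) * ?W) + ennreal (2 * C1 * C2) * ennreal (lyap \<pi> z powr t) + ennreal (lyap \<pi> z)" .
    qed
    also have "\<dots> = ennreal ((a - \<delta>) * ?W) + ennreal (2 * C1 * C2) * (\<integral>\<^sup>+z. ennreal (lyap \<pi> z powr t) \<partial>?k) + (\<integral>\<^sup>+z. ennreal (lyap \<pi> z) \<partial>?k)"
    proof -
      have m1: "(\<lambda>z. ennreal (lyap \<pi> z powr t)) \<in> borel_measurable ?k" "(\<lambda>z. ennreal (lyap \<pi> z)) \<in> borel_measurable ?k"
        unfolding measurable_cong_sets[OF ks refl] by measurable
      then show ?thesis
        by (simp add: nn_integral_add nn_integral_cmult k.emeasure_space_1)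
    qed
    also have "\<dots> \<le> ennreal ((a - \<delta>) * ?W) + ennreal (2 * C1 * C2) * (2 * ennreal (?V powr t)) +
        ennreal (?V - c * (1 + norm (snd \<theta>)) powr (- real ?n / 2) * sqrt ?V + b)"
      using t by (intro add_mono mult_left_mono order_refl lyap_powr_step[OF pos pim dens] PV[OF th]) auto
    also have "\<dots> \<le> ennreal ((a - \<delta>) * ?W) + ennreal (A * ?V powr t) +
        ennreal (?V - c * (1 + norm (snd \<theta>)) powr (- real ?n / 2) * sqrt ?V + b)"
    proof -
      have "ennreal (2 * C1 * C2) * (2 * ennreal (?V powr t)) = ennreal (2 * C1 * C2) * ennreal (2 * ?V powr t)"
        by (simp add: ennreal_mult)
      also have "\<dots> = ennreal (A * ?V powr t)"
        using C1 C2 by (subst ennreal_mult[symmetric]) (auto simp: A_def)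
      finally show ?thesis by simp
    qed
    finally have le: "(\<integral>\<^sup>+z. \<Phi> (Suc i) (am_update gg \<theta> z) z \<partial>?k) \<le> ennreal ((a - \<delta>) * ?W) + ennreal (A * ?V powr t) +
        ennreal (?V - c * (1 + norm (snd \<theta>)) powr (- real ?n / 2) * sqrt ?V + b)" .
    have bal: "(a - \<delta>) * ?W + A * ?V powr t + (?V - c * (1 + norm (snd \<theta>)) powr (- real ?n / 2) * sqrt ?V + b) + 1 \<le> a * ?W + ?V"
    proof -
      have "c * ?W powr (- real ?n / 2) * sqrt ?V \<le> c * (1 + norm (snd \<theta>)) powr (- real ?n / 2) * sqrt ?V"
        using c w1(2)[of \<theta>] Vpos[of y] by (intro mult_right_mono mult_left_mono powr_mono2') (auto intro: add_pos_nonneg)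
      moreover have "- \<delta> * ?W + A * ?V powr t - c * ?W powr (- real ?n / 2) * sqrt ?V \<le> K - \<delta> / 2 * ?W - ?V powr t"
        by (rule K(2)[OF w1(1) Vpos])
      moreover have "L \<le> \<delta> / 2 * ?W + ?V powr t"
      proof (cases "?W \<le> M")
        case False
        then have "\<delta> / 2 * M \<le> \<delta> / 2 * ?W" using \<delta> by (intro mult_left_mono) auto
        moreover have "\<delta> / 2 * M = L" using \<delta> by (simp add: M_def)
        ultimately show ?thesis by (simp add: add_increasing2)
      next
        case True
        then have yR: "R \<le> norm y" using nS by (auto simp: S_def)
        have "norm y powr 1 \<le> norm y powr ?p" using yR R ee by (intro powr_mono) auto
        moreover have "norm y powr 1 = norm y" by simp
        ultimately have "C2 * L \<le> norm y powr ?p" using yR R by linarith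
        also have "\<dots> \<le> C2 * ?V powr t" using f_le[of y] by linarith
        finally have "L \<le> ?V powr t" using C2 by simp
        moreover have "0 \<le> \<delta> / 2 * ?W" using \<delta> w1[of \<theta>] by simp
        ultimately show ?thesis by linarith
      qed
      ultimately show ?thesis by (simp add: L_def algebra_simps)
    qed
    let ?Y = "?V - c * (1 + norm (snd \<theta>)) powr (- real ?n / 2) * sqrt ?V + b"
    have Aw: "0 \<le> A * ?V powr t" using A by (intro mult_nonneg_nonneg) auto
    have "(\<integral>\<^sup>+z. \<Phi> (Suc i) (am_update gg \<theta> z) z \<partial>?k) + 1 \<le>
      ennreal ((a - \<delta>) * ?W) + ennreal (A * ?V powr t) + ennreal ?Y + ennreal 1"
      unfolding ennreal_1 by (rule add_right_mono[OF le])
    also have "\<dots> = ennreal ((a - \<delta>) * ?W + A * ?V powr t + ?Y + 1)"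
    proof -
      note e1 = ennreal_plus[OF aW Aw] and nn1 = add_nonneg_nonneg[OF aW Aw]
      note e2 = ennreal_plus[OF nn1 PVnn[of y \<theta>]] and nn2 = add_nonneg_nonneg[OF nn1 PVnn[of y \<theta>]]
      show ?thesis unfolding ennreal_plus[OF nn2 zero_le_one] e2 e1 ..
    qed
    also have "\<dots> \<le> ennreal (a * ?W + ?V)" by (rule ennreal_leI[OF bal])
    also have "\<dots> = \<Phi> i \<theta> y" by (simp add: \<Phi>_def a_def gg_def)
    finally show ?thesis unfolding gg_def .
  qed
  have main: "measure (am_law \<pi> q \<epsilon> \<gamma> \<theta> x)
      (\<Inter>k. \<Union>i\<in>{k..}. {\<omega> \<in> space (am_law \<pi> q \<epsilon> \<gamma> \<theta> x).
         (am_param \<gamma> \<theta> \<omega> i, \<omega> i) \<in> am_sublevel ee M \<times> ball 0 R}) = 1" if th: "\<theta> \<in> Theta" for \<theta> x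
  proof -
    interpret P: am_process \<pi> q \<epsilon> \<gamma> \<theta> x
      by unfold_locales (use pos pim q e g th in auto)
    let ?L = "am_law \<pi> q \<epsilon> \<gamma> \<theta> x"
    have Ls: "sets ?L = sets (PiM UNIV (\<lambda>_. borel :: (real^'n) measure))" "space ?L = UNIV"
      unfolding P.am_law_eq by (simp_all add: space_PiM)
    have mem: "(am_param \<gamma> \<theta> \<omega> i, \<omega> i) \<in> am_sublevel ee M \<times> ball 0 R \<longleftrightarrow> (am_param \<gamma> \<theta> \<omega> i, \<omega> i) \<in> S" for \<omega> i
      using P.am_param_Theta[of \<omega> i] by (auto simp: am_sublevel_def S_def)
    have AE: "AE \<omega> in ?L. \<forall>k. \<exists>i\<ge>k. (am_param \<gamma> \<theta> \<omega> i, \<omega> i) \<in> S"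
    proof (rule P.AE_visits_infinitely_often[where \<Phi> = \<Phi> and ?i0.0 = i1])
      show "(\<lambda>(t, y). \<Phi> i t y) \<in> borel_measurable borel" for i
        unfolding \<Phi>_def case_prod_beta
        by (intro measurable_compose[OF _ measurable_ennreal] borel_measurable_add borel_measurable_times borel_measurable_const wm' Vm')
      show "\<Phi> i t y < \<top>" for i t y by (simp add: \<Phi>_def)
    qed (use S_sets step in auto)
    have par: "(\<lambda>\<omega>. (am_param \<gamma> \<theta> \<omega> i, \<omega> i)) \<in> borel_measurable ?L" for i
    proof -
      have co: "(\<lambda>\<omega>. \<omega> i) \<in> borel_measurable ?L" for i
        unfolding measurable_cong_sets[OF Ls(1) refl] by (rule measurable_component_singleton) simp
      have "(\<lambda>\<omega>. am_param \<gamma> \<theta> \<omega> i) \<in> borel_measurable ?L" for i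
        by (induction i) (auto intro!: measurable_am_update co)
      then show ?thesis by (rule borel_measurable_Pair[OF _ co])
    qed
    have "{\<omega> \<in> space ?L. (am_param \<gamma> \<theta> \<omega> i, \<omega> i) \<in> S} \<in> sets ?L" for i
      using measurable_sets[OF par S_sets] by (simp add: vimage_def Ls Int_def)
    then have "(\<Inter>k. \<Union>i\<in>{k..}. {\<omega> \<in> space ?L. (am_param \<gamma> \<theta> \<omega> i, \<omega> i) \<in> S}) \<in> sets ?L"
      by (intro sets.countable_INT sets.countable_UN) auto
    moreover have "AE \<omega> in ?L. \<omega> \<in> (\<Inter>k. \<Union>i\<in>{k..}. {\<omega> \<in> space ?L. (am_param \<gamma> \<theta> \<omega> i, \<omega> i) \<in> S})"
      using AE by (rule AE_mp) (auto simp: Ls)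
    moreover have "prob_space ?L" unfolding P.am_law_eq by (rule P.IT.prob_space_lim)
    ultimately show ?thesis
      unfolding mem using prob_space.prob_eq_1 by blast
  qed
  show ?thesis using main M R by (intro exI[of _ M] conjI exI[of _ R]) auto
qed

theorem theorem5:
  fixes \<pi> q :: "real^'n \<Rightarrow> real" and \<gamma> :: "nat \<Rightarrow> real" and \<epsilon>_AM \<gamma>_max :: real
  assumes "\<epsilon>_AM \<in> {0<..<1}"
    and "prob_density \<pi>"
    and "prob_density q" and "\<forall>z. q (- z) = q z"
    and "\<gamma>_max \<in> {0<..<1}" and "\<forall>i\<ge>1. \<gamma> i \<in> {0<..\<gamma>_max}"
    and "superexponential_conditions \<pi> q \<or> CARD('n) = 1 \<and> one_dim_conditions (\<lambda>t. \<pi> (vec t)) (\<lambda>t. q (vec t))"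
    and "limsup (\<lambda>i. ereal (1 / \<gamma> (Suc i) - 1 / \<gamma> i)) < 1"
  shows "\<forall>\<epsilon>>0. \<exists>M>0. \<exists>R>0. \<forall>\<theta>\<in>Theta. \<forall>x.
           measure (am_law \<pi> q \<epsilon>_AM \<gamma> \<theta> x)
             (\<Inter>k. \<Union>i\<in>{k..}. {\<omega> \<in> space (am_law \<pi> q \<epsilon>_AM \<gamma> \<theta> x).
                (am_param \<gamma> \<theta> \<omega> i, \<omega> i) \<in> am_sublevel \<epsilon> M \<times> ball 0 R}) = 1"
proof (intro allI impI)
  fix \<epsilon> :: real assume ee: "0 < \<epsilon>"
  have e: "0 < \<epsilon>_AM" "\<epsilon>_AM < 1" and q: "prob_density q" and lim: "limsup (\<lambda>i. ereal (1 / \<gamma> (Suc i) - 1 / \<gamma> i)) < 1"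
    using assms by auto
  have g: "0 < \<gamma> i \<and> \<gamma> i < 1" if "1 \<le> i" for i
  proof -
    have "0 < \<gamma> i" "\<gamma> i \<le> \<gamma>_max" using assms(6) that by auto
    then show ?thesis using assms(5) by auto
  qed
  have "(\<forall>x. 0 < \<pi> x) \<and> continuous_on UNIV \<pi> \<and>
    (\<exists>c>0. \<exists>R. \<forall>\<theta>\<in>Theta. \<forall>x. R \<le> norm x \<longrightarrow>
      (\<integral>\<^sup>+y. ennreal (metro_fac (\<pi> y / \<pi> x) * am_density q \<epsilon>_AM \<theta> (y - x)) \<partial>lborel) \<le>
      ennreal (1 - c * am_height \<epsilon>_AM \<theta> / sqrt (lyap \<pi> x))) \<and>
    (\<forall>N. \<exists>c>0. \<forall>x. c * (1 + norm x) ^ N \<le> lyap \<pi> x)"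
    using assms(7)
  proof
    assume sup: "superexponential_conditions \<pi> q"
    note D = superexponential_drift[OF e(1) q sup]
    obtain c R where c: "0 < c" and dr: "\<forall>\<theta>\<in>Theta. \<forall>x. R \<le> norm x \<longrightarrow>
      (\<integral>\<^sup>+y. ennreal (metro_fac (\<pi> y / \<pi> x) * am_density q \<epsilon>_AM \<theta> (y - x)) \<partial>lborel) \<le> ennreal (1 - c * am_height \<epsilon>_AM \<theta>)"
      using D(3) by blast
    obtain c4 where c4: "0 < c4" "\<And>x. c4 \<le> lyap \<pi> x" using D(4)[rule_format, of 0] by auto
    \<comment> \<open>The stronger drift, proportional to V, is brought into the common form; V is
      bounded below, so only the constant changes.\<close>
    have "1 - c * am_height \<epsilon>_AM \<theta> \<le> 1 - c * sqrt c4 * am_height \<epsilon>_AM \<theta> / sqrt (lyap \<pi> x)"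
      if th: "\<theta> \<in> Theta" for \<theta> :: "'n param" and x
    proof -
      have h: "0 \<le> am_height \<epsilon>_AM \<theta>" using am_height_sqrt[OF e(1) th] by simp
      have "sqrt c4 / sqrt (lyap \<pi> x) \<le> 1"
        using c4(1) c4(2)[of x] by (simp add: divide_le_eq_1)
      then have "c * am_height \<epsilon>_AM \<theta> * (sqrt c4 / sqrt (lyap \<pi> x)) \<le> c * am_height \<epsilon>_AM \<theta> * 1"
        using c h by (intro mult_left_mono mult_nonneg_nonneg) auto
      then show ?thesis by (simp add: mult_ac)
    qed
    then have "\<forall>\<theta>\<in>Theta. \<forall>x. R \<le> norm x \<longrightarrow>
      (\<integral>\<^sup>+y. ennreal (metro_fac (\<pi> y / \<pi> x) * am_density q \<epsilon>_AM \<theta> (y - x)) \<partial>lborel) \<le>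
      ennreal (1 - c * sqrt c4 * am_height \<epsilon>_AM \<theta> / sqrt (lyap \<pi> x))"
      using dr by (meson ennreal_leI order_trans)
    moreover have "0 < c * sqrt c4" using c c4 by simp
    ultimately show ?thesis using D by blast
  next
    assume "CARD('n) = 1 \<and> one_dim_conditions (\<lambda>t. \<pi> (vec t)) (\<lambda>t. q (vec t))"
    then have one: "CARD('n) = 1" and cond: "one_dim_conditions (\<lambda>t. \<pi> (vec t)) (\<lambda>t. q (vec t))" by auto
    show ?thesis using one_dim_drift[OF one e(1) q cond] by blast
  qed
  then obtain c R where pos: "\<forall>x. 0 < \<pi> x" and cont: "continuous_on UNIV \<pi>" and c: "0 < c"
    and dr: "\<forall>\<theta>\<in>Theta. \<forall>x. R \<le> norm x \<longrightarrow>
      (\<integral>\<^sup>+y. ennreal (metro_fac (\<pi> y / \<pi> x) * am_density q \<epsilon>_AM \<theta> (y - x)) \<partial>lborel) \<le>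
      ennreal (1 - c * am_height \<epsilon>_AM \<theta> / sqrt (lyap \<pi> x))"
    and gr: "\<forall>N. \<exists>c>0. \<forall>x. c * (1 + norm x) ^ N \<le> lyap \<pi> x"
    by (elim conjE exE)
  show "\<exists>M>0. \<exists>R>0. \<forall>\<theta>\<in>Theta. \<forall>x.
           measure (am_law \<pi> q \<epsilon>_AM \<gamma> \<theta> x)
             (\<Inter>k. \<Union>i\<in>{k..}. {\<omega> \<in> space (am_law \<pi> q \<epsilon>_AM \<gamma> \<theta> x).
                (am_param \<gamma> \<theta> \<omega> i, \<omega> i) \<in> am_sublevel \<epsilon> M \<times> ball 0 R}) = 1"
    by (rule am_recurrence[OF e q pos[rule_format] cont g c dr[rule_format] gr[rule_format] lim ee])
qed

end
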